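(* Fix $\delta>0$ small. For $\alpha$ small enough with $r(\alpha)>\delta$, the extremal front $\mathcal F(\alpha,k_M\pi)$ is homeomorphic to a circle. As a consequence, the switching curves $C_k^\varepsilon$, $\varepsilon=\pm$, are optimal up to $k=k_M$, and $OF(\alpha,k_M\pi)$, the minimum time front at time $k_M\pi$, coincides with $\mathcal F(\alpha,k_M\pi)$.
   Context: For $\alpha\in(0,\pi/4)$ set $$F=\begin{pmatrix}0&-\cos\alpha&0\\ \cos\alpha&0&0\\0&0&0\end{pmatrix},\quad G=\begin{pmatrix}0&0&0\\0&0&-\sin\alpha\\0&\sin\alpha&0\end{pmatrix},\quad X_\pm=F\pm G,\quad N=(0,0,1)^T,$$ and let $(\Sigma)_\alpha$ be the control system $\dot x=(F+uG)x$ on the unit sphere $S^2$, with measurable controls $|u|\le1$. Put $k_M=[\pi/(2\alpha)]$ (integer part), $r(\alpha)=\pi/(2\alpha)-k_M$, and $v(s)=\pi+2\arctan\frac{\sin s}{\cos s+\cot^2\alpha}$. An extremal trajectory is an admissible trajectory starting from $N$ and satisfying the Pontryagin Maximum Principle for the minimum time problem. The extremals considered are the bang-bang trajectories $e^{tX_{\pm}}e^{v(s)X_{\mp}}\cdots e^{v(s)X_{-\varepsilon}}e^{sX_\varepsilon}N$ (alternating signs) with first arc of duration $s\in(0,\pi]$, all interior arcs of duration $v(s)$ and last arc of duration $t\in(0,v(s)]$. The extremal front $\mathcal F(\alpha,T)$ is the set of points reached at time $T$ by extremal trajectories, and the minimum time front $OF(\alpha,T)\subset\mathcal F(\alpha,T)$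 is the set of points reached at time $T$ by time optimal trajectories from $N$. The switching curves, made of points where extremals switch between the controls $+1$ and $-1$, are defined inductively by $C_1^\varepsilon(s)=e^{v(s)X_\varepsilon}e^{sX_{-\varepsilon}}N$ and $C_k^\varepsilon(s)=e^{v(s)X_\varepsilon}C_{k-1}^{-\varepsilon}(s)$ for $k=2,\dots,k_M$, with $s\in(0,\pi]$ and $\varepsilon=\pm$. Optimality of switching curves refers to the time optimality of the extremals switching on them; the paper describes the resulting conclusion as: all these extremals are optimal up to time $k_M\pi$. *)

theory Defs
  imports "HOL-Analysis.Analysis"
begin

definition mat_exp :: "real^'n^'n \<Rightarrow> real^'n^'n" where
  "mat_exp A = (\<Sum>n. (1 / fact n) *\<^sub>R ((((**) A) ^^ n) (mat 1)))"

definition F_mat :: "real \<Rightarrow> real^3^3" where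
  "F_mat \<alpha> = vector [vector [0, - cos \<alpha>, 0],
                    vector [cos \<alpha>, 0, 0],
                    vector [0, 0, 0]]"

definition G_mat :: "real \<Rightarrow> real^3^3" where
  "G_mat \<alpha> = vector [vector [0, 0, 0],
                    vector [0, 0, - sin \<alpha>],
                    vector [0, sin \<alpha>, 0]]"

text \<open>The field \<open>F + u G\<close>; the bang fields \<open>X\<^sub>+\<close> and \<open>X\<^sub>-\<close> are \<open>X_mat \<alpha> 1\<close> and
  \<open>X_mat \<alpha> (-1)\<close>. Signs \<open>\<epsilon>\<close> are represented by the reals \<open>1\<close> and \<open>-1\<close>.\<close>

definition X_mat :: "real \<Rightarrow> real \<Rightarrow> real^3^3" where
  "X_mat \<alpha> u = F_mat \<alpha> + u *\<^sub>R G_mat \<alpha>"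

definition flow :: "real \<Rightarrow> real \<Rightarrow> real \<Rightarrow> real^3 \<Rightarrow> real^3" where
  "flow \<alpha> \<epsilon> t x = mat_exp (t *\<^sub>R X_mat \<alpha> \<epsilon>) *v x"

definition north :: "real^3" where
  "north = vector [0, 0, 1]"

definition kM :: "real \<Rightarrow> nat" where
  "kM \<alpha> = nat \<lfloor>pi / (2 * \<alpha>)\<rfloor>"

definition remainder :: "real \<Rightarrow> real" where
  "remainder \<alpha> = pi / (2 * \<alpha>) - real (kM \<alpha>)"

definition v_dur :: "real \<Rightarrow> real \<Rightarrow> real" where
  "v_dur \<alpha> s = pi + 2 * arctan (sin s / (cos s + (cot \<alpha>)\<^sup>2))"

text \<open>Absolutely continuous solutions (Caratheodory solutions) are expressed by the equivalent
  integral equation. For a measurable bounded control and a continuous \<open>x\<close> the integrand is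
  bounded and measurable, so this is the Lebesgue integral; continuity of \<open>x\<close> is itself a
  consequence of the integral equation.\<close>

definition admissible :: "real \<Rightarrow> real \<Rightarrow> (real \<Rightarrow> real^3) \<Rightarrow> (real \<Rightarrow> real) \<Rightarrow> bool" where
  "admissible \<alpha> T x u \<longleftrightarrow>
     0 \<le> T \<and>
     u \<in> borel_measurable (lebesgue_on {0..T}) \<and>
     (\<forall>t\<in>{0..T}. \<bar>u t\<bar> \<le> 1) \<and>
     (\<forall>t\<in>{0..T}. x t \<in> sphere 0 1) \<and>
     (\<forall>t\<in>{0..T}. ((\<lambda>\<tau>. X_mat \<alpha> (u \<tau>) *v x \<tau>) has_integral (x t - x 0)) {0..t})"

definition hamiltonian :: "real \<Rightarrow> real^3 \<Rightarrow> real^3 \<Rightarrow> real \<Rightarrow> real" where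
  "hamiltonian \<alpha> x p w = p \<bullet> (X_mat \<alpha> w *v x)"

text \<open>Pontryagin Maximum Principle for minimum time on the sphere. A covector at \<open>x\<close> is a vector
  \<open>p\<close> of the ambient space orthogonal to \<open>x\<close> and never vanishing along the trajectory; it solves
  the adjoint equation \<open>p' = - (F + u G)\<^sup>T p\<close>, and the maximized Hamiltonian is a nonnegative
  constant (zero being the abnormal case).\<close>

definition pmp :: "real \<Rightarrow> real \<Rightarrow> (real \<Rightarrow> real^3) \<Rightarrow> (real \<Rightarrow> real) \<Rightarrow> bool" where
  "pmp \<alpha> T x u \<longleftrightarrow>
     (\<exists>p h. 0 \<le> h \<and>
        (\<forall>t\<in>{0..T}. p t \<noteq> 0 \<and> p t \<bullet> x t = 0) \<and>
        (\<forall>t\<in>{0..T}. ((\<lambda>\<tau>. - (transpose (X_mat \<alpha> (u \<tau>)) *v p \<tau>)) has_integral (p t - p 0)) {0..t}) \<and>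
        (AE t in lebesgue_on {0..T}.
           (\<forall>w\<in>{-1..1}. hamiltonian \<alpha> (x t) (p t) w \<le> hamiltonian \<alpha> (x t) (p t) (u t)) \<and>
           hamiltonian \<alpha> (x t) (p t) (u t) = h))"

definition extremal :: "real \<Rightarrow> real \<Rightarrow> (real \<Rightarrow> real^3) \<Rightarrow> (real \<Rightarrow> real) \<Rightarrow> bool" where
  "extremal \<alpha> T x u \<longleftrightarrow> admissible \<alpha> T x u \<and> x 0 = north \<and> pmp \<alpha> T x u"

definition time_optimal :: "real \<Rightarrow> real \<Rightarrow> (real \<Rightarrow> real^3) \<Rightarrow> bool" where
  "time_optimal \<alpha> T x \<longleftrightarrow>
     (\<exists>u. admissible \<alpha> T x u) \<and> x 0 = north \<and>
     (\<forall>T' y w. admissible \<alpha> T' y w \<and> y 0 = north \<and> y T' = x T \<longrightarrow> T \<le> T')"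

definition extremal_front :: "real \<Rightarrow> real \<Rightarrow> (real^3) set" where
  "extremal_front \<alpha> T = {x T | x u. extremal \<alpha> T x u}"

definition optimal_front :: "real \<Rightarrow> real \<Rightarrow> (real^3) set" where
  "optimal_front \<alpha> T = {x T | x. time_optimal \<alpha> T x}"

text \<open>The switching curves proper are those with \<open>k \<ge> 1\<close>; the index \<open>0\<close> (endpoints of the first
  arc) only starts the recursion, so that
  \<open>C\<^sub>1\<^sup>\<epsilon>(s) = e\<^bsup>v(s)X_\<epsilon>\<^esup> e\<^bsup>sX_{-\<epsilon>}\<^esup> N\<close>.\<close>

primrec switching_curve :: "real \<Rightarrow> nat \<Rightarrow> real \<Rightarrow> real \<Rightarrow> real^3" where
  "switching_curve \<alpha> 0 \<epsilon> s = flow \<alpha> \<epsilon> s north"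
| "switching_curve \<alpha> (Suc k) \<epsilon> s = flow \<alpha> \<epsilon> (v_dur \<alpha> s) (switching_curve \<alpha> k (- \<epsilon>) s)"

text \<open>The bang-bang extremal as a function of time: first arc with control \<open>\<epsilon>\<close> and duration \<open>s\<close>,
  then arcs of duration \<open>v(s)\<close> with alternating controls. At a time \<open>t > s\<close> there are \<open>n\<close> completed
  interior arcs and a last arc of duration \<open>t - s - n v(s)\<close> in \<open>(0, v(s)]\<close>; \<open>\<sigma>\<close> is the control on
  the last completed arc.\<close>

definition bang_bang :: "real \<Rightarrow> real \<Rightarrow> real \<Rightarrow> real \<Rightarrow> real^3" where
  "bang_bang \<alpha> \<epsilon> s t =
     (if t \<le> s then flow \<alpha> \<epsilon> t north
      else let n = nat (\<lceil>(t - s) / v_dur \<alpha> s\<rceil> - 1);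
               \<sigma> = (-1) ^ n * \<epsilon>
           in flow \<alpha> (- \<sigma>) (t - s - real n * v_dur \<alpha> s) (switching_curve \<alpha> n \<sigma> s))"

lemma v_dur_pos: "0 < v_dur \<alpha> s"
  using arctan_lbound[of "sin s / (cos s + (cot \<alpha>)\<^sup>2)"] by (simp add: v_dur_def)

text \<open>The bang-bang extremal with first control \<open>(-1)\<^sup>k \<epsilon>\<close> is the one that switches on
  \<open>C\<^sub>k\<^sup>\<epsilon>(s)\<close>, at time \<open>s + k v(s)\<close>.\<close>

lemma bang_bang_at_switching_curve:
  "bang_bang \<alpha> ((-1) ^ k * \<epsilon>) s (s + real k * v_dur \<alpha> s) = switching_curve \<alpha> k \<epsilon> s"
proof (cases k)
  case 0
  then show ?thesis by (simp add: bang_bang_def)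
next
  case (Suc n)
  let ?v = "v_dur \<alpha> s"
  have v: "?v > 0" by (rule v_dur_pos)
  have "(s + real k * ?v - s) / ?v = of_int (int k)"
    using v by simp
  then have c: "nat (\<lceil>(s + real k * ?v - s) / ?v\<rceil> - 1) = n"
    unfolding Suc by (simp only: ceiling_of_int)
  have nle: "\<not> s + real k * ?v \<le> s" using v Suc by (simp add: not_le)
  have sg: "(-1) ^ n * ((-1) ^ k * \<epsilon>) = - \<epsilon>"
    by (simp add: Suc mult.assoc[symmetric] power_mult_distrib[symmetric])
  have d: "s + real k * ?v - s - real n * ?v = ?v"
    by (simp add: Suc algebra_simps)
  show ?thesis
    unfolding bang_bang_def Let_def if_not_P[OF nle] c sg d by (simp add: Suc)
qed

text \<open>Optimality of \<open>C\<^sub>k\<^sup>\<epsilon>\<close> is time optimality of the extremals switching on it, here up to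
  time \<open>T\<close>.\<close>

definition switching_curve_optimal :: "real \<Rightarrow> real \<Rightarrow> nat \<Rightarrow> real \<Rightarrow> bool" where
  "switching_curve_optimal \<alpha> T k \<epsilon> \<longleftrightarrow>
     (\<forall>s\<in>{0<..pi}. \<forall>t\<in>{0..T}. time_optimal \<alpha> t (bang_bang \<alpha> ((-1) ^ k * \<epsilon>) s))"

end

theory Submission
  imports Defs "HOL-Complex_Analysis.Great_Picard"
begin

text \<open>If the end point of a trajectory is on the boundary of the reachable set (relative to the
  sphere), its first variations do not span the tangent plane, and a compactness argument makes it
  a bang-bang extremal. So this boundary is contained in the front \<open>\<F>(\<alpha>, T)\<close>. In unit quaternions
  an extremal is an explicit product of rotations; for \<open>T = k\<^sub>M \<pi>\<close> the front is, up to errors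
  \<open>O(\<alpha>\<^sup>2)\<close> that are Lipschitz in \<open>s\<close>, the circle of radius \<open>2 \<alpha> r(\<alpha>)\<close> around the south pole,
  hence a Jordan curve, and no extremal meets the south pole up to this time. The curve separates \<open>N\<close>, which
  is reachable, from \<open>-N\<close>, which is not; a proper subset of it would not, so all of it is boundary.
  A point of the front reached at an earlier time could then also be reached at time \<open>T\<close> by
  first waiting at the equilibrium \<open>N\<close> with control \<open>0\<close>, and this trajectory would have to be
  bang-bang.\<close>

text \<open>No competitor is ever compared with an extremal: optimality follows from the front being
  a Jordan curve that avoids both poles, so all estimates concern one explicit curve. The obstacle
  is the number of arcs, of order 1/\<alpha>: an error made on each arc is magnified by that factor,
  while the limit circle has radius only of order \<alpha>. The angle gained per arc is therefore
  determined up to O(\<alpha>^3). Closeness in the sup norm would still permit self-intersections;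
  every estimate carries a Lipschitz constant in s of the same order, and r(\<alpha>) > \<delta>
  makes the radius beat these errors once \<alpha> is small in terms of \<delta>. The alternation of
  X_+ and X_- is removed by conjugating with the half turn about the polar axis, after which n
  interior arcs act as the n-th power of one unit quaternion and de Moivre's formula applies. The
  south pole must be missed at all earlier times as well; this comes from an exact elimination of
  the last arc, with positivity margins again supplied by r(\<alpha>).\<close>

section \<open>Components, skew symmetry and norms of the generators\<close>

lemma X_mat_components:
  "(X_mat \<alpha> u *v x) $ 1 = - cos \<alpha> * x $ 2"
  "(X_mat \<alpha> u *v x) $ 2 = cos \<alpha> * x $ 1 - u * sin \<alpha> * x $ 3"
  "(X_mat \<alpha> u *v x) $ 3 = u * sin \<alpha> * x $ 2"
  by (simp_all add: X_mat_def F_mat_def G_mat_def matrix_vector_mult_def sum_3 algebra_simps)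

lemma G_mat_components:
  "(G_mat \<alpha> *v x) $ 1 = 0"
  "(G_mat \<alpha> *v x) $ 2 = - sin \<alpha> * x $ 3"
  "(G_mat \<alpha> *v x) $ 3 = sin \<alpha> * x $ 2"
  by (simp_all add: G_mat_def matrix_vector_mult_def sum_3 algebra_simps)

lemma north_components: "north $ 1 = 0" "north $ 2 = 0" "north $ 3 = 1"
  by (simp_all add: north_def)

lemma vec3_eq_iff: "x = y \<longleftrightarrow> x $ 1 = y $ 1 \<and> x $ 2 = y $ 2 \<and> x $ 3 = y $ 3"
  for x y :: "'a^3"
  by (simp add: vec_eq_iff forall_3)

lemma inner_3: "x \<bullet> y = x $ 1 * y $ 1 + x $ 2 * y $ 2 + x $ 3 * y $ 3"
  for x y :: "real^3"
  by (simp add: inner_vec_def sum_3)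

lemma norm_eq_1_3: "norm x = 1 \<longleftrightarrow> (x $ 1)\<^sup>2 + (x $ 2)\<^sup>2 + (x $ 3)\<^sup>2 = 1"
  for x :: "real^3"
  by (simp add: norm_eq_1 inner_3 power2_eq_square)

lemma norm_north [simp]: "norm north = 1"
  by (simp add: norm_eq_1_3 north_components)

lemma X_mat_skew: "y \<bullet> (X_mat \<alpha> u *v z) = - ((X_mat \<alpha> u *v y) \<bullet> z)"
  by (simp add: inner_3 X_mat_components algebra_simps)

lemma X_mat_self_inner: "x \<bullet> (X_mat \<alpha> u *v x) = 0"
  by (simp add: inner_3 X_mat_components algebra_simps)

lemma transpose_X_mat: "transpose (X_mat \<alpha> u) *v x = - (X_mat \<alpha> u *v x)"
  by (simp add: vec3_eq_iff X_mat_def F_mat_def G_mat_def matrix_vector_mult_def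
      transpose_def sum_3 algebra_simps)

lemma X_mat_diff_control:
  "X_mat \<alpha> u *v x = X_mat \<alpha> w *v x + (u - w) *\<^sub>R (G_mat \<alpha> *v x)"
  by (simp add: vec3_eq_iff X_mat_components G_mat_components algebra_simps)

text \<open>The field is the cross product with the angular velocity (u sin \<alpha>, 0, cos
  \<alpha>), whose norm is at most 1. Hence admissible trajectories on the unit sphere have speed at
  most 1.\<close>

lemma norm_X_mat_le: "norm (X_mat \<alpha> u *v x) \<le> norm x" if "\<bar>u\<bar> \<le> 1"
proof -
  have "(X_mat \<alpha> u *v x) = cross3 (vector [u * sin \<alpha>, 0, cos \<alpha>]) x"
    by (simp add: vec3_eq_iff X_mat_components cross_components algebra_simps)
  moreover have "(norm (cross3 a b))\<^sup>2 \<le> (norm a * norm b)\<^sup>2" for a b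
    using norm_cross_dot[of a b] by (metis le_add_same_cancel1 zero_le_power2)
  ultimately have "norm (X_mat \<alpha> u *v x) \<le> norm (vector [u * sin \<alpha>, 0, cos \<alpha>] :: real^3) * norm x"
    by (metis power2_le_imp_le mult_nonneg_nonneg norm_ge_zero)
  moreover have "norm (vector [u * sin \<alpha>, 0, cos \<alpha>] :: real^3) \<le> 1"
  proof -
    have "u\<^sup>2 * (sin \<alpha>)\<^sup>2 \<le> 1 * (sin \<alpha>)\<^sup>2"
      using that by (intro mult_right_mono) (auto simp: abs_square_le_1)
    then have "(u * sin \<alpha>)\<^sup>2 + (cos \<alpha>)\<^sup>2 \<le> 1"
      using sin_cos_squared_add[of \<alpha>] unfolding power_mult_distrib by linarith
    then show ?thesis
      using norm_le_square[of "vector [u * sin \<alpha>, 0, cos \<alpha>] :: real^3" 1]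
      by (simp add: inner_3 power2_eq_square)
  qed
  ultimately show ?thesis
    by (meson mult_left_le_one_le norm_ge_zero order_trans)
qed

lemma norm_G_mat_le: "norm (G_mat \<alpha> *v x) \<le> norm x"
proof (rule norm_le[THEN iffD2])
  have "(sin \<alpha>)\<^sup>2 * ((x$2)\<^sup>2 + (x$3)\<^sup>2) \<le> 1 * ((x$2)\<^sup>2 + (x$3)\<^sup>2)"
    by (intro mult_right_mono) (auto simp: abs_square_le_1)
  then show "(G_mat \<alpha> *v x) \<bullet> (G_mat \<alpha> *v x) \<le> x \<bullet> x"
    unfolding inner_3 G_mat_components by (simp add: power2_eq_square algebra_simps add_increasing)
qed

subsection \<open>The bang flows\<close>

lemma X_mat_minus: "X_mat \<alpha> u *v (- x) = - (X_mat \<alpha> u *v x)"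
  by (simp add: vec3_eq_iff X_mat_components)

text \<open>For u = 1 or u = -1 the angular velocity is a unit vector, so X is the generator of a
  rotation of speed exactly 1 and satisfies X^3 = -X. This gives the exponential a closed
  form.\<close>

lemma X_mat_cubed: "X_mat \<alpha> u *v (X_mat \<alpha> u *v (X_mat \<alpha> u *v x)) = - (X_mat \<alpha> u *v x)"
  if "u\<^sup>2 = 1"
proof -
  have u: "u * u = 1" using that by (simp add: power2_eq_square)
  have s: "sin \<alpha> * sin \<alpha> = 1 - cos \<alpha> * cos \<alpha>"
    using sin_cos_squared_add[of \<alpha>] by (simp add: power2_eq_square)
  show ?thesis
    unfolding vec3_eq_iff vector_uminus_component X_mat_components
    using u s by (intro conjI) algebra+
qed

lemma mat_minus_mult: "(- A) *v x = - (A *v x)" for A :: "real^'n^'m"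
  by (simp add: vec_eq_iff matrix_vector_mult_def sum_negf)

text \<open>The identity splits as P - X^2 with P = 1 + X^2 annihilated by X. On the second part the
  powers of tX run through the sine and cosine coefficients, and P contributes only in degree zero;
  no case distinction modulo 4 arises.\<close>

lemma sums_mat_exp_X_mat:
  assumes "u\<^sup>2 = 1"
  shows "(\<lambda>n. (1 / fact n) *\<^sub>R ((((**) (t *\<^sub>R X_mat \<alpha> u)) ^^ n) (mat 1))) sums
    (mat 1 + sin t *\<^sub>R X_mat \<alpha> u + (1 - cos t) *\<^sub>R (X_mat \<alpha> u ** X_mat \<alpha> u))"
proof -
  let ?X = "X_mat \<alpha> u"
  have X3: "?X ** (?X ** ?X) = - ?X"
    using X_mat_cubed[OF assms, of \<alpha>] by (simp add: matrix_eq matrix_vector_mul_assoc[symmetric] mat_minus_mult)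
  define P where "P = mat 1 + ?X ** ?X"
  have XP: "?X ** P = 0"
    by (simp add: P_def matrix_add_ldistrib X3)
  have sclr: "?X ** (c *\<^sub>R A) = c *\<^sub>R (?X ** A)" for c A
    by (simp add: matrix_eq matrix_vector_mul_assoc[symmetric] scaleR_matrix_vector_assoc[symmetric]
        matrix_vector_mult_scaleR)
  have pow: "(((**) (t *\<^sub>R ?X)) ^^ n) (mat 1) =
      (if n = 0 then 1 else 0) *\<^sub>R P
        + (fact n * sin_coeff n * t ^ n) *\<^sub>R ?X - (fact n * cos_coeff n * t ^ n) *\<^sub>R (?X ** ?X)" for n
  proof (induction n)
    case 0
    then show ?case by (simp add: P_def)
  next
    case (Suc n)
    have f1: "fact (Suc n) * sin_coeff (Suc n) = (fact n * cos_coeff n :: real)"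
      by (simp add: sin_coeff_Suc divide_simps)
    have f2: "fact (Suc n) * cos_coeff (Suc n) = - (fact n * sin_coeff n :: real)"
      by (simp add: cos_coeff_Suc divide_simps)
    have "(((**) (t *\<^sub>R ?X)) ^^ Suc n) (mat 1) = t *\<^sub>R (?X ** (((**) (t *\<^sub>R ?X)) ^^ n) (mat 1))"
      by (simp add: matrix_eq matrix_vector_mul_assoc[symmetric] scaleR_matrix_vector_assoc[symmetric])
    also have "\<dots> = t *\<^sub>R ((fact n * sin_coeff n * t ^ n) *\<^sub>R (?X ** ?X)
        + (fact n * cos_coeff n * t ^ n) *\<^sub>R ?X)"
      unfolding Suc
      by (simp only: matrix_add_ldistrib diff_conv_add_uminus scaleR_minus_left[symmetric] sclr XP X3)
        (simp only: scaleR_zero_right scaleR_minus_left scaleR_minus_right minus_minus add_0)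
    also have "\<dots> = (fact (Suc n) * sin_coeff (Suc n) * t ^ Suc n) *\<^sub>R ?X
        - (fact (Suc n) * cos_coeff (Suc n) * t ^ Suc n) *\<^sub>R (?X ** ?X)"
      unfolding f1 f2 by (simp add: algebra_simps)
    finally show ?case by simp
  qed
  have eq: "(1 / fact n) *\<^sub>R ((((**) (t *\<^sub>R ?X)) ^^ n) (mat 1)) =
      (if n = 0 then 1 else 0) *\<^sub>R P
        + (sin_coeff n *\<^sub>R t ^ n) *\<^sub>R ?X - (cos_coeff n *\<^sub>R t ^ n) *\<^sub>R (?X ** ?X)" for n
    unfolding pow scaleR_diff_right scaleR_add_right by simp
  have "(\<lambda>n. (if n = 0 then 1 else 0 :: real) *\<^sub>R P) sums ((1::real) *\<^sub>R P)"
    using sums_scaleR_left[OF sums_single[of 0 "\<lambda>_. 1::real"], of P] by simp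
  then have "(\<lambda>n. (if n = 0 then 1 else 0) *\<^sub>R P
        + (sin_coeff n *\<^sub>R t ^ n) *\<^sub>R ?X - (cos_coeff n *\<^sub>R t ^ n) *\<^sub>R (?X ** ?X)) sums
      ((1::real) *\<^sub>R P + sin t *\<^sub>R ?X - cos t *\<^sub>R (?X ** ?X))"
    by (rule sums_diff[OF sums_add[OF _ sums_scaleR_left[OF sin_converges]] sums_scaleR_left[OF cos_converges]])
  then show ?thesis
    unfolding eq by (simp add: P_def algebra_simps)
qed

lemma flow_rodrigues:
  assumes "\<epsilon>\<^sup>2 = 1"
  shows "flow \<alpha> \<epsilon> t x = x + sin t *\<^sub>R (X_mat \<alpha> \<epsilon> *v x)
    + (1 - cos t) *\<^sub>R (X_mat \<alpha> \<epsilon> *v (X_mat \<alpha> \<epsilon> *v x))"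
  unfolding flow_def mat_exp_def sums_unique[OF sums_mat_exp_X_mat[OF assms], symmetric]
  by (simp add: matrix_vector_mult_add_rdistrib scaleR_matrix_vector_assoc[symmetric]
      matrix_vector_mul_assoc)

lemma flow_components:
  assumes "\<epsilon>\<^sup>2 = 1"
  shows "flow \<alpha> \<epsilon> t x $ 1 = x$1 - sin t * (cos \<alpha> * x$2)
           - (1 - cos t) * (cos \<alpha> * (cos \<alpha> * x$1 - \<epsilon> * sin \<alpha> * x$3))"
    "flow \<alpha> \<epsilon> t x $ 2 = cos t * x$2 + sin t * (cos \<alpha> * x$1 - \<epsilon> * sin \<alpha> * x$3)"
    "flow \<alpha> \<epsilon> t x $ 3 = x$3 + sin t * (\<epsilon> * sin \<alpha> * x$2)
           + (1 - cos t) * (\<epsilon> * sin \<alpha> * (cos \<alpha> * x$1 - \<epsilon> * sin \<alpha> * x$3))"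
proof -
  have e: "\<epsilon> * \<epsilon> = 1" using assms by (simp add: power2_eq_square)
  have s: "sin \<alpha> * sin \<alpha> = 1 - cos \<alpha> * cos \<alpha>"
    using sin_cos_squared_add[of \<alpha>] by (simp add: power2_eq_square)
  show "flow \<alpha> \<epsilon> t x $ 1 = x$1 - sin t * (cos \<alpha> * x$2)
           - (1 - cos t) * (cos \<alpha> * (cos \<alpha> * x$1 - \<epsilon> * sin \<alpha> * x$3))"
    unfolding flow_rodrigues[OF assms] by (simp add: X_mat_components algebra_simps)
  show "flow \<alpha> \<epsilon> t x $ 2 = cos t * x$2 + sin t * (cos \<alpha> * x$1 - \<epsilon> * sin \<alpha> * x$3)"
    unfolding flow_rodrigues[OF assms] vector_add_component vector_scaleR_component X_mat_components
      real_scaleR_def using e s by algebra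
  show "flow \<alpha> \<epsilon> t x $ 3 = x$3 + sin t * (\<epsilon> * sin \<alpha> * x$2)
           + (1 - cos t) * (\<epsilon> * sin \<alpha> * (cos \<alpha> * x$1 - \<epsilon> * sin \<alpha> * x$3))"
    unfolding flow_rodrigues[OF assms] by (simp add: X_mat_components algebra_simps)
qed

lemma flow_0 [simp]: "\<epsilon>\<^sup>2 = 1 \<Longrightarrow> flow \<alpha> \<epsilon> 0 x = x"
  by (simp add: flow_rodrigues)

lemma flow_has_vector_derivative:
  assumes "\<epsilon>\<^sup>2 = 1"
  shows "((\<lambda>t. flow \<alpha> \<epsilon> t x) has_vector_derivative X_mat \<alpha> \<epsilon> *v flow \<alpha> \<epsilon> t x) (at t within S)"
proof -
  let ?X = "X_mat \<alpha> \<epsilon>"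
  have "((\<lambda>t. x + sin t *\<^sub>R (?X *v x) + (1 - cos t) *\<^sub>R (?X *v (?X *v x))) has_vector_derivative
      (0 + (cos t *\<^sub>R (?X *v x)) + (0 - - sin t) *\<^sub>R (?X *v (?X *v x)))) (at t within S)"
    unfolding scaleR_diff_left
    by (auto intro!: derivative_eq_intros simp: has_vector_derivative_def algebra_simps)
  also have "(0 + (cos t *\<^sub>R (?X *v x)) + (0 - - sin t) *\<^sub>R (?X *v (?X *v x))) = ?X *v flow \<alpha> \<epsilon> t x"
    unfolding flow_rodrigues[OF assms] matrix_vector_right_distrib
      matrix_vector_mult_scaleR X_mat_cubed[OF assms] by (simp add: algebra_simps)
  finally show ?thesis unfolding flow_rodrigues[OF assms] .
qed

text \<open>The difference of two solutions solves the same linear equation, and skew symmetry keeps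
  its squared norm constant, so it stays zero. This replaces a Gronwall estimate.\<close>

lemma flow_unique:
  assumes "\<epsilon>\<^sup>2 = 1"
    and y: "\<And>t. t \<in> {a..b} \<Longrightarrow> (y has_vector_derivative X_mat \<alpha> \<epsilon> *v y t) (at t within {a..b})"
    and t: "t \<in> {a..b}"
  shows "y t = flow \<alpha> \<epsilon> (t - a) (y a)"
proof -
  define z where "z = (\<lambda>t. flow \<alpha> \<epsilon> (t - a) (y a))"
  have z: "(z has_vector_derivative X_mat \<alpha> \<epsilon> *v z t) (at t within {a..b})" for t
  proof -
    have "((\<lambda>t. flow \<alpha> \<epsilon> t (y a)) \<circ> (\<lambda>t. t - a) has_vector_derivative
        1 *\<^sub>R (X_mat \<alpha> \<epsilon> *v flow \<alpha> \<epsilon> (t - a) (y a))) (at t within {a..b})"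
      by (rule vector_diff_chain_within)
        (auto intro!: derivative_eq_intros flow_has_vector_derivative[OF assms(1)])
    then show ?thesis by (simp add: z_def o_def)
  qed
  define d where "d = (\<lambda>t. y t - z t)"
  have d: "(d has_vector_derivative X_mat \<alpha> \<epsilon> *v d t) (at t within {a..b})" if "t \<in> {a..b}" for t
    using has_vector_derivative_diff[OF y[OF that] z[of t]] 
    by (simp add: d_def matrix_vector_mult_diff_distrib)
  have "((\<lambda>t. d t \<bullet> d t) has_derivative (\<lambda>h. 0)) (at t within {a..b})" if "t \<in> {a..b}" for t
    using has_derivative_inner[OF d[OF that, unfolded has_vector_derivative_def] d[OF that, unfolded has_vector_derivative_def]]
    by (simp add: X_mat_self_inner inner_commute)
  then obtain c where c: "\<forall>t\<in>{a..b}. d t \<bullet> d t = c"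
    using has_derivative_zero_constant[of "{a..b}" "\<lambda>t. d t \<bullet> d t"] by auto
  moreover have "d a = 0" by (simp add: d_def z_def assms(1))
  ultimately have "d t = 0"
    using t by (metis atLeastAtMost_iff inner_eq_zero_iff order_refl order_trans)
  then show ?thesis by (simp add: d_def z_def)
qed

lemma flow_add:
  assumes "\<epsilon>\<^sup>2 = 1"
  shows "flow \<alpha> \<epsilon> s (flow \<alpha> \<epsilon> t x) = flow \<alpha> \<epsilon> (s + t) x"
proof -
  have e: "\<epsilon> * \<epsilon> = 1" using assms by (simp add: power2_eq_square)
  have s: "sin \<alpha> * sin \<alpha> = 1 - cos \<alpha> * cos \<alpha>"
    using sin_cos_squared_add[of \<alpha>] by (simp add: power2_eq_square)
  define A where "A = X_mat \<alpha> \<epsilon> *v x"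
  define B where "B = X_mat \<alpha> \<epsilon> *v A"
  have XB: "X_mat \<alpha> \<epsilon> *v B = - A" by (simp add: A_def B_def X_mat_cubed[OF assms])
  have "flow \<alpha> \<epsilon> s (x + sin t *\<^sub>R A + (1 - cos t) *\<^sub>R B) =
      x + sin (s + t) *\<^sub>R A + (1 - cos (s + t)) *\<^sub>R B"
    unfolding flow_rodrigues[OF assms] matrix_vector_right_distrib matrix_vector_mult_scaleR
      A_def[symmetric] B_def[symmetric] XB X_mat_minus sin_add cos_add
    by (simp add: algebra_simps)
  then show ?thesis
    by (simp add: flow_rodrigues[OF assms, of _ t] flow_rodrigues[OF assms, of _ "s + t"] A_def B_def)
qed

subsection \<open>Caratheodory solutions\<close>

text \<open>Absolute continuity in the form of the integral equation of \<open>admissible\<close>;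
  \<open>f'\<close> is any integrand that reproduces \<open>f\<close>, and pointwise
  differentiability is not part of the notion.\<close>

definition primitive :: "real \<Rightarrow> (real \<Rightarrow> 'a::euclidean_space) \<Rightarrow> (real \<Rightarrow> 'a) \<Rightarrow> bool" where
  "primitive T f f' \<longleftrightarrow> (\<forall>t\<in>{0..T}. (f' has_integral (f t - f 0)) {0..t})"

lemma primitive_interval:
  assumes "primitive T f f'" "0 \<le> s" "s \<le> t" "t \<le> T"
  shows "(f' has_integral (f t - f s)) {s..t}"
proof -
  have 1: "(f' has_integral (f t - f 0)) {0..t}" "(f' has_integral (f s - f 0)) {0..s}"
    using assms by (auto simp: primitive_def)
  have "f' integrable_on {s..t}"
    by (rule integrable_subinterval_real[OF has_integral_integrable[OF 1(1)]]) (use assms(2,3) in auto)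
  then have 2: "(f' has_integral integral {s..t} f') {s..t}" by (rule integrable_integral)
  have "f s - f 0 + integral {s..t} f' = f t - f 0"
    by (rule has_integral_unique[OF has_integral_combine[OF assms(2,3) 1(2) 2] 1(1)])
  then have "integral {s..t} f' = f t - f s" by (simp add: algebra_simps)
  with 2 show ?thesis by simp
qed

lemma primitive_integrable: "primitive T f f' \<Longrightarrow> 0 \<le> T \<Longrightarrow> f' integrable_on {0..T}"
  unfolding primitive_def by (metis atLeastAtMost_iff has_integral_integrable order_refl)

lemma primitive_continuous:
  assumes "primitive T f f'"
  shows "continuous_on {0..T} f"
proof (cases "0 \<le> T")
  case True
  have "continuous_on {0..T} (\<lambda>t. f 0 + integral {0..t} f')"
    by (intro continuous_intros indefinite_integral_continuous_1 primitive_integrable[OF assms True])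
  moreover have "f 0 + integral {0..t} f' = f t" if "t \<in> {0..T}" for t
    using integral_unique[of f' "f t - f 0" "{0..t}"] assms that by (simp add: primitive_def)
  ultimately show ?thesis by (rule continuous_on_eq)
qed simp

lemma primitive_subset: "primitive T f f' \<Longrightarrow> t \<le> T \<Longrightarrow> primitive t f f'"
  by (auto simp: primitive_def)

lemma primitive_lipschitz:
  assumes "primitive T f f'" "\<And>t. t \<in> {0..T} \<Longrightarrow> norm (f' t) \<le> A" "s \<in> {0..T}" "t \<in> {0..T}"
  shows "norm (f t - f s) \<le> A * \<bar>t - s\<bar>"
proof -
  have *: "norm (f t - f s) \<le> A * (t - s)" if "s \<le> t" "0 \<le> s" "t \<le> T" for s t
  proof -
    have "0 \<le> A" using order_trans[OF norm_ge_zero assms(2)[of s]] that by auto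
    moreover have "norm (f' x) \<le> A" if "x \<in> cbox s t" for x
      using that \<open>0 \<le> s\<close> \<open>t \<le> T\<close> by (intro assms(2)) auto
    ultimately have "norm (f t - f s) \<le> A * measure lborel (cbox s t)"
      using has_integral_bound[of A f' "f t - f s" s t] primitive_interval[OF assms(1) that(2,1,3)] by auto
    then show ?thesis using that by simp
  qed
  show ?thesis
    using *[of s t] *[of t s] assms(3,4) by (cases "s \<le> t") (auto simp: norm_minus_commute)
qed

text \<open>Increments bounded by a multiple of (t - s)^2 force the derivative to vanish at every
  point. The criterion speaks of increments only, so it applies where integrands are merely
  measurable.\<close>

lemma constant_if_quadratic_increments:
  fixes P :: "real \<Rightarrow> 'a::real_normed_vector"
  assumes "\<And>s t. 0 \<le> s \<Longrightarrow> s \<le> t \<Longrightarrow> t \<le> T \<Longrightarrow> norm (P t - P s) \<le> C * (t - s)\<^sup>2"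
    and "t \<in> {0..T}"
  shows "P t = P 0"
proof -
  have C: "norm (P y - P x) \<le> \<bar>C\<bar> * norm (y - x) * norm (y - x)" if "x \<in> {0..T}" "y \<in> {0..T}" for x y
  proof -
    have "norm (P y - P x) \<le> C * (y - x)\<^sup>2"
      using assms(1)[of x y] assms(1)[of y x] that
      by (cases "x \<le> y") (auto simp: norm_minus_commute power2_commute)
    also have "\<dots> \<le> \<bar>C\<bar> * (y - x)\<^sup>2" by (intro mult_right_mono) auto
    finally show ?thesis by (simp add: power2_eq_square mult.assoc)
  qed
  have D: "(P has_derivative (\<lambda>h. 0)) (at x within {0..T})" if "x \<in> {0..T}" for x
    unfolding has_derivative_within_alt
  proof (intro conjI allI impI)
    fix e :: real assume "e > 0"
    show "\<exists>d>0. \<forall>y\<in>{0..T}. norm (y - x) < d \<longrightarrow> norm (P y - P x - 0) \<le> e * norm (y - x)"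
    proof (intro exI[of _ "e / (\<bar>C\<bar> + 1)"] conjI ballI impI)
      show "0 < e / (\<bar>C\<bar> + 1)" using \<open>e > 0\<close> by (auto intro!: divide_pos_pos)
      fix y assume y: "y \<in> {0..T}" "norm (y - x) < e / (\<bar>C\<bar> + 1)"
      then have "(\<bar>C\<bar> + 1) * norm (y - x) \<le> e" by (simp add: field_simps)
      then have "\<bar>C\<bar> * norm (y - x) \<le> e"
        by (smt (verit) mult_right_mono norm_ge_zero)
      then have "\<bar>C\<bar> * norm (y - x) * norm (y - x) \<le> e * norm (y - x)"
        by (intro mult_right_mono) auto
      with C[OF that y(1)] show "norm (P y - P x - 0) \<le> e * norm (y - x)" by simp
    qed
  qed (rule bounded_linear_zero)
  have "\<exists>c. \<forall>x\<in>{0..T}. P x = c"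
    by (rule has_derivative_zero_constant[OF _ D]) simp_all
  then obtain c where c: "\<forall>x\<in>{0..T}. P x = c" ..
  have "0 \<in> {0..T}" using assms(2) by simp
  then show ?thesis using c assms(2) by metis
qed

text \<open>The product rule holds for Caratheodory solutions because the defect of both sides has
  increments of second order.\<close>

lemma primitive_bilinear:
  fixes f :: "real \<Rightarrow> 'a::euclidean_space" and g :: "real \<Rightarrow> 'b::euclidean_space"
    and h :: "'a \<Rightarrow> 'b \<Rightarrow> 'c::euclidean_space"
  assumes h: "bounded_bilinear h"
    and f: "primitive T f f'" and g: "primitive T g g'"
    and A: "\<And>t. t \<in> {0..T} \<Longrightarrow> norm (f' t) \<le> A" and B: "\<And>t. t \<in> {0..T} \<Longrightarrow> norm (g' t) \<le> B"
  shows "primitive T (\<lambda>t. h (f t) (g t)) (\<lambda>t. h (f' t) (g t) + h (f t) (g' t))"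
proof (cases "0 \<le> T")
  case False
  then show ?thesis by (simp add: primitive_def)
next
  case T: True
  interpret h: bounded_bilinear h by fact
  obtain K where K: "K > 0" "\<And>a b. norm (h a b) \<le> norm a * norm b * K"
    using h.pos_bounded by blast
  have AB: "A \<ge> 0" "B \<ge> 0" using order_trans[OF norm_ge_zero A[of 0]] order_trans[OF norm_ge_zero B[of 0]] T by auto
  define k where "k = (\<lambda>t. h (f' t) (g t) + h (f t) (g' t))"
  have fint: "f' integrable_on {0..T}" and gint: "g' integrable_on {0..T}"
    using primitive_integrable f g T by auto
  have bl: "bilinear h" using h by (simp add: bilinear_conv_bounded_bilinear)
  have bl': "bilinear (\<lambda>x y. h y x)" using h.flip by (simp add: bilinear_conv_bounded_bilinear)
  have fabs: "f' absolutely_integrable_on {0..T}"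
    by (rule absolutely_integrable_integrable_bound[where g = "\<lambda>_. A"]) (use A fint in auto)
  have gabs: "g' absolutely_integrable_on {0..T}"
    by (rule absolutely_integrable_integrable_bound[where g = "\<lambda>_. B"]) (use B gint in auto)
  have fc: "continuous_on {0..T} f" and gc: "continuous_on {0..T} g"
    using f g primitive_continuous by auto
  have ci: "(\<lambda>t. h (f t) (g' t)) absolutely_integrable_on {0..T}"
    by (rule absolutely_integrable_bounded_measurable_product[OF bl _ _ _ gabs])
      (auto intro!: continuous_imp_measurable_on_sets_lebesgue fc compact_imp_bounded
        compact_continuous_image)
  have ci': "(\<lambda>t. h (f' t) (g t)) absolutely_integrable_on {0..T}"
    by (rule absolutely_integrable_bounded_measurable_product[OF bl' _ _ _ fabs])
      (auto intro!: continuous_imp_measurable_on_sets_lebesgue gc compact_imp_bounded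
        compact_continuous_image)
  have kint: "k integrable_on {0..T}"
    unfolding k_def using ci ci'
    by (intro integrable_add) (auto simp: absolutely_integrable_on_def)
  define P where "P = (\<lambda>t. h (f t) (g t) - integral {0..t} k)"
  have Pc: "P t = P 0" if "t \<in> {0..T}" for t
  proof (rule constant_if_quadratic_increments[OF _ that])
    fix s t :: real assume st: "0 \<le> s" "s \<le> t" "t \<le> T"
    have kst: "k integrable_on {s..t}" "k integrable_on {0..t}"
      using kint by (rule integrable_subinterval_real; use st in auto)+
    have 1: "((\<lambda>\<tau>. h (f t) (g' \<tau>)) has_integral h (f t) (g t - g s)) {s..t}"
      using has_integral_linear[OF primitive_interval[OF g st] h.bounded_linear_right[of "f t"]]
      by (simp add: o_def)
    have 2: "((\<lambda>\<tau>. h (f' \<tau>) (g s)) has_integral h (f t - f s) (g s)) {s..t}"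
      using has_integral_linear[OF primitive_interval[OF f st] h.bounded_linear_left[of "g s"]]
      by (simp add: o_def)
    have "integral {0..s} k + integral {s..t} k = integral {0..t} k"
      using st kst by (intro Henstock_Kurzweil_Integration.integral_combine) auto
    then have e: "P t - P s = (h (f t) (g t - g s) + h (f t - f s) (g s)) - integral {s..t} k"
      by (simp add: P_def h.diff_left h.diff_right algebra_simps)
    have "((\<lambda>\<tau>. (h (f t) (g' \<tau>) + h (f' \<tau>) (g s)) - k \<tau>) has_integral (P t - P s)) {s..t}"
      unfolding e by (intro has_integral_diff has_integral_add 1 2 integrable_integral kst)
    moreover have "norm ((h (f t) (g' \<tau>) + h (f' \<tau>) (g s)) - k \<tau>) \<le> 2 * A * B * K * (t - s)"
      if "\<tau> \<in> cbox s t" for \<tau>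
    proof -
      have \<tau>: "\<tau> \<in> {0..T}" "s \<le> \<tau>" "\<tau> \<le> t" using that st by auto
      have "(h (f t) (g' \<tau>) + h (f' \<tau>) (g s)) - k \<tau> = h (f t - f \<tau>) (g' \<tau>) + h (f' \<tau>) (g s - g \<tau>)"
        by (simp add: k_def h.diff_left h.diff_right algebra_simps)
      also have "norm \<dots> \<le> norm (f t - f \<tau>) * norm (g' \<tau>) * K + norm (f' \<tau>) * norm (g s - g \<tau>) * K"
        by (meson K(2) add_mono norm_triangle_le)
      also have "\<dots> \<le> (A * (t - s)) * B * K + A * (B * (t - s)) * K"
      proof -
        have "norm (f t - f \<tau>) \<le> A * (t - s)"
        proof -
          have "norm (f t - f \<tau>) \<le> A * \<bar>t - \<tau>\<bar>"
            by (rule primitive_lipschitz[OF f A]) (use \<tau> st in auto)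
          also have "\<dots> \<le> A * (t - s)" using \<tau> AB by (intro mult_left_mono) auto
          finally show ?thesis .
        qed
        moreover have "norm (g s - g \<tau>) \<le> B * (t - s)"
        proof -
          have "norm (g s - g \<tau>) \<le> B * \<bar>s - \<tau>\<bar>"
            by (rule primitive_lipschitz[OF g B]) (use \<tau> st in auto)
          also have "\<dots> \<le> B * (t - s)" using \<tau> AB by (intro mult_left_mono) auto
          finally show ?thesis .
        qed
        moreover have "norm (f' \<tau>) \<le> A" "norm (g' \<tau>) \<le> B" using A B \<tau> by auto
        ultimately show ?thesis
          using AB K(1) st by (intro add_mono mult_right_mono mult_mono) auto
      qed
      also have "\<dots> = 2 * A * B * K * (t - s)" by (simp add: algebra_simps)
      finally show ?thesis .
    qed
    ultimately have "norm (P t - P s) \<le> (2 * A * B * K * (t - s)) * measure lborel (cbox s t)"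
      using AB K st by (intro has_integral_bound) auto
    then show "norm (P t - P s) \<le> (2 * A * B * K) * (t - s)\<^sup>2"
      using st by (simp add: power2_eq_square mult.assoc)
  qed
  have "integral {0..t} k = h (f t) (g t) - h (f 0) (g 0)" if "t \<in> {0..T}" for t
    using Pc[OF that] by (simp add: P_def algebra_simps)
  moreover have "k integrable_on {0..t}" if "t \<in> {0..T}" for t
    using kint by (rule integrable_subinterval_real) (use that in auto)
  ultimately show ?thesis
    unfolding primitive_def k_def[symmetric] by (metis integrable_integral)
qed

section \<open>Controls, solutions and their dependence on the control\<close>

text \<open>On a bounded interval, integrability together with the bound 1 amounts to the Lebesgue
  measurability required in \<open>admissible\<close>, and it is the form in which the gauge
  integral is applied.\<close>

definition control :: "real \<Rightarrow> (real \<Rightarrow> real) \<Rightarrow> bool" where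
  "control T u \<longleftrightarrow> u integrable_on {0..T} \<and> (\<forall>t\<in>{0..T}. \<bar>u t\<bar> \<le> 1)"

definition solution :: "real \<Rightarrow> real \<Rightarrow> (real \<Rightarrow> real) \<Rightarrow> (real \<Rightarrow> real^3) \<Rightarrow> bool" where
  "solution \<alpha> T u x \<longleftrightarrow> primitive T x (\<lambda>\<tau>. X_mat \<alpha> (u \<tau>) *v x \<tau>)"

lemma control_measurable: "control T u \<Longrightarrow> u \<in> borel_measurable (lebesgue_on {0..T})"
  by (auto simp: control_def intro: integrable_imp_measurable)

lemma controlI:
  assumes "u \<in> borel_measurable (lebesgue_on {0..T})" "\<And>t. t \<in> {0..T} \<Longrightarrow> \<bar>u t\<bar> \<le> 1"
  shows "control T u"
  using measurable_bounded_by_integrable_imp_integrable[of u "{0..T}" "\<lambda>_. 1"] assms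
  by (auto simp: control_def)

lemma control_mult_integrable:
  fixes g :: "real \<Rightarrow> 'a::euclidean_space"
  assumes "control T u" "continuous_on {0..T} g"
  shows "(\<lambda>\<tau>. u \<tau> *\<^sub>R g \<tau>) integrable_on {0..T}"
proof -
  have bl: "bilinear (scaleR :: real \<Rightarrow> 'a \<Rightarrow> 'a)"
    using bounded_bilinear_scaleR by (simp add: bilinear_conv_bounded_bilinear)
  have "bounded (u ` {0..T})"
    using assms(1) by (auto simp: control_def bounded_iff)
  then have "(\<lambda>\<tau>. u \<tau> *\<^sub>R g \<tau>) absolutely_integrable_on {0..T}"
    by (intro absolutely_integrable_bounded_measurable_product[OF bl]
        control_measurable[OF assms(1)] absolutely_integrable_continuous_real assms(2)) auto
  then show ?thesis by (simp add: absolutely_integrable_on_def)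
qed

lemma control_subset: "control T u \<Longrightarrow> t \<le> T \<Longrightarrow> control t u"
  by (auto simp: control_def intro: integrable_subinterval_real)

lemma solution_subset: "solution \<alpha> T u x \<Longrightarrow> t \<le> T \<Longrightarrow> solution \<alpha> t u x"
  by (auto simp: solution_def intro: primitive_subset)

lemma continuous_on_mat_mult: "continuous_on S x \<Longrightarrow> continuous_on S (\<lambda>t. A *v x t)"
  for A :: "real^'n^'m"
  by (rule bounded_linear.continuous_on[OF matrix_vector_mul_bounded_linear])

lemma X_mat_rhs_integrable:
  assumes "control T u" "continuous_on {0..T} x"
  shows "(\<lambda>\<tau>. X_mat \<alpha> (u \<tau>) *v x \<tau>) integrable_on {0..T}"
proof -
  have "(\<lambda>\<tau>. X_mat \<alpha> 0 *v x \<tau> + u \<tau> *\<^sub>R (G_mat \<alpha> *v x \<tau>)) integrable_on {0..T}"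
    by (intro integrable_add integrable_continuous_real control_mult_integrable
        continuous_on_mat_mult assms)
  then show ?thesis
    unfolding X_mat_diff_control[of \<alpha> "u _" _ 0] by simp
qed

lemma solution_continuous: "solution \<alpha> T u x \<Longrightarrow> continuous_on {0..T} x"
  by (auto simp: solution_def primitive_continuous)

lemma solution_bound:
  assumes "control T u" "solution \<alpha> T u x"
  shows "\<exists>B. \<forall>t\<in>{0..T}. norm (X_mat \<alpha> (u t) *v x t) \<le> B"
proof -
  have "bounded (x ` {0..T})"
    using assms by (intro compact_imp_bounded compact_continuous_image solution_continuous) auto
  then obtain B where "\<forall>t\<in>{0..T}. norm (x t) \<le> B"
    by (auto simp: bounded_iff)
  with assms(1) show ?thesis
    by (meson control_def norm_X_mat_le order_trans)
qed

text \<open>By skew symmetry the derivative of the inner product vanishes. Since points and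
  covectors obey the same linear equation, this covers at once the invariance of the sphere, the
  orthogonality of \<open>p\<close> and \<open>x\<close>, and the constancy of |p|.\<close>

lemma solution_inner:
  assumes u: "control T u" and x: "solution \<alpha> T u x" and y: "solution \<alpha> T u y" and t: "t \<in> {0..T}"
  shows "x t \<bullet> y t = x 0 \<bullet> y 0"
proof -
  obtain A where A: "\<And>t. t \<in> {0..T} \<Longrightarrow> norm (X_mat \<alpha> (u t) *v x t) \<le> A"
    using solution_bound[OF u x] by blast
  obtain B where B: "\<And>t. t \<in> {0..T} \<Longrightarrow> norm (X_mat \<alpha> (u t) *v y t) \<le> B"
    using solution_bound[OF u y] by blast
  have *: "(X_mat \<alpha> (u t) *v x t) \<bullet> y t + x t \<bullet> (X_mat \<alpha> (u t) *v y t) = 0" for t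
    using X_mat_skew[of "x t" \<alpha> "u t" "y t"] by linarith
  have "primitive T (\<lambda>t. x t \<bullet> y t)
      (\<lambda>t. (X_mat \<alpha> (u t) *v x t) \<bullet> y t + x t \<bullet> (X_mat \<alpha> (u t) *v y t))"
    using x y unfolding solution_def
    by (rule primitive_bilinear[OF bounded_bilinear_inner _ _ A B]) auto
  then have p: "primitive T (\<lambda>t. x t \<bullet> y t) (\<lambda>t. 0)"
    unfolding * .
  have "((\<lambda>t. 0) has_integral (x t \<bullet> y t - x 0 \<bullet> y 0)) {0..t}"
    using p t unfolding primitive_def by blast
  then have "x t \<bullet> y t - x 0 \<bullet> y 0 = 0" by (rule has_integral_unique) (rule has_integral_0)
  then show ?thesis by simp
qed

lemma solution_norm:
  assumes "control T u" "solution \<alpha> T u x" "t \<in> {0..T}"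
  shows "norm (x t) = norm (x 0)"
  using solution_inner[OF assms(1,2,2,3)] by (simp add: norm_eq_sqrt_inner)

lemma solution_lipschitz:
  assumes "control T u" "solution \<alpha> T u x" "s \<in> {0..T}" "t \<in> {0..T}"
  shows "norm (x t - x s) \<le> norm (x 0) * \<bar>t - s\<bar>"
proof (rule primitive_lipschitz[OF assms(2)[unfolded solution_def] _ assms(3,4)])
  fix t assume t: "t \<in> {0..T}"
  then have "norm (X_mat \<alpha> (u t) *v x t) \<le> norm (x t)"
    using assms(1) by (auto simp: control_def intro: norm_X_mat_le)
  then show "norm (X_mat \<alpha> (u t) *v x t) \<le> norm (x 0)"
    using solution_norm[OF assms(1,2) t] by simp
qed

text \<open>Solutions have constant norm, so the constraint to stay on the sphere reduces to a
  condition on the initial point.\<close>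

lemma admissible_iff:
  "admissible \<alpha> T x u \<longleftrightarrow> 0 \<le> T \<and> control T u \<and> solution \<alpha> T u x \<and> norm (x 0) = 1"
  (is "?L \<longleftrightarrow> ?R")
proof
  assume ?L
  then show ?R
    by (auto simp: admissible_def solution_def primitive_def intro: controlI)
next
  assume R: ?R
  then show ?L
    using solution_norm[of T u \<alpha> x] control_measurable[of T u]
    by (auto simp: admissible_def solution_def primitive_def control_def)
qed

text \<open>In the derivative of |d|^2 the skew part cancels and only the difference of the controls
  survives, multiplied by a vector of norm at most 1. The bound is therefore linear in T instead of
  exponential.\<close>

lemma solution_diff_bound:
  assumes u: "control T u" and w: "control T w"
    and x: "solution \<alpha> T u x" and y: "solution \<alpha> T w y"
    and xy: "x 0 = y 0" and n: "norm (x 0) = 1"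
    and eta: "\<And>t. t \<in> {0..T} \<Longrightarrow> \<bar>u t - w t\<bar> \<le> \<eta>" and t: "t \<in> {0..T}"
  shows "norm (x t - y t) \<le> 2 * \<eta> * T"
proof -
  have T: "0 \<le> T" using t by auto
  have eta0: "0 \<le> \<eta>" using eta[of 0] T by auto
  define d where "d = (\<lambda>t. x t - y t)"
  define d' where "d' = (\<lambda>t. X_mat \<alpha> (u t) *v x t - X_mat \<alpha> (w t) *v y t)"
  have d: "primitive T d d'"
    unfolding primitive_def
  proof
    fix t assume "t \<in> {0..T}"
    then have "(d' has_integral ((x t - x 0) - (y t - y 0))) {0..t}"
      unfolding d'_def using x y
      by (intro has_integral_diff) (auto simp: solution_def primitive_def)
    then show "(d' has_integral d t - d 0) {0..t}"
      by (simp add: d_def algebra_simps)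
  qed
  obtain A where A: "\<And>t. t \<in> {0..T} \<Longrightarrow> norm (X_mat \<alpha> (u t) *v x t) \<le> A"
    using solution_bound[OF u x] by blast
  obtain B where B: "\<And>t. t \<in> {0..T} \<Longrightarrow> norm (X_mat \<alpha> (w t) *v y t) \<le> B"
    using solution_bound[OF w y] by blast
  have d'b: "norm (d' t) \<le> A + B" if "t \<in> {0..T}" for t
    unfolding d'_def using A[OF that] B[OF that] by norm
  have dd: "primitive T (\<lambda>t. d t \<bullet> d t) (\<lambda>t. d' t \<bullet> d t + d t \<bullet> d' t)"
    by (rule primitive_bilinear[OF bounded_bilinear_inner d d d'b d'b])
  have ct: "continuous_on {0..T} (\<lambda>t. norm (d t))"
    by (intro continuous_on_norm primitive_continuous[OF d])
  \<comment> \<open>At the maximum M of |d| the estimate becomes M^2 \<le> 2 \<eta> M T, from which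
    one factor M is cancelled.\<close>
  obtain s where s: "s \<in> {0..T}" "\<And>t. t \<in> {0..T} \<Longrightarrow> norm (d t) \<le> norm (d s)"
    using continuous_attains_sup[OF _ _ ct] T by auto
  define M where "M = norm (d s)"
  have "norm (d' t \<bullet> d t + d t \<bullet> d' t) \<le> 2 * \<eta> * M" if t: "t \<in> {0..T}" for t
  proof -
    have e: "d' t = X_mat \<alpha> (u t) *v d t + (u t - w t) *\<^sub>R (G_mat \<alpha> *v y t)"
      unfolding d'_def d_def X_mat_diff_control[of \<alpha> "w t" "y t" "u t"]
      by (simp add: matrix_vector_mult_diff_distrib algebra_simps)
    have "d' t \<bullet> d t + d t \<bullet> d' t = 2 * ((u t - w t) * ((G_mat \<alpha> *v y t) \<bullet> d t))"
      unfolding e by (simp add: inner_add_left inner_add_right X_mat_self_inner inner_commute)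
    also have "norm \<dots> \<le> 2 * (\<eta> * (1 * M))"
      unfolding real_norm_def abs_mult
    proof (intro mult_mono eta[OF t])
      have "\<bar>(G_mat \<alpha> *v y t) \<bullet> d t\<bar> \<le> norm (G_mat \<alpha> *v y t) * norm (d t)"
        by (rule Cauchy_Schwarz_ineq2)
      also have "\<dots> \<le> norm (y t) * M"
        unfolding M_def by (intro mult_mono norm_G_mat_le s(2) t) auto
      finally show "\<bar>(G_mat \<alpha> *v y t) \<bullet> d t\<bar> \<le> 1 * M"
        using solution_norm[OF w y t] n xy by simp
    qed (auto simp: eta0)
    finally show ?thesis by simp
  qed
  then have "norm (d s \<bullet> d s - d 0 \<bullet> d 0) \<le> 2 * \<eta> * M * \<bar>s - 0\<bar>"
    by (rule primitive_lipschitz[OF dd]) (use s T in auto)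
  moreover have "d 0 = 0" by (simp add: d_def xy)
  ultimately have "M * M \<le> 2 * \<eta> * M * s"
    using s by (simp add: M_def dot_square_norm power2_eq_square)
  also have "\<dots> \<le> 2 * \<eta> * M * T"
    using s eta0 by (intro mult_left_mono) (auto simp: M_def)
  finally have "M * M \<le> (2 * \<eta> * T) * M" by (simp add: mult.assoc mult.commute mult.left_commute)
  then have "M \<le> 2 * \<eta> * T \<or> M = 0"
    by (metis M_def mult_le_cancel_right norm_ge_zero not_le order_antisym_conv order_less_irrefl)
  then have "M \<le> 2 * \<eta> * T" using eta0 T by auto
  then show ?thesis using s(2)[OF t] by (simp add: M_def d_def)
qed

section \<open>Existence of solutions by the Picard series\<close>

text \<open>The terms of the Peano-Baker series, that is, the successive differences of the Picard
  iterates. The equation is linear, so their partial sums are the iterates themselves, and the n-th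
  term is bounded by t^n / n!.\<close>

primrec picard :: "real \<Rightarrow> (real \<Rightarrow> real) \<Rightarrow> real^3 \<Rightarrow> nat \<Rightarrow> real \<Rightarrow> real^3" where
  "picard \<alpha> u y 0 = (\<lambda>t. y)"
| "picard \<alpha> u y (Suc n) = (\<lambda>t. integral {0..t} (\<lambda>\<tau>. X_mat \<alpha> (u \<tau>) *v picard \<alpha> u y n \<tau>))"

lemma has_integral_monomial_fact:
  assumes "0 \<le> (t::real)"
  shows "((\<lambda>\<tau>. c * \<tau> ^ n / fact n) has_integral c * t ^ Suc n / fact (Suc n)) {0..t}"
proof -
  have "((\<lambda>\<tau>. c * \<tau> ^ n / fact n) has_integral c * t ^ Suc n / fact (Suc n) - c * 0 ^ Suc n / fact (Suc n)) {0..t}"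
  proof (rule fundamental_theorem_of_calculus[OF assms])
    fix x :: real
    have "((\<lambda>\<tau>. c * \<tau> ^ Suc n / fact (Suc n)) has_real_derivative
        c * (real (Suc n) * x ^ n) / fact (Suc n)) (at x within {0..t})"
      by (auto intro!: derivative_eq_intros simp del: power_Suc)
    also have "c * (real (Suc n) * x ^ n) / fact (Suc n) = c * x ^ n / fact n"
      unfolding fact_Suc by (simp del: of_nat_Suc)
    finally show "((\<lambda>\<tau>. c * \<tau> ^ Suc n / fact (Suc n)) has_vector_derivative c * x ^ n / fact n)
        (at x within {0..t})"
      by (simp add: has_real_derivative_iff_has_vector_derivative)
  qed
  then show ?thesis by simp
qed

lemma picard_bound:
  assumes u: "control T u"
  shows "continuous_on {0..T} (picard \<alpha> u y n) \<and>
    (\<forall>t\<in>{0..T}. norm (picard \<alpha> u y n t) \<le> norm y * t ^ n / fact n)"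
proof (induction n)
  case 0
  then show ?case by simp
next
  case (Suc n)
  let ?k = "\<lambda>\<tau>. X_mat \<alpha> (u \<tau>) *v picard \<alpha> u y n \<tau>"
  have k: "?k integrable_on {0..T}"
    using Suc by (intro X_mat_rhs_integrable u) simp
  have "norm (picard \<alpha> u y (Suc n) t) \<le> norm y * t ^ Suc n / fact (Suc n)" if t: "t \<in> {0..T}" for t
  proof -
    have t0: "0 \<le> t" using t by simp
    have kt: "?k integrable_on {0..t}"
      by (rule integrable_subinterval_real[OF k]) (use t in auto)
    have m: "norm (?k \<tau>) \<le> norm y * \<tau> ^ n / fact n" if "\<tau> \<in> {0..t}" for \<tau>
    proof -
      have \<tau>: "\<tau> \<in> {0..T}" using that t by auto
      have "norm (?k \<tau>) \<le> norm (picard \<alpha> u y n \<tau>)"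
        using u \<tau> by (intro norm_X_mat_le) (auto simp: control_def)
      also have "\<dots> \<le> norm y * \<tau> ^ n / fact n" using Suc \<tau> by blast
      finally show ?thesis .
    qed
    note I = has_integral_monomial_fact[OF t0, of "norm y" n]
    have "norm (integral {0..t} ?k) \<le> integral {0..t} (\<lambda>\<tau>. norm y * \<tau> ^ n / fact n)"
      by (rule Henstock_Kurzweil_Integration.integral_norm_bound_integral[OF kt has_integral_integrable[OF I] m])
    then show ?thesis unfolding integral_unique[OF I] by simp
  qed
  moreover have "continuous_on {0..T} (picard \<alpha> u y (Suc n))"
    unfolding picard.simps by (rule indefinite_integral_continuous_1[OF k])
  ultimately show ?case by blast
qed

lemma solution_exists:
  assumes u: "control T u" and T: "0 \<le> T"
  shows "\<exists>x. x 0 = y \<and> solution \<alpha> T u x"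
proof -
  let ?p = "picard \<alpha> u y"
  define S where "S = (\<lambda>n t. \<Sum>i<n. ?p i t)"
  define x where "x = (\<lambda>t. \<Sum>i. ?p i t)"
  have pb: "norm (?p n t) \<le> norm y * (T ^ n / fact n)" if "t \<in> {0..T}" for n t
  proof -
    have "norm (?p n t) \<le> norm y * t ^ n / fact n" using picard_bound[OF u] that by blast
    also have "\<dots> = norm y * (t ^ n / fact n)" by simp
    also have "\<dots> \<le> norm y * (T ^ n / fact n)"
      using that by (intro mult_left_mono divide_right_mono power_mono) auto
    finally show ?thesis .
  qed
  have "summable (\<lambda>n. norm y * (T ^ n / fact n))"
    using summable_exp[of T] by (intro summable_mult) (simp add: divide_inverse mult.commute)
  then have ul: "uniform_limit {0..T} S x sequentially"
    unfolding S_def x_def using pb by (intro Weierstrass_m_test) auto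
  have Sc: "continuous_on {0..T} (S n)" for n
    unfolding S_def using picard_bound[OF u] by (intro continuous_on_sum) blast
  have xc: "continuous_on {0..T} x"
    by (rule uniform_limit_theorem[OF _ ul]) (simp_all add: Sc)
  let ?A = "\<lambda>z \<tau>. X_mat \<alpha> (u \<tau>) *v z \<tau>"
  have int: "?A z integrable_on {0..t}" if "t \<in> {0..T}" "continuous_on {0..T} z" for t z
    by (rule integrable_subinterval_real[OF X_mat_rhs_integrable[OF u that(2)]]) (use that in auto)
  have "(?A x has_integral (x t - y)) {0..t}" if t: "t \<in> {0..T}" for t
  proof -
    \<comment> \<open>Integrating a partial sum produces the next partial sum without its constant
      term; the integral equation is the limit of this identity.\<close>
    have SS: "integral {0..t} (?A (S n)) = S (Suc n) t - y" for n
    proof -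
      have "integral {0..t} (?A (S n)) = integral {0..t} (\<lambda>\<tau>. \<Sum>i<n. ?A (?p i) \<tau>)"
        by (simp add: S_def linear_sum[OF matrix_vector_mul_linear])
      also have "\<dots> = (\<Sum>i<n. integral {0..t} (?A (?p i)))"
        by (rule integral_sum) (use int[OF t] picard_bound[OF u] in auto)
      also have "\<dots> = S (Suc n) t - y"
        unfolding S_def sum.lessThan_Suc_shift by simp
      finally show ?thesis .
    qed
    have "(\<lambda>n. integral {0..t} (?A (S n))) \<longlonglongrightarrow> integral {0..t} (?A x)"
    proof (rule LIMSEQ_I)
      fix e :: real assume e: "e > 0"
      define d where "d = e / (2 * (T + 1))"
      have d: "d > 0" using e T by (simp add: d_def)
      obtain N where N: "\<And>n \<tau>. n \<ge> N \<Longrightarrow> \<tau> \<in> {0..T} \<Longrightarrow> dist (S n \<tau>) (x \<tau>) < d"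
        using uniform_limitD[OF ul d] unfolding eventually_sequentially by blast
      show "\<exists>no. \<forall>n\<ge>no. norm (integral {0..t} (?A (S n)) - integral {0..t} (?A x)) < e"
      proof (intro exI[of _ N] allI impI)
        fix n assume n: "n \<ge> N"
        have "((\<lambda>\<tau>. ?A (S n) \<tau> - ?A x \<tau>) has_integral
            (integral {0..t} (?A (S n)) - integral {0..t} (?A x))) {0..t}"
          by (intro has_integral_diff integrable_integral int[OF t] Sc xc)
        moreover have "norm (?A (S n) \<tau> - ?A x \<tau>) \<le> d" if "\<tau> \<in> cbox 0 t" for \<tau>
        proof -
          have \<tau>: "\<tau> \<in> {0..T}" using that t by auto
          have "norm (?A (S n) \<tau> - ?A x \<tau>) = norm (X_mat \<alpha> (u \<tau>) *v (S n \<tau> - x \<tau>))"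
            by (simp add: matrix_vector_mult_diff_distrib)
          also have "\<dots> \<le> norm (S n \<tau> - x \<tau>)"
            using u \<tau> by (intro norm_X_mat_le) (auto simp: control_def)
          also have "\<dots> \<le> d" using N[OF n \<tau>] by (simp add: dist_norm)
          finally show ?thesis .
        qed
        ultimately have "norm (integral {0..t} (?A (S n)) - integral {0..t} (?A x)) \<le>
            d * measure lborel (cbox 0 t)"
          using d by (intro has_integral_bound) auto
        also have "\<dots> = d * t" using t by simp
        also have "\<dots> \<le> d * (T + 1)" using d t by (intro mult_left_mono) auto
        also have "\<dots> = e / 2" using T by (simp add: d_def field_simps)
        also have "\<dots> < e" using e by simp
        finally show "norm (integral {0..t} (?A (S n)) - integral {0..t} (?A x)) < e" .
      qed
    qed
    moreover have "(\<lambda>n. S (Suc n) t - y) \<longlonglongrightarrow> x t - y"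
      using tendsto_uniform_limitI[OF ul t] by (intro tendsto_diff tendsto_const LIMSEQ_Suc)
    ultimately have "integral {0..t} (?A x) = x t - y"
      unfolding SS using LIMSEQ_unique by blast
    then show ?thesis using integrable_integral[OF int[OF t xc]] by simp
  qed
  note xi = this
  have x0: "x 0 = y"
  proof -
    have "x 0 - y = 0"
      using has_integral_unique[OF xi[of 0]] T by force
    then show ?thesis by simp
  qed
  have "solution \<alpha> T u x"
    unfolding solution_def primitive_def using xi x0 by simp
  with x0 show ?thesis by blast
qed

subsection \<open>Concatenation and shift of trajectories\<close>

definition concat_at :: "real \<Rightarrow> (real \<Rightarrow> 'a) \<Rightarrow> (real \<Rightarrow> 'a) \<Rightarrow> real \<Rightarrow> 'a" where
  "concat_at a f g = (\<lambda>t. if t \<le> a then f t else g (t - a))"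

lemma primitive_concat_at:
  assumes f: "primitive a f f'" and g: "primitive b g g'" and eq: "g 0 = f a" and a: "0 \<le> a" and b: "0 \<le> b"
  shows "primitive (a + b) (concat_at a f g) (concat_at a f' g')"
  unfolding primitive_def
proof
  fix t assume t: "t \<in> {0..a + b}"
  have f0: "concat_at a f g 0 = f 0" using a by (simp add: concat_at_def)
  have c1: "(concat_at a f' g' has_integral (f s - f 0)) {0..s}" if "s \<in> {0..a}" for s
  proof (rule has_integral_eq)
    show "(f' has_integral (f s - f 0)) {0..s}" using f that by (auto simp: primitive_def)
  qed (use that in \<open>auto simp: concat_at_def\<close>)
  show "(concat_at a f' g' has_integral concat_at a f g t - concat_at a f g 0) {0..t}"
  proof (cases "t \<le> a")
    case True
    then show ?thesis using c1[of t] t f0 by (simp add: concat_at_def)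
  next
    case False
    have "(g' has_integral (g (t - a) - g 0)) {0..t - a}"
      using g t False by (auto simp: primitive_def)
    then have "((\<lambda>\<tau>. g' (- a + \<tau>)) has_integral (g (t - a) - g 0)) {a..t}"
      using has_integral_shift_Icc_real[of g' "- a" "g (t - a) - g 0" a t] by (simp add: o_def)
    then have "(concat_at a f' g' has_integral (g (t - a) - g 0)) {a..t}"
      by (rule has_integral_spike_finite[of "{a}", rotated 2]) (auto simp: concat_at_def)
    from has_integral_combine[OF a _ c1[of a] this]
    show ?thesis using False a eq by (simp add: concat_at_def f0[unfolded concat_at_def])
  qed
qed

lemma primitive_shift:
  assumes "primitive T f f'" "0 \<le> a" "a \<le> T"
  shows "primitive (T - a) (\<lambda>t. f (t + a)) (\<lambda>t. f' (t + a))"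
  unfolding primitive_def
proof
  fix t assume t: "t \<in> {0..T - a}"
  have "(f' has_integral (f (t + a) - f a)) {a..t + a}"
    using assms t by (intro primitive_interval) auto
  then show "((\<lambda>t. f' (t + a)) has_integral f (t + a) - f (0 + a)) {0..t}"
    using has_integral_shift_Icc_real[of f' a "f (t + a) - f a" 0 t] by (simp add: o_def add.commute)
qed

lemma control_primitive:
  assumes "control T u"
  shows "primitive T (\<lambda>t. integral {0..t} u) u"
  unfolding primitive_def
proof
  fix t assume "t \<in> {0..T}"
  then have "u integrable_on {0..t}"
    using assms by (auto simp: control_def intro: integrable_subinterval_real)
  then show "(u has_integral (integral {0..t} u - integral {0..0} u)) {0..t}"
    by (simp add: integrable_integral)
qed

lemma admissible_concat:
  assumes x: "admissible \<alpha> a x u" and y: "admissible \<alpha> b y w" and eq: "y 0 = x a"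
  shows "admissible \<alpha> (a + b) (concat_at a x y) (concat_at a u w)"
proof -
  have ab: "0 \<le> a" "0 \<le> b" using x y by (auto simp: admissible_iff)
  have cu: "control a u" and cw: "control b w" and sx: "solution \<alpha> a u x" and sy: "solution \<alpha> b w y"
    using x y by (auto simp: admissible_iff)
  have "solution \<alpha> (a + b) (concat_at a u w) (concat_at a x y)"
  proof -
    have "(\<lambda>\<tau>. X_mat \<alpha> (concat_at a u w \<tau>) *v concat_at a x y \<tau>) =
        concat_at a (\<lambda>\<tau>. X_mat \<alpha> (u \<tau>) *v x \<tau>) (\<lambda>\<tau>. X_mat \<alpha> (w \<tau>) *v y \<tau>)"
      by (auto simp: concat_at_def)
    then show ?thesis
      using primitive_concat_at[OF sx[unfolded solution_def] sy[unfolded solution_def] eq ab]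
      by (simp add: solution_def)
  qed
  moreover have "control (a + b) (concat_at a u w)"
  proof -
    \<comment> \<open>The primitive of \<open>w\<close> is shifted so that it continues the
      primitive of \<open>u\<close>; integrability of the spliced control is then read off from the
      spliced primitive.\<close>
    have w': "primitive b (\<lambda>t. integral {0..a} u + integral {0..t} w) w"
      using control_primitive[OF cw] by (simp add: primitive_def)
    have "concat_at a u w integrable_on {0..a + b}"
      by (rule primitive_integrable[OF primitive_concat_at[OF control_primitive[OF cu] w' _ ab]])
        (use ab in auto)
    moreover have "\<bar>concat_at a u w t\<bar> \<le> 1" if "t \<in> {0..a + b}" for t
      using that cu cw by (auto simp: control_def concat_at_def)
    ultimately show ?thesis by (simp add: control_def)
  qed
  moreover have "norm (concat_at a x y 0) = 1"
    using x ab by (simp add: admissible_iff concat_at_def)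
  ultimately show ?thesis using ab by (simp add: admissible_iff)
qed

lemma admissible_shift:
  assumes x: "admissible \<alpha> T x u" and a: "0 \<le> a" "a \<le> T"
  shows "admissible \<alpha> (T - a) (\<lambda>t. x (t + a)) (\<lambda>t. u (t + a))"
proof -
  have u: "control T u" and s: "solution \<alpha> T u x" and n: "norm (x 0) = 1"
    using x by (auto simp: admissible_iff)
  have "solution \<alpha> (T - a) (\<lambda>t. u (t + a)) (\<lambda>t. x (t + a))"
    using primitive_shift[OF s[unfolded solution_def] a] by (simp add: solution_def)
  moreover have "(\<lambda>t. u (t + a)) integrable_on {0..T - a}"
    using primitive_integrable[OF primitive_shift[OF control_primitive[OF u] a]] a by simp
  then have "control (T - a) (\<lambda>t. u (t + a))"
    using u a by (auto simp: control_def)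
  moreover have "norm (x (0 + a)) = 1" using solution_norm[OF u s, of a] a n by simp
  ultimately show ?thesis using a by (simp add: admissible_iff)
qed

lemma admissible_subset:
  assumes "admissible \<alpha> T x u" "0 \<le> t" "t \<le> T"
  shows "admissible \<alpha> t x u"
  using assms control_subset solution_subset by (auto simp: admissible_iff)

lemma admissible_lipschitz:
  assumes "admissible \<alpha> T x u" "s \<in> {0..T}" "t \<in> {0..T}"
  shows "norm (x t - x s) \<le> \<bar>t - s\<bar>"
  using solution_lipschitz[of T u \<alpha> x s t] assms by (auto simp: admissible_iff)

subsection \<open>Reachable sets\<close>

text \<open>Points reached at exactly time \<open>T\<close>. Because a trajectory can first wait at
  N, these sets increase with \<open>T\<close>.\<close>

definition reach :: "real \<Rightarrow> real \<Rightarrow> (real^3) set" where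
  "reach \<alpha> T = {x T | x u. admissible \<alpha> T x u \<and> x 0 = north}"

lemma admissible_wait: "0 \<le> T \<Longrightarrow> admissible \<alpha> T (\<lambda>_. north) (\<lambda>_. 0)"
proof -
  have "X_mat \<alpha> 0 *v north = 0"
    by (simp add: vec3_eq_iff X_mat_components north_components)
  then show "0 \<le> T \<Longrightarrow> ?thesis"
    by (auto simp: admissible_iff control_def solution_def primitive_def integrable_0)
qed

lemma admissible_delay:
  assumes "admissible \<alpha> T y w" "y 0 = north" "0 \<le> a"
  shows "admissible \<alpha> (a + T) (concat_at a (\<lambda>_. north) y) (concat_at a (\<lambda>_. 0) w)"
  by (rule admissible_concat[OF admissible_wait assms(1)]) (use assms in auto)

lemma north_in_reach: "0 \<le> T \<Longrightarrow> north \<in> reach \<alpha> T"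
  unfolding reach_def using admissible_wait by fastforce

lemma reach_subset_sphere: "reach \<alpha> T \<subseteq> sphere 0 1"
  by (auto simp: reach_def admissible_def)

lemma solution_add:
  assumes x: "solution \<alpha> T u x" and y: "solution \<alpha> T u y"
  shows "solution \<alpha> T u (\<lambda>t. a *\<^sub>R x t + b *\<^sub>R y t)"
  unfolding solution_def primitive_def
proof
  fix t assume t: "t \<in> {0..T}"
  have "((\<lambda>\<tau>. a *\<^sub>R (X_mat \<alpha> (u \<tau>) *v x \<tau>) + b *\<^sub>R (X_mat \<alpha> (u \<tau>) *v y \<tau>)) has_integral
      a *\<^sub>R (x t - x 0) + b *\<^sub>R (y t - y 0)) {0..t}"
    by (intro has_integral_add has_integral_cmul)
      (use x y t in \<open>auto simp: solution_def primitive_def\<close>)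
  then show "((\<lambda>\<tau>. X_mat \<alpha> (u \<tau>) *v (a *\<^sub>R x \<tau> + b *\<^sub>R y \<tau>)) has_integral
      a *\<^sub>R x t + b *\<^sub>R y t - (a *\<^sub>R x 0 + b *\<^sub>R y 0)) {0..t}"
    by (simp add: matrix_vector_right_distrib matrix_vector_mult_scaleR algebra_simps)
qed

lemma solution_unique:
  assumes u: "control T u" and x: "solution \<alpha> T u x" and y: "solution \<alpha> T u y"
    and xy: "x 0 = y 0" and t: "t \<in> {0..T}"
  shows "x t = y t"
proof -
  have "norm (1 *\<^sub>R x t + (-1) *\<^sub>R y t) = norm (1 *\<^sub>R x 0 + (-1) *\<^sub>R y 0)"
    by (rule solution_norm[OF u solution_add[OF x y] t])
  with xy show ?thesis by simp
qed

lemma bounded_bilinear_cross3: "bounded_bilinear cross3"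
  using bilinear_cross by (simp add: bilinear_conv_bounded_bilinear)

text \<open>Generators of rotations act as derivations of the cross product. Consequently the frame
  x, p, x \<times> p is carried along by a single linear equation.\<close>

lemma X_mat_cross3:
  "X_mat \<alpha> u *v cross3 x y = cross3 (X_mat \<alpha> u *v x) y + cross3 x (X_mat \<alpha> u *v y)"
  by (simp add: vec3_eq_iff X_mat_components cross_components algebra_simps)

lemma solution_cross3:
  assumes u: "control T u" and x: "solution \<alpha> T u x" and y: "solution \<alpha> T u y"
  shows "solution \<alpha> T u (\<lambda>t. cross3 (x t) (y t))"
proof -
  obtain A where A: "\<And>t. t \<in> {0..T} \<Longrightarrow> norm (X_mat \<alpha> (u t) *v x t) \<le> A"
    using solution_bound[OF u x] by blast
  obtain B where B: "\<And>t. t \<in> {0..T} \<Longrightarrow> norm (X_mat \<alpha> (u t) *v y t) \<le> B"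
    using solution_bound[OF u y] by blast
  show ?thesis
    unfolding solution_def X_mat_cross3
    by (rule primitive_bilinear[OF bounded_bilinear_cross3 x[unfolded solution_def] y[unfolded solution_def] A B])
qed

text \<open>An exact formula, not a linearisation: \<open>p\<close> is transported with
  \<open>u\<close> and \<open>y\<close> with \<open>w\<close>, so the common skew part cancels.
  Putting the reference trajectory in place of \<open>y\<close> under the integral gives the first
  variation, and the difference is the second-order remainder.\<close>

lemma inner_variation:
  assumes u: "control T u" and w: "control T w"
    and p: "solution \<alpha> T u p" and y: "solution \<alpha> T w y" and t: "t \<in> {0..T}"
  shows "((\<lambda>\<tau>. (w \<tau> - u \<tau>) * (p \<tau> \<bullet> (G_mat \<alpha> *v y \<tau>))) has_integral (p t \<bullet> y t - p 0 \<bullet> y 0)) {0..t}"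
proof -
  obtain A where A: "\<And>t. t \<in> {0..T} \<Longrightarrow> norm (X_mat \<alpha> (u t) *v p t) \<le> A"
    using solution_bound[OF u p] by blast
  obtain B where B: "\<And>t. t \<in> {0..T} \<Longrightarrow> norm (X_mat \<alpha> (w t) *v y t) \<le> B"
    using solution_bound[OF w y] by blast
  have *: "(X_mat \<alpha> (u t) *v p t) \<bullet> y t + p t \<bullet> (X_mat \<alpha> (w t) *v y t) =
      (w t - u t) * (p t \<bullet> (G_mat \<alpha> *v y t))" for t
    using X_mat_skew[of "p t" \<alpha> "u t" "y t"]
    unfolding X_mat_diff_control[of \<alpha> "w t" "y t" "u t"] by (simp add: inner_add_right)
  have "primitive T (\<lambda>t. p t \<bullet> y t)
      (\<lambda>t. (X_mat \<alpha> (u t) *v p t) \<bullet> y t + p t \<bullet> (X_mat \<alpha> (w t) *v y t))"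
    by (rule primitive_bilinear[OF bounded_bilinear_inner p[unfolded solution_def] y[unfolded solution_def] A B])
  then show ?thesis
    using t unfolding * primitive_def by blast
qed

section \<open>First variation of the end point and the gap in the maximum condition\<close>

text \<open>The integrated defect in the maximum condition: sin \<alpha> times the first component
  of the rotated covector \<open>m\<close> is the switching function, and the integrand is
  nonnegative for |u| \<le> 1. A pair with gap zero satisfies the maximum condition almost
  everywhere.\<close>

definition gap :: "real \<Rightarrow> (real \<Rightarrow> real) \<Rightarrow> (real \<Rightarrow> real^3) \<Rightarrow> real" where
  "gap T u m = integral {0..T} (\<lambda>\<tau>. \<bar>m \<tau> $ 1\<bar> - u \<tau> * m \<tau> $ 1)"

lemma continuous_on_component: "continuous_on S m \<Longrightarrow> continuous_on S (\<lambda>t. m t $ i)"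
  by (intro continuous_intros)

lemma control_times_integrable:
  "control T u \<Longrightarrow> continuous_on {0..T} g \<Longrightarrow> (\<lambda>\<tau>. u \<tau> * g \<tau>) integrable_on {0..T}"
  for g :: "real \<Rightarrow> real"
  using control_mult_integrable[of T u g] by simp

lemma control_sgn:
  assumes "continuous_on {0..T} g"
  shows "control T (\<lambda>\<tau>. sgn (g \<tau>))"
proof (rule controlI)
  have "g \<in> borel_measurable (lebesgue_on {0..T})"
    using assms by (intro continuous_imp_measurable_on_sets_lebesgue) auto
  then show "(\<lambda>\<tau>. sgn (g \<tau>)) \<in> borel_measurable (lebesgue_on {0..T})" by measurable
qed (simp add: abs_sgn_eq)

text \<open>Parseval's identity in the orthonormal frame x, p, x \<times> p, obtained from |v|^2
  |c|^2 = (v . c)^2 + |v \<times> c|^2 with c = x \<times> p.\<close>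

lemma gram_3:
  fixes x p v :: "real^3"
  assumes "norm x = 1" "norm p = 1" "x \<bullet> p = 0"
  shows "(norm v)\<^sup>2 = (x \<bullet> v)\<^sup>2 + (p \<bullet> v)\<^sup>2 + (cross3 x p \<bullet> v)\<^sup>2"
proof -
  let ?c = "cross3 x p"
  have "(norm ?c)\<^sup>2 = 1" using assms by (simp add: norm_cross)
  moreover have "cross3 v ?c = (v \<bullet> p) *\<^sub>R x - (v \<bullet> x) *\<^sub>R p" by (rule Lagrange)
  then have "(norm (cross3 v ?c))\<^sup>2 = (v \<bullet> p)\<^sup>2 + (v \<bullet> x)\<^sup>2"
    unfolding power2_norm_eq_inner using assms
    by (simp add: inner_diff_left inner_diff_right norm_eq_1 inner_commute power2_eq_square)
  ultimately show ?thesis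
    using norm_cross_dot[of v ?c] by (simp add: inner_commute power_mult_distrib)
qed

lemma abs_inner_le: "norm p = 1 \<Longrightarrow> \<bar>p \<bullet> v\<bar> \<le> norm v" for p v :: "'a::real_inner"
  using Cauchy_Schwarz_ineq2[of p v] by simp

text \<open>The vectors \<open>p\<close> and \<open>q\<close> start as a basis of the tangent plane
  at N and are transported with the control of \<open>x\<close>; they therefore remain an
  orthonormal basis of the tangent plane at the moving point.\<close>

locale reference_trajectory =
  fixes \<alpha> T :: real and u :: "real \<Rightarrow> real" and x p q :: "real \<Rightarrow> real^3"
  assumes T: "0 \<le> T" and sin_pos: "0 < sin \<alpha>"
    and u: "control T u" and x: "solution \<alpha> T u x" and x0: "x 0 = north"
    and p: "solution \<alpha> T u p" and p0: "p 0 = axis 1 1"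
    and q: "solution \<alpha> T u q" and q0: "q 0 = axis 2 1"
begin

lemma norms: "t \<in> {0..T} \<Longrightarrow> norm (x t) = 1" "t \<in> {0..T} \<Longrightarrow> norm (p t) = 1" "t \<in> {0..T} \<Longrightarrow> norm (q t) = 1"
  using solution_norm[OF u x] solution_norm[OF u p] solution_norm[OF u q]
  by (simp_all add: x0 p0 q0)

lemma ortho: "t \<in> {0..T} \<Longrightarrow> p t \<bullet> x t = 0" "t \<in> {0..T} \<Longrightarrow> q t \<bullet> x t = 0"
  using solution_inner[OF u p x] solution_inner[OF u q x]
  by (simp_all add: x0 p0 q0 inner_axis' north_components)

lemma cross_x_p: "t \<in> {0..T} \<Longrightarrow> cross3 (x t) (p t) = q t"
  by (rule solution_unique[OF u solution_cross3[OF u x p] q])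
    (simp_all add: x0 p0 q0 vec3_eq_iff cross_components north_components axis_def)

lemma cross_x_q: "t \<in> {0..T} \<Longrightarrow> cross3 (x t) (q t) = - p t"
proof -
  have "t \<in> {0..T} \<Longrightarrow> cross3 (x t) (q t) = (-1) *\<^sub>R p t + 0 *\<^sub>R p t"
    by (rule solution_unique[OF u solution_cross3[OF u x q] solution_add[OF p p]])
      (simp_all add: x0 p0 q0 vec3_eq_iff cross_components north_components axis_def)
  then show "t \<in> {0..T} \<Longrightarrow> ?thesis" by simp
qed

text \<open>G is the cross product with sin \<alpha> times the first basis vector, so this is a
  triple product. It identifies the switching function with a first component.\<close>

lemma inner_G: "y \<bullet> (G_mat \<alpha> *v z) = sin \<alpha> * cross3 z y $ 1"
  by (simp add: inner_3 G_mat_components cross_components algebra_simps)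

text \<open>First variation of the end point, read in the moving frame \<open>p, q\<close>.\<close>

definition variation :: "(real \<Rightarrow> real) \<Rightarrow> complex" where
  "variation w = Complex (integral {0..T} (\<lambda>\<tau>. (w \<tau> - u \<tau>) * (p \<tau> \<bullet> (G_mat \<alpha> *v x \<tau>))))
     (integral {0..T} (\<lambda>\<tau>. (w \<tau> - u \<tau>) * (q \<tau> \<bullet> (G_mat \<alpha> *v x \<tau>))))"

lemma cont_inner_G: "solution \<alpha> T a y \<Longrightarrow> solution \<alpha> T b z \<Longrightarrow> continuous_on {0..T} (\<lambda>\<tau>. y \<tau> \<bullet> (G_mat \<alpha> *v z \<tau>))"
  by (intro continuous_on_inner continuous_on_mat_mult solution_continuous)

lemma variation_integrable:
  "control T w \<Longrightarrow> control T v \<Longrightarrow> solution \<alpha> T a y \<Longrightarrow> solution \<alpha> T b z \<Longrightarrow>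
    (\<lambda>\<tau>. (w \<tau> - v \<tau>) * (y \<tau> \<bullet> (G_mat \<alpha> *v z \<tau>))) integrable_on {0..T}"
  unfolding left_diff_distrib
  by (intro integrable_diff control_times_integrable cont_inner_G)

lemma variation_affine:
  assumes w: "control T w" and v: "control T v"
  shows "variation (\<lambda>\<tau>. a * w \<tau> + (1 - a) * v \<tau>) = a *\<^sub>R variation w + (1 - a) *\<^sub>R variation v"
proof -
  have e: "(a * w \<tau> + (1 - a) * v \<tau> - u \<tau>) * g = a *\<^sub>R ((w \<tau> - u \<tau>) * g) + (1 - a) *\<^sub>R ((v \<tau> - u \<tau>) * g)"
    for \<tau> g by (simp add: algebra_simps)
  have "integral {0..T} (\<lambda>\<tau>. (a * w \<tau> + (1 - a) * v \<tau> - u \<tau>) * (y \<tau> \<bullet> (G_mat \<alpha> *v x \<tau>))) =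
      a *\<^sub>R integral {0..T} (\<lambda>\<tau>. (w \<tau> - u \<tau>) * (y \<tau> \<bullet> (G_mat \<alpha> *v x \<tau>)))
      + (1 - a) *\<^sub>R integral {0..T} (\<lambda>\<tau>. (v \<tau> - u \<tau>) * (y \<tau> \<bullet> (G_mat \<alpha> *v x \<tau>)))"
    if y: "solution \<alpha> T u y" for y
    unfolding e
    by (subst integral_add) (auto intro!: integrable_cmul variation_integrable[OF w u y x] variation_integrable[OF v u y x]
        simp del: real_scaleR_def)
  from this[OF p] this[OF q] show ?thesis
    by (simp add: variation_def complex_eq_iff)
qed

lemma control_affine:
  assumes "control T w" "control T v" "0 \<le> a" "a \<le> 1"
  shows "control T (\<lambda>\<tau>. a * w \<tau> + (1 - a) * v \<tau>)"
  unfolding control_def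
proof
  show "(\<lambda>\<tau>. a * w \<tau> + (1 - a) * v \<tau>) integrable_on {0..T}"
    using assms by (intro integrable_add integrable_on_mult_right) (auto simp: control_def)
  show "\<forall>t\<in>{0..T}. \<bar>a * w t + (1 - a) * v t\<bar> \<le> 1"
  proof
    fix t assume "t \<in> {0..T}"
    then have "\<bar>w t\<bar> \<le> 1" "\<bar>v t\<bar> \<le> 1" using assms by (auto simp: control_def)
    then have "a * \<bar>w t\<bar> + (1 - a) * \<bar>v t\<bar> \<le> a * 1 + (1 - a) * 1"
      using assms by (intro add_mono mult_left_mono) auto
    then show "\<bar>a * w t + (1 - a) * v t\<bar> \<le> 1"
      using abs_triangle_ineq[of "a * w t" "(1 - a) * v t"] assms by (simp add: abs_mult)
  qed
qed

lemma convex_variations: "convex {variation w | w. control T w}"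
  unfolding convex_alt
proof (intro ballI allI impI)
  fix y z and c :: real
  assume "y \<in> {variation w | w. control T w}" "z \<in> {variation w | w. control T w}" and c: "0 \<le> c \<and> c \<le> 1"
  then obtain w v where w: "control T w" "y = variation w" and v: "control T v" "z = variation v" by blast
  have "(1 - c) *\<^sub>R y + c *\<^sub>R z = variation (\<lambda>\<tau>. c * v \<tau> + (1 - c) * w \<tau>)"
    using variation_affine[OF v(1) w(1), of c] w v by (simp add: add.commute)
  then show "(1 - c) *\<^sub>R y + c *\<^sub>R z \<in> {variation w | w. control T w}"
    using control_affine[OF v(1) w(1), of c] c by blast
qed

text \<open>Testing the variation against (a, b) amounts to using the covector a p + b q; its
  rotated form x \<times> (a p + b q) = a q - b p appears in the integral.\<close>

lemma variation_inner:
  assumes w: "control T w"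
  shows "Complex a b \<bullet> variation w =
    sin \<alpha> * integral {0..T} (\<lambda>\<tau>. (w \<tau> - u \<tau>) * (a *\<^sub>R q \<tau> + (- b) *\<^sub>R p \<tau>) $ 1)"
proof -
  have "Complex a b \<bullet> variation w = a *\<^sub>R integral {0..T} (\<lambda>\<tau>. (w \<tau> - u \<tau>) * (p \<tau> \<bullet> (G_mat \<alpha> *v x \<tau>)))
      + b *\<^sub>R integral {0..T} (\<lambda>\<tau>. (w \<tau> - u \<tau>) * (q \<tau> \<bullet> (G_mat \<alpha> *v x \<tau>)))"
    by (simp add: inner_complex_def variation_def)
  also have "\<dots> = integral {0..T} (\<lambda>\<tau>. a *\<^sub>R ((w \<tau> - u \<tau>) * (p \<tau> \<bullet> (G_mat \<alpha> *v x \<tau>)))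
      + b *\<^sub>R ((w \<tau> - u \<tau>) * (q \<tau> \<bullet> (G_mat \<alpha> *v x \<tau>))))"
    by (subst integral_add) (auto intro!: integrable_cmul variation_integrable[OF w u p x] variation_integrable[OF w u q x]
        simp del: real_scaleR_def)
  also have "\<dots> = integral {0..T} (\<lambda>\<tau>. sin \<alpha> * ((w \<tau> - u \<tau>) * (a *\<^sub>R q \<tau> + (- b) *\<^sub>R p \<tau>) $ 1))"
    by (rule integral_cong) (simp add: inner_G cross_x_p cross_x_q algebra_simps)
  finally show ?thesis by simp
qed

text \<open>If \<open>z\<close> is not a first variation, a hyperplane separates it from the convex
  set of all of them. The separating functional is maximised by the bang-bang control
  \<open>sgn (m \<tau> $ 1)\<close>, where its value is |a| sin \<alpha> times the gap of the
  corresponding rotated covector; a gap of at least \<open>\<rho>\<close> contradicts the size of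
  \<open>z\<close>.\<close>

lemma ball_subset_variations:
  assumes gap: "\<And>m. solution \<alpha> T u m \<Longrightarrow> norm (m 0) = 1 \<Longrightarrow> m 0 $ 3 = 0 \<Longrightarrow> \<rho> \<le> gap T u m"
    and z: "norm z < sin \<alpha> * \<rho>"
  shows "\<exists>w. control T w \<and> variation w = z"
proof (rule ccontr)
  assume not: "\<not> ?thesis"
  have "control T (\<lambda>_. 0)" by (auto simp: control_def)
  then have ne: "{variation w | w. control T w} \<noteq> {}" by blast
  have disj: "{variation w | w. control T w} \<inter> {z} = {}" using not by blast
  obtain a b where a: "a \<noteq> 0" and b: "\<forall>y\<in>{variation w | w. control T w}. a \<bullet> y \<le> b"
    and z': "\<forall>y\<in>{z}. b \<le> a \<bullet> y"
    using separating_hyperplane_sets[OF convex_variations convex_singleton ne _ disj] by blast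
  define n where "n = norm a"
  have n: "n > 0" using a by (simp add: n_def)
  define m where "m = (\<lambda>\<tau>. (Re a / n) *\<^sub>R q \<tau> + (- (Im a / n)) *\<^sub>R p \<tau>)"
  have m: "solution \<alpha> T u m" unfolding m_def by (rule solution_add[OF q p])
  have "(Re a / n)\<^sup>2 + (Im a / n)\<^sup>2 = 1"
    using a by (auto simp: n_def cmod_power2 power_divide add_divide_distrib[symmetric] complex_eq_iff)
  then have m0: "norm (m 0) = 1" "m 0 $ 3 = 0"
    by (simp_all add: m_def p0 q0 norm_eq_1_3 axis_def)
  have mc: "continuous_on {0..T} (\<lambda>\<tau>. m \<tau> $ 1)"
    by (intro continuous_on_component solution_continuous[OF m])
  let ?w = "\<lambda>\<tau>. sgn (m \<tau> $ 1)"
  have w: "control T ?w" by (rule control_sgn[OF mc])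
  have "a \<bullet> variation ?w = n * (Complex (Re a / n) (Im a / n) \<bullet> variation ?w)"
    using n by (simp add: inner_complex_def field_simps)
  also have "\<dots> = n * (sin \<alpha> * gap T u m)"
  proof -
    have "(Re a / n) *\<^sub>R q \<tau> + (- (Im a / n)) *\<^sub>R p \<tau> = m \<tau>" for \<tau> by (simp add: m_def)
    moreover have "(?w \<tau> - u \<tau>) * m \<tau> $ 1 = \<bar>m \<tau> $ 1\<bar> - u \<tau> * m \<tau> $ 1" for \<tau>
      by (simp add: abs_sgn algebra_simps)
    ultimately show ?thesis
      unfolding variation_inner[OF w] gap_def by presburger
  qed
  finally have "n * (sin \<alpha> * gap T u m) \<le> a \<bullet> z" using b z' w by fastforce
  also have "\<dots> \<le> n * norm z" unfolding n_def by (rule norm_cauchy_schwarz)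
  finally have "sin \<alpha> * gap T u m \<le> norm z" using n by simp
  moreover have "sin \<alpha> * \<rho> \<le> sin \<alpha> * gap T u m"
    using gap[OF m m0] sin_pos by (intro mult_left_mono) auto
  ultimately show False using z by simp
qed

end

context reference_trajectory
begin

text \<open>A Lipschitz right inverse \<open>c \<mapsto> u\<^sub>c\<close> of the first variation, piecewise affine on the four
  quadrants, turns the end point map into a perturbation of the identity, to which Brouwer's
  theorem applies.\<close>

lemma sphere_ball_subset_reach:
  assumes h: "0 < h" and surj: "\<And>z. norm z \<le> h \<Longrightarrow> \<exists>w. control T w \<and> variation w = z"
    and R: "0 < R" "R \<le> 1" "2 * R \<le> h" "512 * R * T\<^sup>2 \<le> h\<^sup>2" "32 * R * T \<le> h"
  shows "ball (x T) (R / 4) \<inter> sphere 0 1 \<subseteq> reach \<alpha> T"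
proof
  fix b assume b: "b \<in> ball (x T) (R / 4) \<inter> sphere 0 1"
  have TT: "T \<in> {0..T}" using T by simp
  obtain w1 where w1: "control T w1" "variation w1 = Complex h 0"
    using surj[of "Complex h 0"] h by (auto simp: cmod_def)
  obtain w2 where w2: "control T w2" "variation w2 = Complex (- h) 0"
    using surj[of "Complex (- h) 0"] h by (auto simp: cmod_def)
  obtain w3 where w3: "control T w3" "variation w3 = Complex 0 h"
    using surj[of "Complex 0 h"] h by (auto simp: cmod_def)
  obtain w4 where w4: "control T w4" "variation w4 = Complex 0 (- h)"
    using surj[of "Complex 0 (- h)"] h by (auto simp: cmod_def)
  \<comment> \<open>Positive and negative parts of the coordinates of \<open>c\<close> in units of
    \<open>h\<close>. For |c| \<le> R and 2 R \<le> h they sum to at most 1, so \<open>uc c\<close>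
    is a convex combination of \<open>u\<close>, \<open>w1\<close>, ..., \<open>w4\<close> and hence
    an admissible control.\<close>
  define k1 where "k1 = (\<lambda>c. max (Re c) 0 / h)"
  define k2 where "k2 = (\<lambda>c. max (- Re c) 0 / h)"
  define k3 where "k3 = (\<lambda>c. max (Im c) 0 / h)"
  define k4 where "k4 = (\<lambda>c. max (- Im c) 0 / h)"
  note kd = k1_def k2_def k3_def k4_def
  have k_nonneg: "0 \<le> k1 c" "0 \<le> k2 c" "0 \<le> k3 c" "0 \<le> k4 c" for c
    using h by (auto simp: kd)
  have k_lip: "\<bar>k c - k c'\<bar> \<le> norm (c - c') / h" if "k \<in> {k1, k2, k3, k4}" for k c c'
  proof -
    have m: "\<bar>max a 0 / h - max b 0 / h\<bar> \<le> norm (c - c') / h" if "\<bar>a - b\<bar> \<le> norm (c - c')" for a b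
    proof -
      have "\<bar>max a 0 / h - max b 0 / h\<bar> = \<bar>max a 0 - max b 0\<bar> / h"
        using h by (simp add: diff_divide_distrib[symmetric])
      also have "\<dots> \<le> norm (c - c') / h"
        using that h by (intro divide_right_mono) (auto simp: max_def)
      finally show ?thesis .
    qed
    show ?thesis
      using that abs_Re_le_cmod[of "c - c'"] abs_Im_le_cmod[of "c - c'"]
      by (auto simp: kd intro!: m)
  qed
  define uc where "uc = (\<lambda>c \<tau>. u \<tau> + k1 c * (w1 \<tau> - u \<tau>) + k2 c * (w2 \<tau> - u \<tau>)
    + k3 c * (w3 \<tau> - u \<tau>) + k4 c * (w4 \<tau> - u \<tau>))"
  \<comment> \<open>Four weights, each Lipschitz with constant 1/h, multiply differences of controls
    that are bounded by 2; this gives the factor 8.\<close>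
  define \<eta> where "\<eta> = (\<lambda>c c' :: complex. 8 * norm (c - c') / h)"
  have b1: "\<bar>u t\<bar> \<le> 1" "\<bar>w1 t\<bar> \<le> 1" "\<bar>w2 t\<bar> \<le> 1" "\<bar>w3 t\<bar> \<le> 1" "\<bar>w4 t\<bar> \<le> 1" if "t \<in> {0..T}" for t
    using that u w1 w2 w3 w4 by (auto simp: control_def)
  have uc: "control T (uc c)" if c: "norm c \<le> R" for c
  proof -
    have "k1 c + k2 c + k3 c + k4 c = (\<bar>Re c\<bar> + \<bar>Im c\<bar>) / h"
      unfolding kd by (simp add: add_divide_distrib max_def)
    also have "\<dots> \<le> (h / 2 + h / 2) / h"
      using abs_Re_le_cmod[of c] abs_Im_le_cmod[of c] c R(3) h by (intro divide_right_mono) linarith+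
    finally have k: "k1 c + k2 c + k3 c + k4 c \<le> 1" using h by simp
    have "\<bar>uc c t\<bar> \<le> 1" if t: "t \<in> {0..T}" for t
    proof -
      have "uc c t = (1 - (k1 c + k2 c + k3 c + k4 c)) * u t + k1 c * w1 t + k2 c * w2 t + k3 c * w3 t + k4 c * w4 t"
        by (simp add: uc_def algebra_simps)
      moreover have "\<bar>k * w\<bar> \<le> k" if "0 \<le> k" "\<bar>w\<bar> \<le> 1" for k w :: real
        using that by (simp add: abs_mult mult_left_le)
      then have "\<bar>(1 - (k1 c + k2 c + k3 c + k4 c)) * u t\<bar> \<le> 1 - (k1 c + k2 c + k3 c + k4 c)"
        "\<bar>k1 c * w1 t\<bar> \<le> k1 c" "\<bar>k2 c * w2 t\<bar> \<le> k2 c" "\<bar>k3 c * w3 t\<bar> \<le> k3 c" "\<bar>k4 c * w4 t\<bar> \<le> k4 c"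
        using k k_nonneg b1[OF t] by simp_all
      ultimately show ?thesis by linarith
    qed
    moreover have "uc c integrable_on {0..T}"
      unfolding uc_def using u w1 w2 w3 w4
      by (intro integrable_add integrable_diff integrable_on_mult_right) (auto simp: control_def)
    ultimately show ?thesis by (simp add: control_def)
  qed
  have uc_lip: "\<bar>uc c t - uc c' t\<bar> \<le> \<eta> c c'" if t: "t \<in> {0..T}" for c c' t
  proof -
    have e: "uc c t - uc c' t = (k1 c - k1 c') * (w1 t - u t) + (k2 c - k2 c') * (w2 t - u t)
        + (k3 c - k3 c') * (w3 t - u t) + (k4 c - k4 c') * (w4 t - u t)"
      by (simp add: uc_def algebra_simps)
    have m: "\<bar>(k c - k c') * (w t - u t)\<bar> \<le> norm (c - c') / h * 2"
      if "k \<in> {k1, k2, k3, k4}" "\<bar>w t\<bar> \<le> 1" for k w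
      unfolding abs_mult by (intro mult_mono k_lip that(1)) (use that(2) b1(1)[OF t] h in auto)
    have "\<bar>(k1 c - k1 c') * (w1 t - u t)\<bar> \<le> norm (c - c') / h * 2"
      "\<bar>(k2 c - k2 c') * (w2 t - u t)\<bar> \<le> norm (c - c') / h * 2"
      "\<bar>(k3 c - k3 c') * (w3 t - u t)\<bar> \<le> norm (c - c') / h * 2"
      "\<bar>(k4 c - k4 c') * (w4 t - u t)\<bar> \<le> norm (c - c') / h * 2"
      by (rule m; use b1[OF t] in simp)+
    then have "\<bar>uc c t - uc c' t\<bar> \<le> 8 * (norm (c - c') / h)"
      unfolding e by linarith
    then show ?thesis by (simp add: \<eta>_def)
  qed
  have uc0: "uc 0 = u" by (simp add: uc_def kd fun_eq_iff)
  have lin: "integral {0..T} (\<lambda>\<tau>. (uc c \<tau> - u \<tau>) * (y \<tau> \<bullet> (G_mat \<alpha> *v x \<tau>))) =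
      k1 c *\<^sub>R integral {0..T} (\<lambda>\<tau>. (w1 \<tau> - u \<tau>) * (y \<tau> \<bullet> (G_mat \<alpha> *v x \<tau>)))
    + k2 c *\<^sub>R integral {0..T} (\<lambda>\<tau>. (w2 \<tau> - u \<tau>) * (y \<tau> \<bullet> (G_mat \<alpha> *v x \<tau>)))
    + k3 c *\<^sub>R integral {0..T} (\<lambda>\<tau>. (w3 \<tau> - u \<tau>) * (y \<tau> \<bullet> (G_mat \<alpha> *v x \<tau>)))
    + k4 c *\<^sub>R integral {0..T} (\<lambda>\<tau>. (w4 \<tau> - u \<tau>) * (y \<tau> \<bullet> (G_mat \<alpha> *v x \<tau>)))"
    if y: "solution \<alpha> T u y" for c y
  proof (rule integral_unique)
    let ?g = "\<lambda>\<tau>. y \<tau> \<bullet> (G_mat \<alpha> *v x \<tau>)"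
    have e: "(uc c \<tau> - u \<tau>) * ?g \<tau> = k1 c *\<^sub>R ((w1 \<tau> - u \<tau>) * ?g \<tau>) + k2 c *\<^sub>R ((w2 \<tau> - u \<tau>) * ?g \<tau>)
        + k3 c *\<^sub>R ((w3 \<tau> - u \<tau>) * ?g \<tau>) + k4 c *\<^sub>R ((w4 \<tau> - u \<tau>) * ?g \<tau>)" for \<tau>
      by (simp add: uc_def algebra_simps)
    show "((\<lambda>\<tau>. (uc c \<tau> - u \<tau>) * ?g \<tau>) has_integral
        k1 c *\<^sub>R integral {0..T} (\<lambda>\<tau>. (w1 \<tau> - u \<tau>) * ?g \<tau>)
        + k2 c *\<^sub>R integral {0..T} (\<lambda>\<tau>. (w2 \<tau> - u \<tau>) * ?g \<tau>)
        + k3 c *\<^sub>R integral {0..T} (\<lambda>\<tau>. (w3 \<tau> - u \<tau>) * ?g \<tau>)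
        + k4 c *\<^sub>R integral {0..T} (\<lambda>\<tau>. (w4 \<tau> - u \<tau>) * ?g \<tau>)) {0..T}"
      unfolding e
      by (intro has_integral_add has_integral_cmul integrable_integral
          variation_integrable[OF _ u y x] w1(1) w2(1) w3(1) w4(1))
  qed
  have var: "variation (uc c) = c" for c
  proof -
    have "variation (uc c) = k1 c *\<^sub>R variation w1 + k2 c *\<^sub>R variation w2 + k3 c *\<^sub>R variation w3 + k4 c *\<^sub>R variation w4"
      unfolding variation_def by (simp add: complex_eq_iff lin[OF p] lin[OF q])
    also have "\<dots> = c"
      using h unfolding w1(2) w2(2) w3(2) w4(2) complex_eq_iff kd by (auto simp: max_def)
    finally show ?thesis .
  qed
  have "\<forall>c. \<exists>y. norm c \<le> R \<longrightarrow> y 0 = north \<and> solution \<alpha> T (uc c) y"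
    using solution_exists[OF uc T] by blast
  then obtain Y where Y: "\<And>c. norm c \<le> R \<Longrightarrow> Y c 0 = north" "\<And>c. norm c \<le> R \<Longrightarrow> solution \<alpha> T (uc c) (Y c)"
    by metis
  have Ylip: "norm (Y c t - Y c' t) \<le> 2 * \<eta> c c' * T" if "norm c \<le> R" "norm c' \<le> R" "t \<in> {0..T}" for c c' t
    by (rule solution_diff_bound[OF uc uc Y(2) Y(2) _ _ uc_lip that(3)]) (use that Y in auto)
  have Yx: "norm (Y c t - x t) \<le> 2 * \<eta> c 0 * T" if "norm c \<le> R" "t \<in> {0..T}" for c t
    by (rule solution_diff_bound[OF uc u Y(2) x _ _ _ that(2)])
      (use that Y x0 uc_lip[of _ c 0] uc0 in auto)
  define \<Phi> where "\<Phi> = (\<lambda>c. Complex (p T \<bullet> Y c T) (q T \<bullet> Y c T))"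
  \<comment> \<open>The exact variation formula contains \<open>Y c\<close> in place of
    \<open>x\<close>. Replacing it changes the integrand by at most \<open>\<eta> c 0\<close> times
    the distance 2 \<eta> T of the trajectories, so the remainder is quadratic in
    \<open>c\<close>.\<close>
  have err: "\<bar>y T \<bullet> Y c T - integral {0..T} (\<lambda>\<tau>. (uc c \<tau> - u \<tau>) * (y \<tau> \<bullet> (G_mat \<alpha> *v x \<tau>)))\<bar> \<le> 2 * (\<eta> c 0)\<^sup>2 * T\<^sup>2"
    if c: "norm c \<le> R" and y: "solution \<alpha> T u y" "norm (y 0) = 1" "y 0 \<bullet> north = 0" for c y
  proof -
    have \<eta>0: "0 \<le> \<eta> c 0" using h by (simp add: \<eta>_def)
    have "((\<lambda>\<tau>. (uc c \<tau> - u \<tau>) * (y \<tau> \<bullet> (G_mat \<alpha> *v Y c \<tau>))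
        - (uc c \<tau> - u \<tau>) * (y \<tau> \<bullet> (G_mat \<alpha> *v x \<tau>))) has_integral
        ((y T \<bullet> Y c T - y 0 \<bullet> Y c 0) - integral {0..T} (\<lambda>\<tau>. (uc c \<tau> - u \<tau>) * (y \<tau> \<bullet> (G_mat \<alpha> *v x \<tau>))))) {0..T}"
      by (intro has_integral_diff inner_variation[OF u uc y(1) Y(2)] integrable_integral
          variation_integrable[OF uc u y(1) x] TT c)
    moreover have "norm ((uc c \<tau> - u \<tau>) * (y \<tau> \<bullet> (G_mat \<alpha> *v Y c \<tau>))
        - (uc c \<tau> - u \<tau>) * (y \<tau> \<bullet> (G_mat \<alpha> *v x \<tau>))) \<le> \<eta> c 0 * (2 * \<eta> c 0 * T)"
      if "\<tau> \<in> cbox 0 T" for \<tau>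
    proof -
      have \<tau>: "\<tau> \<in> {0..T}" using that by auto
      have "norm ((uc c \<tau> - u \<tau>) * (y \<tau> \<bullet> (G_mat \<alpha> *v Y c \<tau>))
        - (uc c \<tau> - u \<tau>) * (y \<tau> \<bullet> (G_mat \<alpha> *v x \<tau>))) = \<bar>uc c \<tau> - u \<tau>\<bar> * \<bar>y \<tau> \<bullet> (G_mat \<alpha> *v (Y c \<tau> - x \<tau>))\<bar>"
        by (simp add: right_diff_distrib[symmetric] inner_diff_right[symmetric]
            matrix_vector_mult_diff_distrib abs_mult)
      also have "\<dots> \<le> \<eta> c 0 * (2 * \<eta> c 0 * T)"
      proof (intro mult_mono)
        show "\<bar>uc c \<tau> - u \<tau>\<bar> \<le> \<eta> c 0" using uc_lip[OF \<tau>, of c 0] uc0 by simp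
        have "\<bar>y \<tau> \<bullet> (G_mat \<alpha> *v (Y c \<tau> - x \<tau>))\<bar> \<le> norm (G_mat \<alpha> *v (Y c \<tau> - x \<tau>))"
          using solution_norm[OF u y(1) \<tau>] y(2) by (intro abs_inner_le) simp
        also have "\<dots> \<le> norm (Y c \<tau> - x \<tau>)" by (rule norm_G_mat_le)
        also have "\<dots> \<le> 2 * \<eta> c 0 * T" by (rule Yx[OF c \<tau>])
        finally show "\<bar>y \<tau> \<bullet> (G_mat \<alpha> *v (Y c \<tau> - x \<tau>))\<bar> \<le> 2 * \<eta> c 0 * T" .
      qed (use \<eta>0 in auto)
      finally show ?thesis .
    qed
    ultimately have "norm ((y T \<bullet> Y c T - y 0 \<bullet> Y c 0) - integral {0..T} (\<lambda>\<tau>. (uc c \<tau> - u \<tau>) * (y \<tau> \<bullet> (G_mat \<alpha> *v x \<tau>))))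
        \<le> \<eta> c 0 * (2 * \<eta> c 0 * T) * measure lborel (cbox 0 T)"
      using T \<eta>0 by (intro has_integral_bound) auto
    then show ?thesis
      using T y(3) Y(1)[OF c] by (simp add: power2_eq_square mult_ac)
  qed
  \<comment> \<open>Two coordinates with error 2 \<eta>^2 T^2 each and \<eta> = 8 |c| / h give 256
    |c|^2 T^2 / h^2; the condition 512 R T^2 \<le> h^2 turns this into R / 2.\<close>
  have \<Phi>_close: "norm (\<Phi> c - c) \<le> R / 2" if c: "norm c \<le> R" for c
  proof -
    have "norm (\<Phi> c - c) = norm (\<Phi> c - variation (uc c))" by (simp add: var)
    also have "\<dots> \<le> \<bar>Re (\<Phi> c - variation (uc c))\<bar> + \<bar>Im (\<Phi> c - variation (uc c))\<bar>"
      by (rule cmod_le)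
    also have "\<dots> \<le> 2 * (\<eta> c 0)\<^sup>2 * T\<^sup>2 + 2 * (\<eta> c 0)\<^sup>2 * T\<^sup>2"
    proof (rule add_mono)
      show "\<bar>Re (\<Phi> c - variation (uc c))\<bar> \<le> 2 * (\<eta> c 0)\<^sup>2 * T\<^sup>2"
        using err[OF c p] by (simp add: \<Phi>_def variation_def p0 inner_axis' north_components)
      show "\<bar>Im (\<Phi> c - variation (uc c))\<bar> \<le> 2 * (\<eta> c 0)\<^sup>2 * T\<^sup>2"
        using err[OF c q] by (simp add: \<Phi>_def variation_def q0 inner_axis' north_components)
    qed
    also have "\<dots> = 256 * (norm c)\<^sup>2 * T\<^sup>2 / h\<^sup>2"
      by (simp add: \<eta>_def power_divide power_mult_distrib)
    also have "\<dots> \<le> 256 * R\<^sup>2 * T\<^sup>2 / h\<^sup>2"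
      using c by (intro divide_right_mono mult_right_mono mult_left_mono power_mono) auto
    also have "\<dots> = R / 2 * ((512 * R * T\<^sup>2) / h\<^sup>2)" by (simp add: power2_eq_square)
    also have "\<dots> \<le> R / 2 * 1"
      using R(1,4) h by (intro mult_left_mono) (auto simp: divide_le_eq)
    finally show ?thesis by simp
  qed
  have "continuous_on (cball 0 R) \<Phi>"
  proof -
    have "continuous_on (cball 0 R) (\<lambda>c. Y c T)"
    proof (rule lipschitz_on_continuous_on[OF lipschitz_onI])
      fix c c' :: complex assume "c \<in> cball 0 R" "c' \<in> cball 0 R"
      then have "norm (Y c T - Y c' T) \<le> 2 * \<eta> c c' * T" by (intro Ylip TT) auto
      then show "dist (Y c T) (Y c' T) \<le> (16 * T / h) * dist c c'"
        by (simp add: dist_norm \<eta>_def mult_ac)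
    qed (use T h in auto)
    then show ?thesis
      unfolding \<Phi>_def Complex_eq by (intro continuous_intros)
  qed
  define z where "z = Complex (p T \<bullet> b) (q T \<bullet> b)"
  have nb: "norm b = 1" "norm (b - x T) < R / 4"
    using b by (auto simp: dist_norm norm_minus_commute)
  have z: "norm z \<le> R / 2"
  proof -
    have "p T \<bullet> b = p T \<bullet> (b - x T)" "q T \<bullet> b = q T \<bullet> (b - x T)"
      using ortho[OF TT] by (simp_all add: inner_diff_right)
    then have "\<bar>p T \<bullet> b\<bar> \<le> norm (b - x T)" "\<bar>q T \<bullet> b\<bar> \<le> norm (b - x T)"
      using abs_inner_le norms[OF TT] by metis+
    then show ?thesis
      using cmod_le[of z] nb(2) by (simp add: z_def)
  qed
  \<comment> \<open>A fixed point of c - \<Phi>(c) + z solves \<Phi>(c) = z. The ball is mapped into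
    itself because |\<Phi>(c) - c| and |z| are each at most R / 2.\<close>
  obtain c where c: "c \<in> cball 0 R" "c - \<Phi> c + z = c"
  proof (rule brouwer_ball[OF R(1), of 0 "\<lambda>c. c - \<Phi> c + z"])
    show "continuous_on (cball 0 R) (\<lambda>c. c - \<Phi> c + z)"
      using \<open>continuous_on (cball 0 R) \<Phi>\<close> by (intro continuous_intros)
    show "(\<lambda>c. c - \<Phi> c + z) \<in> cball 0 R \<rightarrow> cball 0 R"
    proof (clarsimp)
      fix c :: complex assume "norm c \<le> R"
      from \<Phi>_close[OF this] z norm_triangle_ineq[of "c - \<Phi> c" z] 
      show "norm (c - \<Phi> c + z) \<le> R" by (simp add: norm_minus_commute)
    qed
  qed blast
  have cR: "norm c \<le> R" using c(1) by simp
  have "\<Phi> c = z" using c(2) by simp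
  then have pq: "p T \<bullet> (Y c T) = p T \<bullet> b" "q T \<bullet> (Y c T) = q T \<bullet> b"
    by (simp_all add: \<Phi>_def z_def)
  have nY: "norm (Y c T) = 1" using solution_norm[OF uc[OF cR] Y(2)[OF cR] TT] Y(1)[OF cR] by simp
  \<comment> \<open>The products with \<open>p T\<close> and \<open>q T\<close> determine a unit
    vector only up to the sign of its component along \<open>x T\<close>. Staying within distance
    1/2 of \<open>x T\<close> fixes this sign.\<close>
  have dY: "norm (Y c T - x T) \<le> 1 / 2"
  proof -
    have "norm (Y c T - x T) \<le> 2 * \<eta> c 0 * T" by (rule Yx[OF cR TT])
    also have "\<dots> = 16 * norm c * T / h" by (simp add: \<eta>_def)
    also have "\<dots> \<le> 16 * R * T / h"
      using cR T h by (intro divide_right_mono mult_right_mono mult_left_mono) auto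
    also have "\<dots> \<le> 1 / 2" using R(5) h by (simp add: divide_le_eq)
    finally show ?thesis .
  qed
  have pos: "0 < x T \<bullet> y" if "norm (y - x T) \<le> 1 / 2" for y
  proof -
    have "\<bar>x T \<bullet> (y - x T)\<bar> \<le> norm (y - x T)" using norms[OF TT] by (intro abs_inner_le)
    moreover have "x T \<bullet> x T = 1" using norms(1)[OF TT] by (simp add: norm_eq_1)
    ultimately show ?thesis using that by (simp add: inner_diff_right)
  qed
  have gram: "(norm v)\<^sup>2 = (x T \<bullet> v)\<^sup>2 + (p T \<bullet> v)\<^sup>2 + (q T \<bullet> v)\<^sup>2" for v
    using gram_3[of "x T" "p T" v] norms[OF TT] ortho[OF TT] cross_x_p[OF TT] by (simp add: inner_commute)
  have "(x T \<bullet> Y c T)\<^sup>2 = (x T \<bullet> b)\<^sup>2"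
    using gram[of "Y c T"] gram[of b] nY nb(1) pq by simp
  moreover have "0 < x T \<bullet> Y c T" "0 < x T \<bullet> b"
    using dY nb(2) R(2) by (auto intro!: pos)
  ultimately have "x T \<bullet> Y c T = x T \<bullet> b" by (simp add: power2_eq_iff_nonneg)
  then have "norm (Y c T - b) = 0"
    using gram[of "Y c T - b"] pq by (simp add: inner_diff_right)
  then have "Y c T = b" by simp
  moreover have "admissible \<alpha> T (Y c) (uc c)"
    using T uc[OF cR] Y[OF cR] by (simp add: admissible_iff)
  ultimately show "b \<in> reach \<alpha> T"
    using Y(1)[OF cR] unfolding reach_def by blast
qed

end

text \<open>The point is uniformity: the radius depends on \<alpha>, T and \<rho> alone and not on
  the trajectory. Only thus can nearby trajectories with different controls be treated together near
  a boundary point.\<close>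

lemma reach_open:
  assumes sa: "0 < sin \<alpha>" and T: "0 \<le> T" and \<rho>: "0 < \<rho>"
  shows "\<exists>r>0. \<forall>x u. admissible \<alpha> T x u \<and> x 0 = north \<and>
     (\<forall>m. solution \<alpha> T u m \<and> norm (m 0) = 1 \<and> m 0 $ 3 = 0 \<longrightarrow> \<rho> \<le> gap T u m) \<longrightarrow>
     ball (x T) r \<inter> sphere 0 1 \<subseteq> reach \<alpha> T"
proof -
  define h where "h = sin \<alpha> * \<rho> / 2"
  have h: "h > 0" using sa \<rho> by (simp add: h_def)
  \<comment> \<open>One entry for each smallness condition of the covering lemma;
    \<open>T\<^sup>2 + 1\<close> and \<open>T + 1\<close> keep the quotients meaningful at T =
    0.\<close>
  define R where "R = min (min 1 (h / 2)) (min (h\<^sup>2 / (512 * (T\<^sup>2 + 1))) (h / (32 * (T + 1))))"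
  have T21: "0 < T\<^sup>2 + 1" by (simp add: add_nonneg_pos)
  have R: "0 < R" "R \<le> 1" "2 * R \<le> h" "512 * R * T\<^sup>2 \<le> h\<^sup>2" "32 * R * T \<le> h"
  proof -
    show R0: "0 < R" using h T T21 by (simp add: R_def)
    show "R \<le> 1" by (simp add: R_def)
    have "R \<le> h / 2" unfolding R_def by (meson min.cobounded1 min.cobounded2 order_trans)
    then show "2 * R \<le> h" by linarith
    have "R \<le> h\<^sup>2 / (512 * (T\<^sup>2 + 1))" unfolding R_def by (meson min.cobounded1 min.cobounded2 order_trans)
    then have "512 * R * (T\<^sup>2 + 1) \<le> h\<^sup>2" using T21 by (simp add: field_simps)
    moreover have "512 * R * T\<^sup>2 \<le> 512 * R * (T\<^sup>2 + 1)" using R0 by (intro mult_left_mono) auto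
    ultimately show "512 * R * T\<^sup>2 \<le> h\<^sup>2" by linarith
    have "R \<le> h / (32 * (T + 1))" unfolding R_def by (meson min.cobounded1 min.cobounded2 order_trans)
    then have "32 * R * (T + 1) \<le> h" using T by (simp add: field_simps)
    moreover have "32 * R * T \<le> 32 * R * (T + 1)" using R0 by (intro mult_left_mono) auto
    ultimately show "32 * R * T \<le> h" by linarith
  qed
  have R4: "0 < R / 4" using R(1) by simp
  show ?thesis
  proof (intro exI[of _ "R / 4"] conjI allI impI)
    fix x u
    assume A: "admissible \<alpha> T x u \<and> x 0 = north \<and>
     (\<forall>m. solution \<alpha> T u m \<and> norm (m 0) = 1 \<and> m 0 $ 3 = 0 \<longrightarrow> \<rho> \<le> gap T u m)"
    then have u: "control T u" and x: "solution \<alpha> T u x" and x0: "x 0 = north"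
      by (auto simp: admissible_iff)
    obtain p where p: "p 0 = axis 1 1" "solution \<alpha> T u p" using solution_exists[OF u T] by blast
    obtain q where q: "q 0 = axis 2 1" "solution \<alpha> T u q" using solution_exists[OF u T] by blast
    interpret reference_trajectory \<alpha> T u x p q
      by unfold_locales (use T sa u x x0 p q in auto)
    show "ball (x T) (R / 4) \<inter> sphere 0 1 \<subseteq> reach \<alpha> T"
    proof (rule sphere_ball_subset_reach[OF h _ R])
      fix z :: complex assume "norm z \<le> h"
      then have "norm z < sin \<alpha> * \<rho>" using h by (simp add: h_def)
      then show "\<exists>w. control T w \<and> variation w = z"
        using A by (intro ball_subset_variations[of \<rho>]) auto
    qed
  qed (rule R4)
qed

subsection \<open>Limits of nearly extremal trajectories\<close>

text \<open>Closed under uniform limits: the control is eliminated, and \<open>m = x \<times> p\<close> is the rotated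
  covector, whose first component is the switching function.\<close>

definition weak_extremal :: "real \<Rightarrow> real \<Rightarrow> (real \<Rightarrow> real^3) \<Rightarrow> (real \<Rightarrow> real^3) \<Rightarrow> bool" where
  "weak_extremal \<alpha> T x m \<longleftrightarrow>
     continuous_on {0..T} x \<and> continuous_on {0..T} m \<and> x 0 = north \<and> norm (m 0) = 1 \<and> m 0 $ 3 = 0 \<and>
     (\<forall>t\<in>{0..T}. ((\<lambda>\<tau>. - cos \<alpha> * m \<tau> $ 2) has_integral (m t $ 1 - m 0 $ 1)) {0..t}) \<and>
     (\<forall>\<sigma> a b. \<sigma>\<^sup>2 = 1 \<and> 0 \<le> a \<and> a \<le> b \<and> b \<le> T \<and> (\<forall>t\<in>{a..b}. 0 < \<sigma> * m t $ 1) \<longrightarrow>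
        (\<forall>t\<in>{a..b}. x t = flow \<alpha> \<sigma> (t - a) (x a) \<and> m t = flow \<alpha> \<sigma> (t - a) (m a)))"

lemma abs_control_diff: "\<bar>u\<bar> \<le> 1 \<Longrightarrow> \<sigma>\<^sup>2 = 1 \<Longrightarrow> \<bar>u - \<sigma>\<bar> = 1 - \<sigma> * u" for u \<sigma> :: real
  by (auto simp: power2_eq_1_iff)

lemma control_defect_integrable:
  assumes "control T u" "0 \<le> a" "b \<le> T"
  shows "(\<lambda>\<tau>. 1 - \<sigma> * u \<tau>) integrable_on {a..b}"
proof -
  have "u integrable_on {a..b}"
    using assms by (auto simp: control_def intro: integrable_subinterval_real)
  then show ?thesis by (intro integrable_diff integrable_on_mult_right integrable_const_ivl)
qed

lemma nonpos_if_le_all_mult: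
  fixes c K :: real
  assumes "\<And>e. 0 < e \<Longrightarrow> c \<le> e * K" "0 < K"
  shows "c \<le> 0"
proof (rule field_le_epsilon)
  fix e :: real assume "0 < e"
  then show "c \<le> 0 + e" using assms(1)[of "e / K"] assms(2) by simp
qed

text \<open>Since |u - \<sigma>| = 1 - \<sigma> u for admissible controls, the hypothesis says that
  the controls tend to the constant \<sigma> in mean on [a, b]. The integral equations then pass to
  the limit, which solves the equation with constant control.\<close>

lemma flow_limit:
  assumes u: "\<And>n. control T (u n)" and v: "\<And>n. solution \<alpha> T (u n) (v n)"
    and v0: "\<And>n. norm (v n 0) = 1"
    and lim: "uniform_limit {0..T} v w sequentially" and wc: "continuous_on {0..T} w"
    and ab: "0 \<le> a" "a \<le> b" "b \<le> T" and \<sigma>: "\<sigma>\<^sup>2 = 1"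
    and I: "(\<lambda>n. integral {a..b} (\<lambda>\<tau>. 1 - \<sigma> * u n \<tau>)) \<longlonglongrightarrow> 0"
    and t: "t \<in> {a..b}"
  shows "w t = flow \<alpha> \<sigma> (t - a) (w a)"
proof -
  let ?X = "X_mat \<alpha> \<sigma>"
  have Xc: "continuous_on {a..b} (\<lambda>\<tau>. ?X *v w \<tau>)"
    using ab by (intro continuous_on_mat_mult continuous_on_subset[OF wc]) auto
  have main: "w t - w a = integral {a..t} (\<lambda>\<tau>. ?X *v w \<tau>)" if t: "t \<in> {a..b}" for t
  proof -
    define E where "E = w t - w a - integral {a..t} (\<lambda>\<tau>. ?X *v w \<tau>)"
    have wint: "(\<lambda>\<tau>. ?X *v w \<tau>) integrable_on {a..t}"
      by (intro integrable_continuous_real continuous_on_subset[OF Xc]) (use t in auto)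
    have "norm E \<le> e * (T + 3)" if e: "e > 0" for e
    proof -
      obtain N1 where N1: "\<And>n \<tau>. n \<ge> N1 \<Longrightarrow> \<tau> \<in> {0..T} \<Longrightarrow> dist (v n \<tau>) (w \<tau>) < e"
        using uniform_limitD[OF lim e] unfolding eventually_sequentially by blast
      obtain N2 where N2: "\<And>n. n \<ge> N2 \<Longrightarrow> norm (integral {a..b} (\<lambda>\<tau>. 1 - \<sigma> * u n \<tau>) - 0) < e"
        using LIMSEQ_D[OF I e] by blast
      define n where "n = max N1 N2"
      have d: "norm (v n \<tau> - w \<tau>) \<le> e" if "\<tau> \<in> {0..T}" for \<tau>
        using N1[of n \<tau>] that by (simp add: n_def dist_norm)
      have J: "integral {a..b} (\<lambda>\<tau>. 1 - \<sigma> * u n \<tau>) \<le> e"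
        using N2[of n] by (simp add: n_def)
      have 1: "((\<lambda>\<tau>. X_mat \<alpha> (u n \<tau>) *v v n \<tau>) has_integral (v n t - v n a)) {a..t}"
        using primitive_interval[OF v[unfolded solution_def]] ab t by auto
      have H1: "((\<lambda>\<tau>. X_mat \<alpha> (u n \<tau>) *v v n \<tau> - ?X *v w \<tau>) has_integral
          ((v n t - v n a) - integral {a..t} (\<lambda>\<tau>. ?X *v w \<tau>))) {a..t}"
        by (intro has_integral_diff 1 integrable_integral wint)
      have H2: "((\<lambda>\<tau>. e + (1 - \<sigma> * u n \<tau>)) has_integral (e * (t - a) + integral {a..t} (\<lambda>\<tau>. 1 - \<sigma> * u n \<tau>))) {a..t}"
        using has_integral_const_real[of e a t] ab t
        by (intro has_integral_add integrable_integral control_defect_integrable[OF u]) (auto simp: mult.commute)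
      have H3: "norm (X_mat \<alpha> (u n \<tau>) *v v n \<tau> - ?X *v w \<tau>) \<le> e + (1 - \<sigma> * u n \<tau>)" if \<tau>: "\<tau> \<in> {a..t}" for \<tau>
      proof -
        have \<tau>T: "\<tau> \<in> {0..T}" using \<tau> t ab by auto
        have un: "\<bar>u n \<tau>\<bar> \<le> 1" using u \<tau>T by (auto simp: control_def)
        have "X_mat \<alpha> (u n \<tau>) *v v n \<tau> - ?X *v w \<tau> =
            ?X *v (v n \<tau> - w \<tau>) + (u n \<tau> - \<sigma>) *\<^sub>R (G_mat \<alpha> *v v n \<tau>)"
          unfolding X_mat_diff_control[of \<alpha> "u n \<tau>" "v n \<tau>" \<sigma>]
          by (simp add: matrix_vector_mult_diff_distrib algebra_simps)
        also have "norm \<dots> \<le> norm (?X *v (v n \<tau> - w \<tau>)) + \<bar>u n \<tau> - \<sigma>\<bar> * norm (G_mat \<alpha> *v v n \<tau>)"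
          by (rule norm_triangle_le) simp
        also have "\<dots> \<le> e + \<bar>u n \<tau> - \<sigma>\<bar> * 1"
        proof (intro add_mono mult_left_mono)
          show "norm (?X *v (v n \<tau> - w \<tau>)) \<le> e"
            using \<sigma> by (intro order_trans[OF norm_X_mat_le d[OF \<tau>T]]) (auto simp: power2_eq_1_iff)
          show "norm (G_mat \<alpha> *v v n \<tau>) \<le> 1"
            using norm_G_mat_le[of \<alpha> "v n \<tau>"] solution_norm[OF u v \<tau>T] v0 by simp
        qed simp
        finally show ?thesis using abs_control_diff[OF un \<sigma>] by simp
      qed
      have "norm ((v n t - v n a) - integral {a..t} (\<lambda>\<tau>. ?X *v w \<tau>))
          \<le> e * (t - a) + integral {a..t} (\<lambda>\<tau>. 1 - \<sigma> * u n \<tau>)"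
        using Henstock_Kurzweil_Integration.integral_norm_bound_integral
          [OF has_integral_integrable[OF H1] has_integral_integrable[OF H2] H3]
        unfolding integral_unique[OF H1] integral_unique[OF H2] .
      moreover have "integral {a..t} (\<lambda>\<tau>. 1 - \<sigma> * u n \<tau>) \<le> integral {a..b} (\<lambda>\<tau>. 1 - \<sigma> * u n \<tau>)"
      proof (rule Henstock_Kurzweil_Integration.integral_subset_le)
        show "\<forall>\<tau>\<in>{a..b}. 0 \<le> 1 - \<sigma> * u n \<tau>"
        proof
          fix \<tau> assume "\<tau> \<in> {a..b}"
          then have "\<bar>u n \<tau>\<bar> \<le> 1" using u ab by (auto simp: control_def)
          then show "0 \<le> 1 - \<sigma> * u n \<tau>" using \<sigma> by (auto simp: power2_eq_1_iff)
        qed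
      qed (use t ab in \<open>auto intro!: control_defect_integrable[OF u]\<close>)
      moreover have "e * (t - a) \<le> e * T" using t ab e by (intro mult_left_mono) auto
      ultimately have 2: "norm ((v n t - v n a) - integral {a..t} (\<lambda>\<tau>. ?X *v w \<tau>)) \<le> e * T + e"
        using J by linarith
      have "norm E = norm (((v n t - v n a) - integral {a..t} (\<lambda>\<tau>. ?X *v w \<tau>)) - (v n t - w t) + (v n a - w a))"
        by (simp add: E_def algebra_simps)
      also have "\<dots> \<le> norm ((v n t - v n a) - integral {a..t} (\<lambda>\<tau>. ?X *v w \<tau>)) + norm (v n t - w t) + norm (v n a - w a)"
        by norm
      also have "\<dots> \<le> (e * T + e) + e + e"
        using t ab by (intro add_mono 2 d) auto
      finally show ?thesis by (simp add: algebra_simps)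
    qed
    then have "norm E \<le> 0" by (rule nonpos_if_le_all_mult) (use ab in auto)
    then show ?thesis by (simp add: E_def)
  qed
  have "(w has_vector_derivative ?X *v w t) (at t within {a..b})" if t: "t \<in> {a..b}" for t
  proof -
    have "((\<lambda>s. w a + integral {a..s} (\<lambda>\<tau>. ?X *v w \<tau>)) has_vector_derivative 0 + ?X *v w t) (at t within {a..b})"
      by (intro has_vector_derivative_add has_vector_derivative_const integral_has_vector_derivative Xc t)
    then have "((\<lambda>s. w a + integral {a..s} (\<lambda>\<tau>. ?X *v w \<tau>)) has_vector_derivative ?X *v w t) (at t within {a..b})"
      by simp
    then show ?thesis
      by (rule has_vector_derivative_transform[OF t, rotated]) (simp add: main[symmetric])
  qed
  from flow_unique[OF \<sigma> this t] show ?thesis .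
qed

lemma gap_integrable:
  assumes "control T u" "continuous_on {0..T} m"
  shows "(\<lambda>\<tau>. \<bar>m \<tau> $ 1\<bar> - u \<tau> * m \<tau> $ 1) integrable_on {0..T}"
  by (intro integrable_diff integrable_continuous_real control_times_integrable assms
      continuous_on_rabs continuous_on_component)

lemma gap_integrand_nonneg: "\<bar>u\<bar> \<le> 1 \<Longrightarrow> 0 \<le> \<bar>m\<bar> - u * m" for u m :: real
proof -
  assume "\<bar>u\<bar> \<le> 1"
  then have "\<bar>u\<bar> * \<bar>m\<bar> \<le> 1 * \<bar>m\<bar>" by (intro mult_right_mono) auto
  moreover have "u * m \<le> \<bar>u\<bar> * \<bar>m\<bar>" unfolding abs_mult[symmetric] by (rule abs_ge_self)
  ultimately show ?thesis by simp
qed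

text \<open>Where \<sigma> m_1 is positive the integrand of the gap equals \<sigma> m_1 (1 -
  \<sigma> u). A small gap therefore forces the control close to \<sigma> wherever the switching
  function stays away from zero.\<close>

lemma gap_lower_bound:
  assumes u: "control T u" and m: "continuous_on {0..T} m" and ab: "0 \<le> a" "a \<le> b" "b \<le> T"
    and \<sigma>: "\<sigma>\<^sup>2 = 1" and \<eta>: "\<And>t. t \<in> {a..b} \<Longrightarrow> \<eta> \<le> \<sigma> * m t $ 1" "0 < \<eta>"
  shows "\<eta> * integral {a..b} (\<lambda>\<tau>. 1 - \<sigma> * u \<tau>) \<le> gap T u m"
proof -
  let ?g = "\<lambda>\<tau>. \<bar>m \<tau> $ 1\<bar> - u \<tau> * m \<tau> $ 1"
  have g: "?g integrable_on {0..T}" "?g integrable_on {a..b}"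
    using gap_integrable[OF u m] ab by (auto intro: integrable_subinterval_real)
  have "\<eta> * integral {a..b} (\<lambda>\<tau>. 1 - \<sigma> * u \<tau>) = integral {a..b} (\<lambda>\<tau>. \<eta> * (1 - \<sigma> * u \<tau>))"
    by simp
  also have "\<dots> \<le> integral {a..b} ?g"
  proof (rule integral_le[OF _ g(2)])
    show "(\<lambda>\<tau>. \<eta> * (1 - \<sigma> * u \<tau>)) integrable_on {a..b}"
      by (intro integrable_on_mult_right control_defect_integrable[OF u] ab)
    fix t assume t: "t \<in> {a..b}"
    have ut: "\<bar>u t\<bar> \<le> 1" using u t ab by (auto simp: control_def)
    have "?g t = (\<sigma> * m t $ 1) * (1 - \<sigma> * u t)"
      using \<sigma> \<eta>(1)[OF t] \<eta>(2) by (auto simp: power2_eq_1_iff algebra_simps)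
    moreover have "0 \<le> 1 - \<sigma> * u t" using \<sigma> ut by (auto simp: power2_eq_1_iff)
    ultimately show "\<eta> * (1 - \<sigma> * u t) \<le> ?g t"
      using \<eta>(1)[OF t] by (simp add: mult_right_mono)
  qed
  also have "\<dots> \<le> gap T u m"
    unfolding gap_def
    by (intro Henstock_Kurzweil_Integration.integral_subset_le g ballI gap_integrand_nonneg)
      (use ab u in \<open>auto simp: control_def\<close>)
  finally show ?thesis .
qed

text \<open>The first component of the field does not contain the control, so its equation survives
  uniform convergence of the trajectories alone, even where the controls oscillate.\<close>

lemma component_limit:
  assumes u: "\<And>n. control T (u n)" and v: "\<And>n. solution \<alpha> T (u n) (v n)"
    and lim: "uniform_limit {0..T} v w sequentially" and wc: "continuous_on {0..T} w"
    and t: "t \<in> {0..T}"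
  shows "((\<lambda>\<tau>. - cos \<alpha> * w \<tau> $ 2) has_integral (w t $ 1 - w 0 $ 1)) {0..t}"
proof -
  let ?f = "\<lambda>v \<tau>. - cos \<alpha> * v \<tau> $ 2"
  have T: "0 \<in> {0..T}" "0 \<le> T" using t by auto
  have wint: "?f w integrable_on {0..t}"
    using t by (intro integrable_continuous_real continuous_intros continuous_on_subset[OF wc]) auto
  have vint: "(?f (v n) has_integral (v n t $ 1 - v n 0 $ 1)) {0..t}" for n
  proof -
    have "((\<lambda>\<tau>. X_mat \<alpha> (u n \<tau>) *v v n \<tau>) has_integral (v n t - v n 0)) {0..t}"
      using v[of n] t by (simp add: solution_def primitive_def)
    from has_integral_linear[OF this bounded_linear_vec_nth[of 1]]
    show ?thesis by (simp add: o_def X_mat_components)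
  qed
  define E where "E = w t $ 1 - w 0 $ 1 - integral {0..t} (?f w)"
  have "\<bar>E\<bar> \<le> e * (T + 2)" if e: "e > 0" for e
  proof -
    obtain n where n: "\<And>\<tau>. \<tau> \<in> {0..T} \<Longrightarrow> dist (v n \<tau>) (w \<tau>) < e"
      using uniform_limitD[OF lim e] unfolding eventually_sequentially by blast
    have d: "\<bar>v n \<tau> $ i - w \<tau> $ i\<bar> \<le> e" if "\<tau> \<in> {0..T}" for \<tau> i
      using n[OF that] component_le_norm_cart[of "v n \<tau> - w \<tau>" i] by (simp add: dist_norm)
    have "((\<lambda>\<tau>. ?f (v n) \<tau> - ?f w \<tau>) has_integral ((v n t $ 1 - v n 0 $ 1) - integral {0..t} (?f w))) {0..t}"
      by (intro has_integral_diff vint integrable_integral wint)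
    moreover have "norm (?f (v n) \<tau> - ?f w \<tau>) \<le> e" if "\<tau> \<in> cbox 0 t" for \<tau>
    proof -
      have "norm (?f (v n) \<tau> - ?f w \<tau>) = \<bar>cos \<alpha>\<bar> * \<bar>v n \<tau> $ 2 - w \<tau> $ 2\<bar>"
        by (simp add: abs_mult[symmetric] algebra_simps abs_minus_commute)
      also have "\<dots> \<le> 1 * e"
        by (intro mult_mono d) (use that t e in auto)
      finally show ?thesis by simp
    qed
    ultimately have "norm ((v n t $ 1 - v n 0 $ 1) - integral {0..t} (?f w)) \<le> e * measure lborel (cbox 0 t)"
      using e by (intro has_integral_bound) auto
    also have "\<dots> = e * t" using t by simp
    also have "\<dots> \<le> e * T" using e t by (intro mult_left_mono) auto
    finally have "\<bar>(v n t $ 1 - v n 0 $ 1) - integral {0..t} (?f w)\<bar> \<le> e * T" by simp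
    with d[OF t, of 1] d[OF T(1), of 1] have "\<bar>E\<bar> \<le> e * T + e + e" unfolding E_def by linarith
    then show ?thesis by (simp add: algebra_simps)
  qed
  then have "\<bar>E\<bar> \<le> 0" by (rule nonpos_if_le_all_mult) (use T in auto)
  then have "w t $ 1 - w 0 $ 1 = integral {0..t} (?f w)" by (simp add: E_def)
  then show ?thesis using integrable_integral[OF wint] by (simp only:)
qed

text \<open>Trajectories and momenta have norm 1 and are Lipschitz with constant 1, so the pairs (x,
  m) are precompact by Arzela-Ascoli. Convergence of controls is recovered only on intervals where
  the limiting switching function has a sign, which is exactly what a weak extremal records.\<close>

lemma weak_extremal_limit:
  assumes T: "0 \<le> T"
    and x: "\<And>n. admissible \<alpha> T (x n) (u n)" "\<And>n. x n 0 = north"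
    and m: "\<And>n. solution \<alpha> T (u n) (m n)" "\<And>n. norm (m n 0) = 1" "\<And>n. m n 0 $ 3 = 0"
    and gap: "(\<lambda>n. gap T (u n) (m n)) \<longlonglongrightarrow> 0"
  shows "\<exists>r y z. strict_mono r \<and> weak_extremal \<alpha> T y z \<and> (\<forall>t\<in>{0..T}. (\<lambda>n. x (r n) t) \<longlonglongrightarrow> y t)"
proof -
  have u: "control T (u n)" and xs: "solution \<alpha> T (u n) (x n)" for n
    using x(1)[of n] by (auto simp: admissible_iff)
  let ?f = "\<lambda>n t. (x n t, m n t)"
  obtain g r where g: "continuous_on {0..T} g" and r: "strict_mono (r :: nat \<Rightarrow> nat)"
    and lim: "\<And>e. 0 < e \<Longrightarrow> \<exists>N. \<forall>n t. n \<ge> N \<and> t \<in> {0..T} \<longrightarrow> norm (?f (r n) t - g t) < e"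
  proof (rule Arzela_Ascoli[of "{0..T}" ?f 2])
    fix n t assume t: "t \<in> {0..T}"
    have "norm (?f n t) \<le> norm (x n t) + norm (m n t)" by (rule norm_Pair_le)
    then show "norm (?f n t) \<le> 2"
      using solution_norm[OF u xs t] solution_norm[OF u m(1) t] by (simp add: x(2) m(2))
  next
    fix t e :: real assume t: "t \<in> {0..T}" and e: "0 < e"
    show "\<exists>d>0. \<forall>n y. y \<in> {0..T} \<and> norm (t - y) < d \<longrightarrow> norm (?f n t - ?f n y) < e"
    proof (intro exI[of _ "e / 2"] conjI allI impI)
      fix n y assume y: "y \<in> {0..T} \<and> norm (t - y) < e / 2"
      have "norm (?f n t - ?f n y) \<le> norm (x n t - x n y) + norm (m n t - m n y)"
        unfolding diff_Pair by (rule norm_Pair_le)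
      also have "\<dots> \<le> \<bar>t - y\<bar> + \<bar>t - y\<bar>"
        using solution_lipschitz[OF u xs, of y t] solution_lipschitz[OF u m(1), of y t] y t
        by (intro add_mono) (auto simp: x(2) m(2))
      finally show "norm (?f n t - ?f n y) < e" using y by simp
    qed (use e in simp)
  qed auto
  define y where "y = (\<lambda>t. fst (g t))"
  define z where "z = (\<lambda>t. snd (g t))"
  have yc: "continuous_on {0..T} y" and zc: "continuous_on {0..T} z"
    unfolding y_def z_def using g by (auto intro: continuous_intros)
  have xl: "uniform_limit {0..T} (\<lambda>n. x (r n)) y sequentially"
    unfolding uniform_limit_sequentially_iff
  proof (intro allI impI)
    fix e :: real assume "0 < e"
    from lim[OF this] obtain N where N: "\<And>n t. n \<ge> N \<Longrightarrow> t \<in> {0..T} \<Longrightarrow> norm (?f (r n) t - g t) < e" by blast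
    have "dist (x (r n) t) (y t) < e" if "n \<ge> N" "t \<in> {0..T}" for n t
      using N[OF that] norm_fst_le[of "x (r n) t - fst (g t)" "m (r n) t - snd (g t)"]
      by (simp add: dist_norm y_def minus_prod_def)
    then show "\<exists>N. \<forall>n\<ge>N. \<forall>t\<in>{0..T}. dist (x (r n) t) (y t) < e" by blast
  qed
  have ml: "uniform_limit {0..T} (\<lambda>n. m (r n)) z sequentially"
    unfolding uniform_limit_sequentially_iff
  proof (intro allI impI)
    fix e :: real assume "0 < e"
    from lim[OF this] obtain N where N: "\<And>n t. n \<ge> N \<Longrightarrow> t \<in> {0..T} \<Longrightarrow> norm (?f (r n) t - g t) < e" by blast
    have "dist (m (r n) t) (z t) < e" if "n \<ge> N" "t \<in> {0..T}" for n t
      using N[OF that] norm_snd_le[of "m (r n) t - snd (g t)" "x (r n) t - fst (g t)"]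
      by (simp add: dist_norm z_def minus_prod_def)
    then show "\<exists>N. \<forall>n\<ge>N. \<forall>t\<in>{0..T}. dist (m (r n) t) (z t) < e" by blast
  qed
  have xt: "(\<lambda>n. x (r n) t) \<longlonglongrightarrow> y t" if "t \<in> {0..T}" for t
    using tendsto_uniform_limitI[OF xl that] .
  have mt: "(\<lambda>n. m (r n) t) \<longlonglongrightarrow> z t" if "t \<in> {0..T}" for t
    using tendsto_uniform_limitI[OF ml that] .
  have T0: "0 \<in> {0..T}" using T by simp
  have gapr: "(\<lambda>n. gap T (u (r n)) (m (r n))) \<longlonglongrightarrow> 0"
    using LIMSEQ_subseq_LIMSEQ[OF gap r] by (simp add: o_def)
  have defect: "(\<lambda>n. integral {a..b} (\<lambda>\<tau>. 1 - \<sigma> * u (r n) \<tau>)) \<longlonglongrightarrow> 0"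
    if \<sigma>: "\<sigma>\<^sup>2 = 1" and ab: "0 \<le> a" "a \<le> b" "b \<le> T" and pos: "\<forall>t\<in>{a..b}. 0 < \<sigma> * z t $ 1" for \<sigma> a b
  proof -
    have "continuous_on {a..b} (\<lambda>t. \<sigma> * z t $ 1)"
      using ab by (intro continuous_intros continuous_on_subset[OF zc]) auto
    from continuous_attains_inf[OF _ _ this] ab
    obtain t0 where t0: "t0 \<in> {a..b}" "\<forall>t\<in>{a..b}. \<sigma> * z t0 $ 1 \<le> \<sigma> * z t $ 1" by auto
    \<comment> \<open>Half of the minimum of \<sigma> z_1 on the interval: once the momenta are
      uniformly within \<eta> of the limit, their first components are still at least
      \<eta>.\<close>
    define \<eta> where "\<eta> = \<sigma> * z t0 $ 1 / 2"
    have \<eta>: "\<eta> > 0" using pos t0 by (simp add: \<eta>_def)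
    obtain N where N: "\<And>n t. n \<ge> N \<Longrightarrow> t \<in> {0..T} \<Longrightarrow> dist (m (r n) t) (z t) < \<eta>"
      using uniform_limitD[OF ml \<eta>] unfolding eventually_sequentially by blast
    have ub: "integral {a..b} (\<lambda>\<tau>. 1 - \<sigma> * u (r n) \<tau>) \<le> gap T (u (r n)) (m (r n)) / \<eta>" if n: "n \<ge> N" for n
    proof -
      have "\<eta> * integral {a..b} (\<lambda>\<tau>. 1 - \<sigma> * u (r n) \<tau>) \<le> gap T (u (r n)) (m (r n))"
      proof (rule gap_lower_bound[OF u solution_continuous[OF m(1)] ab \<sigma> _ \<eta>])
        fix t assume t: "t \<in> {a..b}"
        have "\<bar>m (r n) t $ 1 - z t $ 1\<bar> \<le> norm (m (r n) t - z t)"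
          using component_le_norm_cart[of "m (r n) t - z t" 1] by simp
        also have "\<dots> < \<eta>" using N[OF n, of t] t ab by (simp add: dist_norm)
        finally have "\<bar>\<sigma> * m (r n) t $ 1 - \<sigma> * z t $ 1\<bar> < \<eta>"
          using \<sigma> by (auto simp: power2_eq_1_iff)
        moreover have "2 * \<eta> \<le> \<sigma> * z t $ 1" using t0 t by (simp add: \<eta>_def)
        ultimately show "\<eta> \<le> \<sigma> * m (r n) t $ 1" by linarith
      qed
      then show ?thesis using \<eta> by (simp add: le_divide_eq mult.commute)
    qed
    have lb: "0 \<le> integral {a..b} (\<lambda>\<tau>. 1 - \<sigma> * u (r n) \<tau>)" for n
    proof (rule integral_nonneg[OF control_defect_integrable[OF u ab(1,3)]])
      fix \<tau> assume "\<tau> \<in> {a..b}"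
      then have "\<bar>u (r n) \<tau>\<bar> \<le> 1" using u[of "r n"] ab by (auto simp: control_def)
      then show "0 \<le> 1 - \<sigma> * u (r n) \<tau>" using \<sigma> by (auto simp: power2_eq_1_iff)
    qed
    have "(\<lambda>n. gap T (u (r n)) (m (r n)) / \<eta>) \<longlonglongrightarrow> 0"
      using tendsto_divide[OF gapr tendsto_const[of \<eta>]] \<eta> by simp
    then show ?thesis
      by (rule tendsto_sandwich[OF _ _ tendsto_const, rotated 2])
        (use lb ub in \<open>auto simp: eventually_sequentially\<close>)
  qed
  have "weak_extremal \<alpha> T y z"
    unfolding weak_extremal_def
  proof (intro conjI allI impI ballI yc zc)
    show "y 0 = north"
      using LIMSEQ_unique[OF xt[OF T0]] by (simp add: x(2))
    show "norm (z 0) = 1"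
      using LIMSEQ_unique[OF tendsto_norm[OF mt[OF T0]]] by (simp add: m(2))
    show "z 0 $ 3 = 0"
      using LIMSEQ_unique[OF tendsto_vec_nth[OF mt[OF T0], of 3]] by (simp add: m(3))
    show "((\<lambda>\<tau>. - cos \<alpha> * z \<tau> $ 2) has_integral z t $ 1 - z 0 $ 1) {0..t}" if "t \<in> {0..T}" for t
      by (rule component_limit[OF u m(1) ml zc that])
    fix \<sigma> a b t
    assume A: "\<sigma>\<^sup>2 = 1 \<and> 0 \<le> a \<and> a \<le> b \<and> b \<le> T \<and> (\<forall>t\<in>{a..b}. 0 < \<sigma> * z t $ 1)" and t: "t \<in> {a..b}"
    then have \<sigma>: "\<sigma>\<^sup>2 = 1" and ab: "0 \<le> a" "a \<le> b" "b \<le> T" and pos: "\<forall>t\<in>{a..b}. 0 < \<sigma> * z t $ 1" by auto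
    show "y t = flow \<alpha> \<sigma> (t - a) (y a)"
      by (rule flow_limit[OF u xs _ xl yc ab \<sigma> defect[OF \<sigma> ab pos] t]) (simp add: x(2))
    show "z t = flow \<alpha> \<sigma> (t - a) (z a)"
      by (rule flow_limit[OF u m(1) m(2) ml zc ab \<sigma> defect[OF \<sigma> ab pos] t])
  qed
  with r xt show ?thesis by blast
qed

subsection \<open>Extremals are bang-bang\<close>

lemma small_angle:
  assumes "0 < \<alpha>" "\<alpha> < pi / 4"
  shows "0 < sin \<alpha>" "0 < cos \<alpha>" "sin \<alpha> < cos \<alpha>" "(sin \<alpha>)\<^sup>2 < (cos \<alpha>)\<^sup>2"
proof -
  have p: "pi > 0" by simp
  show 1: "0 < sin \<alpha>" using assms p by (intro sin_gt_zero) linarith+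
  show "0 < cos \<alpha>" using assms p by (intro cos_gt_zero_pi) linarith+
  have "cos (pi / 2 - \<alpha>) < cos \<alpha>" using assms p by (intro cos_monotone_0_pi) linarith+
  then show 2: "sin \<alpha> < cos \<alpha>" by (simp add: sin_cos_eq)
  show "(sin \<alpha>)\<^sup>2 < (cos \<alpha>)\<^sup>2" using 1 2 by (intro power_strict_mono) auto
qed

text \<open>The rotated momentum \<open>m = x \<times> p\<close> of the extremal with first control \<open>\<epsilon>\<close> and first
  duration \<open>s\<close>, at time \<open>0\<close> and at the start of an interior arc with control \<open>\<sigma>\<close>.\<close>

definition momentum_start :: "real \<Rightarrow> real \<Rightarrow> real \<Rightarrow> real^3" where
  "momentum_start \<alpha> s \<epsilon> = vector [\<epsilon> * (cos \<alpha> * sin s), \<epsilon> * ((cos \<alpha>)\<^sup>2 * cos s + (sin \<alpha>)\<^sup>2), 0]"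

definition momentum_switch :: "real \<Rightarrow> real \<Rightarrow> real \<Rightarrow> real^3" where
  "momentum_switch \<alpha> s \<sigma> = vector [0, - \<sigma> * ((cos \<alpha>)\<^sup>2 + (sin \<alpha>)\<^sup>2 * cos s), sin \<alpha> * sin s]"

text \<open>Half of the excess of an interior arc over \<pi>. It is the argument of the complex
  number cos^2 \<alpha> + sin^2 \<alpha> e^(is) in the range of \<alpha> considered, which explains
  the arctangent in \<open>v_dur\<close>.\<close>

definition half_excess :: "real \<Rightarrow> real \<Rightarrow> real" where
  "half_excess \<alpha> s = arctan (sin s / (cos s + (cot \<alpha>)\<^sup>2))"

lemma v_dur_half_excess: "v_dur \<alpha> s = pi + 2 * half_excess \<alpha> s"
  by (simp add: v_dur_def half_excess_def)

lemma flow_scaleR: "flow \<alpha> \<epsilon> t (k *\<^sub>R x) = k *\<^sub>R flow \<alpha> \<epsilon> t x"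
  by (simp add: flow_def matrix_vector_mult_scaleR)

context
  fixes \<alpha> :: real
  assumes \<alpha>: "0 < \<alpha>" "\<alpha> < pi / 4"
begin

lemma switch_denominator_pos: "0 < (cos \<alpha>)\<^sup>2 + (sin \<alpha>)\<^sup>2 * cos s"
proof -
  have "(sin \<alpha>)\<^sup>2 * (- cos s) \<le> (sin \<alpha>)\<^sup>2 * 1" using cos_ge_minus_one[of s] by (intro mult_left_mono) auto
  then show ?thesis using small_angle(4)[OF \<alpha>] by simp
qed

lemma half_excess_eq: "half_excess \<alpha> s = arctan ((sin \<alpha>)\<^sup>2 * sin s / ((cos \<alpha>)\<^sup>2 + (sin \<alpha>)\<^sup>2 * cos s))"
proof -
  have s0: "sin \<alpha> \<noteq> 0" using small_angle[OF \<alpha>] by auto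
  have "cos s + (cot \<alpha>)\<^sup>2 = ((cos \<alpha>)\<^sup>2 + (sin \<alpha>)\<^sup>2 * cos s) / (sin \<alpha>)\<^sup>2"
    using s0 by (simp add: cot_def power_divide add_divide_distrib)
  then show ?thesis using s0 by (simp add: half_excess_def mult.commute)
qed

text \<open>Polar coordinates of cos^2 \<alpha> + sin^2 \<alpha> e^(is). With these, later
  identities involving the arctangent become polynomial in the sine and cosine of one angle.\<close>

lemma half_excess_polar:
  obtains R where "0 < R" "(cos \<alpha>)\<^sup>2 + (sin \<alpha>)\<^sup>2 * cos s = R * cos (half_excess \<alpha> s)"
    "(sin \<alpha>)\<^sup>2 * sin s = R * sin (half_excess \<alpha> s)"
proof -
  let ?g = "(cos \<alpha>)\<^sup>2 + (sin \<alpha>)\<^sup>2 * cos s" and ?D = "half_excess \<alpha> s"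
  have D: "- (pi / 2) < ?D" "?D < pi / 2" using arctan_bounded by (auto simp: half_excess_def)
  then have c: "cos ?D > 0" by (intro cos_gt_zero_pi) auto
  have "tan ?D = (sin \<alpha>)\<^sup>2 * sin s / ?g" by (simp add: half_excess_eq tan_arctan)
  then have "sin ?D * ?g = (sin \<alpha>)\<^sup>2 * sin s * cos ?D"
    using c switch_denominator_pos[of s] by (simp add: tan_def field_simps)
  then have "(sin \<alpha>)\<^sup>2 * sin s = ?g / cos ?D * sin ?D" using c by (simp add: field_simps)
  then show ?thesis
    using c switch_denominator_pos[of s] that[of "?g / cos ?D"] by simp
qed

lemma half_excess_nonneg:
  assumes "0 \<le> s" "s \<le> pi"
  shows "0 \<le> half_excess \<alpha> s" "half_excess \<alpha> s < pi / 2"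
proof -
  show "0 \<le> half_excess \<alpha> s"
    using switch_denominator_pos[of s] sin_ge_zero[OF assms] by (simp add: half_excess_eq)
  show "half_excess \<alpha> s < pi / 2" unfolding half_excess_def by (rule arctan_ubound)
qed

lemma momentum_start_component:
  assumes \<epsilon>: "\<epsilon>\<^sup>2 = 1"
  shows "\<epsilon> * flow \<alpha> \<epsilon> t (momentum_start \<alpha> s \<epsilon>) $ 1 =
    cos \<alpha> * ((sin \<alpha>)\<^sup>2 * (sin s - sin t) + (cos \<alpha>)\<^sup>2 * sin (s - t))"
proof -
  have e: "\<epsilon> * \<epsilon> = 1" using \<epsilon> by (simp add: power2_eq_square)
  have sc: "(sin \<alpha>)\<^sup>2 = 1 - (cos \<alpha>)\<^sup>2" by (simp add: sin_squared_eq)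
  show ?thesis
    unfolding flow_components[OF \<epsilon>] momentum_start_def vector_3 sin_diff sc
    using e by algebra
qed

text \<open>After the factor sin((s - t)/2) is split off, what remains is sin^2 \<alpha> cos((s +
  t)/2) + cos^2 \<alpha> cos((s - t)/2), positive because s \<le> \<pi> bounds the first cosine
  below by minus the second. The excluded case t = 0, s = \<pi> is a zero of the switching
  function.\<close>

lemma momentum_start_positive:
  assumes \<epsilon>: "\<epsilon>\<^sup>2 = 1" and s: "s \<le> pi" and t: "0 \<le> t" "t < s" "0 < t \<or> s < pi"
  shows "0 < \<epsilon> * flow \<alpha> \<epsilon> t (momentum_start \<alpha> s \<epsilon>) $ 1"
proof -
  let ?p = "(s + t) / 2" and ?q = "(s - t) / 2"
  have e: "(sin \<alpha>)\<^sup>2 * (sin s - sin t) + (cos \<alpha>)\<^sup>2 * sin (s - t) =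
      2 * sin ?q * ((sin \<alpha>)\<^sup>2 * cos ?p + (cos \<alpha>)\<^sup>2 * cos ?q)"
  proof -
    have "s - t = 2 * ?q" by simp
    then have "sin (s - t) = 2 * sin ?q * cos ?q" by (metis sin_double)
    then show ?thesis using sin_diff_sin[of s t] by (simp add: algebra_simps)
  qed
  have q: "0 < ?q" "?q < pi / 2" using s t by auto
  have sq: "0 < sin ?q" using q pi_gt_zero by (intro sin_gt_zero) linarith+
  have cq: "0 < cos ?q" using q by (intro cos_gt_zero_pi) auto
  have "?p \<le> pi - ?q" using s by (simp add: diff_divide_distrib add_divide_distrib)
  moreover have "0 \<le> ?p" "pi - ?q \<le> pi" using t by auto
  ultimately have "cos (pi - ?q) \<le> cos ?p" by (intro cos_monotone_0_pi_le)
  then have "- cos ?q \<le> cos ?p" by simp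
  then have "(sin \<alpha>)\<^sup>2 * (- cos ?q) \<le> (sin \<alpha>)\<^sup>2 * cos ?p" by (intro mult_left_mono) auto
  moreover have "(sin \<alpha>)\<^sup>2 * cos ?q < (cos \<alpha>)\<^sup>2 * cos ?q"
    using small_angle(4)[OF \<alpha>] cq by (intro mult_strict_right_mono) auto
  ultimately have "0 < (sin \<alpha>)\<^sup>2 * cos ?p + (cos \<alpha>)\<^sup>2 * cos ?q" by simp
  then show ?thesis
    unfolding momentum_start_component[OF \<epsilon>] e
    using sq small_angle(2)[OF \<alpha>] by (intro mult_pos_pos) auto
qed

lemma flow_momentum_start:
  assumes \<epsilon>: "\<epsilon>\<^sup>2 = 1"
  shows "flow \<alpha> \<epsilon> s (momentum_start \<alpha> s \<epsilon>) = momentum_switch \<alpha> s (- \<epsilon>)"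
proof -
  have e: "\<epsilon> * \<epsilon> = 1" using \<epsilon> by (simp add: power2_eq_square)
  have sc: "sin \<alpha> * sin \<alpha> + cos \<alpha> * cos \<alpha> = 1" "sin s * sin s + cos s * cos s = 1"
    using sin_cos_squared_add by (simp_all add: power2_eq_square)
  show ?thesis
    unfolding vec3_eq_iff flow_components[OF \<epsilon>] momentum_start_def momentum_switch_def vector_3 power2_eq_square
    using e sc by (intro conjI) algebra+
qed

lemma momentum_switch_component:
  assumes \<sigma>: "\<sigma>\<^sup>2 = 1"
  shows "\<sigma> * flow \<alpha> \<sigma> t (momentum_switch \<alpha> s \<sigma>) $ 1 =
    cos \<alpha> * (((cos \<alpha>)\<^sup>2 + (sin \<alpha>)\<^sup>2 * cos s) * sin t + (sin \<alpha>)\<^sup>2 * sin s * (1 - cos t))"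
proof -
  have e: "\<sigma> * \<sigma> = 1" using \<sigma> by (simp add: power2_eq_square)
  show ?thesis
    unfolding flow_components[OF \<sigma>] momentum_switch_def vector_3 power2_eq_square
    using e by algebra
qed

text \<open>In the polar form the switching function on an interior arc is a positive multiple of
  sin(t/2) cos(t/2 - D) with D = \<open>half_excess \<alpha> s\<close>. Its next zero after t = 0 is
  \<pi> + 2 D, which is the origin of the duration v(s).\<close>

lemma momentum_switch_positive:
  assumes \<sigma>: "\<sigma>\<^sup>2 = 1" and s: "0 \<le> s" "s \<le> pi" and t: "0 < t" "t < v_dur \<alpha> s"
  shows "0 < \<sigma> * flow \<alpha> \<sigma> t (momentum_switch \<alpha> s \<sigma>) $ 1"
proof -
  let ?D = "half_excess \<alpha> s"
  obtain R where R: "0 < R" "(cos \<alpha>)\<^sup>2 + (sin \<alpha>)\<^sup>2 * cos s = R * cos ?D" "(sin \<alpha>)\<^sup>2 * sin s = R * sin ?D"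
    using half_excess_polar .
  have st: "sin t = 2 * sin (t / 2) * cos (t / 2)" "cos t = 1 - 2 * (sin (t / 2))\<^sup>2"
    using sin_double[of "t / 2"] cos_double_sin[of "t / 2"] by simp_all
  have "R * cos ?D * sin t + R * sin ?D * (1 - cos t) = 2 * R * sin (t / 2) * cos (t / 2 - ?D)"
    unfolding st by (simp add: cos_diff power2_eq_square algebra_simps)
  moreover have "0 < sin (t / 2)"
    using t half_excess_nonneg[OF s] by (intro sin_gt_zero) (auto simp: v_dur_half_excess)
  moreover have "0 < cos (t / 2 - ?D)"
    using t half_excess_nonneg[OF s] by (intro cos_gt_zero_pi) (auto simp: v_dur_half_excess)
  ultimately show ?thesis
    unfolding momentum_switch_component[OF \<sigma>] R(2,3)
    using R(1) small_angle(2)[OF \<alpha>] by simp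
qed

text \<open>Over an interior arc the momentum returns to its initial value up to the sign of the
  second component. Each following arc is thus the mirror image of the preceding one, so that all
  interior arcs have the same duration.\<close>

lemma flow_momentum_switch:
  assumes \<sigma>: "\<sigma>\<^sup>2 = 1"
  shows "flow \<alpha> \<sigma> (v_dur \<alpha> s) (momentum_switch \<alpha> s \<sigma>) = momentum_switch \<alpha> s (- \<sigma>)"
proof -
  let ?D = "half_excess \<alpha> s"
  obtain R where R: "0 < R" "(cos \<alpha>)\<^sup>2 + (sin \<alpha>)\<^sup>2 * cos s = R * cos ?D" "(sin \<alpha>)\<^sup>2 * sin s = R * sin ?D"
    using half_excess_polar .
  define g where "g = (cos \<alpha>)\<^sup>2 + (sin \<alpha>)\<^sup>2 * cos s"
  define C where "C = cos ?D"
  define S where "S = sin ?D"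
  have CS: "C * C + S * S = 1" using sin_cos_squared_add[of ?D] by (simp add: C_def S_def power2_eq_square)
  have e: "\<sigma> * \<sigma> = 1" using \<sigma> by (simp add: power2_eq_square)
  have sv: "sin (v_dur \<alpha> s) = - 2 * S * C" "cos (v_dur \<alpha> s) = 2 * S * S - 1"
    by (simp_all add: v_dur_half_excess sin_double cos_double_sin C_def S_def power2_eq_square sin_add cos_add)
  have g: "g = R * C" and y: "sin \<alpha> * sin \<alpha> * sin s = R * S"
    using R(2,3) by (simp_all add: g_def C_def S_def power2_eq_square)
  have R0: "R \<noteq> 0" using R by simp
  note comps = flow_components[OF \<sigma>] momentum_switch_def vector_3 sv g_def[symmetric]
  show ?thesis
    unfolding vec3_eq_iff
  proof (intro conjI)
    show "flow \<alpha> \<sigma> (v_dur \<alpha> s) (momentum_switch \<alpha> s \<sigma>) $ 1 = momentum_switch \<alpha> s (- \<sigma>) $ 1"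
      unfolding comps using e CS g y by algebra
    show "flow \<alpha> \<sigma> (v_dur \<alpha> s) (momentum_switch \<alpha> s \<sigma>) $ 2 = momentum_switch \<alpha> s (- \<sigma>) $ 2"
      unfolding comps using e CS g y by algebra
    show "flow \<alpha> \<sigma> (v_dur \<alpha> s) (momentum_switch \<alpha> s \<sigma>) $ 3 = momentum_switch \<alpha> s (- \<sigma>) $ 3"
      unfolding comps using e CS g y by algebra
  qed
qed

text \<open>Every unit momentum that is possible at N belongs to some sign and some first duration
  in (0, \<pi>]. The direction of the momentum is matched by the intermediate value theorem, its
  length by the factor k.\<close>

lemma momentum_start_exists:
  assumes "a\<^sup>2 + b\<^sup>2 = (1::real)"
  shows "\<exists>\<epsilon> s k. \<epsilon> \<in> {-1, 1} \<and> 0 < s \<and> s \<le> pi \<and> 0 < k \<and>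
    a = k * (\<epsilon> * (cos \<alpha> * sin s)) \<and> b = k * (\<epsilon> * ((cos \<alpha>)\<^sup>2 * cos s + (sin \<alpha>)\<^sup>2))"
proof (cases "a = 0")
  case True
  then have b: "b = 1 \<or> b = -1" using assms by (simp add: power2_eq_1_iff)
  have d: "0 < (cos \<alpha>)\<^sup>2 - (sin \<alpha>)\<^sup>2" using small_angle(4)[OF \<alpha>] by simp
  show ?thesis
  \<comment> \<open>A vanishing first component corresponds to s = \<pi>; there the second component
    of the start momentum is \<epsilon> (sin^2 \<alpha> - cos^2 \<alpha>), which has the sign of
    -\<epsilon>.\<close>
  proof (rule exI[of _ "- b"], rule exI[of _ pi], rule exI[of _ "1 / ((cos \<alpha>)\<^sup>2 - (sin \<alpha>)\<^sup>2)"], intro conjI)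
    show "b = 1 / ((cos \<alpha>)\<^sup>2 - (sin \<alpha>)\<^sup>2) * (- b * ((cos \<alpha>)\<^sup>2 * cos pi + (sin \<alpha>)\<^sup>2))"
      using d by (simp add: field_simps)
  qed (use b d True in auto)
next
  case False
  define \<epsilon> where "\<epsilon> = sgn a"
  have \<epsilon>: "\<epsilon> \<in> {-1, 1}" using False by (auto simp: \<epsilon>_def sgn_real_def)
  \<comment> \<open>Up to normalisation, the determinant of (a, b) and the start momentum for
    duration t: it vanishes exactly when the two are parallel.\<close>
  define f where "f = (\<lambda>t. \<bar>a\<bar> * ((cos \<alpha>)\<^sup>2 * cos t + (sin \<alpha>)\<^sup>2) - cos \<alpha> * (\<epsilon> * b) * sin t)"
  have f0: "0 < f 0" using False by (simp add: f_def)
  have "f pi = \<bar>a\<bar> * (- ((cos \<alpha>)\<^sup>2 - (sin \<alpha>)\<^sup>2))" by (simp add: f_def)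
  then have fpi: "f pi < 0" using False small_angle(4)[OF \<alpha>] by (simp add: mult_pos_neg)
  have "\<exists>s\<ge>0. s \<le> pi \<and> f s = 0"
    using f0 fpi by (intro IVT2') (auto simp: f_def intro!: continuous_intros)
  then obtain s where s: "0 \<le> s" "s \<le> pi" "f s = 0" by blast
  have s': "0 < s" "s < pi" using s f0 fpi by (metis less_eq_real_def less_irrefl)+
  have sp: "0 < sin s" using s' by (rule sin_gt_zero)
  have ca: "0 < cos \<alpha>" using small_angle[OF \<alpha>] by simp
  have f: "\<bar>a\<bar> * ((cos \<alpha>)\<^sup>2 * cos s + (sin \<alpha>)\<^sup>2) = cos \<alpha> * (\<epsilon> * b) * sin s"
    using s(3) by (simp add: f_def)
  have a: "a = \<epsilon> * \<bar>a\<bar>" by (simp add: \<epsilon>_def sgn_mult_abs)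
  have ee: "\<epsilon> * \<epsilon> = 1" using \<epsilon> by auto
  show ?thesis
  proof (rule exI[of _ \<epsilon>], rule exI[of _ s], rule exI[of _ "\<bar>a\<bar> / (cos \<alpha> * sin s)"], intro conjI \<epsilon>)
    show "a = \<bar>a\<bar> / (cos \<alpha> * sin s) * (\<epsilon> * (cos \<alpha> * sin s))"
      using a sp ca by (simp add: mult.commute)
    have "\<bar>a\<bar> / (cos \<alpha> * sin s) * (\<epsilon> * ((cos \<alpha>)\<^sup>2 * cos s + (sin \<alpha>)\<^sup>2))
        = \<epsilon> * (\<bar>a\<bar> * ((cos \<alpha>)\<^sup>2 * cos s + (sin \<alpha>)\<^sup>2)) / (cos \<alpha> * sin s)" by simp
    also have "\<dots> = \<epsilon> * \<epsilon> * b" unfolding f using sp ca by simp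
    finally show "b = \<bar>a\<bar> / (cos \<alpha> * sin s) * (\<epsilon> * ((cos \<alpha>)\<^sup>2 * cos s + (sin \<alpha>)\<^sup>2))"
      using ee by simp
  qed (use False sp ca s' in auto)
qed

text \<open>An arc is required to follow the flow only once its initial momentum is known to be the
  switching momentum. In this form one induction over the arcs serves both an abstract weak extremal
  and the trajectory of the explicit bang-bang control.\<close>

lemma bang_bang_from_arcs:
  assumes s: "0 < s" "s \<le> pi" and \<epsilon>: "\<epsilon>\<^sup>2 = 1" and x0: "x 0 = north"
    and start: "\<And>t. 0 \<le> t \<Longrightarrow> t \<le> s \<Longrightarrow> t \<le> T \<Longrightarrow>
        x t = flow \<alpha> \<epsilon> t north \<and> m t = k *\<^sub>R flow \<alpha> \<epsilon> t (momentum_start \<alpha> s \<epsilon>)"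
    and step: "\<And>n \<sigma> t0 t. t0 = s + real n * v_dur \<alpha> s \<Longrightarrow> \<sigma> = - ((-1) ^ n * \<epsilon>) \<Longrightarrow>
        m t0 = k *\<^sub>R momentum_switch \<alpha> s \<sigma> \<Longrightarrow> t0 < t \<Longrightarrow> t \<le> T \<Longrightarrow> t \<le> t0 + v_dur \<alpha> s \<Longrightarrow>
        x t = flow \<alpha> \<sigma> (t - t0) (x t0) \<and> m t = flow \<alpha> \<sigma> (t - t0) (m t0)"
  shows "\<And>n \<sigma> t0 t. t0 = s + real n * v_dur \<alpha> s \<Longrightarrow> \<sigma> = - ((-1) ^ n * \<epsilon>) \<Longrightarrow>
        t0 \<le> t \<Longrightarrow> t \<le> T \<Longrightarrow> t \<le> t0 + v_dur \<alpha> s \<Longrightarrow>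
        x t = flow \<alpha> \<sigma> (t - t0) (switching_curve \<alpha> n (- \<sigma>) s) \<and>
        m t = k *\<^sub>R flow \<alpha> \<sigma> (t - t0) (momentum_switch \<alpha> s \<sigma>)"
    and "\<And>t. 0 \<le> t \<Longrightarrow> t \<le> T \<Longrightarrow> x t = bang_bang \<alpha> \<epsilon> s t"
proof -
  let ?v = "v_dur \<alpha> s"
  have v: "?v > 0" by (rule v_dur_pos)
  have sq: "((-1) ^ n * \<epsilon>)\<^sup>2 = 1" for n
    using \<epsilon> by (simp add: power_mult_distrib power_mult[symmetric])
  have sw: "s + real n * ?v \<le> T \<longrightarrow> x (s + real n * ?v) = switching_curve \<alpha> n ((-1) ^ n * \<epsilon>) s \<and>
      m (s + real n * ?v) = k *\<^sub>R momentum_switch \<alpha> s (- ((-1) ^ n * \<epsilon>))" for n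
  proof (induction n)
    case 0
    then show ?case
      using start[of s] s flow_momentum_start[OF \<epsilon>, of s] by auto
  next
    case (Suc n)
    show ?case
    proof
      assume T: "s + real (Suc n) * ?v \<le> T"
      let ?t0 = "s + real n * ?v" and ?\<sigma> = "- ((-1) ^ n * \<epsilon>)"
      have t: "s + real (Suc n) * ?v = ?t0 + ?v" by (simp add: algebra_simps)
      have "?t0 \<le> T" using T t v by simp
      with Suc have IH: "x ?t0 = switching_curve \<alpha> n (- ?\<sigma>) s" "m ?t0 = k *\<^sub>R momentum_switch \<alpha> s ?\<sigma>"
        by simp_all
      have \<sigma>: "?\<sigma>\<^sup>2 = 1" using sq[of n] by simp
      have "x (?t0 + ?v) = flow \<alpha> ?\<sigma> ?v (x ?t0) \<and> m (?t0 + ?v) = flow \<alpha> ?\<sigma> ?v (m ?t0)"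
        using step[OF refl refl IH(2), of "?t0 + ?v"] T t v by simp
      then have "x (?t0 + ?v) = switching_curve \<alpha> (Suc n) ?\<sigma> s \<and>
          m (?t0 + ?v) = k *\<^sub>R momentum_switch \<alpha> s (- ?\<sigma>)"
        unfolding IH flow_scaleR flow_momentum_switch[OF \<sigma>] by simp
      then show "x (s + real (Suc n) * ?v) = switching_curve \<alpha> (Suc n) ((-1) ^ Suc n * \<epsilon>) s \<and>
          m (s + real (Suc n) * ?v) = k *\<^sub>R momentum_switch \<alpha> s (- ((-1) ^ Suc n * \<epsilon>))"
        unfolding t by simp
    qed
  qed
  show arcs: "x t = flow \<alpha> \<sigma> (t - t0) (switching_curve \<alpha> n (- \<sigma>) s) \<and>
        m t = k *\<^sub>R flow \<alpha> \<sigma> (t - t0) (momentum_switch \<alpha> s \<sigma>)"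
    if "t0 = s + real n * ?v" "\<sigma> = - ((-1) ^ n * \<epsilon>)" "t0 \<le> t" "t \<le> T" "t \<le> t0 + ?v" for n \<sigma> t0 t
  proof -
    have \<sigma>: "\<sigma>\<^sup>2 = 1" using that(2) sq[of n] by simp
    have IH: "x t0 = switching_curve \<alpha> n (- \<sigma>) s" "m t0 = k *\<^sub>R momentum_switch \<alpha> s \<sigma>"
      using sw[of n] that by auto
    show ?thesis
    proof (cases "t = t0")
      case True
      then show ?thesis using IH \<sigma> by simp
    next
      case False
      then show ?thesis
        using step[OF that(1,2) IH(2) _ that(4,5)] that(3) by (simp add: IH flow_scaleR)
    qed
  qed
  show "x t = bang_bang \<alpha> \<epsilon> s t" if t: "0 \<le> t" "t \<le> T" for t
  proof (cases "t \<le> s")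
    case True
    then show ?thesis using start t by (simp add: bang_bang_def)
  next
    case False
    define n where "n = nat (\<lceil>(t - s) / ?v\<rceil> - 1)"
    define \<sigma> where "\<sigma> = (-1) ^ n * \<epsilon>"
    have pos: "0 < (t - s) / ?v" using False v by simp
    have "0 < \<lceil>(t - s) / ?v\<rceil>" using pos by simp
    then have nn: "real n = of_int \<lceil>(t - s) / ?v\<rceil> - 1"
      unfolding n_def by simp
    have "real n < (t - s) / ?v" "(t - s) / ?v \<le> real n + 1"
      unfolding nn using ceiling_correct[of "(t - s) / ?v"] by linarith+
    then have "real n * ?v < t - s" "t - s \<le> (real n + 1) * ?v" using v by (simp_all add: field_simps)
    then have "x t = flow \<alpha> (- \<sigma>) (t - (s + real n * ?v)) (switching_curve \<alpha> n (- (- \<sigma>)) s)"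
      using arcs[of "s + real n * ?v" n "- \<sigma>" t] t by (simp add: \<sigma>_def algebra_simps)
    then show ?thesis
      using False by (simp add: bang_bang_def Let_def n_def[symmetric] \<sigma>_def[symmetric] diff_diff_eq)
  qed
qed

end

section \<open>Arcs of weak extremals\<close>

lemma continuous_on_flow_joint:
  fixes S :: "real set"
  assumes "\<sigma>\<^sup>2 = 1" "continuous_on S f" "continuous_on S y"
  shows "continuous_on S (\<lambda>t. flow \<alpha> \<sigma> (f t) (y t))"
  unfolding flow_rodrigues[OF assms(1)]
  using assms(2,3) by (auto intro!: continuous_intros continuous_on_mat_mult)

text \<open>The sign of the switching function is known only in the interior of an arc. Transporting
  y(t) to the midpoint time gives a continuous function that is constant inside, hence also at the
  two ends.\<close>

lemma flow_on_closure:
  assumes \<sigma>: "\<sigma>\<^sup>2 = 1" and ab: "a < b" and y: "continuous_on {a..b} y"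
    and fl: "\<And>c t. a < c \<Longrightarrow> c \<le> t \<Longrightarrow> t < b \<Longrightarrow> y t = flow \<alpha> \<sigma> (t - c) (y c)"
    and t: "t \<in> {a..b}"
  shows "y t = flow \<alpha> \<sigma> (t - a) (y a)"
proof -
  define c where "c = (a + b) / 2"
  have c: "a < c" "c < b" using ab by (auto simp: c_def)
  have mid: "y c = flow \<alpha> \<sigma> (c - t) (y t)" if "t \<in> {a..b}" for t
  proof -
    have "flow \<alpha> \<sigma> (c - t) (y t) = y c"
    proof (rule continuous_constant_on_closure[where S = "{a<..<b}"])
      show "continuous_on (closure {a<..<b}) (\<lambda>t. flow \<alpha> \<sigma> (c - t) (y t))"
        using ab y by (auto intro!: continuous_on_flow_joint \<sigma> continuous_intros)
      show "t \<in> closure {a<..<b}" using that ab by simp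
      fix t assume t: "t \<in> {a<..<b}"
      show "flow \<alpha> \<sigma> (c - t) (y t) = y c"
      proof (cases "c \<le> t")
        case True
        then show ?thesis using fl[of c t] t c by (simp add: flow_add[OF \<sigma>] \<sigma>)
      next
        case False
        then show ?thesis using fl[of t c] t c by simp
      qed
    qed
    then show ?thesis by simp
  qed
  have "y t = flow \<alpha> \<sigma> (t - c) (y c)"
    unfolding mid[OF t] by (simp add: flow_add[OF \<sigma>] \<sigma>)
  also have "\<dots> = flow \<alpha> \<sigma> (t - a) (y a)"
    using mid[of a] ab by (simp add: flow_add[OF \<sigma>])
  finally show ?thesis .
qed

lemma weak_extremalD:
  assumes "weak_extremal \<alpha> T x m"
  shows "continuous_on {0..T} x" "continuous_on {0..T} m" "x 0 = north" "norm (m 0) = 1" "m 0 $ 3 = 0"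
    "primitive T (\<lambda>t. m t $ 1) (\<lambda>\<tau>. - cos \<alpha> * m \<tau> $ 2)"
    "\<And>\<sigma> a b t. \<sigma>\<^sup>2 = 1 \<Longrightarrow> 0 \<le> a \<Longrightarrow> a \<le> b \<Longrightarrow> b \<le> T \<Longrightarrow> \<forall>t\<in>{a..b}. 0 < \<sigma> * m t $ 1 \<Longrightarrow> t \<in> {a..b} \<Longrightarrow>
      x t = flow \<alpha> \<sigma> (t - a) (x a) \<and> m t = flow \<alpha> \<sigma> (t - a) (m a)"
  using assms unfolding weak_extremal_def primitive_def by blast+

lemma weak_extremal_flow:
  assumes W: "weak_extremal \<alpha> T x m" and \<sigma>: "\<sigma>\<^sup>2 = 1" and ab: "0 \<le> a" "a < b" "b \<le> T"
    and pos: "\<And>t. a < t \<Longrightarrow> t < b \<Longrightarrow> 0 < \<sigma> * m t $ 1" and t: "t \<in> {a..b}"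
  shows "x t = flow \<alpha> \<sigma> (t - a) (x a) \<and> m t = flow \<alpha> \<sigma> (t - a) (m a)"
proof
  have sub: "{a..b} \<subseteq> {0..T}" using ab by auto
  have *: "x t = flow \<alpha> \<sigma> (t - c) (x c) \<and> m t = flow \<alpha> \<sigma> (t - c) (m c)" if "a < c" "c \<le> t" "t < b" for c t
    by (rule weak_extremalD(7)[OF W \<sigma>, of c t]) (use that ab pos in auto)
  show "x t = flow \<alpha> \<sigma> (t - a) (x a)"
    using * by (intro flow_on_closure[OF \<sigma> ab(2) continuous_on_subset[OF weak_extremalD(1)[OF W] sub] _ t]) blast
  show "m t = flow \<alpha> \<sigma> (t - a) (m a)"
    using * by (intro flow_on_closure[OF \<sigma> ab(2) continuous_on_subset[OF weak_extremalD(2)[OF W] sub] _ t]) blast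
qed

lemma continuous_on_greater_near:
  fixes f :: "real \<Rightarrow> real"
  assumes "continuous_on {0..T} f" "t0 \<in> {0..T}" "c < f t0"
  shows "\<exists>e>0. \<forall>t\<in>{0..T}. \<bar>t - t0\<bar> < e \<longrightarrow> c < f t"
proof -
  obtain e where e: "e > 0" "\<forall>t\<in>{0..T}. dist t t0 < e \<longrightarrow> dist (f t) (f t0) < f t0 - c"
    using assms unfolding continuous_on_iff by (meson diff_gt_0_iff_gt)
  then show ?thesis
    by (intro exI[of _ e]) (auto simp: dist_real_def)
qed

text \<open>If m_1 vanishes at t0, its rate of change -cos \<alpha> m_2 decides the sign just
  afterwards. This is where the equation for the first component, which holds also at switchings,
  enters.\<close>

lemma weak_extremal_initial_sign:
  assumes W: "weak_extremal \<alpha> T x m" and ca: "0 < cos \<alpha>" and t0: "t0 \<in> {0..T}"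
    and init: "0 < \<sigma> * m t0 $ 1 \<or> m t0 $ 1 = 0 \<and> \<sigma> * m t0 $ 2 < 0"
  shows "\<exists>e>0. \<forall>t. t0 < t \<and> t < t0 + e \<and> t \<le> T \<longrightarrow> 0 < \<sigma> * m t $ 1"
  using init
proof
  assume "0 < \<sigma> * m t0 $ 1"
  moreover have "continuous_on {0..T} (\<lambda>t. \<sigma> * m t $ 1)"
    using weak_extremalD(2)[OF W] by (intro continuous_intros)
  ultimately obtain e where e: "e > 0" "\<forall>t\<in>{0..T}. \<bar>t - t0\<bar> < e \<longrightarrow> 0 < \<sigma> * m t $ 1"
    using continuous_on_greater_near[OF _ t0] by blast
  then show ?thesis using t0 by (intro exI[of _ e]) auto
next
  assume A: "m t0 $ 1 = 0 \<and> \<sigma> * m t0 $ 2 < 0"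
  define c where "c = - \<sigma> * m t0 $ 2 / 2"
  have c: "0 < c" using A by (simp add: c_def)
  have c2: "c < - \<sigma> * m t0 $ 2" using A by (simp add: c_def)
  have "continuous_on {0..T} (\<lambda>t. - \<sigma> * m t $ 2)"
    using weak_extremalD(2)[OF W] by (intro continuous_intros)
  from continuous_on_greater_near[OF this t0 c2]
  obtain e where e: "e > 0" "\<forall>t\<in>{0..T}. \<bar>t - t0\<bar> < e \<longrightarrow> c < - \<sigma> * m t $ 2" by blast
  show ?thesis
  proof (intro exI[of _ e] conjI e(1) allI impI)
    fix t assume t: "t0 < t \<and> t < t0 + e \<and> t \<le> T"
    have "((\<lambda>\<tau>. \<sigma> * (- cos \<alpha> * m \<tau> $ 2)) has_integral \<sigma> * (m t $ 1 - m t0 $ 1)) {t0..t}"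
      using primitive_interval[OF weak_extremalD(6)[OF W], of t0 t] t t0
      by (intro has_integral_mult_right) auto
    moreover have "((\<lambda>\<tau>. cos \<alpha> * c) has_integral (t - t0) *\<^sub>R (cos \<alpha> * c)) {t0..t}"
      using has_integral_const_real[of "cos \<alpha> * c" t0 t] t by simp
    moreover have "cos \<alpha> * c \<le> \<sigma> * (- cos \<alpha> * m \<tau> $ 2)" if "\<tau> \<in> {t0..t}" for \<tau>
    proof -
      have "c \<le> - \<sigma> * m \<tau> $ 2" using e(2) that t t0 by (auto intro: less_imp_le)
      then have "cos \<alpha> * c \<le> cos \<alpha> * (- \<sigma> * m \<tau> $ 2)" using ca by (intro mult_left_mono) auto
      then show ?thesis by (simp add: algebra_simps)
    qed
    ultimately have "(t - t0) *\<^sub>R (cos \<alpha> * c) \<le> \<sigma> * (m t $ 1 - m t0 $ 1)"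
      using has_integral_le by blast
    moreover have "0 < (t - t0) *\<^sub>R (cos \<alpha> * c)" using t ca c by simp
    ultimately show "0 < \<sigma> * m t $ 1" using A by simp
  qed
qed

text \<open>A continuation argument: up to the first time at which \<sigma> m_1 is not positive, the
  momentum follows the flow of X_\<sigma>, and there the first component of the flow is positive by
  hypothesis, a contradiction.\<close>

lemma weak_extremal_arc:
  assumes W: "weak_extremal \<alpha> T x m" and ca: "0 < cos \<alpha>" and \<sigma>: "\<sigma>\<^sup>2 = 1"
    and t01: "0 \<le> t0" "t0 < t1" "t1 \<le> T"
    and init: "0 < \<sigma> * m t0 $ 1 \<or> m t0 $ 1 = 0 \<and> \<sigma> * m t0 $ 2 < 0"
    and pos: "\<And>t. 0 < t \<Longrightarrow> t < t1 - t0 \<Longrightarrow> 0 < \<sigma> * flow \<alpha> \<sigma> t (m t0) $ 1"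
    and t: "t \<in> {t0..t1}"
  shows "x t = flow \<alpha> \<sigma> (t - t0) (x t0) \<and> m t = flow \<alpha> \<sigma> (t - t0) (m t0)"
proof (rule weak_extremal_flow[OF W \<sigma> t01 _ t])
  obtain e where e: "e > 0" "\<And>t. t0 < t \<Longrightarrow> t < t0 + e \<Longrightarrow> t \<le> T \<Longrightarrow> 0 < \<sigma> * m t $ 1"
    using weak_extremal_initial_sign[OF W ca _ init] t01 by auto
  fix \<tau> assume \<tau>: "t0 < \<tau>" "\<tau> < t1"
  show "0 < \<sigma> * m \<tau> $ 1"
  proof (rule ccontr)
    assume neg: "\<not> ?thesis"
    \<comment> \<open>The set of bad times starts at \<open>t0 + e/2\<close> because \<sigma> m_1
      may vanish at \<open>t0\<close> itself; this makes it compact without containing the start of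
      the arc.\<close>
    define B where "B = {t0 + e/2..\<tau>} \<inter> (\<lambda>t. \<sigma> * m t $ 1) -` {..0}"
    have te: "t0 + e / 2 \<le> \<tau>"
      using neg e(2)[of \<tau>] \<tau> t01 e(1) by (smt (verit) field_sum_of_halves)
    have "compact B"
    proof -
      have "continuous_on {t0 + e/2..\<tau>} (\<lambda>t. \<sigma> * m t $ 1)"
        using \<tau> t01 e(1) by (intro continuous_intros continuous_on_subset[OF weak_extremalD(2)[OF W]]) auto
      then have "closed B" unfolding B_def by (rule continuous_closed_preimage) auto
      moreover have "bounded B" unfolding B_def by (rule bounded_subset[of "{t0 + e/2..\<tau>}"]) auto
      ultimately show ?thesis by (simp add: compact_eq_bounded_closed)
    qed
    moreover have "\<tau> \<in> B" using te neg by (auto simp: B_def)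
    ultimately obtain s where s: "s \<in> B" "\<And>t. t \<in> B \<Longrightarrow> s \<le> t"
      using compact_attains_inf[of B] by blast
    have sb: "t0 + e/2 \<le> s" "s \<le> \<tau>" "\<sigma> * m s $ 1 \<le> 0" using s(1) by (auto simp: B_def)
    have before: "0 < \<sigma> * m t $ 1" if "t0 < t" "t < s" for t
    proof (cases "t < t0 + e")
      case True
      then show ?thesis using e(2) that sb \<tau> t01 by simp
    next
      case False
      then have "t \<notin> B" using s(2) that by force
      then show ?thesis using False that sb e(1) by (auto simp: B_def not_le)
    qed
    have "x s = flow \<alpha> \<sigma> (s - t0) (x t0) \<and> m s = flow \<alpha> \<sigma> (s - t0) (m t0)"
      by (rule weak_extremal_flow[OF W \<sigma> t01(1), of s]) (use sb e(1) \<tau> t01 before in auto)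
    moreover have "0 < \<sigma> * flow \<alpha> \<sigma> (s - t0) (m t0) $ 1"
      by (rule pos) (use sb e(1) \<tau> in auto)
    ultimately have "0 < \<sigma> * m s $ 1" by metis
    then show False using sb by simp
  qed
qed

context
  fixes \<alpha> :: real
  assumes \<alpha>: "0 < \<alpha>" "\<alpha> < pi / 4"
begin

text \<open>The initial momentum determines \<epsilon> and s; from then on the switching function of
  the explicit momentum has a known sign on each arc, and the arcs follow one another.\<close>

lemma weak_extremal_bang_bang:
  assumes W: "weak_extremal \<alpha> T x m"
  shows "\<exists>\<epsilon>\<in>{-1, 1}. \<exists>s. 0 < s \<and> s \<le> pi \<and> (\<forall>t\<in>{0..T}. x t = bang_bang \<alpha> \<epsilon> s t)"
proof -
  note ca = small_angle(2)[OF \<alpha>]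
  have m0: "(m 0 $ 1)\<^sup>2 + (m 0 $ 2)\<^sup>2 = 1"
    using weak_extremalD(4,5)[OF W] by (simp add: norm_eq_1_3)
  obtain \<epsilon> s k where \<epsilon>: "\<epsilon> \<in> {-1, 1}" and s: "0 < s" "s \<le> pi" and k: "0 < k"
    and m: "m 0 $ 1 = k * (\<epsilon> * (cos \<alpha> * sin s))" "m 0 $ 2 = k * (\<epsilon> * ((cos \<alpha>)\<^sup>2 * cos s + (sin \<alpha>)\<^sup>2))"
    using momentum_start_exists[OF \<alpha> m0] by blast
  have \<epsilon>2: "\<epsilon>\<^sup>2 = 1" using \<epsilon> by auto
  have mk: "m 0 = k *\<^sub>R momentum_start \<alpha> s \<epsilon>"
    by (simp add: vec3_eq_iff momentum_start_def m weak_extremalD(5)[OF W])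
  have init: "0 < \<epsilon> * m 0 $ 1 \<or> m 0 $ 1 = 0 \<and> \<epsilon> * m 0 $ 2 < 0"
  proof (cases "s = pi")
    case True
    have "\<epsilon> * m 0 $ 2 = k * ((sin \<alpha>)\<^sup>2 - (cos \<alpha>)\<^sup>2)" using True \<epsilon> by (auto simp: m)
    also have "\<dots> < 0" using k small_angle(4)[OF \<alpha>] by (simp add: mult_pos_neg)
    finally show ?thesis using True by (simp add: m)
  next
    case False
    then have "0 < sin s" using s by (intro sin_gt_zero) auto
    moreover have "\<epsilon> * m 0 $ 1 = k * (cos \<alpha> * sin s)" using \<epsilon> by (auto simp: m)
    ultimately show ?thesis using k ca by simp
  qed
  have start: "x t = flow \<alpha> \<epsilon> t north \<and> m t = k *\<^sub>R flow \<alpha> \<epsilon> t (momentum_start \<alpha> s \<epsilon>)"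
    if t: "0 \<le> t" "t \<le> s" "t \<le> T" for t
  proof (cases "t = 0")
    case True
    then show ?thesis using weak_extremalD(3)[OF W] \<epsilon>2 by (simp add: mk)
  next
    case False
    have "x t = flow \<alpha> \<epsilon> (t - 0) (x 0) \<and> m t = flow \<alpha> \<epsilon> (t - 0) (m 0)"
    proof (rule weak_extremal_arc[OF W ca \<epsilon>2 _ _ _ init])
      fix \<tau> assume "0 < \<tau>" "\<tau> < t - 0"
      then have "0 < \<epsilon> * flow \<alpha> \<epsilon> \<tau> (momentum_start \<alpha> s \<epsilon>) $ 1"
        using t s by (intro momentum_start_positive[OF \<alpha> \<epsilon>2]) auto
      then show "0 < \<epsilon> * flow \<alpha> \<epsilon> \<tau> (m 0) $ 1"
        using mult_pos_pos[OF k] by (simp add: mk flow_scaleR mult.left_commute[of \<epsilon>])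
    qed (use t False in auto)
    then show ?thesis using weak_extremalD(3)[OF W] by (simp add: mk flow_scaleR)
  qed
  have step: "x t = flow \<alpha> \<sigma> (t - t0) (x t0) \<and> m t = flow \<alpha> \<sigma> (t - t0) (m t0)"
    if that0: "t0 = s + real n * v_dur \<alpha> s" "\<sigma> = - ((-1) ^ n * \<epsilon>)"
      "m t0 = k *\<^sub>R momentum_switch \<alpha> s \<sigma>" "t0 < t" "t \<le> T" "t \<le> t0 + v_dur \<alpha> s" for n \<sigma> t0 t
  proof (rule weak_extremal_arc[OF W ca _ _ that(4,5)])
    show \<sigma>: "\<sigma>\<^sup>2 = 1" using that(2) \<epsilon>2 by (simp add: power_mult_distrib power_mult[symmetric])
    have "\<sigma> * m t0 $ 2 = - (\<sigma>\<^sup>2) * (k * ((cos \<alpha>)\<^sup>2 + (sin \<alpha>)\<^sup>2 * cos s))"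
      by (simp add: that(3) momentum_switch_def power2_eq_square algebra_simps)
    then have "\<sigma> * m t0 $ 2 < 0"
      using k switch_denominator_pos[OF \<alpha>, of s] \<sigma> by simp
    then show "0 < \<sigma> * m t0 $ 1 \<or> m t0 $ 1 = 0 \<and> \<sigma> * m t0 $ 2 < 0"
      by (simp add: that(3) momentum_switch_def)
    show "0 \<le> t0" using s v_dur_pos[of \<alpha> s] by (simp add: that(1))
    show "0 < \<sigma> * flow \<alpha> \<sigma> \<tau> (m t0) $ 1" if \<tau>: "0 < \<tau>" "\<tau> < t - t0" for \<tau>
    proof -
      have "0 < \<sigma> * flow \<alpha> \<sigma> \<tau> (momentum_switch \<alpha> s \<sigma>) $ 1"
        using \<tau> s that0(6) by (intro momentum_switch_positive[OF \<alpha> \<sigma>]) auto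
      then show ?thesis
        using mult_pos_pos[OF k] by (simp add: that0(3) flow_scaleR mult.left_commute[of \<sigma>])
    qed
  qed (use that in auto)
  have "x t = bang_bang \<alpha> \<epsilon> s t" if "t \<in> {0..T}" for t
    by (rule bang_bang_from_arcs(2)[OF \<alpha> s \<epsilon>2 weak_extremalD(3)[OF W] start step]) (use that in auto)
  with \<epsilon> s show ?thesis by blast
qed

lemma near_extremal_limit:
  assumes T: "0 \<le> T"
    and x: "\<And>n. admissible \<alpha> T (x n) (u n)" "\<And>n. x n 0 = north"
    and m: "\<And>n. solution \<alpha> T (u n) (m n)" "\<And>n. norm (m n 0) = 1" "\<And>n. m n 0 $ 3 = 0"
    and gap: "(\<lambda>n. gap T (u n) (m n)) \<longlonglongrightarrow> 0"
  shows "\<exists>r \<epsilon> s. strict_mono r \<and> \<epsilon> \<in> {-1, 1} \<and> 0 < s \<and> s \<le> pi \<and>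
    (\<forall>t\<in>{0..T}. (\<lambda>n. x (r n) t) \<longlonglongrightarrow> bang_bang \<alpha> \<epsilon> s t)"
  using weak_extremal_limit[OF T x m gap] weak_extremal_bang_bang by metis

end

section \<open>Extremals of the maximum principle are the bang-bang trajectories\<close>

text \<open>The Hamiltonian depends on (x, p) only through x \<times> p: the third component carries
  the drift and the first one the control.\<close>

lemma hamiltonian_cross3:
  "hamiltonian \<alpha> x p w = cos \<alpha> * cross3 x p $ 3 + w * (sin \<alpha> * cross3 x p $ 1)"
  by (simp add: hamiltonian_def inner_3 X_mat_components cross_components algebra_simps)

lemma flow_hamiltonian:
  assumes "\<sigma>\<^sup>2 = 1"
  shows "cos \<alpha> * flow \<alpha> \<sigma> t x $ 3 + \<sigma> * sin \<alpha> * flow \<alpha> \<sigma> t x $ 1 = cos \<alpha> * x $ 3 + \<sigma> * sin \<alpha> * x $ 1"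
  unfolding flow_components[OF assms] by (simp add: algebra_simps)

text \<open>The limit lemma for a constant sequence, whose control defect is zero. It yields the arc
  from the integral equation even though the control may take another value at the left end
  point.\<close>

lemma solution_flow:
  assumes u: "control T u" and v: "solution \<alpha> T u v" and v0: "norm (v 0) = 1" and \<sigma>: "\<sigma>\<^sup>2 = 1"
    and ab: "0 \<le> a" "a \<le> b" "b \<le> T" and c: "\<And>\<tau>. a < \<tau> \<Longrightarrow> \<tau> \<le> b \<Longrightarrow> u \<tau> = \<sigma>" and t: "t \<in> {a..b}"
  shows "v t = flow \<alpha> \<sigma> (t - a) (v a)"
proof -
  have "integral {a..b} (\<lambda>\<tau>. 1 - \<sigma> * u \<tau>) = integral {a..b} (\<lambda>\<tau>. 0)"
    by (rule integral_spike[of "{a}"]) (use c \<sigma> in \<open>auto simp: power2_eq_square\<close>)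
  then have I: "(\<lambda>n. integral {a..b} (\<lambda>\<tau>. 1 - \<sigma> * u \<tau>)) \<longlonglongrightarrow> 0" by simp
  have "uniform_limit {0..T} (\<lambda>_. v) v sequentially"
    by (auto simp: uniform_limit_sequentially_iff)
  from flow_limit[of T "\<lambda>_. u" \<alpha> "\<lambda>_. v" v, OF u v v0 this solution_continuous[OF v] ab \<sigma> I t]
  show ?thesis .
qed

context
  fixes \<alpha> :: real
  assumes \<alpha>: "0 < \<alpha>" "\<alpha> < pi / 4"
begin

text \<open>The maximum condition says that the gap of the rotated and normalised covector is zero,
  so the constant sequence formed by the extremal is a sequence of near-extremals and the
  compactness result identifies its limit, which is the extremal itself.\<close>

lemma extremal_bang_bang:
  assumes E: "extremal \<alpha> T x u"
  shows "\<exists>\<epsilon>\<in>{-1, 1}. \<exists>s. 0 < s \<and> s \<le> pi \<and> (\<forall>t\<in>{0..T}. x t = bang_bang \<alpha> \<epsilon> s t)"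
proof -
  have adm: "admissible \<alpha> T x u" and x0: "x 0 = north" and "pmp \<alpha> T x u"
    using E by (auto simp: extremal_def)
  then obtain p h where p: "\<forall>t\<in>{0..T}. p t \<noteq> 0 \<and> p t \<bullet> x t = 0"
    "\<forall>t\<in>{0..T}. ((\<lambda>\<tau>. - (transpose (X_mat \<alpha> (u \<tau>)) *v p \<tau>)) has_integral (p t - p 0)) {0..t}"
    "AE t in lebesgue_on {0..T}.
       (\<forall>w\<in>{-1..1}. hamiltonian \<alpha> (x t) (p t) w \<le> hamiltonian \<alpha> (x t) (p t) (u t)) \<and>
       hamiltonian \<alpha> (x t) (p t) (u t) = h"
    unfolding pmp_def by blast
  have T: "0 \<le> T" and u: "control T u" and x: "solution \<alpha> T u x" using adm by (auto simp: admissible_iff)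
  have ps: "solution \<alpha> T u p"
    using p(2) unfolding solution_def primitive_def transpose_X_mat minus_minus .
  have xp0: "cross3 (x 0) (p 0) $ 3 = 0" by (simp add: cross_components x0 north_components)
  have p00: "p 0 \<noteq> 0" "p 0 \<bullet> north = 0" using p(1) T x0 by force+
  \<comment> \<open>As p is orthogonal to the unit vector x, rotating it into x \<times> p preserves
    its length; so the rotated covector is nonzero and can be normalised by
    \<open>k\<close>.\<close>
  have "(norm (cross3 (x 0) (p 0)))\<^sup>2 = (norm (p 0))\<^sup>2"
    using norm_cross[of "x 0" "p 0"] p00 by (simp add: x0 inner_commute)
  then have np: "norm (cross3 (x 0) (p 0)) \<noteq> 0" using p00 by auto
  define k where "k = 1 / norm (cross3 (x 0) (p 0))"
  have k: "k > 0" using np by (simp add: k_def)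
  define m where "m = (\<lambda>t. k *\<^sub>R cross3 (x t) (p t) + 0 *\<^sub>R cross3 (x t) (p t))"
  have m: "solution \<alpha> T u m"
    unfolding m_def by (intro solution_add solution_cross3 u x ps)
  have m0: "norm (m 0) = 1" "m 0 $ 3 = 0" using np xp0 by (simp_all add: m_def k_def)
  from p(3) obtain N where N: "N \<in> null_sets (lebesgue_on {0..T})"
    "{t \<in> space (lebesgue_on {0..T}). \<not> ((\<forall>w\<in>{-1..1}. hamiltonian \<alpha> (x t) (p t) w \<le> hamiltonian \<alpha> (x t) (p t) (u t)) \<and>
       hamiltonian \<alpha> (x t) (p t) (u t) = h)} \<subseteq> N"
    unfolding eventually_ae_filter by blast
  have negl: "negligible N"
    using N(1) by (simp add: negligible_iff_null_sets null_sets_restrict_space)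
  have "\<bar>m t $ 1\<bar> - u t * m t $ 1 = 0" if t: "t \<in> {0..T} - N" for t
  proof -
    \<comment> \<open>The competitor is the control value that maximises the switching term.\<close>
    have le: "hamiltonian \<alpha> (x t) (p t) (sgn (m t $ 1)) \<le> hamiltonian \<alpha> (x t) (p t) (u t)"
      using N(2) t by (auto simp: sgn_real_def)
    then have "sgn (m t $ 1) * (sin \<alpha> * cross3 (x t) (p t) $ 1) \<le> u t * (sin \<alpha> * cross3 (x t) (p t) $ 1)"
      by (simp add: hamiltonian_cross3)
    then have "sin \<alpha> * (sgn (m t $ 1) * cross3 (x t) (p t) $ 1) \<le> sin \<alpha> * (u t * cross3 (x t) (p t) $ 1)"
      by (simp add: mult_ac)
    then have "sgn (m t $ 1) * cross3 (x t) (p t) $ 1 \<le> u t * cross3 (x t) (p t) $ 1"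
      using small_angle(1)[OF \<alpha>] by simp
    then have "k * (sgn (m t $ 1) * cross3 (x t) (p t) $ 1) \<le> k * (u t * cross3 (x t) (p t) $ 1)"
      using k by simp
    then have "sgn (m t $ 1) * m t $ 1 \<le> u t * m t $ 1" by (simp add: m_def mult_ac)
    then have "\<bar>m t $ 1\<bar> \<le> u t * m t $ 1" by (simp add: abs_sgn mult.commute)
    moreover have "0 \<le> \<bar>m t $ 1\<bar> - u t * m t $ 1"
      using u t by (intro gap_integrand_nonneg) (auto simp: control_def)
    ultimately show ?thesis by simp
  qed
  then have "gap T u m = integral {0..T} (\<lambda>_. 0)"
    unfolding gap_def by (intro integral_spike[OF negl]) auto
  then have gap: "(\<lambda>n::nat. gap T u m) \<longlonglongrightarrow> 0" by simp
  from near_extremal_limit[OF \<alpha> T, of "\<lambda>_. x" "\<lambda>_. u" "\<lambda>_. m", OF adm x0 m m0 gap]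
  obtain \<epsilon> s where "\<epsilon> \<in> {-1, 1}" "0 < s" "s \<le> pi" "\<forall>t\<in>{0..T}. (\<lambda>n::nat. x t) \<longlonglongrightarrow> bang_bang \<alpha> \<epsilon> s t" by blast
  then show ?thesis using LIMSEQ_const_iff by blast
qed

end

lemma flow_zero: "flow \<alpha> \<epsilon> t 0 = 0"
  by (simp add: flow_def)

lemma power_minus_one_square: "((-1) ^ n * \<epsilon>)\<^sup>2 = \<epsilon>\<^sup>2" for \<epsilon> :: real
  by (simp add: power_mult_distrib power_mult[symmetric])

text \<open>At a switching time the value is that of the arc which ends there, in agreement with the
  half-open intervals of \<open>bang_bang\<close>.\<close>

definition bang_control :: "real \<Rightarrow> real \<Rightarrow> real \<Rightarrow> real \<Rightarrow> real" where
  "bang_control \<alpha> \<epsilon> s t =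
     (if t \<le> s then \<epsilon> else - ((-1) ^ nat (\<lceil>(t - s) / v_dur \<alpha> s\<rceil> - 1) * \<epsilon>))"

lemma bang_control_control:
  assumes "\<epsilon> \<in> {-1, 1}"
  shows "control T (bang_control \<alpha> \<epsilon> s)"
proof (rule controlI)
  have "(\<lambda>t. \<lceil>(t - s) / v_dur \<alpha> s\<rceil>) \<in> measurable borel (count_space UNIV)"
    by measurable
  then have "(\<lambda>t. - ((-1) ^ nat (\<lceil>(t - s) / v_dur \<alpha> s\<rceil> - 1) * \<epsilon>)) \<in> borel_measurable borel"
    by (rule measurable_compose[where g = "\<lambda>i. - ((-1) ^ nat (i - 1) * \<epsilon>)"]) simp
  then have "bang_control \<alpha> \<epsilon> s \<in> borel_measurable borel"
    unfolding bang_control_def by (intro measurable_If) auto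
  then show "bang_control \<alpha> \<epsilon> s \<in> borel_measurable (lebesgue_on {0..T})"
    by (intro measurable_restrict_space1 measurable_completion) simp
qed (use assms in \<open>auto simp: bang_control_def power_abs abs_mult\<close>)

lemma bang_control_first: "t \<le> s \<Longrightarrow> bang_control \<alpha> \<epsilon> s t = \<epsilon>"
  by (simp add: bang_control_def)

lemma arc_index:
  fixes v :: real
  assumes "0 < v" "s + real n * v < t" "t \<le> s + real n * v + v"
  shows "nat (\<lceil>(t - s) / v\<rceil> - 1) = n"
proof -
  have "\<lceil>(t - s) / v\<rceil> = int n + 1"
    by (rule ceiling_unique) (use assms in \<open>auto simp: field_simps\<close>)
  then show ?thesis by simp
qed

lemma arc_index_exists:
  fixes v :: real
  assumes v: "0 < v" and t: "s < t"
  obtains n where "s + real n * v < t" "t \<le> s + real n * v + v"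
proof -
  have pos: "0 < \<lceil>(t - s) / v\<rceil>" using v t by simp
  define n where "n = nat (\<lceil>(t - s) / v\<rceil> - 1)"
  have nn: "real n = of_int \<lceil>(t - s) / v\<rceil> - 1" unfolding n_def using pos by simp
  have "real n < (t - s) / v" "(t - s) / v \<le> real n + 1"
    unfolding nn using ceiling_correct[of "(t - s) / v"] by linarith+
  then have "real n * v < t - s" "t - s \<le> (real n + 1) * v" using v by (simp_all add: field_simps)
  then show ?thesis using that[of n] by (simp add: algebra_simps)
qed

lemma bang_control_arc:
  assumes "s + real n * v_dur \<alpha> s < t" "t \<le> s + real n * v_dur \<alpha> s + v_dur \<alpha> s"
  shows "bang_control \<alpha> \<epsilon> s t = - ((-1) ^ n * \<epsilon>)"
proof -
  have "0 \<le> real n * v_dur \<alpha> s" using v_dur_pos[of \<alpha> s] by simp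
  then have "\<not> t \<le> s" using assms(1) by linarith
  then show ?thesis using arc_index[OF v_dur_pos assms] by (simp add: bang_control_def)
qed

lemma admissible_cong:
  assumes "admissible \<alpha> T x u" "\<And>t. t \<in> {0..T} \<Longrightarrow> x t = y t"
  shows "admissible \<alpha> T y u"
proof -
  have T: "0 \<le> T" using assms(1) by (simp add: admissible_iff)
  have "((\<lambda>\<tau>. X_mat \<alpha> (u \<tau>) *v y \<tau>) has_integral y t - y 0) {0..t}" if t: "t \<in> {0..T}" for t
  proof (rule has_integral_eq)
    have "((\<lambda>\<tau>. X_mat \<alpha> (u \<tau>) *v x \<tau>) has_integral x t - x 0) {0..t}"
      using assms(1) t by (auto simp: admissible_def)
    moreover have "x t = y t" "x 0 = y 0" using assms(2) t T by auto
    ultimately show "((\<lambda>\<tau>. X_mat \<alpha> (u \<tau>) *v x \<tau>) has_integral y t - y 0) {0..t}" by (simp only:)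
  qed (use t assms(2) in auto)
  then show ?thesis
    using assms by (auto simp: admissible_def)
qed

context
  fixes \<alpha> :: real
  assumes \<alpha>: "0 < \<alpha>" "\<alpha> < pi / 4"
begin

text \<open>The trajectory and the momentum are obtained by solving the linear equation for the
  explicit control and are then identified arc by arc. The conserved quantity \<open>h\<close> and
  the zero gap are what the maximum principle and the compactness argument ask for,
  respectively.\<close>

lemma bang_bang_realized:
  assumes \<epsilon>: "\<epsilon> \<in> {-1, 1}" and s: "0 < s" "s \<le> pi" and T: "0 \<le> T"
  obtains u m h where "admissible \<alpha> T (bang_bang \<alpha> \<epsilon> s) u" "solution \<alpha> T u m"
    "norm (m 0) = 1" "m 0 $ 3 = 0" "0 \<le> h" "gap T u m = 0"
    "\<And>t. 0 < t \<Longrightarrow> t \<le> T \<Longrightarrow> u t * m t $ 1 = \<bar>m t $ 1\<bar> \<and> cos \<alpha> * m t $ 3 + sin \<alpha> * \<bar>m t $ 1\<bar> = h"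
proof -
  let ?u = "bang_control \<alpha> \<epsilon> s" and ?M = "momentum_start \<alpha> s \<epsilon>"
  have \<epsilon>2: "\<epsilon>\<^sup>2 = 1" using \<epsilon> by auto
  have u: "control T ?u" by (rule bang_control_control[OF \<epsilon>])
  have "0 < \<epsilon> * flow \<alpha> \<epsilon> (s / 2) ?M $ 1"
    using s by (intro momentum_start_positive[OF \<alpha> \<epsilon>2]) auto
  then have M0: "?M \<noteq> 0" by (auto simp: flow_zero)
  define k where "k = 1 / norm ?M"
  have k: "0 < k" using M0 by (simp add: k_def)
  obtain x where x: "x 0 = north" "solution \<alpha> T ?u x" using solution_exists[OF u T] by blast
  obtain m where m: "m 0 = k *\<^sub>R ?M" "solution \<alpha> T ?u m" using solution_exists[OF u T] by blast
  have m0: "norm (m 0) = 1" "m 0 $ 3 = 0"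
    using M0 by (simp_all add: m(1) k_def momentum_start_def)
  have x1: "norm (x 0) = 1" by (simp add: x(1))
  have start: "x t = flow \<alpha> \<epsilon> t north \<and> m t = k *\<^sub>R flow \<alpha> \<epsilon> t ?M"
    if t: "0 \<le> t" "t \<le> s" "t \<le> T" for t
  proof -
    have c: "?u \<tau> = \<epsilon>" if "0 < \<tau>" "\<tau> \<le> t" for \<tau>
      using that t by (intro bang_control_first) auto
    have "x t = flow \<alpha> \<epsilon> (t - 0) (x 0)"
      by (rule solution_flow[OF u x(2) x1 \<epsilon>2, where b = t]) (use t c in auto)
    moreover have "m t = flow \<alpha> \<epsilon> (t - 0) (m 0)"
      by (rule solution_flow[OF u m(2) m0(1) \<epsilon>2, where b = t]) (use t c in auto)
    ultimately show ?thesis by (simp add: x(1) m(1) flow_scaleR)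
  qed
  have step: "x t = flow \<alpha> \<sigma> (t - t0) (x t0) \<and> m t = flow \<alpha> \<sigma> (t - t0) (m t0)"
    if that0: "t0 = s + real n * v_dur \<alpha> s" "\<sigma> = - ((-1) ^ n * \<epsilon>)" "m t0 = k *\<^sub>R momentum_switch \<alpha> s \<sigma>"
      "t0 < t" "t \<le> T" "t \<le> t0 + v_dur \<alpha> s"
    for n \<sigma> t0 t
  proof -
    have \<sigma>: "\<sigma>\<^sup>2 = 1" using that0(2) \<epsilon>2 by (simp add: power_minus_one_square)
    have t0: "0 \<le> t0" using s v_dur_pos[of \<alpha> s] by (simp add: that0(1))
    have c: "?u \<tau> = \<sigma>" if "t0 < \<tau>" "\<tau> \<le> t" for \<tau>
      unfolding that0(2) by (rule bang_control_arc) (use that that0 in auto)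
    have "x t = flow \<alpha> \<sigma> (t - t0) (x t0)"
      by (rule solution_flow[OF u x(2) x1 \<sigma> t0, where b = t]) (use that0(4-6) c in auto)
    moreover have "m t = flow \<alpha> \<sigma> (t - t0) (m t0)"
      by (rule solution_flow[OF u m(2) m0(1) \<sigma> t0, where b = t]) (use that0(4-6) c in auto)
    ultimately show ?thesis ..
  qed
  have xb: "x t = bang_bang \<alpha> \<epsilon> s t" if "t \<in> {0..T}" for t
    by (rule bang_bang_from_arcs(2)[where T = T, OF \<alpha> s \<epsilon>2 x(1) start step]) (use that in auto)
  \<comment> \<open>The value of the Hamiltonian at time 0, up to the normalising factor
    \<open>k\<close>. It is constant along each flow arc and agrees at switchings because the third
    component of the switching momentum is sin \<alpha> sin s throughout.\<close>
  define h where "h = k * (cos \<alpha> * (sin \<alpha> * sin s))"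
  have h: "0 \<le> h"
    using k small_angle[OF \<alpha>] sin_ge_zero[of s] s by (simp add: h_def)
  have goal: "?u t * m t $ 1 = \<bar>m t $ 1\<bar> \<and> cos \<alpha> * m t $ 3 + sin \<alpha> * \<bar>m t $ 1\<bar> = h"
    if t: "0 < t" "t \<le> T" for t
  proof -
    have "\<exists>\<sigma> \<tau> y. \<sigma>\<^sup>2 = 1 \<and> ?u t = \<sigma> \<and> m t = k *\<^sub>R flow \<alpha> \<sigma> \<tau> y \<and> 0 \<le> \<sigma> * flow \<alpha> \<sigma> \<tau> y $ 1
        \<and> cos \<alpha> * y $ 3 + \<sigma> * sin \<alpha> * y $ 1 = cos \<alpha> * (sin \<alpha> * sin s)"
    proof (cases "t \<le> s")
      case True
      have "0 \<le> \<epsilon> * flow \<alpha> \<epsilon> t ?M $ 1"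
      proof (cases "t = s")
        case True
        then show ?thesis unfolding True flow_momentum_start[OF \<alpha> \<epsilon>2] by (simp add: momentum_switch_def)
      next
        case False
        then show ?thesis
          using True t s by (intro less_imp_le[OF momentum_start_positive[OF \<alpha> \<epsilon>2]]) auto
      qed
      moreover have "cos \<alpha> * ?M $ 3 + \<epsilon> * sin \<alpha> * ?M $ 1 = cos \<alpha> * (sin \<alpha> * sin s)"
        using \<epsilon> by (auto simp: momentum_start_def)
      ultimately show ?thesis
        using start[of t] t True \<epsilon>2 bang_control_first[OF True] by (metis less_imp_le)
    next
      case False
      then obtain n where n: "s + real n * v_dur \<alpha> s < t" "t \<le> s + real n * v_dur \<alpha> s + v_dur \<alpha> s"
        using arc_index_exists[OF v_dur_pos, of s t] by auto
      define \<sigma> where "\<sigma> = - ((-1) ^ n * \<epsilon>)"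
      define t0 where "t0 = s + real n * v_dur \<alpha> s"
      have \<sigma>: "\<sigma>\<^sup>2 = 1" using \<epsilon>2 by (simp add: \<sigma>_def power_minus_one_square)
      have mt: "m t = k *\<^sub>R flow \<alpha> \<sigma> (t - t0) (momentum_switch \<alpha> s \<sigma>)"
      proof -
        have "x t = flow \<alpha> \<sigma> (t - t0) (switching_curve \<alpha> n (- \<sigma>) s) \<and>
            m t = k *\<^sub>R flow \<alpha> \<sigma> (t - t0) (momentum_switch \<alpha> s \<sigma>)"
          by (rule bang_bang_from_arcs(1)[where T = T, OF \<alpha> s \<epsilon>2 x(1) start step t0_def \<sigma>_def])
            (use n t in \<open>auto simp: t0_def\<close>)
        then show ?thesis ..
      qed
      have "0 \<le> \<sigma> * flow \<alpha> \<sigma> (t - t0) (momentum_switch \<alpha> s \<sigma>) $ 1"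
      proof (cases "t - t0 = v_dur \<alpha> s")
        case True
        then show ?thesis unfolding True flow_momentum_switch[OF \<alpha> \<sigma>] by (simp add: momentum_switch_def)
      next
        case False
        then show ?thesis
          using n s by (intro less_imp_le[OF momentum_switch_positive[OF \<alpha> \<sigma>]]) (auto simp: t0_def)
      qed
      moreover have "cos \<alpha> * momentum_switch \<alpha> s \<sigma> $ 3 + \<sigma> * sin \<alpha> * momentum_switch \<alpha> s \<sigma> $ 1 =
          cos \<alpha> * (sin \<alpha> * sin s)"
        by (simp add: momentum_switch_def)
      moreover have "?u t = \<sigma>" unfolding \<sigma>_def by (rule bang_control_arc[OF n])
      ultimately show ?thesis using \<sigma> mt by blast
    qed
    then obtain \<sigma> \<tau> y where \<sigma>: "\<sigma>\<^sup>2 = 1" "?u t = \<sigma>" and mt: "m t = k *\<^sub>R flow \<alpha> \<sigma> \<tau> y"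
      and pos: "0 \<le> \<sigma> * flow \<alpha> \<sigma> \<tau> y $ 1"
      and H: "cos \<alpha> * y $ 3 + \<sigma> * sin \<alpha> * y $ 1 = cos \<alpha> * (sin \<alpha> * sin s)" by blast
    have "\<sigma> * m t $ 1 = k * (\<sigma> * flow \<alpha> \<sigma> \<tau> y $ 1)" by (simp add: mt)
    then have "0 \<le> \<sigma> * m t $ 1" using k pos by (metis less_imp_le mult_nonneg_nonneg)
    then have a: "\<bar>m t $ 1\<bar> = \<sigma> * m t $ 1" using \<sigma>(1) by (auto simp: power2_eq_1_iff)
    have "cos \<alpha> * m t $ 3 + sin \<alpha> * (\<sigma> * m t $ 1)
        = k * (cos \<alpha> * flow \<alpha> \<sigma> \<tau> y $ 3 + \<sigma> * sin \<alpha> * flow \<alpha> \<sigma> \<tau> y $ 1)"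
      by (simp add: mt algebra_simps)
    then show ?thesis
      unfolding flow_hamiltonian[OF \<sigma>(1)] H a by (simp add: \<sigma>(2) h_def)
  qed
  have "gap T ?u m = integral {0..T} (\<lambda>_. 0)"
    unfolding gap_def using goal by (intro integral_spike[of "{0}"]) auto
  then have "gap T ?u m = 0" by simp
  moreover have "admissible \<alpha> T (bang_bang \<alpha> \<epsilon> s) ?u"
    by (rule admissible_cong[OF _ xb]) (use T u x in \<open>auto simp: admissible_iff\<close>)
  ultimately show ?thesis
    using that[of ?u m h] m(2) m0 h goal by blast
qed

lemma bang_bang_start: "\<epsilon> \<in> {-1, 1} \<Longrightarrow> 0 < s \<Longrightarrow> bang_bang \<alpha> \<epsilon> s 0 = north"
  by (auto simp: bang_bang_def)

lemma bang_bang_extremal: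
  assumes \<epsilon>: "\<epsilon> \<in> {-1, 1}" and s: "0 < s" "s \<le> pi" and T: "0 \<le> T"
  shows "\<exists>u. extremal \<alpha> T (bang_bang \<alpha> \<epsilon> s) u"
proof -
  let ?x = "bang_bang \<alpha> \<epsilon> s"
  obtain u m h where adm: "admissible \<alpha> T ?x u" and m: "solution \<alpha> T u m"
    "norm (m 0) = 1" "m 0 $ 3 = 0" "0 \<le> h" "gap T u m = 0"
    "\<And>t. 0 < t \<Longrightarrow> t \<le> T \<Longrightarrow> u t * m t $ 1 = \<bar>m t $ 1\<bar> \<and> cos \<alpha> * m t $ 3 + sin \<alpha> * \<bar>m t $ 1\<bar> = h"
    using bang_bang_realized[OF assms] by blast
  have u: "control T u" and x: "solution \<alpha> T u ?x" using adm by (auto simp: admissible_iff)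
  have x0: "?x 0 = north" using \<epsilon> s by (simp add: bang_bang_start)
  \<comment> \<open>This inverts m = x \<times> p: for m orthogonal to the unit vector x one has x
    \<times> (m \<times> x) = m.\<close>
  define p where "p = (\<lambda>t. cross3 (m t) (?x t))"
  have ps: "solution \<alpha> T u p" unfolding p_def by (rule solution_cross3[OF u m(1) x])
  have mx: "m t \<bullet> ?x t = 0" if "t \<in> {0..T}" for t
    using solution_inner[OF u m(1) x that] m(3) by (simp add: x0 inner_3 north_components)
  have xx: "?x t \<bullet> ?x t = 1" if "t \<in> {0..T}" for t
    using solution_norm[OF u x that] x0 by (simp add: norm_eq_1[symmetric])
  have xp: "cross3 (?x t) (p t) = m t" if "t \<in> {0..T}" for t
    using mx[OF that] xx[OF that] by (simp add: p_def Lagrange inner_commute)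
  have "pmp \<alpha> T ?x u"
    unfolding pmp_def
  proof (intro exI[of _ p] exI[of _ h] conjI ballI m(4))
    fix t assume t: "t \<in> {0..T}"
    have "norm (m t) = 1" using solution_norm[OF u m(1) t] m(2) by simp
    then show "p t \<noteq> 0" using xp[OF t] by auto
    show "p t \<bullet> ?x t = 0" by (simp add: p_def dot_cross_self)
    show "((\<lambda>\<tau>. - (transpose (X_mat \<alpha> (u \<tau>)) *v p \<tau>)) has_integral p t - p 0) {0..t}"
      using ps t unfolding transpose_X_mat minus_minus by (auto simp: solution_def primitive_def)
  next
    have pm: "(\<forall>w\<in>{-1..1}. hamiltonian \<alpha> (?x t) (p t) w \<le> hamiltonian \<alpha> (?x t) (p t) (u t)) \<and>
         hamiltonian \<alpha> (?x t) (p t) (u t) = h" if t: "t \<in> {0..T}" "t \<noteq> 0" for t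
    proof -
      have 1: "hamiltonian \<alpha> (?x t) (p t) w = cos \<alpha> * m t $ 3 + sin \<alpha> * (w * m t $ 1)" for w
        by (simp add: hamiltonian_cross3 xp[OF t(1)])
      have um: "u t * m t $ 1 = \<bar>m t $ 1\<bar>" "cos \<alpha> * m t $ 3 + sin \<alpha> * \<bar>m t $ 1\<bar> = h"
        using m(6)[of t] t by auto
      have "w * m t $ 1 \<le> \<bar>m t $ 1\<bar>" if "w \<in> {-1..1}" for w
        using gap_integrand_nonneg[of w "m t $ 1"] that by (simp add: abs_le_iff)
      then show ?thesis
        unfolding 1 um using um(2) small_angle(1)[OF \<alpha>] by (auto intro!: mult_left_mono)
    qed
    show "AE t in lebesgue_on {0..T}.
       (\<forall>w\<in>{-1..1}. hamiltonian \<alpha> (?x t) (p t) w \<le> hamiltonian \<alpha> (?x t) (p t) (u t)) \<and>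
       hamiltonian \<alpha> (?x t) (p t) (u t) = h"
    proof (rule AE_I')
      show "{0} \<in> null_sets (lebesgue_on {0..T})"
        using T by (simp add: null_sets_restrict_space negligible_iff_null_sets[symmetric])
    qed (use pm in auto)
  qed
  with adm x0 show ?thesis by (auto simp: extremal_def)
qed

definition bang_front :: "real \<Rightarrow> (real^3) set" where
  "bang_front T = {bang_bang \<alpha> \<epsilon> s T | \<epsilon> s. \<epsilon> \<in> {-1, 1} \<and> 0 < s \<and> s \<le> pi}"

lemma extremal_front_eq:
  assumes "0 \<le> T"
  shows "extremal_front \<alpha> T = bang_front T"
proof
  show "extremal_front \<alpha> T \<subseteq> bang_front T"
  proof
    fix q assume "q \<in> extremal_front \<alpha> T"
    then obtain x u where E: "extremal \<alpha> T x u" "q = x T" by (auto simp: extremal_front_def)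
    from extremal_bang_bang[OF \<alpha> E(1)] obtain \<epsilon> s where
      "\<epsilon> \<in> {-1, 1}" "0 < s" "s \<le> pi" "\<forall>t\<in>{0..T}. x t = bang_bang \<alpha> \<epsilon> s t" by blast
    moreover have "T \<in> {0..T}" using assms by simp
    ultimately show "q \<in> bang_front T" unfolding bang_front_def E(2) by blast
  qed
  show "bang_front T \<subseteq> extremal_front \<alpha> T"
  proof
    fix q assume "q \<in> bang_front T"
    then obtain \<epsilon> s where q: "q = bang_bang \<alpha> \<epsilon> s T" "\<epsilon> \<in> {-1, 1}" "0 < s" "s \<le> pi"
      by (auto simp: bang_front_def)
    from bang_bang_extremal[OF q(2-4) assms] show "q \<in> extremal_front \<alpha> T"
      unfolding extremal_front_def q(1) by blast
  qed
qed

end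

subsection \<open>Boundary of the reachable set\<close>

text \<open>The boundary relative to the sphere. The frontier in the ambient space would be of no
  use, as a subset of the sphere has empty interior there and its frontier is its whole
  closure.\<close>

definition sphere_boundary :: "(real^3) set \<Rightarrow> (real^3) set" where
  "sphere_boundary R = {q \<in> sphere 0 1. \<forall>r>0. ball q r \<inter> R \<noteq> {} \<and> \<not> ball q r \<inter> sphere 0 1 \<subseteq> R}"

lemma connected_meets_sphere_boundary:
  assumes C: "connected C" "C \<subseteq> sphere 0 1" and y: "y \<in> C" "y \<in> R" and q: "q \<in> C" "q \<notin> R"
  shows "\<exists>b\<in>C. b \<in> sphere_boundary R"
proof (rule ccontr)
  assume none: "\<not> ?thesis"
  define U where "U = (\<Union>{ball p r | p r. ball p r \<inter> sphere 0 1 \<subseteq> R})"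
  define V where "V = (\<Union>{ball p r | p r. ball p r \<inter> R = {}})"
  have op: "open U" "open V" unfolding U_def V_def by (auto intro!: open_Union)
  have sub: "C \<subseteq> U \<union> V"
  proof
    fix c assume c: "c \<in> C"
    then obtain r where "r > 0" "ball c r \<inter> R = {} \<or> ball c r \<inter> sphere 0 1 \<subseteq> R"
      using none C(2) unfolding sphere_boundary_def by blast
    then show "c \<in> U \<union> V" unfolding U_def V_def using centre_in_ball[of c r] by blast
  qed
  have 1: "U \<inter> C \<subseteq> R" using C(2) unfolding U_def by blast
  have 2: "V \<inter> R = {}" unfolding V_def by blast
  have "U \<inter> V \<inter> C = {}" using 1 2 by blast
  moreover have "U \<inter> C \<noteq> {}" "V \<inter> C \<noteq> {}" using sub y q 1 2 by blast+
  ultimately show False using connectedD[OF C(1) op _ sub] by blast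
qed

text \<open>The segment from y to q stays within distance less than 1 of the unit vector q, so it
  avoids the origin and projects radially to a connected subset of the sphere. The projection moves
  a point by at most its distance to q, hence the factor 2.\<close>

lemma sphere_boundary_near:
  assumes y: "y \<in> sphere 0 1" "y \<in> R" and q: "q \<in> sphere 0 1" "q \<notin> R" and d: "norm (y - q) < 1"
  shows "\<exists>b\<in>sphere_boundary R. norm (b - q) \<le> 2 * norm (y - q)"
proof -
  let ?C = "(\<lambda>p. p /\<^sub>R norm p) ` closed_segment y q"
  have near: "norm (p - q) \<le> norm (y - q)" if "p \<in> closed_segment y q" for p
    using segment_bound(2)[OF that] by (simp add: norm_minus_commute)
  have nz: "p \<noteq> 0" if "p \<in> closed_segment y q" for p
    using near[OF that] d q(1) by (auto simp: norm_minus_commute)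
  have "connected ?C"
    by (intro connected_continuous_image continuous_intros) (use nz in auto)
  moreover have "?C \<subseteq> sphere 0 1" using nz by auto
  moreover have "y \<in> ?C" "q \<in> ?C" using y(1) q(1) by (auto intro!: image_eqI[of y _ y] image_eqI[of q _ q])
  ultimately obtain b where b: "b \<in> ?C" "b \<in> sphere_boundary R"
    using connected_meets_sphere_boundary[of ?C y R q] y(2) q(2) by blast
  then obtain p where p: "p \<in> closed_segment y q" "b = p /\<^sub>R norm p" by blast
  have 1: "norm (b - q) \<le> norm (b - p) + norm (p - q)" by norm
  have 2: "norm (b - p) = \<bar>1 - norm p\<bar>"
  proof -
    have "b - p = (1 / norm p - 1) *\<^sub>R p" unfolding p(2) by (simp add: scaleR_diff_left divide_inverse)
    then have "norm (b - p) = \<bar>1 / norm p - 1\<bar> * norm p" by simp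
    also have "\<dots> = \<bar>(1 / norm p - 1) * norm p\<bar>" by (simp add: abs_mult)
    also have "(1 / norm p - 1) * norm p = 1 - norm p" using nz[OF p(1)] by (simp add: left_diff_distrib)
    finally show ?thesis .
  qed
  have 3: "\<bar>1 - norm p\<bar> \<le> norm (p - q)"
    using q(1) norm_triangle_ineq3[of p q] by (simp add: abs_minus_commute)
  have "norm (b - q) \<le> 2 * norm (y - q)" using 1 2 3 near[OF p(1)] by linarith
  then show ?thesis using b(2) by blast
qed

context
  fixes \<alpha> :: real
  assumes \<alpha>: "0 < \<alpha>" "\<alpha> < pi / 4"
begin

text \<open>If all gaps were at least \<rho>, a ball of a fixed radius r around the end point would
  be reachable; an end point closer than r/2 to q would then make q interior.\<close>

lemma gap_small_near_boundary:
  assumes T: "0 \<le> T" and q: "\<And>r. 0 < r \<Longrightarrow> \<not> ball q r \<inter> sphere 0 1 \<subseteq> reach \<alpha> T" and \<rho>: "0 < \<rho>"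
  shows "\<exists>d>0. \<forall>x u. admissible \<alpha> T x u \<and> x 0 = north \<and> dist (x T) q < d \<longrightarrow>
    (\<exists>m. solution \<alpha> T u m \<and> norm (m 0) = 1 \<and> m 0 $ 3 = 0 \<and> gap T u m < \<rho>)"
proof -
  obtain r where r: "r > 0" "\<And>x u. admissible \<alpha> T x u \<Longrightarrow> x 0 = north \<Longrightarrow>
     (\<forall>m. solution \<alpha> T u m \<and> norm (m 0) = 1 \<and> m 0 $ 3 = 0 \<longrightarrow> \<rho> \<le> gap T u m) \<Longrightarrow>
     ball (x T) r \<inter> sphere 0 1 \<subseteq> reach \<alpha> T"
    using reach_open[OF small_angle(1)[OF \<alpha>] T \<rho>] by blast
  have "\<exists>m. solution \<alpha> T u m \<and> norm (m 0) = 1 \<and> m 0 $ 3 = 0 \<and> gap T u m < \<rho>"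
    if A: "admissible \<alpha> T x u" "x 0 = north" "dist (x T) q < r / 2" for x u
  proof (rule ccontr)
    assume "\<not> ?thesis"
    then have "ball (x T) r \<inter> sphere 0 1 \<subseteq> reach \<alpha> T" using r(2)[OF A(1,2)] not_le by blast
    moreover have "ball q (r / 2) \<subseteq> ball (x T) r"
    proof
      fix b assume "b \<in> ball q (r / 2)"
      then have "dist q b < r / 2" by simp
      then show "b \<in> ball (x T) r" using A(3) dist_triangle[of "x T" b q] by simp
    qed
    ultimately have "ball q (r / 2) \<inter> sphere 0 1 \<subseteq> reach \<alpha> T" by blast
    then show False using q[of "r / 2"] r(1) by simp
  qed
  then show ?thesis using r(1) by (intro exI[of _ "r / 2"]) auto
qed

lemma gap_nonneg: "control T u \<Longrightarrow> continuous_on {0..T} m \<Longrightarrow> 0 \<le> gap T u m"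
  unfolding gap_def
  by (intro integral_nonneg gap_integrable gap_integrand_nonneg) (auto simp: control_def)

text \<open>The predicate \<open>P\<close> records which trajectories may be used for the
  approximation. Left free, it describes boundary points; restricted to one trajectory, it describes
  that trajectory.\<close>

lemma near_boundary_limit:
  assumes T: "0 \<le> T" and q: "\<And>r. 0 < r \<Longrightarrow> \<not> ball q r \<inter> sphere 0 1 \<subseteq> reach \<alpha> T"
    and x: "\<And>d. 0 < d \<Longrightarrow> \<exists>x u. P x \<and> admissible \<alpha> T x u \<and> x 0 = north \<and> dist (x T) q < d"
  shows "\<exists>X \<epsilon> s. (\<forall>n. P (X n)) \<and> \<epsilon> \<in> {-1, 1} \<and> 0 < s \<and> s \<le> pi \<and> bang_bang \<alpha> \<epsilon> s T = q \<and>
    (\<forall>t\<in>{0..T}. (\<lambda>n::nat. X n t) \<longlonglongrightarrow> bang_bang \<alpha> \<epsilon> s t)"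
proof -
  have "\<exists>x u m. P x \<and> admissible \<alpha> T x u \<and> x 0 = north \<and> dist (x T) q < inverse (real (Suc n)) \<and>
     solution \<alpha> T u m \<and> norm (m 0) = 1 \<and> m 0 $ 3 = 0 \<and> gap T u m < inverse (real (Suc n))" for n
  proof -
    have pos: "0 < inverse (real (Suc n))" by simp
    obtain d where d: "d > 0" "\<And>x u. admissible \<alpha> T x u \<and> x 0 = north \<and> dist (x T) q < d \<Longrightarrow>
      (\<exists>m. solution \<alpha> T u m \<and> norm (m 0) = 1 \<and> m 0 $ 3 = 0 \<and> gap T u m < inverse (real (Suc n)))"
      using gap_small_near_boundary[OF T q pos] by blast
    obtain x u where "P x" "admissible \<alpha> T x u" "x 0 = north" "dist (x T) q < min d (inverse (real (Suc n)))"
      using x[of "min d (inverse (real (Suc n)))"] d(1) by auto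
    then show ?thesis using d(2)[of x u] by auto
  qed
  then obtain X U M where XUM: "\<And>n. P (X n)" "\<And>n. admissible \<alpha> T (X n) (U n)" "\<And>n. X n 0 = north"
    "\<And>n. dist (X n T) q < inverse (real (Suc n))" "\<And>n. solution \<alpha> T (U n) (M n)"
    "\<And>n. norm (M n 0) = 1" "\<And>n. M n 0 $ 3 = 0" "\<And>n. gap T (U n) (M n) < inverse (real (Suc n))"
    by metis
  have g0: "0 \<le> gap T (U n) (M n)" for n
    using XUM(2,5) by (intro gap_nonneg solution_continuous) (auto simp: admissible_iff)
  have "(\<lambda>n. gap T (U n) (M n)) \<longlonglongrightarrow> 0"
    by (rule tendsto_sandwich[OF _ _ tendsto_const LIMSEQ_inverse_real_of_nat])
      (use g0 XUM(8) in \<open>auto intro!: always_eventually less_imp_le\<close>)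
  from near_extremal_limit[OF \<alpha> T XUM(2,3,5-7) this]
  obtain r \<epsilon> s where r: "strict_mono r" and \<epsilon>: "\<epsilon> \<in> {-1, 1}" "0 < s" "s \<le> pi"
    and lim: "\<forall>t\<in>{0..T}. (\<lambda>n. X (r n) t) \<longlonglongrightarrow> bang_bang \<alpha> \<epsilon> s t" by blast
  have "(\<lambda>n. dist (X n T) q) \<longlonglongrightarrow> 0"
    by (rule tendsto_sandwich[OF _ _ tendsto_const LIMSEQ_inverse_real_of_nat])
      (use XUM(4) in \<open>auto intro!: always_eventually less_imp_le\<close>)
  then have XT: "(\<lambda>n. X n T) \<longlonglongrightarrow> q" using tendsto_dist_iff by blast
  have "(\<lambda>n. X (r n) T) \<longlonglongrightarrow> q" using LIMSEQ_subseq_LIMSEQ[OF XT r] by (simp add: o_def)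
  moreover have "(\<lambda>n. X (r n) T) \<longlonglongrightarrow> bang_bang \<alpha> \<epsilon> s T" using lim T by auto
  ultimately have "bang_bang \<alpha> \<epsilon> s T = q" using LIMSEQ_unique by blast
  with \<epsilon> lim XUM(1) show ?thesis by (intro exI[of _ "\<lambda>n. X (r n)"]) blast
qed

lemma sphere_boundary_subset:
  assumes T: "0 \<le> T"
  shows "sphere_boundary (reach \<alpha> T) \<subseteq> bang_front \<alpha> T"
proof
  fix q assume "q \<in> sphere_boundary (reach \<alpha> T)"
  then have q: "\<And>r. 0 < r \<Longrightarrow> \<not> ball q r \<inter> sphere 0 1 \<subseteq> reach \<alpha> T"
    "\<And>r. 0 < r \<Longrightarrow> ball q r \<inter> reach \<alpha> T \<noteq> {}"
    unfolding sphere_boundary_def by blast+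
  have ex: "\<exists>x u. True \<and> admissible \<alpha> T x u \<and> x 0 = north \<and> dist (x T) q < d" if d: "0 < d" for d
  proof -
    obtain b where "b \<in> ball q d" "b \<in> reach \<alpha> T" using q(2)[OF d] by blast
    then show ?thesis by (auto simp: reach_def dist_commute)
  qed
  from near_boundary_limit[of T q "\<lambda>_. True", OF T q(1) ex]
  show "q \<in> bang_front \<alpha> T" unfolding bang_front_def[OF \<alpha>] by blast
qed

text \<open>The approximating sequence is constant, so the bang-bang limit is the given trajectory
  at all times and not merely at its end.\<close>

lemma boundary_trajectory:
  assumes adm: "admissible \<alpha> T x u" "x 0 = north" and b: "x T \<in> sphere_boundary (reach \<alpha> T)"
  shows "\<exists>\<epsilon>\<in>{-1, 1}. \<exists>s. 0 < s \<and> s \<le> pi \<and> (\<forall>t\<in>{0..T}. x t = bang_bang \<alpha> \<epsilon> s t)"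
proof -
  have T: "0 \<le> T" using adm by (simp add: admissible_iff)
  have q: "\<And>r. 0 < r \<Longrightarrow> \<not> ball (x T) r \<inter> sphere 0 1 \<subseteq> reach \<alpha> T"
    using b unfolding sphere_boundary_def by blast
  have ex: "\<exists>y u. y = x \<and> admissible \<alpha> T y u \<and> y 0 = north \<and> dist (y T) (x T) < d" if "0 < d" for d
    using adm that by auto
  from near_boundary_limit[of T "x T" "\<lambda>y. y = x", OF T q ex]
  obtain X \<epsilon> s where X: "\<forall>n. X n = x" "\<epsilon> \<in> {-1, 1}" "0 < s" "s \<le> pi"
    "\<forall>t\<in>{0..T}. (\<lambda>n::nat. X n t) \<longlonglongrightarrow> bang_bang \<alpha> \<epsilon> s t" by blast
  then have "\<forall>t\<in>{0..T}. x t = bang_bang \<alpha> \<epsilon> s t" by (simp add: LIMSEQ_const_iff)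
  with X show ?thesis by blast
qed

text \<open>The parameter s ranges over the half-open interval (0, \<pi>], so closedness is no
  matter of continuity alone. It follows from the compactness of trajectories with gap zero, whose
  limits again have a parameter in this range.\<close>

lemma closed_bang_front:
  assumes T: "0 \<le> T"
  shows "closed (bang_front \<alpha> T)"
  unfolding closed_sequential_limits
proof (intro allI impI, elim conjE)
  fix f l assume f: "\<forall>n. f n \<in> bang_front \<alpha> T" and l: "f \<longlonglongrightarrow> l"
  have "\<exists>x u m. f n = x T \<and> admissible \<alpha> T x u \<and> x 0 = north \<and> solution \<alpha> T u m \<and> norm (m 0) = 1 \<and>
      m 0 $ 3 = 0 \<and> gap T u m = 0" for n
  proof -
    obtain \<epsilon> s where \<epsilon>: "f n = bang_bang \<alpha> \<epsilon> s T" "\<epsilon> \<in> {-1, 1}" "0 < s" "s \<le> pi"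
      using f unfolding bang_front_def[OF \<alpha>] by blast
    from bang_bang_realized[OF \<alpha> \<epsilon>(2-4) T] obtain u m where
      "admissible \<alpha> T (bang_bang \<alpha> \<epsilon> s) u" "solution \<alpha> T u m" "norm (m 0) = 1" "m 0 $ 3 = 0" "gap T u m = 0"
      by metis
    with \<epsilon> bang_bang_start[OF \<alpha> \<epsilon>(2,3)] show ?thesis by blast
  qed
  then obtain X U M where XUM: "\<And>n. f n = X n T" "\<And>n. admissible \<alpha> T (X n) (U n)" "\<And>n. X n 0 = north"
    "\<And>n. solution \<alpha> T (U n) (M n)" "\<And>n. norm (M n 0) = 1" "\<And>n. M n 0 $ 3 = 0" "\<And>n. gap T (U n) (M n) = 0"
    by metis
  have "(\<lambda>n. gap T (U n) (M n)) \<longlonglongrightarrow> 0" by (simp add: XUM(7))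
  from near_extremal_limit[OF \<alpha> T XUM(2-6) this]
  obtain r \<epsilon> s where r: "strict_mono r" and \<epsilon>: "\<epsilon> \<in> {-1, 1}" "0 < s" "s \<le> pi"
    and lim: "\<forall>t\<in>{0..T}. (\<lambda>n. X (r n) t) \<longlonglongrightarrow> bang_bang \<alpha> \<epsilon> s t" by blast
  have "(\<lambda>n. X (r n) T) \<longlonglongrightarrow> l" using LIMSEQ_subseq_LIMSEQ[OF l r] by (simp add: o_def XUM(1))
  moreover have "(\<lambda>n. X (r n) T) \<longlonglongrightarrow> bang_bang \<alpha> \<epsilon> s T" using lim T by auto
  ultimately have "l = bang_bang \<alpha> \<epsilon> s T" using LIMSEQ_unique by blast
  with \<epsilon> show "l \<in> bang_front \<alpha> T" unfolding bang_front_def[OF \<alpha>] by blast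
qed

text \<open>Slightly before T the point q is unreachable while a trajectory that will soon meet q is
  close to it, so a boundary point of the earlier reachable set lies near q. Prolonging its
  bang-bang trajectory to time T moves little, and the front is closed. The attainment of q at T
  itself is replaced by attainment arbitrarily soon after T.\<close>

lemma first_reach_in_front:
  assumes T: "0 < T" and q: "q \<in> sphere 0 1"
    and before: "\<And>t. 0 \<le> t \<Longrightarrow> t < T \<Longrightarrow> q \<notin> reach \<alpha> t"
    and after: "\<And>e. 0 < e \<Longrightarrow> \<exists>t. T \<le> t \<and> t < T + e \<and> q \<in> reach \<alpha> t"
  shows "q \<in> bang_front \<alpha> T"
proof -
  have "\<exists>b\<in>bang_front \<alpha> T. dist b q < e" if e: "0 < e" for e
  proof -
    \<comment> \<open>The total displacement is at most 5 d, below e by the entry e/6; the entry 1/4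
      keeps the distance 2 d under the bound 1 required for the radial projection, and T/2 keeps the
      earlier time positive.\<close>
    define d where "d = min (min (e / 6) (1 / 4)) (T / 2)"
    have d: "0 < d" "d \<le> e / 6" "d \<le> 1 / 4" "d < T" using e T by (auto simp: d_def)
    obtain t' where t': "T \<le> t'" "t' < T + d" "q \<in> reach \<alpha> t'" using after[OF d(1)] by blast
    obtain x u where x: "admissible \<alpha> t' x u" "x 0 = north" "q = x t'" using t'(3) by (auto simp: reach_def)
    define t where "t = T - d"
    have t: "0 \<le> t" "t < T" using d by (auto simp: t_def)
    have y: "x t \<in> reach \<alpha> t"
      unfolding reach_def using admissible_subset[OF x(1), of t] x(2) t t' by auto
    have "norm (x t' - x t) \<le> \<bar>t' - t\<bar>" using t t' by (intro admissible_lipschitz[OF x(1)]) auto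
    then have yq: "norm (x t - q) \<le> 2 * d" using t' by (simp add: t_def x(3) norm_minus_commute)
    obtain b where b: "b \<in> sphere_boundary (reach \<alpha> t)" "norm (b - q) \<le> 2 * norm (x t - q)"
      using sphere_boundary_near[of "x t" "reach \<alpha> t" q] y q before[OF t] reach_subset_sphere yq d by force
    obtain \<epsilon> s where \<epsilon>: "b = bang_bang \<alpha> \<epsilon> s t" "\<epsilon> \<in> {-1, 1}" "0 < s" "s \<le> pi"
      using b(1) sphere_boundary_subset[OF t(1)] unfolding bang_front_def[OF \<alpha>] by blast
    obtain w where w: "admissible \<alpha> T (bang_bang \<alpha> \<epsilon> s) w"
      using bang_bang_realized[OF \<alpha> \<epsilon>(2-4), of T] T by (metis less_imp_le)
    have "norm (bang_bang \<alpha> \<epsilon> s T - b) \<le> \<bar>T - t\<bar>"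
      unfolding \<epsilon>(1) using t by (intro admissible_lipschitz[OF w]) auto
    then have "norm (bang_bang \<alpha> \<epsilon> s T - b) \<le> d" using d by (simp add: t_def)
    then have "norm (bang_bang \<alpha> \<epsilon> s T - q) \<le> d + 2 * (2 * d)"
      using b(2) yq norm_triangle_ineq[of "bang_bang \<alpha> \<epsilon> s T - b" "b - q"] by simp
    also have "\<dots> < e" using d e by simp
    finally show ?thesis unfolding bang_front_def[OF \<alpha>] using \<epsilon> by (auto simp: dist_norm)
  qed
  then have "q \<in> closure (bang_front \<alpha> T)" by (simp add: closure_approachable)
  then show ?thesis using closed_bang_front T by (simp add: closure_closed)
qed

end

section \<open>Arcs and Jordan curves on the sphere\<close>

lemma simple_path_homeo_arc:
  assumes "arc \<gamma>" "continuous_on S h" "inj_on h S" "path_image \<gamma> \<subseteq> S"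
  shows "arc (h \<circ> \<gamma>)"
  using assms unfolding arc_def
  by (metis comp_inj_on continuous_on_subset inj_on_subset path_continuous_image path_image_def)

text \<open>Removing the point q turns the sphere into a plane, where the complement of an arc is
  connected.\<close>

lemma sphere_minus_arc_connected:
  fixes \<gamma> :: "real \<Rightarrow> real^3"
  assumes \<gamma>: "arc \<gamma>" "path_image \<gamma> \<subseteq> sphere 0 1 - {q}" and q: "q \<in> sphere 0 1"
  shows "connected (sphere 0 1 - {q} - path_image \<gamma>)"
proof -
  have "(sphere 0 1 - {q}) homeomorphic (UNIV :: complex set)"
    by (rule homeomorphic_punctured_sphere_affine) (use q in \<open>auto simp: aff_dim_UNIV\<close>)
  then obtain h k where hk: "homeomorphism (sphere 0 1 - {q}) (UNIV :: complex set) h k"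
    unfolding homeomorphic_def by blast
  have hc: "continuous_on (sphere 0 1 - {q}) h" and kc: "continuous_on UNIV k"
    and khx: "\<And>x. x \<in> sphere 0 1 - {q} \<Longrightarrow> k (h x) = x" and hky: "\<And>y. h (k y) = y"
    and kr: "range k = sphere 0 1 - {q}"
    using hk unfolding homeomorphism_def by blast+
  have ks: "\<And>y. k y \<in> sphere 0 1 - {q}" using kr by blast
  have inj: "inj_on h (sphere 0 1 - {q})" by (metis inj_onI khx)
  have "arc (h \<circ> \<gamma>)" by (rule simple_path_homeo_arc[OF \<gamma>(1) hc inj \<gamma>(2)])
  then have "connected (- path_image (h \<circ> \<gamma>))" by (intro connected_arc_complement) auto
  then have "connected (k ` (- path_image (h \<circ> \<gamma>)))"
    by (intro connected_continuous_image continuous_on_subset[OF kc]) auto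
  moreover have "k ` (- path_image (h \<circ> \<gamma>)) = sphere 0 1 - {q} - path_image \<gamma>"
  proof
    show "k ` (- path_image (h \<circ> \<gamma>)) \<subseteq> sphere 0 1 - {q} - path_image \<gamma>"
    proof
      fix x assume "x \<in> k ` (- path_image (h \<circ> \<gamma>))"
      then obtain y where y: "x = k y" "y \<notin> h ` path_image \<gamma>" by (auto simp: path_image_compose)
      then have "x \<notin> path_image \<gamma>" using hky by (metis imageI)
      then show "x \<in> sphere 0 1 - {q} - path_image \<gamma>" using ks y(1) by blast
    qed
    show "sphere 0 1 - {q} - path_image \<gamma> \<subseteq> k ` (- path_image (h \<circ> \<gamma>))"
    proof
      fix x assume x: "x \<in> sphere 0 1 - {q} - path_image \<gamma>"
      have "h x \<notin> h ` path_image \<gamma>"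
        using x \<gamma>(2) inj unfolding inj_on_def by blast
      moreover have "x = k (h x)" using khx x by simp
      ultimately show "x \<in> k ` (- path_image (h \<circ> \<gamma>))" by (auto simp: path_image_compose)
    qed
  qed
  ultimately show ?thesis by simp
qed

text \<open>A set whose boundary lies on a Jordan curve and which separates two points off the curve has
  the whole curve as its boundary, since an arc does not separate the sphere.\<close>

lemma loop_subset_sphere_boundary:
  fixes \<gamma> :: "real \<Rightarrow> real^3"
  assumes \<gamma>: "simple_path \<gamma>" "pathfinish \<gamma> = pathstart \<gamma>" "path_image \<gamma> \<subseteq> sphere 0 1"
    and R: "sphere_boundary R \<subseteq> path_image \<gamma>"
    and a: "a \<in> sphere 0 1" "a \<in> R" "a \<notin> path_image \<gamma>"
    and b: "b \<in> sphere 0 1" "b \<notin> R" "b \<notin> path_image \<gamma>"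
  shows "path_image \<gamma> \<subseteq> sphere_boundary R"
proof
  fix q assume q: "q \<in> path_image \<gamma>"
  show "q \<in> sphere_boundary R"
  proof (rule ccontr)
    assume nb: "q \<notin> sphere_boundary R"
    have qS: "q \<in> sphere 0 1" using q \<gamma>(3) by blast
    then obtain r where r: "r > 0" "ball q r \<inter> R = {} \<or> ball q r \<inter> sphere 0 1 \<subseteq> R"
      using nb unfolding sphere_boundary_def by blast
    have far: "p \<notin> sphere_boundary R" if p: "p \<in> ball q r" for p
    proof -
      obtain r' where r': "r' > 0" "ball p r' \<subseteq> ball q r"
        using openE[OF open_ball p] by blast
      then have "ball p r' \<inter> R = {} \<or> ball p r' \<inter> sphere 0 1 \<subseteq> R" using r(2) by blast
      then show ?thesis using r'(1) unfolding sphere_boundary_def by blast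
    qed
    obtain \<tau> where \<tau>: "\<tau> \<in> {0..1}" "\<gamma> \<tau> = q" using q unfolding path_image_def by blast
    define g where "g = shiftpath \<tau> \<gamma>"
    have g: "simple_path g" "path_image g = path_image \<gamma>" "g 0 = q" "g 1 = q"
      using \<tau> \<gamma>(1,2) pathstart_shiftpath[of \<tau> \<gamma>] pathfinish_shiftpath[of \<tau> \<gamma>]
      by (auto simp: g_def simple_path_shiftpath path_image_shiftpath pathstart_def pathfinish_def)
    have gc: "continuous_on {0..1} g" using simple_path_imp_path[OF g(1)] by (simp add: path_def)
    obtain d0 where d0: "d0 > 0" "\<forall>t\<in>{0..1}. dist t 0 < d0 \<longrightarrow> dist (g t) (g 0) < r"
      using gc r(1) unfolding continuous_on_iff by (meson atLeastAtMost_iff order_refl zero_le_one)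
    obtain d1 where d1: "d1 > 0" "\<forall>t\<in>{0..1}. dist t 1 < d1 \<longrightarrow> dist (g t) (g 1) < r"
      using gc r(1) unfolding continuous_on_iff by (meson atLeastAtMost_iff order_refl zero_le_one)
    \<comment> \<open>The loop is based at q. Both of its ends, of parameter length \<eta>, lie in
      the ball around q that contains no boundary point; what is left in the middle is an
      arc.\<close>
    define \<eta> where "\<eta> = min (1/4) (min (d0 / 2) (d1 / 2))"
    have \<eta>: "0 < \<eta>" "\<eta> \<le> 1/4" "\<eta> < d0" "\<eta> < d1" using d0(1) d1(1) by (auto simp: \<eta>_def)
    define A where "A = subpath \<eta> (1 - \<eta>) g"
    have A: "arc A" unfolding A_def by (rule arc_simple_path_subpath_interior[OF g(1)]) (use \<eta> in auto)
    have Aim: "path_image A = g ` {\<eta>..1 - \<eta>}" unfolding A_def path_image_subpath using \<eta> by auto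
    have qA: "q \<notin> path_image A"
    proof
      assume "q \<in> path_image A"
      then obtain t where t: "t \<in> {\<eta>..1 - \<eta>}" "g t = g 0" unfolding Aim g(3) by auto
      then show False using g(1) \<eta> unfolding simple_path_def loop_free_def by force
    qed
    have AS: "path_image A \<subseteq> sphere 0 1 - {q}"
      using qA \<gamma>(3) g(2) path_image_subpath_subset[of \<eta> "1 - \<eta>" g] \<eta> by (auto simp: A_def)
    let ?C = "sphere 0 1 - {q} - path_image A"
    have A\<gamma>: "path_image A \<subseteq> path_image \<gamma>"
      using g(2) path_image_subpath_subset[of \<eta> "1 - \<eta>" g] \<eta> by (auto simp: A_def)
    have "a \<in> ?C" "b \<in> ?C" using a b q A\<gamma> by blast+
    moreover have "connected ?C" by (rule sphere_minus_arc_connected[OF A AS qS])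
    ultimately obtain c where c: "c \<in> ?C" "c \<in> sphere_boundary R"
      using connected_meets_sphere_boundary[of ?C a R b] a b by blast
    then obtain t where t: "t \<in> {0..1}" "c = g t" using R g(2) unfolding path_image_def by blast
    have nball: "dist (g t) q \<ge> r" using far[of c] c(2) t(2) by (force simp: dist_commute)
    have "\<eta> \<le> t"
    proof (rule ccontr)
      assume "\<not> ?thesis"
      then have "dist t 0 < d0" using t \<eta> by (auto simp: dist_real_def)
      then show False using d0(2) t nball g(3) by force
    qed
    moreover have "t \<le> 1 - \<eta>"
    proof (rule ccontr)
      assume "\<not> ?thesis"
      then have "dist t 1 < d1" using t \<eta> by (auto simp: dist_real_def)
      then show False using d1(2) t nball g(4) by force
    qed
    ultimately have "c \<in> path_image A" unfolding Aim t(2) by simp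
    then show False using c(1) by blast
  qed
qed

section \<open>Optimality from the boundary property\<close>

context
  fixes \<alpha> :: real
  assumes \<alpha>: "0 < \<alpha>" "\<alpha> < pi / 4"
begin

lemma flow_north_ne:
  assumes \<epsilon>: "\<epsilon>\<^sup>2 = 1" and t: "0 < t" "t \<le> pi"
  shows "flow \<alpha> \<epsilon> t north \<noteq> north" "flow \<alpha> \<epsilon> t north \<noteq> - north"
proof -
  have e: "\<epsilon> * \<epsilon> = 1" using \<epsilon> by (simp add: power2_eq_square)
  have "flow \<alpha> \<epsilon> t north $ 3 = 1 - (\<epsilon> * \<epsilon>) * ((1 - cos t) * (sin \<alpha>)\<^sup>2)"
    unfolding flow_components[OF \<epsilon>] north_components by (simp add: power2_eq_square)
  then have f: "flow \<alpha> \<epsilon> t north $ 3 = 1 - (1 - cos t) * (sin \<alpha>)\<^sup>2" by (simp add: e)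
  have "cos t < cos 0" using t by (intro cos_monotone_0_pi) auto
  then have "0 < (1 - cos t) * (sin \<alpha>)\<^sup>2" using small_angle(1)[OF \<alpha>] by simp
  then show "flow \<alpha> \<epsilon> t north \<noteq> north" using f by (auto simp: north_components)
  have "(1 - cos t) * (sin \<alpha>)\<^sup>2 \<le> 2 * (sin \<alpha>)\<^sup>2"
    using cos_ge_minus_one[of t] by (intro mult_right_mono) auto
  also have "\<dots> < (sin \<alpha>)\<^sup>2 + (cos \<alpha>)\<^sup>2" using small_angle(4)[OF \<alpha>] by linarith
  finally have "flow \<alpha> \<epsilon> t north $ 3 \<noteq> - 1" using f by simp
  then show "flow \<alpha> \<epsilon> t north \<noteq> - north" by (auto simp: north_components)
qed

lemma bang_front_subset_sphere: "0 \<le> T \<Longrightarrow> bang_front \<alpha> T \<subseteq> sphere 0 1"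
proof
  fix q assume T: "0 \<le> T" and "q \<in> bang_front \<alpha> T"
  then obtain \<epsilon> s where \<epsilon>: "q = bang_bang \<alpha> \<epsilon> s T" "\<epsilon> \<in> {-1, 1}" "0 < s" "s \<le> pi"
    unfolding bang_front_def[OF \<alpha>] by blast
  from bang_bang_realized[OF \<alpha> \<epsilon>(2-4) T] show "q \<in> sphere 0 1"
    unfolding \<epsilon>(1) using T by (metis admissible_def atLeastAtMost_iff order_refl)
qed

lemma time_optimal_if_boundary:
  assumes T: "0 < T" and bd: "bang_front \<alpha> T \<subseteq> sphere_boundary (reach \<alpha> T)"
    and \<epsilon>: "\<epsilon> \<in> {-1, 1}" "0 < s" "s \<le> pi" and t: "0 \<le> t" "t \<le> T"
  shows "time_optimal \<alpha> t (bang_bang \<alpha> \<epsilon> s)"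
proof -
  let ?x = "bang_bang \<alpha> \<epsilon> s"
  obtain u where u: "admissible \<alpha> T ?x u"
    using bang_bang_realized[OF \<alpha> \<epsilon>, of T] T by (metis less_imp_le)
  have x0: "?x 0 = north" by (rule bang_bang_start[OF \<alpha> \<epsilon>(1,2)])
  have xT: "?x T \<in> bang_front \<alpha> T" unfolding bang_front_def[OF \<alpha>] using \<epsilon> by blast
  have opt: "T \<le> T'" if y: "admissible \<alpha> T' y w" "y 0 = north" "y T' = ?x T" for T' y w
  proof (rule ccontr)
    assume "\<not> T \<le> T'"
    define a where "a = T - T'"
    have a: "0 < a" and T': "0 \<le> T'" using y(1) \<open>\<not> T \<le> T'\<close> by (auto simp: a_def admissible_iff)
    let ?z = "concat_at a (\<lambda>_. north) y"
    have z: "admissible \<alpha> T ?z (concat_at a (\<lambda>_. 0) w)"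
      using admissible_delay[OF y(1,2), of a] a by (simp add: a_def)
    have z0: "?z 0 = north" using a by (simp add: concat_at_def)
    have "?z T = ?x T" using y(2,3) T' by (cases "T' = 0") (auto simp: concat_at_def a_def)
    then have "?z T \<in> sphere_boundary (reach \<alpha> T)" using xT bd by auto
    from boundary_trajectory[OF \<alpha> z z0 this]
    obtain \<sigma> \<rho> where \<sigma>: "\<sigma> \<in> {-1, 1}" "0 < \<rho>" "\<rho> \<le> pi" "\<forall>t\<in>{0..T}. ?z t = bang_bang \<alpha> \<sigma> \<rho> t" by blast
    \<comment> \<open>A time within both the waiting period and the first bang arc: the waiting
      trajectory is still at N, whereas the bang arc has left it.\<close>
    define \<tau> where "\<tau> = min a \<rho>"
    have \<tau>: "0 < \<tau>" "\<tau> \<le> a" "\<tau> \<le> \<rho>" "\<tau> \<le> T" using a \<sigma>(2) T' by (auto simp: \<tau>_def a_def)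
    have "flow \<alpha> \<sigma> \<tau> north = ?z \<tau>" using \<sigma>(4) \<tau> by (simp add: bang_bang_def)
    also have "\<dots> = north" using \<tau> by (simp add: concat_at_def)
    finally show False using flow_north_ne(1)[of \<sigma> \<tau>] \<sigma> \<tau> by auto
  qed
  \<comment> \<open>A quicker way to an intermediate point, followed by the rest of the extremal,
    would be a quicker way to its end point. So optimality at T is inherited by all earlier
    times.\<close>
  have "t \<le> T'" if y: "admissible \<alpha> T' y w" "y 0 = north" "y T' = ?x t" for T' y w
  proof -
    have T': "0 \<le> T'" using y(1) by (simp add: admissible_iff)
    have sh: "admissible \<alpha> (T - t) (\<lambda>\<tau>. ?x (\<tau> + t)) (\<lambda>\<tau>. u (\<tau> + t))"
      by (rule admissible_shift[OF u t])
    let ?z = "concat_at T' y (\<lambda>\<tau>. ?x (\<tau> + t))"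
    have z: "admissible \<alpha> (T' + (T - t)) ?z (concat_at T' w (\<lambda>\<tau>. u (\<tau> + t)))"
      by (rule admissible_concat[OF y(1) sh]) (simp add: y(3))
    have "?z 0 = north" using T' y(2) by (simp add: concat_at_def)
    moreover have "?z (T' + (T - t)) = ?x T"
      using t y(3) by (cases "t = T") (auto simp: concat_at_def)
    ultimately have "T \<le> T' + (T - t)" using opt[OF z] by blast
    then show ?thesis by simp
  qed
  moreover have "admissible \<alpha> t ?x u" by (rule admissible_subset[OF u t])
  ultimately show ?thesis unfolding time_optimal_def using x0 by blast
qed

text \<open>One inclusion is the optimality of the extremals. Conversely, an end point of an optimal
  trajectory is unreachable before T, hence first reached at T.\<close>

lemma optimal_front_eq:
  assumes T: "0 < T" and bd: "bang_front \<alpha> T \<subseteq> sphere_boundary (reach \<alpha> T)"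
  shows "optimal_front \<alpha> T = bang_front \<alpha> T"
proof
  show "bang_front \<alpha> T \<subseteq> optimal_front \<alpha> T"
  proof
    fix q assume "q \<in> bang_front \<alpha> T"
    then obtain \<epsilon> s where "q = bang_bang \<alpha> \<epsilon> s T" "\<epsilon> \<in> {-1, 1}" "0 < s" "s \<le> pi"
      unfolding bang_front_def[OF \<alpha>] by blast
    then show "q \<in> optimal_front \<alpha> T"
      unfolding optimal_front_def using time_optimal_if_boundary[OF T bd, of \<epsilon> s T] T by auto
  qed
  show "optimal_front \<alpha> T \<subseteq> bang_front \<alpha> T"
  proof
    fix q assume "q \<in> optimal_front \<alpha> T"
    then obtain x u where x: "q = x T" "admissible \<alpha> T x u" "x 0 = north"
      and opt: "\<And>T' y w. admissible \<alpha> T' y w \<Longrightarrow> y 0 = north \<Longrightarrow> y T' = x T \<Longrightarrow> T \<le> T'"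
      unfolding optimal_front_def time_optimal_def by blast
    have qr: "q \<in> reach \<alpha> T" using x unfolding reach_def by blast
    show "q \<in> bang_front \<alpha> T"
    proof (rule first_reach_in_front[OF \<alpha> T])
      show "q \<in> sphere 0 1" using qr reach_subset_sphere by blast
      show "q \<notin> reach \<alpha> t" if "0 \<le> t" "t < T" for t
        using opt[of t] that unfolding reach_def x(1) by fastforce
      show "\<exists>t. T \<le> t \<and> t < T + e \<and> q \<in> reach \<alpha> t" if "0 < e" for e
        using qr that by (intro exI[of _ T]) auto
    qed
  qed
qed

text \<open>At the infimum of its reaching times a point lies on the front, whether or not the
  infimum is attained. This infimum is positive because q differs from N and the speed is at most
  1.\<close>

lemma not_reach_if_not_in_fronts:
  assumes q: "q \<in> sphere 0 1" "q \<noteq> north" and T: "0 \<le> T"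
    and nf: "\<And>t. 0 < t \<Longrightarrow> t \<le> T \<Longrightarrow> q \<notin> bang_front \<alpha> t"
  shows "q \<notin> reach \<alpha> T"
proof
  assume qT: "q \<in> reach \<alpha> T"
  define A where "A = {t. 0 \<le> t \<and> q \<in> reach \<alpha> t}"
  define T0 where "T0 = Inf A"
  have TA: "T \<in> A" using T qT by (simp add: A_def)
  have lb: "norm (q - north) \<le> t" if "t \<in> A" for t
  proof -
    obtain x u where x: "admissible \<alpha> t x u" "x 0 = north" "q = x t" and "0 \<le> t"
      using \<open>t \<in> A\<close> by (auto simp: A_def reach_def)
    then show ?thesis using admissible_lipschitz[OF x(1), of 0 t] by simp
  qed
  have bdd: "bdd_below A" using lb by (meson bdd_below.I)
  have "norm (q - north) \<le> T0" unfolding T0_def using TA lb by (intro cInf_greatest) auto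
  then have T0: "0 < T0" using q(2) by (smt (verit) norm_le_zero_iff right_minus_eq)
  have T0T: "T0 \<le> T" unfolding T0_def by (rule cInf_lower[OF TA bdd])
  have "q \<in> bang_front \<alpha> T0"
  proof (rule first_reach_in_front[OF \<alpha> T0 q(1)])
    show "q \<notin> reach \<alpha> t" if "0 \<le> t" "t < T0" for t
      using cInf_lower[OF _ bdd, of t] that unfolding T0_def A_def by force
    fix e :: real assume "0 < e"
    then obtain t where "t \<in> A" "t < T0 + e"
      unfolding T0_def using TA bdd by (metis cInf_lessD empty_iff less_add_same_cancel1)
    then show "\<exists>t. T0 \<le> t \<and> t < T0 + e \<and> q \<in> reach \<alpha> t"
      using cInf_lower[OF \<open>t \<in> A\<close> bdd] by (auto simp: T0_def A_def)
  qed
  then show False using nf T0 T0T by blast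
qed

theorem front_optimal:
  assumes T: "0 < T" and \<gamma>: "simple_path \<gamma>" "pathfinish \<gamma> = pathstart \<gamma>" "path_image \<gamma> = bang_front \<alpha> T"
    and n: "north \<notin> bang_front \<alpha> T" and s: "\<And>t. 0 < t \<Longrightarrow> t \<le> T \<Longrightarrow> - north \<notin> bang_front \<alpha> t"
  shows "extremal_front \<alpha> T homeomorphic sphere (0 :: real^2) 1"
    and "\<And>\<epsilon> s t. \<epsilon> \<in> {-1, 1} \<Longrightarrow> 0 < s \<Longrightarrow> s \<le> pi \<Longrightarrow> 0 \<le> t \<Longrightarrow> t \<le> T \<Longrightarrow>
      time_optimal \<alpha> t (bang_bang \<alpha> \<epsilon> s)"
    and "optimal_front \<alpha> T = extremal_front \<alpha> T"
proof -
  have T0: "0 \<le> T" using T by simp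
  have ef: "extremal_front \<alpha> T = bang_front \<alpha> T" by (rule extremal_front_eq[OF \<alpha> T0])
  have "north \<noteq> - north" by (simp add: vec3_eq_iff north_components)
  then have nr: "- north \<notin> reach \<alpha> T"
    using s T by (intro not_reach_if_not_in_fronts) auto
  have bd: "bang_front \<alpha> T \<subseteq> sphere_boundary (reach \<alpha> T)"
    unfolding \<gamma>(3)[symmetric]
  proof (rule loop_subset_sphere_boundary[OF \<gamma>(1,2)])
    show "path_image \<gamma> \<subseteq> sphere 0 1" unfolding \<gamma>(3) by (rule bang_front_subset_sphere[OF T0])
    show "sphere_boundary (reach \<alpha> T) \<subseteq> path_image \<gamma>" unfolding \<gamma>(3) by (rule sphere_boundary_subset[OF \<alpha> T0])
    show "north \<in> reach \<alpha> T" by (rule north_in_reach[OF T0])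
    show "north \<notin> path_image \<gamma>" "- north \<notin> path_image \<gamma>" unfolding \<gamma>(3) using n s T by auto
  qed (use nr in auto)
  show "extremal_front \<alpha> T homeomorphic sphere (0 :: real^2) 1"
  proof -
    have "path_image \<gamma> homeomorphic sphere (0::complex) 1"
      by (rule homeomorphic_simple_path_image_circle[OF \<gamma>(1,2)]) simp
    moreover have "sphere (0::complex) 1 homeomorphic sphere (0 :: real^2) 1"
      by (rule homeomorphic_spheres_gen) auto
    ultimately show ?thesis unfolding ef \<gamma>(3) by (rule homeomorphic_trans)
  qed
  show "optimal_front \<alpha> T = extremal_front \<alpha> T" unfolding ef by (rule optimal_front_eq[OF T bd])
  show "time_optimal \<alpha> t (bang_bang \<alpha> \<epsilon> s)"
    if "\<epsilon> \<in> {-1, 1}" "0 < s" "s \<le> pi" "0 \<le> t" "t \<le> T" for \<epsilon> s t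
    by (rule time_optimal_if_boundary[OF T bd that])
qed

end

subsection \<open>Quaternion coordinates\<close>

text \<open>The image of the north pole under the rotation of the quaternion \<open>a + b i + c j + d k\<close>.\<close>

definition qpoint :: "real \<Rightarrow> real \<Rightarrow> real \<Rightarrow> real \<Rightarrow> real^3" where
  "qpoint a b c d = vector [2 * (b * d + a * c), 2 * (c * d - a * b), a\<^sup>2 + d\<^sup>2 - b\<^sup>2 - c\<^sup>2]"

definition half_turn :: "real \<Rightarrow> real^3 \<Rightarrow> real^3" where
  "half_turn \<sigma> x = vector [\<sigma> * x $ 1, \<sigma> * x $ 2, x $ 3]"

lemma qpoint_1: "qpoint 1 0 0 0 = north"
  by (simp add: qpoint_def north_def)

lemma qpoint_minus: "qpoint (- a) (- b) (- c) (- d) = qpoint a b c d"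
  by (simp add: qpoint_def)

text \<open>The half turn about the polar axis is left multiplication by the quaternion k.\<close>

lemma half_turn_qpoint: "half_turn (-1) (qpoint a b c d) = qpoint (- d) (- c) b a"
  by (simp add: vec3_eq_iff half_turn_def qpoint_def algebra_simps)

lemma half_turn_north: "half_turn \<sigma> north = north"
  by (simp add: half_turn_def north_def)

lemma half_turn_mult: "half_turn \<sigma> (half_turn \<rho> x) = half_turn (\<sigma> * \<rho>) x"
  by (simp add: half_turn_def mult.assoc)

text \<open>Conjugation by the half turn exchanges X_+ and X_-, so all arcs can be written with the
  single field X_+.\<close>

lemma flow_half_turn:
  assumes "\<sigma>\<^sup>2 = 1" "\<epsilon>\<^sup>2 = 1"
  shows "flow \<alpha> (\<sigma> * \<epsilon>) t (half_turn \<sigma> x) = half_turn \<sigma> (flow \<alpha> \<epsilon> t x)"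
proof -
  have s: "\<sigma> * \<sigma> = 1" "(\<sigma> * \<epsilon>)\<^sup>2 = 1" using assms by (simp_all add: power2_eq_square mult_ac)
  show ?thesis
    unfolding vec3_eq_iff half_turn_def vector_3 flow_components[OF s(2)] flow_components[OF assms(2)]
    using s(1) by (intro conjI; (simp add: algebra_simps; fail | algebra))
qed

text \<open>Left multiplication by the unit quaternion C + x i + y k, which represents the rotation
  by angle t about the axis (\<epsilon> sin \<alpha>, 0, cos \<alpha>); hence the half
  angles.\<close>

lemma flow_qpoint:
  assumes "\<epsilon>\<^sup>2 = 1" and t: "C = cos (t / 2)" "x = \<epsilon> * sin \<alpha> * sin (t / 2)" "y = cos \<alpha> * sin (t / 2)"
  shows "flow \<alpha> \<epsilon> t (qpoint a b c d) =
    qpoint (C * a - x * b - y * d) (C * b + x * a - y * c) (C * c + y * b - x * d) (C * d + y * a + x * c)"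
proof -
  define S where "S = sin (t / 2)"
  have e: "\<epsilon> * \<epsilon> = 1" using assms by (simp add: power2_eq_square)
  have sc: "sin \<alpha> * sin \<alpha> + cos \<alpha> * cos \<alpha> = 1" "S * S + C * C = 1"
    using sin_cos_squared_add by (simp_all add: power2_eq_square S_def t)
  have st: "sin t = 2 * S * C" "cos t = 1 - 2 * (S * S)"
    using sin_double[of "t / 2"] cos_double_sin[of "t / 2"] by (simp_all add: S_def t power2_eq_square)
  have xy: "x = \<epsilon> * sin \<alpha> * S" "y = cos \<alpha> * S" by (simp_all add: t S_def)
  note comps = flow_components[OF assms(1)] qpoint_def vector_3 st xy power2_eq_square
  show ?thesis
    unfolding vec3_eq_iff
  proof (intro conjI)
    show "flow \<alpha> \<epsilon> t (qpoint a b c d) $ 1 =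
      qpoint (C * a - x * b - y * d) (C * b + x * a - y * c) (C * c + y * b - x * d) (C * d + y * a + x * c) $ 1"
      unfolding comps using e sc by algebra
    show "flow \<alpha> \<epsilon> t (qpoint a b c d) $ 2 =
      qpoint (C * a - x * b - y * d) (C * b + x * a - y * c) (C * c + y * b - x * d) (C * d + y * a + x * c) $ 2"
      unfolding comps using e sc by algebra
    show "flow \<alpha> \<epsilon> t (qpoint a b c d) $ 3 =
      qpoint (C * a - x * b - y * d) (C * b + x * a - y * c) (C * c + y * b - x * d) (C * d + y * a + x * c) $ 3"
      unfolding comps using e sc by algebra
  qed
qed

text \<open>The product of a^2 + d^2 and b^2 + c^2 is a quarter of the sum of the squares of the
  first two coordinates. On the axis one of the pairs vanishes, and the third coordinate decides
  which.\<close>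

lemma qpoint_eq_south:
  assumes "qpoint a b c d = - north"
  shows "a = 0 \<and> d = 0"
proof -
  have e: "b * d + a * c = 0" "c * d - a * b = 0" "a\<^sup>2 + d\<^sup>2 - b\<^sup>2 - c\<^sup>2 = -1"
    using assms by (simp_all add: vec3_eq_iff qpoint_def north_components)
  have "(a\<^sup>2 + d\<^sup>2) * (b\<^sup>2 + c\<^sup>2) = (b * d + a * c)\<^sup>2 + (c * d - a * b)\<^sup>2"
    by (simp add: power2_eq_square algebra_simps)
  then have "(a\<^sup>2 + d\<^sup>2) * (b\<^sup>2 + c\<^sup>2) = 0" using e by simp
  moreover have "b\<^sup>2 + c\<^sup>2 \<noteq> 0" using e(3) sum_power2_ge_zero[of a d] by linarith
  ultimately show ?thesis by (auto simp: sum_power2_eq_zero_iff)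
qed

lemma qpoint_eq_north:
  assumes "qpoint a b c d = north"
  shows "b = 0 \<and> c = 0"
proof -
  have e: "b * d + a * c = 0" "c * d - a * b = 0" "a\<^sup>2 + d\<^sup>2 - b\<^sup>2 - c\<^sup>2 = 1"
    using assms by (simp_all add: vec3_eq_iff qpoint_def north_components)
  have "(a\<^sup>2 + d\<^sup>2) * (b\<^sup>2 + c\<^sup>2) = (b * d + a * c)\<^sup>2 + (c * d - a * b)\<^sup>2"
    by (simp add: power2_eq_square algebra_simps)
  then have "(a\<^sup>2 + d\<^sup>2) * (b\<^sup>2 + c\<^sup>2) = 0" using e by simp
  moreover have "a\<^sup>2 + d\<^sup>2 \<noteq> 0" using e(3) sum_power2_ge_zero[of b c] by linarith
  ultimately show ?thesis by (auto simp: sum_power2_eq_zero_iff)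
qed

text \<open>\<open>step_angle\<close> is half the angle of the rotation that carries one switching point to the next,
  up to a half turn about the polar axis.\<close>

definition step_angle :: "real \<Rightarrow> real \<Rightarrow> real" where
  "step_angle \<alpha> s = arccos (cos (half_excess \<alpha> s) * cos \<alpha>)"

definition pow_re :: "real \<Rightarrow> nat \<Rightarrow> real \<Rightarrow> real" where
  "pow_re \<alpha> n s = cos (real n * step_angle \<alpha> s)"

text \<open>De Moivre's formula: the n-th power of a unit quaternion with real part cos \<kappa> has
  real part cos(n \<kappa>), and its vector part is multiplied by sin(n \<kappa>) / sin
  \<kappa>.\<close>

definition pow_im :: "real \<Rightarrow> nat \<Rightarrow> real \<Rightarrow> real" where
  "pow_im \<alpha> n s = sin (real n * step_angle \<alpha> s) / sin (step_angle \<alpha> s)"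

text \<open>C + E j + F k is the n-th power of the quaternion of one interior arc combined with the
  half turn, and (p0, p1, p2, p3) is its product with the first arc c + x i + y k. The last line
  multiplies this by k and then by the last arc c' + x' i + y' k.\<close>

definition front_coords :: "real \<Rightarrow> nat \<Rightarrow> real \<Rightarrow> real \<Rightarrow> real \<times> real \<times> real \<times> real" where
  "front_coords \<alpha> n s t =
    (let C = pow_re \<alpha> n s; E = pow_im \<alpha> n s * (cos (half_excess \<alpha> s) * sin \<alpha>);
         F = pow_im \<alpha> n s * sin (half_excess \<alpha> s);
         c = cos (s / 2); x = sin \<alpha> * sin (s / 2); y = cos \<alpha> * sin (s / 2);
         c' = cos (t / 2); x' = sin \<alpha> * sin (t / 2); y' = cos \<alpha> * sin (t / 2);
         p0 = C * c - F * y; p1 = C * x + E * y; p2 = E * c + F * x; p3 = C * y + F * c - E * x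
     in (- c' * p3 + x' * p2 - y' * p0, - c' * p2 - x' * p3 - y' * p1,
         c' * p1 - y' * p2 - x' * p0, c' * p0 - y' * p3 + x' * p1))"

definition qpoint4 :: "real \<times> real \<times> real \<times> real \<Rightarrow> real^3" where
  "qpoint4 q = (case q of (a, b, c, d) \<Rightarrow> qpoint a b c d)"

context
  fixes \<alpha> :: real
  assumes \<alpha>: "0 < \<alpha>" "\<alpha> < pi / 4"
begin

lemma step_angle_bounds:
  shows "cos (step_angle \<alpha> s) = cos (half_excess \<alpha> s) * cos \<alpha>"
    and "\<alpha> \<le> step_angle \<alpha> s" "step_angle \<alpha> s < pi / 2" "0 < sin (step_angle \<alpha> s)"
proof -
  let ?D = "half_excess \<alpha> s"
  have ca: "0 < cos \<alpha>" using small_angle(2)[OF \<alpha>] .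
  have D: "- (pi / 2) < ?D" "?D < pi / 2" unfolding half_excess_def by (rule arctan_lbound arctan_ubound)+
  have cD: "0 < cos ?D" using D by (intro cos_gt_zero_pi) auto
  have pos: "0 < cos ?D * cos \<alpha>" using cD ca by simp
  have le: "cos ?D * cos \<alpha> \<le> 1 * cos \<alpha>" using ca by (intro mult_right_mono) auto
  then have le1: "cos ?D * cos \<alpha> \<le> 1" by (simp add: order_trans[OF _ cos_le_one])
  show c: "cos (step_angle \<alpha> s) = cos ?D * cos \<alpha>"
    unfolding step_angle_def using pos le1 by (intro cos_arccos) auto
  have "arccos (cos \<alpha>) \<le> arccos (cos ?D * cos \<alpha>)"
    using le pos by (intro arccos_le_arccos) auto
  then show lo: "\<alpha> \<le> step_angle \<alpha> s"
    using \<alpha> by (simp add: step_angle_def arccos_cos)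
  have "arccos (cos ?D * cos \<alpha>) < arccos 0" using pos le1 by (intro arccos_less_arccos) auto
  then show hi: "step_angle \<alpha> s < pi / 2" by (simp add: step_angle_def)
  show "0 < sin (step_angle \<alpha> s)" using lo hi \<alpha>(1) by (intro sin_gt_zero) linarith+
qed

text \<open>The squared length of the vector part of a unit quaternion with real part cos \<kappa>
  is sin^2 \<kappa>.\<close>

lemma pow_im_sin_squared: "pow_im \<alpha> n s * ((cos (half_excess \<alpha> s) * sin \<alpha>)\<^sup>2 + (sin (half_excess \<alpha> s))\<^sup>2)
    = sin (real n * step_angle \<alpha> s) * sin (step_angle \<alpha> s)"
proof -
  let ?D = "half_excess \<alpha> s" and ?k = "step_angle \<alpha> s"
  have "(sin ?k)\<^sup>2 = 1 - (cos ?D * cos \<alpha>)\<^sup>2"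
    using sin_squared_eq[of ?k] step_angle_bounds(1)[of s] by simp
  also have "\<dots> = (cos ?D * sin \<alpha>)\<^sup>2 + (sin ?D)\<^sup>2"
    by (simp add: power_mult_distrib sin_squared_eq algebra_simps)
  finally have q: "(sin ?k)\<^sup>2 = (cos ?D * sin \<alpha>)\<^sup>2 + (sin ?D)\<^sup>2" .
  show ?thesis
    using step_angle_bounds(4)[of s] unfolding q[symmetric] by (simp add: pow_im_def power2_eq_square)
qed

text \<open>Each step adds an arc of X_+ preceded by a half turn. Since v/2 = \<pi>/2 + D, this
  combination is, up to sign, the fixed quaternion cos D cos \<alpha> + cos D sin \<alpha> j + sin D
  k, so the induction is the addition theorem for its powers.\<close>

lemma switching_curve_qpoint:
  assumes \<epsilon>: "\<epsilon>\<^sup>2 = 1"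
  shows "switching_curve \<alpha> n ((-1) ^ n * \<epsilon>) s = half_turn ((-1) ^ n * \<epsilon>)
    (let C = pow_re \<alpha> n s; E = pow_im \<alpha> n s * (cos (half_excess \<alpha> s) * sin \<alpha>);
         F = pow_im \<alpha> n s * sin (half_excess \<alpha> s);
         c = cos (s / 2); x = sin \<alpha> * sin (s / 2); y = cos \<alpha> * sin (s / 2)
     in qpoint (C * c - F * y) (C * x + E * y) (E * c + F * x) (C * y + F * c - E * x))"
proof (induction n)
  case 0
  have "flow \<alpha> \<epsilon> s north = half_turn \<epsilon> (flow \<alpha> 1 s (qpoint 1 0 0 0))"
    using flow_half_turn[of \<epsilon> 1 \<alpha> s north] \<epsilon> by (simp add: half_turn_north qpoint_1)
  then show ?case
    by (simp add: flow_qpoint[OF _ refl refl refl] pow_re_def pow_im_def)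
next
  case (Suc n)
  let ?D = "half_excess \<alpha> s" and ?k = "step_angle \<alpha> s"
  define \<sigma> where "\<sigma> = (-1) ^ n * \<epsilon>"
  have \<sigma>: "\<sigma>\<^sup>2 = 1" using \<epsilon> by (simp add: \<sigma>_def power_minus_one_square)
  define C where "C = pow_re \<alpha> n s"
  define S where "S = pow_im \<alpha> n s"
  define e where "e = cos ?D * sin \<alpha>"
  define f where "f = sin ?D"
  define g where "g = cos ?D * cos \<alpha>"
  define c where "c = cos (s / 2)"
  define x where "x = sin \<alpha> * sin (s / 2)"
  define y where "y = cos \<alpha> * sin (s / 2)"
  define P where "P = qpoint (C * c - S * f * y) (C * x + S * e * y) (S * e * c + S * f * x) (C * y + S * f * c - S * e * x)"
  have IH: "switching_curve \<alpha> n \<sigma> s = half_turn \<sigma> P"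
    using Suc by (simp add: \<sigma>_def C_def S_def e_def f_def c_def x_def y_def P_def Let_def)
  have m: "half_turn \<sigma> P = half_turn (- \<sigma>) (half_turn (-1) P)" by (simp add: half_turn_mult)
  have v: "v_dur \<alpha> s / 2 = pi / 2 + ?D" by (simp add: v_dur_half_excess add_divide_distrib)
  have cv: "- f = cos (v_dur \<alpha> s / 2)" "e = 1 * sin \<alpha> * sin (v_dur \<alpha> s / 2)" "g = cos \<alpha> * sin (v_dur \<alpha> s / 2)"
    unfolding v by (simp_all add: cos_add sin_add f_def e_def g_def)
  have gk: "g = cos ?k" by (simp add: g_def step_angle_bounds(1))
  have nk: "real (Suc n) * ?k = real n * ?k + ?k" by (simp add: algebra_simps)
  have C': "pow_re \<alpha> (Suc n) s = g * C - S * (e * e + f * f)"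
    using pow_im_sin_squared[of n s] unfolding pow_re_def nk cos_add
    by (simp add: pow_re_def gk C_def S_def e_def f_def power2_eq_square mult.commute)
  have S': "pow_im \<alpha> (Suc n) s = g * S + C"
    using step_angle_bounds(4)[of s] unfolding pow_im_def nk sin_add
    by (simp add: pow_re_def pow_im_def gk C_def S_def add_divide_distrib mult.commute)
  have "switching_curve \<alpha> (Suc n) ((-1) ^ Suc n * \<epsilon>) s = flow \<alpha> (- \<sigma>) (v_dur \<alpha> s) (switching_curve \<alpha> n \<sigma> s)"
    by (simp add: \<sigma>_def)
  also have "\<dots> = half_turn (- \<sigma>) (flow \<alpha> 1 (v_dur \<alpha> s) (half_turn (-1) P))"
    unfolding IH m using flow_half_turn[of "- \<sigma>" 1 \<alpha> "v_dur \<alpha> s" "half_turn (-1) P"] \<sigma> by simp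
  also have "flow \<alpha> 1 (v_dur \<alpha> s) (half_turn (-1) P) =
      qpoint (pow_re \<alpha> (Suc n) s * c - pow_im \<alpha> (Suc n) s * f * y)
        (pow_re \<alpha> (Suc n) s * x + pow_im \<alpha> (Suc n) s * e * y)
        (pow_im \<alpha> (Suc n) s * e * c + pow_im \<alpha> (Suc n) s * f * x)
        (pow_re \<alpha> (Suc n) s * y + pow_im \<alpha> (Suc n) s * f * c - pow_im \<alpha> (Suc n) s * e * x)"
    unfolding P_def half_turn_qpoint flow_qpoint[OF one_power2 cv] C' S'
    by (subst qpoint_minus[symmetric]) (simp add: algebra_simps)
  finally show ?case
    by (simp add: \<sigma>_def e_def f_def c_def x_def y_def Let_def)
qed

lemma bang_bang_arc:
  assumes \<tau>: "0 \<le> \<tau>" "\<tau> \<le> v_dur \<alpha> s" and \<epsilon>: "\<epsilon>\<^sup>2 = 1"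
  shows "bang_bang \<alpha> \<epsilon> s (s + real n * v_dur \<alpha> s + \<tau>) =
    flow \<alpha> (- ((-1) ^ n * \<epsilon>)) \<tau> (switching_curve \<alpha> n ((-1) ^ n * \<epsilon>) s)"
proof (cases "\<tau> = 0")
  case True
  have "(-1) ^ n * ((-1) ^ n * \<epsilon>) = \<epsilon>" by (simp add: mult.assoc[symmetric] power_mult_distrib[symmetric])
  then have "bang_bang \<alpha> \<epsilon> s (s + real n * v_dur \<alpha> s) = switching_curve \<alpha> n ((-1) ^ n * \<epsilon>) s"
    using bang_bang_at_switching_curve[of \<alpha> n "(-1) ^ n * \<epsilon>" s] by simp
  then show ?thesis using \<epsilon> by (simp add: True power_minus_one_square)
next
  case False
  have i: "nat (\<lceil>(s + real n * v_dur \<alpha> s + \<tau> - s) / v_dur \<alpha> s\<rceil> - 1) = n"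
    by (rule arc_index[OF v_dur_pos]) (use False \<tau> in auto)
  have "0 \<le> real n * v_dur \<alpha> s" using v_dur_pos[of \<alpha> s] by simp
  then have "\<not> s + real n * v_dur \<alpha> s + \<tau> \<le> s" using False \<tau> by linarith
  then show ?thesis unfolding bang_bang_def Let_def i by simp
qed

lemma bang_bang_front_coords:
  assumes \<tau>: "0 \<le> \<tau>" "\<tau> \<le> v_dur \<alpha> s" and \<epsilon>: "\<epsilon>\<^sup>2 = 1"
  shows "bang_bang \<alpha> \<epsilon> s (s + real n * v_dur \<alpha> s + \<tau>) =
    half_turn (- ((-1) ^ n * \<epsilon>)) (qpoint4 (front_coords \<alpha> n s \<tau>))"
proof -
  define \<sigma> where "\<sigma> = (-1) ^ n * \<epsilon>"
  have \<sigma>: "\<sigma>\<^sup>2 = 1" using \<epsilon> by (simp add: \<sigma>_def power_minus_one_square)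
  have m: "half_turn \<sigma> P = half_turn (- \<sigma>) (half_turn (-1) P)" for P by (simp add: half_turn_mult)
  have fl: "flow \<alpha> (- \<sigma>) \<tau> (half_turn \<sigma> P) = half_turn (- \<sigma>) (flow \<alpha> 1 \<tau> (half_turn (-1) P))" for P
    unfolding m using flow_half_turn[of "- \<sigma>" 1 \<alpha> \<tau> "half_turn (-1) P"] \<sigma> by simp
  show ?thesis
    unfolding bang_bang_arc[OF assms] \<sigma>_def[symmetric]
    unfolding switching_curve_qpoint[OF \<epsilon>, of n s, folded \<sigma>_def] fl
      Let_def half_turn_qpoint flow_qpoint[OF one_power2 refl refl refl] front_coords_def qpoint4_def prod.case
    by (simp add: algebra_simps)
qed

lemma front_coords_0:
  "fst (front_coords \<alpha> n s t) = sin ((s + t) / 2) * (pow_im \<alpha> n s * (cos (half_excess \<alpha> s) * (sin \<alpha>)\<^sup>2) - cos \<alpha> * pow_re \<alpha> n s)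
    - pow_im \<alpha> n s * sin (half_excess \<alpha> s) * cos ((s + t) / 2)"
proof -
  have sc: "sin \<alpha> * sin \<alpha> + cos \<alpha> * cos \<alpha> = 1"
    using sin_cos_squared_add[of \<alpha>] by (simp add: power2_eq_square)
  show ?thesis
    unfolding front_coords_def Let_def fst_conv add_divide_distrib sin_add cos_add power2_eq_square
    using sc by algebra
qed

lemma front_coords_3:
  "snd (snd (snd (front_coords \<alpha> n s t))) =
    pow_re \<alpha> n s * (cos ((s + t) / 2) + 2 * (sin \<alpha>)\<^sup>2 * (sin (s / 2) * sin (t / 2)))
    - cos \<alpha> * (pow_im \<alpha> n s * sin (half_excess \<alpha> s) * sin ((s + t) / 2))
    + 2 * (sin (s / 2) * sin (t / 2)) * (pow_im \<alpha> n s * (cos (half_excess \<alpha> s) * (sin \<alpha>)\<^sup>2) * cos \<alpha>)"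
proof -
  have sc: "sin \<alpha> * sin \<alpha> + cos \<alpha> * cos \<alpha> = 1"
    using sin_cos_squared_add[of \<alpha>] by (simp add: power2_eq_square)
  show ?thesis
    unfolding front_coords_def Let_def snd_conv add_divide_distrib sin_add cos_add power2_eq_square
    using sc by algebra
qed

end

subsection \<open>Uniform first-order asymptotics\<close>

text \<open>O(\<alpha>^k) uniformly in s, with a Lipschitz constant in s of the same order. It plays
  the role of a C^1 estimate without derivatives and is stable under products and
  compositions.\<close>

definition lip_order :: "nat \<Rightarrow> (real \<Rightarrow> real \<Rightarrow> real) \<Rightarrow> bool" where
  "lip_order k f \<longleftrightarrow> (\<exists>C\<ge>0. \<exists>a>0. \<forall>\<alpha>. 0 < \<alpha> \<and> \<alpha> < a \<longrightarrow>
     (\<forall>s\<in>{0..pi}. \<bar>f \<alpha> s\<bar> \<le> C * \<alpha> ^ k) \<and>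
     (\<forall>s\<in>{0..pi}. \<forall>s'\<in>{0..pi}. \<bar>f \<alpha> s - f \<alpha> s'\<bar> \<le> C * \<alpha> ^ k * \<bar>s - s'\<bar>))"

lemma lip_orderE:
  assumes "lip_order k f"
  obtains C a where "0 \<le> C" "0 < a"
    "\<And>\<alpha> s. 0 < \<alpha> \<Longrightarrow> \<alpha> < a \<Longrightarrow> s \<in> {0..pi} \<Longrightarrow> \<bar>f \<alpha> s\<bar> \<le> C * \<alpha> ^ k"
    "\<And>\<alpha> s s'. 0 < \<alpha> \<Longrightarrow> \<alpha> < a \<Longrightarrow> s \<in> {0..pi} \<Longrightarrow> s' \<in> {0..pi} \<Longrightarrow>
       \<bar>f \<alpha> s - f \<alpha> s'\<bar> \<le> C * \<alpha> ^ k * \<bar>s - s'\<bar>"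
  using assms unfolding lip_order_def by blast

lemma lip_orderI:
  assumes "0 \<le> C" "0 < a"
    "\<And>\<alpha> s. 0 < \<alpha> \<Longrightarrow> \<alpha> < a \<Longrightarrow> s \<in> {0..pi} \<Longrightarrow> \<bar>f \<alpha> s\<bar> \<le> C * \<alpha> ^ k"
    "\<And>\<alpha> s s'. 0 < \<alpha> \<Longrightarrow> \<alpha> < a \<Longrightarrow> s \<in> {0..pi} \<Longrightarrow> s' \<in> {0..pi} \<Longrightarrow>
       \<bar>f \<alpha> s - f \<alpha> s'\<bar> \<le> C * \<alpha> ^ k * \<bar>s - s'\<bar>"
  shows "lip_order k f"
  using assms unfolding lip_order_def by blast

lemma lip_order_cong:
  assumes f: "lip_order k f" and "0 < b"
    and eq: "\<And>\<alpha> s. 0 < \<alpha> \<Longrightarrow> \<alpha> < b \<Longrightarrow> s \<in> {0..pi} \<Longrightarrow> g \<alpha> s = f \<alpha> s"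
  shows "lip_order k g"
proof -
  obtain C a where C: "0 \<le> C" "0 < a"
    "\<And>\<alpha> s. 0 < \<alpha> \<Longrightarrow> \<alpha> < a \<Longrightarrow> s \<in> {0..pi} \<Longrightarrow> \<bar>f \<alpha> s\<bar> \<le> C * \<alpha> ^ k"
    "\<And>\<alpha> s s'. 0 < \<alpha> \<Longrightarrow> \<alpha> < a \<Longrightarrow> s \<in> {0..pi} \<Longrightarrow> s' \<in> {0..pi} \<Longrightarrow>
       \<bar>f \<alpha> s - f \<alpha> s'\<bar> \<le> C * \<alpha> ^ k * \<bar>s - s'\<bar>"
    by (rule lip_orderE[OF f]) blast
  show ?thesis
    by (rule lip_orderI[of C "min a b"]) (use C eq \<open>0 < b\<close> in auto)
qed

text \<open>The comparison of g with f is assumed only where |f| \<le> \<delta>; a positive order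
  makes f that small for all small \<alpha>.\<close>

lemma lip_order_dominated:
  assumes f: "lip_order k f" and K: "0 \<le> K" and b: "0 < b" and \<delta>: "0 < \<delta>" and k: "0 < k \<or> \<delta> = 0"
    and 1: "\<And>\<alpha> s. 0 < \<alpha> \<Longrightarrow> \<alpha> < b \<Longrightarrow> s \<in> {0..pi} \<Longrightarrow> \<bar>f \<alpha> s\<bar> \<le> \<delta> \<Longrightarrow> \<bar>g \<alpha> s\<bar> \<le> K * \<bar>f \<alpha> s\<bar>"
    and 2: "\<And>\<alpha> s s'. 0 < \<alpha> \<Longrightarrow> \<alpha> < b \<Longrightarrow> s \<in> {0..pi} \<Longrightarrow> s' \<in> {0..pi} \<Longrightarrow> \<bar>f \<alpha> s\<bar> \<le> \<delta> \<Longrightarrow> \<bar>f \<alpha> s'\<bar> \<le> \<delta> \<Longrightarrow>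
        \<bar>g \<alpha> s - g \<alpha> s'\<bar> \<le> K * \<bar>f \<alpha> s - f \<alpha> s'\<bar>"
  shows "lip_order k g"
proof -
  obtain C a where C: "0 \<le> C" "0 < a"
    "\<And>\<alpha> s. 0 < \<alpha> \<Longrightarrow> \<alpha> < a \<Longrightarrow> s \<in> {0..pi} \<Longrightarrow> \<bar>f \<alpha> s\<bar> \<le> C * \<alpha> ^ k"
    "\<And>\<alpha> s s'. 0 < \<alpha> \<Longrightarrow> \<alpha> < a \<Longrightarrow> s \<in> {0..pi} \<Longrightarrow> s' \<in> {0..pi} \<Longrightarrow>
       \<bar>f \<alpha> s - f \<alpha> s'\<bar> \<le> C * \<alpha> ^ k * \<bar>s - s'\<bar>"
    by (rule lip_orderE[OF f]) blast
  have k: "0 < k" using k \<delta> by simp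
  define c where "c = min (min a b) (min 1 (\<delta> / (C + 1)))"
  have c: "0 < c" "c \<le> a" "c \<le> b" "c \<le> 1" "c \<le> \<delta> / (C + 1)"
    using C b \<delta> by (auto simp: c_def)
  have small: "\<bar>f \<alpha> s\<bar> \<le> \<delta>" if "0 < \<alpha>" "\<alpha> < c" "s \<in> {0..pi}" for \<alpha> s
  proof -
    have "\<alpha> ^ k \<le> \<alpha> ^ 1" using k that c by (intro power_decreasing) auto
    then have "C * \<alpha> ^ k \<le> (C + 1) * \<alpha>" using C(1) that by (intro mult_mono) auto
    also have "\<dots> \<le> (C + 1) * c" using that C(1) by (intro mult_left_mono) auto
    also have "\<dots> \<le> \<delta>" using c(5) C(1) by (simp add: pos_le_divide_eq mult.commute)
    finally show ?thesis using C(3)[of \<alpha> s] that c by simp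
  qed
  show ?thesis
  proof (rule lip_orderI[of "K * C" c])
    fix \<alpha> s assume A: "0 < \<alpha>" "\<alpha> < c" "s \<in> {0..pi}"
    have "\<bar>g \<alpha> s\<bar> \<le> K * \<bar>f \<alpha> s\<bar>" using 1[of \<alpha> s] small[OF A] A c by simp
    also have "\<dots> \<le> K * (C * \<alpha> ^ k)" using C(3)[of \<alpha> s] A c K by (intro mult_left_mono) auto
    finally show "\<bar>g \<alpha> s\<bar> \<le> K * C * \<alpha> ^ k" by (simp add: mult.assoc)
  next
    fix \<alpha> s s' assume A: "0 < \<alpha>" "\<alpha> < c" "s \<in> {0..pi}" "s' \<in> {0..pi}"
    have "\<bar>g \<alpha> s - g \<alpha> s'\<bar> \<le> K * \<bar>f \<alpha> s - f \<alpha> s'\<bar>"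
      using 2[of \<alpha> s s'] small[OF A(1-3)] small[OF A(1,2,4)] A c by simp
    also have "\<dots> \<le> K * (C * \<alpha> ^ k * \<bar>s - s'\<bar>)" using C(4)[of \<alpha> s s'] A c K by (intro mult_left_mono) auto
    finally show "\<bar>g \<alpha> s - g \<alpha> s'\<bar> \<le> K * C * \<alpha> ^ k * \<bar>s - s'\<bar>" by (simp add: mult.assoc)
  qed (use C K c in auto)
qed

lemma lip_order_lipschitz:
  assumes f: "lip_order k f" and \<phi>: "\<And>x y. \<bar>\<phi> x - \<phi> y\<bar> \<le> \<bar>x - y\<bar>" "\<phi> 0 = (0::real)"
  shows "lip_order k (\<lambda>\<alpha> s. \<phi> (f \<alpha> s))"
proof -
  obtain C a where C: "0 \<le> C" "0 < a"
    "\<And>\<alpha> s. 0 < \<alpha> \<Longrightarrow> \<alpha> < a \<Longrightarrow> s \<in> {0..pi} \<Longrightarrow> \<bar>f \<alpha> s\<bar> \<le> C * \<alpha> ^ k"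
    "\<And>\<alpha> s s'. 0 < \<alpha> \<Longrightarrow> \<alpha> < a \<Longrightarrow> s \<in> {0..pi} \<Longrightarrow> s' \<in> {0..pi} \<Longrightarrow>
       \<bar>f \<alpha> s - f \<alpha> s'\<bar> \<le> C * \<alpha> ^ k * \<bar>s - s'\<bar>"
    by (rule lip_orderE[OF f]) blast
  show ?thesis
  proof (rule lip_orderI[OF C(1,2)])
    fix \<alpha> s assume A: "0 < \<alpha>" "\<alpha> < a" "s \<in> {0..pi}"
    show "\<bar>\<phi> (f \<alpha> s)\<bar> \<le> C * \<alpha> ^ k" using \<phi>(1)[of "f \<alpha> s" 0] C(3)[OF A] by (simp add: \<phi>(2))
  next
    fix \<alpha> s s' assume A: "0 < \<alpha>" "\<alpha> < a" "s \<in> {0..pi}" "s' \<in> {0..pi}"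
    show "\<bar>\<phi> (f \<alpha> s) - \<phi> (f \<alpha> s')\<bar> \<le> C * \<alpha> ^ k * \<bar>s - s'\<bar>"
      using \<phi>(1) C(4)[OF A] by (rule order_trans)
  qed
qed

lemma lip_order_add:
  assumes f: "lip_order k f" and g: "lip_order k g"
  shows "lip_order k (\<lambda>\<alpha> s. f \<alpha> s + g \<alpha> s)"
proof -
  obtain C a where C: "0 \<le> C" "0 < a"
    "\<And>\<alpha> s. 0 < \<alpha> \<Longrightarrow> \<alpha> < a \<Longrightarrow> s \<in> {0..pi} \<Longrightarrow> \<bar>f \<alpha> s\<bar> \<le> C * \<alpha> ^ k"
    "\<And>\<alpha> s s'. 0 < \<alpha> \<Longrightarrow> \<alpha> < a \<Longrightarrow> s \<in> {0..pi} \<Longrightarrow> s' \<in> {0..pi} \<Longrightarrow>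
       \<bar>f \<alpha> s - f \<alpha> s'\<bar> \<le> C * \<alpha> ^ k * \<bar>s - s'\<bar>"
    by (rule lip_orderE[OF f]) blast
  obtain D b where D: "0 \<le> D" "0 < b"
    "\<And>\<alpha> s. 0 < \<alpha> \<Longrightarrow> \<alpha> < b \<Longrightarrow> s \<in> {0..pi} \<Longrightarrow> \<bar>g \<alpha> s\<bar> \<le> D * \<alpha> ^ k"
    "\<And>\<alpha> s s'. 0 < \<alpha> \<Longrightarrow> \<alpha> < b \<Longrightarrow> s \<in> {0..pi} \<Longrightarrow> s' \<in> {0..pi} \<Longrightarrow>
       \<bar>g \<alpha> s - g \<alpha> s'\<bar> \<le> D * \<alpha> ^ k * \<bar>s - s'\<bar>"
    by (rule lip_orderE[OF g]) blast
  show ?thesis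
  proof (rule lip_orderI[of "C + D" "min a b"])
    fix \<alpha> s assume A: "0 < \<alpha>" "\<alpha> < min a b" "s \<in> {0..pi}"
    have "\<bar>f \<alpha> s + g \<alpha> s\<bar> \<le> C * \<alpha> ^ k + D * \<alpha> ^ k" using C(3)[of \<alpha> s] D(3)[of \<alpha> s] A by simp
    then show "\<bar>f \<alpha> s + g \<alpha> s\<bar> \<le> (C + D) * \<alpha> ^ k" by (simp add: distrib_right)
  next
    fix \<alpha> s s' assume A: "0 < \<alpha>" "\<alpha> < min a b" "s \<in> {0..pi}" "s' \<in> {0..pi}"
    have "\<bar>(f \<alpha> s + g \<alpha> s) - (f \<alpha> s' + g \<alpha> s')\<bar> \<le> C * \<alpha> ^ k * \<bar>s - s'\<bar> + D * \<alpha> ^ k * \<bar>s - s'\<bar>"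
      using C(4)[of \<alpha> s s'] D(4)[of \<alpha> s s'] A by simp
    then show "\<bar>(f \<alpha> s + g \<alpha> s) - (f \<alpha> s' + g \<alpha> s')\<bar> \<le> (C + D) * \<alpha> ^ k * \<bar>s - s'\<bar>"
      by (simp add: distrib_right)
  qed (use C D in auto)
qed

lemma lip_order_mult:
  assumes f: "lip_order k f" and g: "lip_order l g"
  shows "lip_order (k + l) (\<lambda>\<alpha> s. f \<alpha> s * g \<alpha> s)"
proof -
  obtain C a where C: "0 \<le> C" "0 < a"
    "\<And>\<alpha> s. 0 < \<alpha> \<Longrightarrow> \<alpha> < a \<Longrightarrow> s \<in> {0..pi} \<Longrightarrow> \<bar>f \<alpha> s\<bar> \<le> C * \<alpha> ^ k"
    "\<And>\<alpha> s s'. 0 < \<alpha> \<Longrightarrow> \<alpha> < a \<Longrightarrow> s \<in> {0..pi} \<Longrightarrow> s' \<in> {0..pi} \<Longrightarrow>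
       \<bar>f \<alpha> s - f \<alpha> s'\<bar> \<le> C * \<alpha> ^ k * \<bar>s - s'\<bar>"
    by (rule lip_orderE[OF f]) blast
  obtain D b where D: "0 \<le> D" "0 < b"
    "\<And>\<alpha> s. 0 < \<alpha> \<Longrightarrow> \<alpha> < b \<Longrightarrow> s \<in> {0..pi} \<Longrightarrow> \<bar>g \<alpha> s\<bar> \<le> D * \<alpha> ^ l"
    "\<And>\<alpha> s s'. 0 < \<alpha> \<Longrightarrow> \<alpha> < b \<Longrightarrow> s \<in> {0..pi} \<Longrightarrow> s' \<in> {0..pi} \<Longrightarrow>
       \<bar>g \<alpha> s - g \<alpha> s'\<bar> \<le> D * \<alpha> ^ l * \<bar>s - s'\<bar>"
    by (rule lip_orderE[OF g]) blast
  show ?thesis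
  proof (rule lip_orderI[of "2 * (C * D)" "min a b"])
    fix \<alpha> s assume A: "0 < \<alpha>" "\<alpha> < min a b" "s \<in> {0..pi}"
    have "\<bar>f \<alpha> s * g \<alpha> s\<bar> \<le> (C * \<alpha> ^ k) * (D * \<alpha> ^ l)"
      unfolding abs_mult using C D A by (intro mult_mono) auto
    moreover have "0 \<le> (C * \<alpha> ^ k) * (D * \<alpha> ^ l)" using C D A by simp
    ultimately show "\<bar>f \<alpha> s * g \<alpha> s\<bar> \<le> 2 * (C * D) * \<alpha> ^ (k + l)"
      by (simp add: power_add mult_ac)
  next
    fix \<alpha> s s' assume A: "0 < \<alpha>" "\<alpha> < min a b" "s \<in> {0..pi}" "s' \<in> {0..pi}"
    have "f \<alpha> s * g \<alpha> s - f \<alpha> s' * g \<alpha> s' = (f \<alpha> s - f \<alpha> s') * g \<alpha> s + f \<alpha> s' * (g \<alpha> s - g \<alpha> s')"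
      by (simp add: algebra_simps)
    also have "\<bar>\<dots>\<bar> \<le> \<bar>f \<alpha> s - f \<alpha> s'\<bar> * \<bar>g \<alpha> s\<bar> + \<bar>f \<alpha> s'\<bar> * \<bar>g \<alpha> s - g \<alpha> s'\<bar>"
      unfolding abs_mult[symmetric] by (rule abs_triangle_ineq)
    also have "\<dots> \<le> (C * \<alpha> ^ k * \<bar>s - s'\<bar>) * (D * \<alpha> ^ l) + (C * \<alpha> ^ k) * (D * \<alpha> ^ l * \<bar>s - s'\<bar>)"
      using C D A by (intro add_mono mult_mono) auto
    also have "\<dots> = 2 * (C * D) * \<alpha> ^ (k + l) * \<bar>s - s'\<bar>" by (simp add: power_add)
    finally show "\<bar>f \<alpha> s * g \<alpha> s - f \<alpha> s' * g \<alpha> s'\<bar> \<le> 2 * (C * D) * \<alpha> ^ (k + l) * \<bar>s - s'\<bar>" .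
  qed (use C D in auto)
qed

lemma lip_order_mono:
  assumes f: "lip_order k f" and l: "l \<le> k"
  shows "lip_order l f"
proof -
  obtain C a where C: "0 \<le> C" "0 < a"
    "\<And>\<alpha> s. 0 < \<alpha> \<Longrightarrow> \<alpha> < a \<Longrightarrow> s \<in> {0..pi} \<Longrightarrow> \<bar>f \<alpha> s\<bar> \<le> C * \<alpha> ^ k"
    "\<And>\<alpha> s s'. 0 < \<alpha> \<Longrightarrow> \<alpha> < a \<Longrightarrow> s \<in> {0..pi} \<Longrightarrow> s' \<in> {0..pi} \<Longrightarrow>
       \<bar>f \<alpha> s - f \<alpha> s'\<bar> \<le> C * \<alpha> ^ k * \<bar>s - s'\<bar>"
    by (rule lip_orderE[OF f]) blast
  have p: "C * \<alpha> ^ k \<le> C * \<alpha> ^ l" if "0 < \<alpha>" "\<alpha> < min a 1" for \<alpha>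
    using that C l by (intro mult_left_mono power_decreasing) auto
  show ?thesis
  proof (rule lip_orderI[of C "min a 1"])
    fix \<alpha> s assume A: "0 < \<alpha>" "\<alpha> < min a 1" "s \<in> {0..pi}"
    show "\<bar>f \<alpha> s\<bar> \<le> C * \<alpha> ^ l" using C(3)[of \<alpha> s] p[OF A(1,2)] A by simp
  next
    fix \<alpha> s s' assume A: "0 < \<alpha>" "\<alpha> < min a 1" "s \<in> {0..pi}" "s' \<in> {0..pi}"
    have "\<bar>f \<alpha> s - f \<alpha> s'\<bar> \<le> C * \<alpha> ^ k * \<bar>s - s'\<bar>" using C(4)[of \<alpha> s s'] A by simp
    also have "\<dots> \<le> C * \<alpha> ^ l * \<bar>s - s'\<bar>" using p[OF A(1,2)] by (intro mult_right_mono) auto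
    finally show "\<bar>f \<alpha> s - f \<alpha> s'\<bar> \<le> C * \<alpha> ^ l * \<bar>s - s'\<bar>" .
  qed (use C in auto)
qed

lemma lip_order_param:
  assumes "0 \<le> C" "0 < a" "\<And>\<alpha>. 0 < \<alpha> \<Longrightarrow> \<alpha> < a \<Longrightarrow> \<bar>g \<alpha>\<bar> \<le> C * \<alpha> ^ k"
  shows "lip_order k (\<lambda>\<alpha> s. g \<alpha>)"
  by (rule lip_orderI[of C a]) (use assms in auto)

lemma lip_order_const: "lip_order 0 (\<lambda>\<alpha> s. c)"
  by (rule lip_order_param[of "\<bar>c\<bar>" 1]) auto

lemma lip_order_ident: "lip_order 1 (\<lambda>\<alpha> s. \<alpha>)"
  by (rule lip_order_param[of 1 1]) auto

lemma lip_order_fixed: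
  assumes "0 \<le> B" "\<And>s. \<bar>h s\<bar> \<le> B" "\<And>s s'. \<bar>h s - h s'\<bar> \<le> \<bar>s - s'\<bar>"
  shows "lip_order 0 (\<lambda>\<alpha> s. h s)"
proof (rule lip_orderI[of "max B 1" 1])
  fix s s' :: real
  have "\<bar>h s - h s'\<bar> \<le> 1 * \<bar>s - s'\<bar>" using assms(3) by simp
  also have "\<dots> \<le> max B 1 * \<bar>s - s'\<bar>" by (intro mult_right_mono) auto
  finally show "\<bar>h s - h s'\<bar> \<le> max B 1 * \<alpha> ^ 0 * \<bar>s - s'\<bar>" for \<alpha> by simp
qed (use assms in \<open>auto simp: le_max_iff_disj\<close>)

lemma lip_order_minus: "lip_order k f \<Longrightarrow> lip_order k (\<lambda>\<alpha> s. - f \<alpha> s)"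
  by (rule lip_order_lipschitz[where \<phi> = uminus]) auto

lemma lip_order_diff: "lip_order k f \<Longrightarrow> lip_order k g \<Longrightarrow> lip_order k (\<lambda>\<alpha> s. f \<alpha> s - g \<alpha> s)"
  using lip_order_add[OF _ lip_order_minus] by simp

lemma lip_order_mult_le:
  "lip_order k f \<Longrightarrow> lip_order l g \<Longrightarrow> m \<le> k + l \<Longrightarrow> lip_order m (\<lambda>\<alpha> s. f \<alpha> s * g \<alpha> s)"
  using lip_order_mono[OF lip_order_mult] by blast

text \<open>A factor of size 1/\<alpha>, such as the number of arcs, costs exactly one
  order.\<close>

lemma lip_order_divide:
  assumes f: "lip_order (Suc k) f" and c: "0 \<le> c" "0 < b" "\<And>\<alpha>. 0 < \<alpha> \<Longrightarrow> \<alpha> < b \<Longrightarrow> \<bar>g \<alpha>\<bar> \<le> c / \<alpha>"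
  shows "lip_order k (\<lambda>\<alpha> s. g \<alpha> * f \<alpha> s)"
proof -
  obtain C a where C: "0 \<le> C" "0 < a"
    "\<And>\<alpha> s. 0 < \<alpha> \<Longrightarrow> \<alpha> < a \<Longrightarrow> s \<in> {0..pi} \<Longrightarrow> \<bar>f \<alpha> s\<bar> \<le> C * \<alpha> ^ Suc k"
    "\<And>\<alpha> s s'. 0 < \<alpha> \<Longrightarrow> \<alpha> < a \<Longrightarrow> s \<in> {0..pi} \<Longrightarrow> s' \<in> {0..pi} \<Longrightarrow>
       \<bar>f \<alpha> s - f \<alpha> s'\<bar> \<le> C * \<alpha> ^ Suc k * \<bar>s - s'\<bar>"
    by (rule lip_orderE[OF f]) blast
  show ?thesis
  proof (rule lip_orderI[of "c * C" "min a b"])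
    fix \<alpha> s assume A: "0 < \<alpha>" "\<alpha> < min a b" "s \<in> {0..pi}"
    have "\<bar>g \<alpha> * f \<alpha> s\<bar> \<le> (c / \<alpha>) * (C * \<alpha> ^ Suc k)"
      unfolding abs_mult using C(1) C(3)[of \<alpha> s] c(1) c(3)[of \<alpha>] A by (intro mult_mono) auto
    then show "\<bar>g \<alpha> * f \<alpha> s\<bar> \<le> c * C * \<alpha> ^ k" using A by simp
  next
    fix \<alpha> s s' assume A: "0 < \<alpha>" "\<alpha> < min a b" "s \<in> {0..pi}" "s' \<in> {0..pi}"
    have "\<bar>g \<alpha> * f \<alpha> s - g \<alpha> * f \<alpha> s'\<bar> = \<bar>g \<alpha>\<bar> * \<bar>f \<alpha> s - f \<alpha> s'\<bar>"
      by (simp add: right_diff_distrib[symmetric] abs_mult)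
    also have "\<dots> \<le> (c / \<alpha>) * (C * \<alpha> ^ Suc k * \<bar>s - s'\<bar>)"
      using C(1) C(4)[of \<alpha> s s'] c(1) c(3)[of \<alpha>] A by (intro mult_mono) auto
    also have "\<dots> = c * C * \<alpha> ^ k * \<bar>s - s'\<bar>" using A by simp
    finally show "\<bar>g \<alpha> * f \<alpha> s - g \<alpha> * f \<alpha> s'\<bar> \<le> c * C * \<alpha> ^ k * \<bar>s - s'\<bar>" .
  qed (use C c in auto)
qed

lemma abs_sin_diff_le: "\<bar>sin x - sin y\<bar> \<le> \<bar>x - y\<bar>" for x y :: real
proof -
  have "\<bar>sin x - sin y\<bar> = 2 * (\<bar>sin ((x - y) / 2)\<bar> * \<bar>cos ((x + y) / 2)\<bar>)"
    by (simp add: sin_diff_sin abs_mult)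
  also have "\<dots> \<le> 2 * (\<bar>(x - y) / 2\<bar> * 1)"
    by (intro mult_left_mono mult_mono abs_sin_x_le_abs_x) auto
  finally show ?thesis by simp
qed

lemma abs_cos_diff_le: "\<bar>cos x - cos y\<bar> \<le> M * \<bar>x - y\<bar>" if "\<bar>x\<bar> \<le> M" "\<bar>y\<bar> \<le> M" for x y :: real
proof -
  have "\<bar>cos x - cos y\<bar> = 2 * (\<bar>sin ((x + y) / 2)\<bar> * \<bar>sin ((y - x) / 2)\<bar>)"
    by (simp add: cos_diff_cos abs_mult)
  also have "\<dots> \<le> 2 * (\<bar>(x + y) / 2\<bar> * \<bar>(y - x) / 2\<bar>)"
    by (intro mult_left_mono mult_mono abs_sin_x_le_abs_x) auto
  also have "\<dots> \<le> 2 * (M * \<bar>(y - x) / 2\<bar>)"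
    using that by (intro mult_left_mono mult_right_mono) auto
  finally show ?thesis by (simp add: abs_minus_commute)
qed

lemma abs_cos_diff_le1: "\<bar>cos x - cos y\<bar> \<le> \<bar>x - y\<bar>" for x y :: real
  using abs_sin_diff_le[of "pi / 2 - x" "pi / 2 - y"] by (simp add: sin_diff abs_minus_commute)

lemma lip_order_sin: "lip_order k f \<Longrightarrow> lip_order k (\<lambda>\<alpha> s. sin (f \<alpha> s))"
  by (rule lip_order_lipschitz[where \<phi> = sin]) (auto intro: abs_sin_diff_le)

lemma lip_order_arctan: "lip_order k f \<Longrightarrow> lip_order k (\<lambda>\<alpha> s. arctan (f \<alpha> s))"
proof (rule lip_order_lipschitz[where \<phi> = arctan])
  show "\<bar>arctan x - arctan y\<bar> \<le> \<bar>x - y\<bar>" for x y :: real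
  proof -
    have "norm (arctan x - arctan y) \<le> 1 * norm (x - y)"
    proof (rule field_differentiable_bound[of UNIV _ "\<lambda>z. inverse (1 + z\<^sup>2)"])
      show "(arctan has_field_derivative inverse (1 + z\<^sup>2)) (at z within UNIV)" for z
        using DERIV_arctan[of z] by simp
      show "norm (inverse (1 + z\<^sup>2)) \<le> 1" for z :: real
        by (simp add: abs_of_nonneg inverse_le_1_iff)
    qed auto
    then show ?thesis by simp
  qed
  assume "lip_order k f"
  then show "lip_order k f" .
qed (rule arctan_zero_zero)

text \<open>1 - cos x = 2 sin^2(x/2) doubles the order. This is why the excess of the arcs, itself
  of order 2, enters the step angle only through a quantity of order 4.\<close>

lemma lip_order_one_minus_cos:
  assumes "lip_order k f"
  shows "lip_order (2 * k) (\<lambda>\<alpha> s. 1 - cos (f \<alpha> s))"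
proof -
  have "1 - cos x = 2 * (sin (x / 2) * sin (x / 2))" for x :: real
    using cos_double_sin[of "x / 2"] by (simp add: power2_eq_square)
  moreover have h: "lip_order k (\<lambda>\<alpha> s. sin (f \<alpha> s / 2))"
    using lip_order_sin[OF lip_order_mult[OF lip_order_const[of "1/2"] assms]] by simp
  have "lip_order (2 * k) (\<lambda>\<alpha> s. 2 * (sin (f \<alpha> s / 2) * sin (f \<alpha> s / 2)))"
    by (rule lip_order_mult_le[OF lip_order_const lip_order_mult[OF h h]]) simp
  ultimately show ?thesis by simp
qed

lemma lip_order_inverse:
  assumes f: "lip_order k f" and k: "0 < k"
  shows "lip_order k (\<lambda>\<alpha> s. 1 / (1 - f \<alpha> s) - 1)"
proof (rule lip_order_dominated[OF f, of 4 1 "1/2"])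
  have d: "1 / 2 \<le> 1 - x" if "\<bar>x\<bar> \<le> 1/2" for x :: real using that by linarith
  show "\<bar>1 / (1 - f \<alpha> s) - 1\<bar> \<le> 4 * \<bar>f \<alpha> s\<bar>" if "\<bar>f \<alpha> s\<bar> \<le> 1/2" for \<alpha> s
  proof -
    have "1 / (1 - f \<alpha> s) - 1 = f \<alpha> s * (1 / (1 - f \<alpha> s))" using d[OF that] by (simp add: field_simps)
    also have "\<bar>\<dots>\<bar> = \<bar>f \<alpha> s\<bar> * (1 / (1 - f \<alpha> s))" using d[OF that] by (simp add: abs_mult)
    also have "\<dots> \<le> \<bar>f \<alpha> s\<bar> * 4" using d[OF that] by (intro mult_left_mono) (auto simp: divide_le_eq)
    finally show ?thesis by simp
  qed
  show "\<bar>1 / (1 - f \<alpha> s) - 1 - (1 / (1 - f \<alpha> s') - 1)\<bar> \<le> 4 * \<bar>f \<alpha> s - f \<alpha> s'\<bar>"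
    if "\<bar>f \<alpha> s\<bar> \<le> 1/2" "\<bar>f \<alpha> s'\<bar> \<le> 1/2" for \<alpha> s s'
  proof -
    have p: "1/2 * (1/2) \<le> (1 - f \<alpha> s) * (1 - f \<alpha> s')" using d[OF that(1)] d[OF that(2)] by (intro mult_mono) auto
    have "1 / (1 - f \<alpha> s) - 1 - (1 / (1 - f \<alpha> s') - 1) = (f \<alpha> s - f \<alpha> s') * (1 / ((1 - f \<alpha> s) * (1 - f \<alpha> s')))"
      using d[OF that(1)] d[OF that(2)] by (simp add: field_simps)
    also have "\<bar>\<dots>\<bar> = \<bar>f \<alpha> s - f \<alpha> s'\<bar> * (1 / ((1 - f \<alpha> s) * (1 - f \<alpha> s')))"
      using p d[OF that(1)] d[OF that(2)] by (simp add: abs_mult)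
    also have "\<dots> \<le> \<bar>f \<alpha> s - f \<alpha> s'\<bar> * 4"
      using p by (intro mult_left_mono) (auto simp: divide_le_eq)
    finally show ?thesis by simp
  qed
qed (use k in auto)

text \<open>On [-M, M] the derivative cos - 1 of sin x - x is at most M^2 in absolute value;
  multiplied by the size and the variation of f, this triples the order.\<close>

lemma lip_order_sin_minus:
  assumes f: "lip_order k f"
  shows "lip_order (3 * k) (\<lambda>\<alpha> s. sin (f \<alpha> s) - f \<alpha> s)"
proof -
  obtain C a where C: "0 \<le> C" "0 < a"
    "\<And>\<alpha> s. 0 < \<alpha> \<Longrightarrow> \<alpha> < a \<Longrightarrow> s \<in> {0..pi} \<Longrightarrow> \<bar>f \<alpha> s\<bar> \<le> C * \<alpha> ^ k"
    "\<And>\<alpha> s s'. 0 < \<alpha> \<Longrightarrow> \<alpha> < a \<Longrightarrow> s \<in> {0..pi} \<Longrightarrow> s' \<in> {0..pi} \<Longrightarrow>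
       \<bar>f \<alpha> s - f \<alpha> s'\<bar> \<le> C * \<alpha> ^ k * \<bar>s - s'\<bar>"
    by (rule lip_orderE[OF f]) blast
  have b: "\<bar>(sin x - x) - (sin y - y)\<bar> \<le> M\<^sup>2 * \<bar>x - y\<bar>" if "\<bar>x\<bar> \<le> M" "\<bar>y\<bar> \<le> M" for x y M :: real
  proof -
    have "norm ((sin x - x) - (sin y - y)) \<le> M\<^sup>2 * norm (x - y)"
    proof (rule field_differentiable_bound[of "{-M..M}" "\<lambda>x. sin x - x" "\<lambda>z. cos z - 1"])
      show "((\<lambda>x. sin x - x) has_field_derivative cos z - 1) (at z within {-M..M})" for z
        by (auto intro!: derivative_eq_intros)
      show "norm (cos z - 1) \<le> M\<^sup>2" if "z \<in> {-M..M}" for z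
      proof -
        have zM: "\<bar>z\<bar> \<le> M" using that by auto
        have "\<bar>cos z - cos 0\<bar> \<le> M * \<bar>z - 0\<bar>" by (rule abs_cos_diff_le) (use zM in auto)
        also have "\<dots> \<le> M * M" using zM by (intro mult_left_mono) auto
        finally show ?thesis by (simp add: power2_eq_square)
      qed
    qed (use that in auto)
    then show ?thesis by simp
  qed
  show ?thesis
  proof (rule lip_orderI[of "C ^ 3" a])
    fix \<alpha> s assume A: "0 < \<alpha>" "\<alpha> < a" "s \<in> {0..pi}"
    have "\<bar>(sin (f \<alpha> s) - f \<alpha> s) - (sin 0 - 0)\<bar> \<le> (C * \<alpha> ^ k)\<^sup>2 * \<bar>f \<alpha> s - 0\<bar>"
      by (rule b) (use C(3)[OF A] C(1) A in auto)
    also have "\<dots> \<le> (C * \<alpha> ^ k)\<^sup>2 * (C * \<alpha> ^ k)" using C(3)[OF A] by (intro mult_left_mono) auto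
    also have "\<dots> = C ^ 3 * \<alpha> ^ (3 * k)"
      by (simp add: power_mult_distrib power2_eq_square power3_eq_cube power_add[symmetric] mult_ac)
        (simp add: numeral_3_eq_3)
    finally show "\<bar>sin (f \<alpha> s) - f \<alpha> s\<bar> \<le> C ^ 3 * \<alpha> ^ (3 * k)" by simp
  next
    fix \<alpha> s s' assume A: "0 < \<alpha>" "\<alpha> < a" "s \<in> {0..pi}" "s' \<in> {0..pi}"
    have "\<bar>(sin (f \<alpha> s) - f \<alpha> s) - (sin (f \<alpha> s') - f \<alpha> s')\<bar> \<le> (C * \<alpha> ^ k)\<^sup>2 * \<bar>f \<alpha> s - f \<alpha> s'\<bar>"
      by (rule b) (use C(3) A in auto)
    also have "\<dots> \<le> (C * \<alpha> ^ k)\<^sup>2 * (C * \<alpha> ^ k * \<bar>s - s'\<bar>)" using C(4)[OF A] by (intro mult_left_mono) auto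
    also have "\<dots> = (C * \<alpha> ^ k) ^ 3 * \<bar>s - s'\<bar>" by (simp add: power2_eq_square power3_eq_cube)
    also have "\<dots> = C ^ 3 * \<alpha> ^ (3 * k) * \<bar>s - s'\<bar>" by (simp add: power_mult_distrib power_mult[symmetric] mult.commute)
    finally show "\<bar>(sin (f \<alpha> s) - f \<alpha> s) - (sin (f \<alpha> s') - f \<alpha> s')\<bar> \<le> C ^ 3 * \<alpha> ^ (3 * k) * \<bar>s - s'\<bar>" .
  qed (use C in auto)
qed

section \<open>Calculus of approximations up to a given order\<close>

definition approx_order :: "nat \<Rightarrow> (real \<Rightarrow> real \<Rightarrow> real) \<Rightarrow> (real \<Rightarrow> real \<Rightarrow> real) \<Rightarrow> bool" where
  "approx_order k f g \<longleftrightarrow> lip_order k (\<lambda>\<alpha> s. f \<alpha> s - g \<alpha> s)"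

lemma approx_refl: "approx_order k f f"
  unfolding approx_order_def using lip_order_param[of 0 1 "\<lambda>_. 0" k] by simp

lemma approx_mono: "approx_order k f g \<Longrightarrow> l \<le> k \<Longrightarrow> approx_order l f g"
  unfolding approx_order_def by (rule lip_order_mono)

lemma approx_add: "approx_order k f f' \<Longrightarrow> approx_order k g g' \<Longrightarrow>
    approx_order k (\<lambda>\<alpha> s. f \<alpha> s + g \<alpha> s) (\<lambda>\<alpha> s. f' \<alpha> s + g' \<alpha> s)"
  unfolding approx_order_def by (drule (1) lip_order_add) (simp add: algebra_simps)

lemma approx_diff: "approx_order k f f' \<Longrightarrow> approx_order k g g' \<Longrightarrow>
    approx_order k (\<lambda>\<alpha> s. f \<alpha> s - g \<alpha> s) (\<lambda>\<alpha> s. f' \<alpha> s - g' \<alpha> s)"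
  unfolding approx_order_def by (drule (1) lip_order_diff) (simp add: algebra_simps)

lemma approx_minus: "approx_order k f f' \<Longrightarrow> approx_order k (\<lambda>\<alpha> s. - f \<alpha> s) (\<lambda>\<alpha> s. - f' \<alpha> s)"
  unfolding approx_order_def by (drule lip_order_minus) (simp add: algebra_simps)

text \<open>The error splits into (f - f') g', f' (g - g') and (f - f')(g - g'); the three
  conditions on m are the orders of these terms. A small limit function thus raises the order gained
  from the other factor.\<close>

lemma approx_mult:
  assumes f: "approx_order k f f'" and g: "approx_order l g g'"
    and f': "lip_order i f'" and g': "lip_order j g'" and m: "m \<le> k + j" "m \<le> i + l" "m \<le> k + l"
  shows "approx_order m (\<lambda>\<alpha> s. f \<alpha> s * g \<alpha> s) (\<lambda>\<alpha> s. f' \<alpha> s * g' \<alpha> s)"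
proof -
  have "lip_order m (\<lambda>\<alpha> s. (f \<alpha> s - f' \<alpha> s) * g' \<alpha> s + f' \<alpha> s * (g \<alpha> s - g' \<alpha> s)
      + (f \<alpha> s - f' \<alpha> s) * (g \<alpha> s - g' \<alpha> s))"
    using f g f' g' m unfolding approx_order_def by (intro lip_order_add lip_order_mult_le)
  then show ?thesis unfolding approx_order_def by (simp add: algebra_simps)
qed

lemma approx_lip_order: "approx_order k f g \<Longrightarrow> lip_order k g \<Longrightarrow> lip_order k f"
  unfolding approx_order_def by (drule (1) lip_order_add) simp

lemma approx_trans: "approx_order k f g \<Longrightarrow> approx_order k g h \<Longrightarrow> approx_order k f h"
  unfolding approx_order_def by (drule (1) lip_order_add) simp

lemma approx_zero: "approx_order k f (\<lambda>\<alpha> s. 0) \<longleftrightarrow> lip_order k f"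
  unfolding approx_order_def by simp

lemma approx_cong:
  assumes "approx_order k f g" "0 < b"
    "\<And>\<alpha> s. 0 < \<alpha> \<Longrightarrow> \<alpha> < b \<Longrightarrow> s \<in> {0..pi} \<Longrightarrow> f' \<alpha> s = f \<alpha> s"
    "\<And>\<alpha> s. 0 < \<alpha> \<Longrightarrow> \<alpha> < b \<Longrightarrow> s \<in> {0..pi} \<Longrightarrow> g' \<alpha> s = g \<alpha> s"
  shows "approx_order k f' g'"
  using assms unfolding approx_order_def by (intro lip_order_cong[OF assms(1)[unfolded approx_order_def]]) auto

lemma approx_sin:
  assumes "lip_order k f" "m \<le> 3 * k"
  shows "approx_order m (\<lambda>\<alpha> s. sin (f \<alpha> s)) f"
  unfolding approx_order_def by (rule lip_order_mono[OF lip_order_sin_minus[OF assms(1)] assms(2)])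

lemma approx_cos:
  assumes "lip_order k f" "m \<le> 2 * k"
  shows "approx_order m (\<lambda>\<alpha> s. cos (f \<alpha> s)) (\<lambda>\<alpha> s. 1)"
  unfolding approx_order_def
  using lip_order_minus[OF lip_order_mono[OF lip_order_one_minus_cos[OF assms(1)] assms(2)]] by simp

lemma approx_sin_shift:
  assumes f: "lip_order 0 f" and g: "lip_order k g"
  shows "approx_order k (\<lambda>\<alpha> s. sin (f \<alpha> s + g \<alpha> s)) (\<lambda>\<alpha> s. sin (f \<alpha> s))"
    "approx_order k (\<lambda>\<alpha> s. cos (f \<alpha> s + g \<alpha> s)) (\<lambda>\<alpha> s. cos (f \<alpha> s))"
proof -
  have cf: "lip_order 0 (\<lambda>\<alpha> s. cos (f \<alpha> s))"
    using lip_order_diff[OF lip_order_const[of 1] lip_order_one_minus_cos[OF f, unfolded mult_0_right]] by simp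
  have sf: "lip_order 0 (\<lambda>\<alpha> s. sin (f \<alpha> s))" by (rule lip_order_sin[OF f])
  have sg: "lip_order k (\<lambda>\<alpha> s. sin (g \<alpha> s))" by (rule lip_order_sin[OF g])
  have cg: "lip_order k (\<lambda>\<alpha> s. 1 - cos (g \<alpha> s))"
    by (rule lip_order_mono[OF lip_order_one_minus_cos[OF g]]) simp
  have "lip_order k (\<lambda>\<alpha> s. cos (f \<alpha> s) * sin (g \<alpha> s) - sin (f \<alpha> s) * (1 - cos (g \<alpha> s)))"
    by (intro lip_order_diff lip_order_mult_le[OF cf sg] lip_order_mult_le[OF sf cg]) simp_all
  then show "approx_order k (\<lambda>\<alpha> s. sin (f \<alpha> s + g \<alpha> s)) (\<lambda>\<alpha> s. sin (f \<alpha> s))"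
    unfolding approx_order_def by (simp add: sin_add algebra_simps)
  have "lip_order k (\<lambda>\<alpha> s. - (cos (f \<alpha> s) * (1 - cos (g \<alpha> s))) - sin (f \<alpha> s) * sin (g \<alpha> s))"
    by (intro lip_order_diff lip_order_minus lip_order_mult_le[OF cf cg] lip_order_mult_le[OF sf sg]) simp_all
  then show "approx_order k (\<lambda>\<alpha> s. cos (f \<alpha> s + g \<alpha> s)) (\<lambda>\<alpha> s. cos (f \<alpha> s))"
    unfolding approx_order_def by (simp add: cos_add algebra_simps)
qed

text \<open>A crude linear bound, with a constant chosen for convenience: sin y \<ge> y/2 up to
  \<pi>/3, then the angle is doubled.\<close>

lemma sin_ge_quarter: "x / 4 \<le> sin x" if "0 \<le> x" "x \<le> pi / 2" for x :: real
proof -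
  have half: "y / 2 \<le> sin y" if y: "0 \<le> y" "y \<le> pi / 3" for y :: real
  proof (cases "y = 0")
    case False
    then have "0 < y" using y by simp
    then obtain z where z: "0 < z" "z < y" "sin y - sin 0 = (y - 0) * cos z"
      using MVT2[of 0 y sin cos] by (metis DERIV_sin)
    have "cos (pi / 3) \<le> cos z" using z y pi_gt_zero by (intro cos_monotone_0_pi_le) linarith+
    then have "y * (1 / 2) \<le> y * cos z" using y by (intro mult_left_mono) (simp_all add: cos_60)
    then show ?thesis using z by simp
  qed simp
  have "x / 2 / 2 \<le> sin (x / 2)" using that by (intro half) auto
  moreover have "1 / 2 \<le> cos (x / 2)"
  proof -
    have "cos (pi / 3) \<le> cos (x / 2)" using that pi_gt_zero by (intro cos_monotone_0_pi_le) linarith+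
    then show ?thesis by (simp add: cos_60)
  qed
  ultimately have "2 * (x / 2 / 2) * (1 / 2) \<le> 2 * sin (x / 2) * cos (x / 2)"
    using that by (intro mult_mono) auto
  then show ?thesis using sin_double[of "x / 2"] by simp
qed

section \<open>Asymptotics of the quaternion coordinates at time k_M \<pi>\<close>

lemma remainder_bounds:
  assumes "0 < \<alpha>"
  shows "0 \<le> remainder \<alpha>" "remainder \<alpha> < 1"
proof -
  have "0 \<le> pi / (2 * \<alpha>)" using assms by simp
  then have "real (kM \<alpha>) = of_int \<lfloor>pi / (2 * \<alpha>)\<rfloor>" by (simp add: kM_def)
  then show "0 \<le> remainder \<alpha>" "remainder \<alpha> < 1"
    using floor_correct[of "pi / (2 * \<alpha>)"] by (simp_all add: remainder_def) linarith+
qed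

text \<open>The number of full interior arcs in a trajectory of duration k_M \<pi>; the first and
  the last arc together take the remaining time.\<close>

abbreviation arcs :: "real \<Rightarrow> nat" where "arcs \<alpha> \<equiv> kM \<alpha> - 1"

text \<open>The third equation is where r(\<alpha>) enters: k_M - 1 steps of angle \<alpha> fall
  short of a right angle by \<alpha> (1 + r(\<alpha>)).\<close>

lemma arcs_eq:
  assumes "0 < \<alpha>" "\<alpha> < pi / 4"
  shows "2 \<le> kM \<alpha>" "real (arcs \<alpha>) = pi / (2 * \<alpha>) - remainder \<alpha> - 1"
    "real (arcs \<alpha>) * \<alpha> = pi / 2 - \<alpha> * (1 + remainder \<alpha>)" "\<bar>real (arcs \<alpha>)\<bar> \<le> (pi / 2) / \<alpha>"
proof -
  have "2 \<le> pi / (2 * \<alpha>)" using assms by (simp add: field_simps)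
  then have "2 \<le> \<lfloor>pi / (2 * \<alpha>)\<rfloor>" by (simp add: le_floor_iff)
  then show k: "2 \<le> kM \<alpha>" unfolding kM_def by linarith
  show r: "real (arcs \<alpha>) = pi / (2 * \<alpha>) - remainder \<alpha> - 1"
    using k by (simp add: remainder_def of_nat_diff)
  show "real (arcs \<alpha>) * \<alpha> = pi / 2 - \<alpha> * (1 + remainder \<alpha>)"
    unfolding r using assms by (simp add: field_simps)
  show "\<bar>real (arcs \<alpha>)\<bar> \<le> (pi / 2) / \<alpha>"
    using r remainder_bounds(1)[OF assms(1)] by simp
qed

lemma lip_order_sin_s: "lip_order 0 (\<lambda>\<alpha> s. sin s)"
  by (rule lip_order_fixed[of 1]) (auto intro: abs_sin_diff_le)

lemma lip_order_cos_s: "lip_order 0 (\<lambda>\<alpha> s. cos s)"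
  by (rule lip_order_fixed[of 1]) (auto intro: abs_cos_diff_le1)

lemma lip_order_half_s: "lip_order 0 (\<lambda>\<alpha> s. s / 2)"
proof (rule lip_orderI[of pi 1])
  fix s s' :: real
  have "1 * \<bar>s - s'\<bar> \<le> pi * \<bar>s - s'\<bar>" using pi_ge_two by (intro mult_right_mono) auto
  then show "\<bar>s / 2 - s' / 2\<bar> \<le> pi * \<alpha> ^ 0 * \<bar>s - s'\<bar>" for \<alpha> :: real
    by (simp add: diff_divide_distrib[symmetric])
qed auto

lemma lip_order_sin_half: "lip_order 0 (\<lambda>\<alpha> s. sin (s / 2))"
  by (rule lip_order_sin[OF lip_order_half_s])

lemma lip_order_cos_half: "lip_order 0 (\<lambda>\<alpha> s. cos (s / 2))"
proof (rule lip_order_fixed[of 1])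
  show "\<bar>cos (s / 2) - cos (s' / 2)\<bar> \<le> \<bar>s - s'\<bar>" for s s' :: real
    using abs_cos_diff_le1[of "s / 2" "s' / 2"] by linarith
qed auto

lemma approx_sin_alpha: "approx_order 3 (\<lambda>\<alpha> s. sin \<alpha>) (\<lambda>\<alpha> s. \<alpha>)"
  by (rule approx_sin[OF lip_order_ident]) simp

lemma approx_cos_alpha: "approx_order 2 (\<lambda>\<alpha> s. cos \<alpha>) (\<lambda>\<alpha> s. 1)"
  by (rule approx_cos[OF lip_order_ident]) simp

lemma lip_order_sin_alpha: "lip_order 1 (\<lambda>\<alpha> s. sin \<alpha>)"
  by (rule lip_order_sin[OF lip_order_ident])

lemma lip_order_sin_alpha_sq: "lip_order 2 (\<lambda>\<alpha> s. (sin \<alpha>)\<^sup>2)"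
  using lip_order_mult[OF lip_order_sin_alpha lip_order_sin_alpha] by (simp add: power2_eq_square numeral_2_eq_2)

lemma approx_sin_alpha_sq: "approx_order 4 (\<lambda>\<alpha> s. (sin \<alpha>)\<^sup>2) (\<lambda>\<alpha> s. \<alpha> * \<alpha>)"
  unfolding power2_eq_square
  by (rule approx_mult[OF approx_sin_alpha approx_sin_alpha lip_order_ident lip_order_ident]) simp_all

lemma lip_order_alpha_sq: "lip_order 2 (\<lambda>\<alpha> s. \<alpha> * \<alpha>)"
  by (rule lip_order_mult_le[OF lip_order_ident lip_order_ident]) simp

lemma approx_inverse_denominator:
  "approx_order 2 (\<lambda>\<alpha> s. 1 / ((cos \<alpha>)\<^sup>2 + (sin \<alpha>)\<^sup>2 * cos s)) (\<lambda>\<alpha> s. 1)"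
proof -
  have "lip_order 2 (\<lambda>\<alpha> s. (sin \<alpha>)\<^sup>2 * (1 - cos s))"
    by (rule lip_order_mult_le[OF lip_order_sin_alpha_sq lip_order_diff[OF lip_order_const lip_order_cos_s]]) simp
  from lip_order_inverse[OF this]
  have "lip_order 2 (\<lambda>\<alpha> s. 1 / (1 - (sin \<alpha>)\<^sup>2 * (1 - cos s)) - 1)" by simp
  moreover have "1 - (sin \<alpha>)\<^sup>2 * (1 - cos s) = (cos \<alpha>)\<^sup>2 + (sin \<alpha>)\<^sup>2 * cos s" for \<alpha> s :: real
    by (simp add: cos_squared_eq algebra_simps)
  ultimately show ?thesis unfolding approx_order_def by simp
qed

lemma lip_order_half_excess: "lip_order 2 half_excess"
proof -
  have 1: "lip_order 0 (\<lambda>\<alpha> s. 1 / ((cos \<alpha>)\<^sup>2 + (sin \<alpha>)\<^sup>2 * cos s))"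
    by (rule approx_lip_order[OF approx_mono[OF approx_inverse_denominator] lip_order_const]) simp
  have "lip_order 2 (\<lambda>\<alpha> s. ((sin \<alpha>)\<^sup>2 * sin s) * (1 / ((cos \<alpha>)\<^sup>2 + (sin \<alpha>)\<^sup>2 * cos s)))"
    by (rule lip_order_mult_le[OF lip_order_mult[OF lip_order_sin_alpha_sq lip_order_sin_s] 1]) simp_all
  then have "lip_order 2 (\<lambda>\<alpha> s. arctan (((sin \<alpha>)\<^sup>2 * sin s) * (1 / ((cos \<alpha>)\<^sup>2 + (sin \<alpha>)\<^sup>2 * cos s))))"
    by (rule lip_order_arctan)
  then show ?thesis
    by (rule lip_order_cong[where b = "pi / 4"]) (auto simp: half_excess_eq)
qed

lemma approx_cos_half_excess: "approx_order 4 (\<lambda>\<alpha> s. cos (half_excess \<alpha> s)) (\<lambda>\<alpha> s. 1)"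
  by (rule approx_cos[OF lip_order_half_excess]) simp

lemma approx_sin_half_excess: "approx_order 4 (\<lambda>\<alpha> s. sin (half_excess \<alpha> s)) (\<lambda>\<alpha> s. \<alpha> * \<alpha> * sin s)"
proof -
  have 1: "approx_order 4 (\<lambda>\<alpha> s. (sin \<alpha>)\<^sup>2 * sin s) (\<lambda>\<alpha> s. \<alpha> * \<alpha> * sin s)"
    by (rule approx_mult[OF approx_sin_alpha_sq approx_refl[of 4] lip_order_alpha_sq lip_order_sin_s]) simp_all
  have 2: "approx_order 2 (\<lambda>\<alpha> s. cos (half_excess \<alpha> s) * (1 / ((cos \<alpha>)\<^sup>2 + (sin \<alpha>)\<^sup>2 * cos s))) (\<lambda>\<alpha> s. 1 * 1)"
    by (rule approx_mult[OF approx_cos_half_excess approx_inverse_denominator lip_order_const lip_order_const]) simp_all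
  have 3: "approx_order 4 (\<lambda>\<alpha> s. ((sin \<alpha>)\<^sup>2 * sin s) * (cos (half_excess \<alpha> s) * (1 / ((cos \<alpha>)\<^sup>2 + (sin \<alpha>)\<^sup>2 * cos s))))
      (\<lambda>\<alpha> s. (\<alpha> * \<alpha> * sin s) * (1 * 1))"
    by (rule approx_mult[OF 1 2 lip_order_mult[OF lip_order_alpha_sq lip_order_sin_s] lip_order_mult[OF lip_order_const lip_order_const]]) simp_all
  show ?thesis
  proof (rule approx_cong[OF 3, of "pi / 4"])
    fix \<alpha> s :: real assume A: "0 < \<alpha>" "\<alpha> < pi / 4"
    obtain R where R: "0 < R" "(cos \<alpha>)\<^sup>2 + (sin \<alpha>)\<^sup>2 * cos s = R * cos (half_excess \<alpha> s)"
      "(sin \<alpha>)\<^sup>2 * sin s = R * sin (half_excess \<alpha> s)"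
      by (rule half_excess_polar[OF A])
    have "R \<noteq> 0 \<and> cos (half_excess \<alpha> s) \<noteq> 0"
      using switch_denominator_pos[OF A, of s] unfolding R(2) by auto
    then show "sin (half_excess \<alpha> s) = ((sin \<alpha>)\<^sup>2 * sin s) * (cos (half_excess \<alpha> s) * (1 / ((cos \<alpha>)\<^sup>2 + (sin \<alpha>)\<^sup>2 * cos s)))"
      unfolding R(2,3) by simp
  qed auto
qed

text \<open>The cosine of the step angle is known up to a variation of order 4, and near \<alpha>
  the arccosine has slope of order 1/\<alpha>, so one order is lost. As arccos is not Lipschitz at
  1, the difference of the angles is bounded through the product formula for cos k - cos l, using
  sin((k + l)/2) \<ge> \<alpha>/4. At s = 0 the step angle is exactly \<alpha>.\<close>

lemma approx_step_angle: "approx_order 3 step_angle (\<lambda>\<alpha> s. \<alpha>)"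
proof -
  have "lip_order 4 (\<lambda>\<alpha> s. 1 - cos (half_excess \<alpha> s))"
    using lip_order_one_minus_cos[OF lip_order_half_excess] by simp
  then obtain C a where C: "0 \<le> C" "0 < a"
    "\<And>\<alpha> s s'. 0 < \<alpha> \<Longrightarrow> \<alpha> < a \<Longrightarrow> s \<in> {0..pi} \<Longrightarrow> s' \<in> {0..pi} \<Longrightarrow>
       \<bar>(1 - cos (half_excess \<alpha> s)) - (1 - cos (half_excess \<alpha> s'))\<bar> \<le> C * \<alpha> ^ 4 * \<bar>s - s'\<bar>"
    by (rule lip_orderE) blast
  have lip: "\<bar>step_angle \<alpha> s - step_angle \<alpha> s'\<bar> \<le> 16 * C * \<alpha> ^ 3 * \<bar>s - s'\<bar>"
    if A: "0 < \<alpha>" "\<alpha> < min a (pi / 4)" "s \<in> {0..pi}" "s' \<in> {0..pi}" for \<alpha> s s'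
  proof -
    have \<alpha>: "0 < \<alpha>" "\<alpha> < pi / 4" using A by auto
    let ?k = "step_angle \<alpha> s" and ?l = "step_angle \<alpha> s'"
    have b: "\<alpha> \<le> ?k" "?k < pi / 2" "\<alpha> \<le> ?l" "?l < pi / 2" using step_angle_bounds[OF \<alpha>] by auto
    have "\<bar>cos ?k - cos ?l\<bar> = \<bar>cos \<alpha>\<bar> * \<bar>cos (half_excess \<alpha> s) - cos (half_excess \<alpha> s')\<bar>"
      unfolding step_angle_bounds(1)[OF \<alpha>] by (simp add: left_diff_distrib[symmetric] abs_mult)
    also have "\<dots> \<le> 1 * (C * \<alpha> ^ 4 * \<bar>s - s'\<bar>)"
      using C(3)[of \<alpha> s s'] A by (intro mult_mono) (auto simp: abs_minus_commute)
    finally have up: "\<bar>cos ?k - cos ?l\<bar> \<le> C * \<alpha> ^ 4 * \<bar>s - s'\<bar>" by simp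
    have "\<alpha> / 4 \<le> (?k + ?l) / 2 / 4" using b by simp
    also have "\<dots> \<le> sin ((?k + ?l) / 2)" using b \<alpha> by (intro sin_ge_quarter) auto
    finally have 1: "\<alpha> / 4 \<le> \<bar>sin ((?k + ?l) / 2)\<bar>" by simp
    have 2: "\<bar>?k - ?l\<bar> / 2 / 4 \<le> \<bar>sin ((?l - ?k) / 2)\<bar>"
    proof (cases "?k \<le> ?l")
      case True
      then show ?thesis using sin_ge_quarter[of "(?l - ?k) / 2"] b \<alpha> by simp
    next
      case False
      then have "(?k - ?l) / 2 / 4 \<le> sin ((?k - ?l) / 2)" using b \<alpha> by (intro sin_ge_quarter) auto
      moreover have "sin ((?l - ?k) / 2) = - sin ((?k - ?l) / 2)" unfolding sin_minus[symmetric] by (simp add: minus_divide_left)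
      ultimately show ?thesis using False by simp
    qed
    have "2 * ((\<alpha> / 4) * (\<bar>?k - ?l\<bar> / 2 / 4)) \<le> 2 * (\<bar>sin ((?k + ?l) / 2)\<bar> * \<bar>sin ((?l - ?k) / 2)\<bar>)"
      using 1 2 \<alpha> by (intro mult_left_mono mult_mono) auto
    also have "\<dots> = \<bar>cos ?k - cos ?l\<bar>" by (simp add: cos_diff_cos abs_mult)
    finally have "\<alpha> * \<bar>?k - ?l\<bar> \<le> 16 * (C * \<alpha> ^ 4 * \<bar>s - s'\<bar>)" using up by simp
    then have "\<alpha> * \<bar>?k - ?l\<bar> \<le> \<alpha> * (16 * C * \<alpha> ^ 3 * \<bar>s - s'\<bar>)"
      by (simp add: power_numeral_reduce mult_ac)
    then show ?thesis using \<alpha> by simp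
  qed
  have z: "step_angle \<alpha> 0 = \<alpha>" if "0 < \<alpha>" "\<alpha> < pi / 4" for \<alpha>
    using that by (simp add: step_angle_def half_excess_def arccos_cos)
  show ?thesis
    unfolding approx_order_def
  proof (rule lip_orderI[of "16 * C * (pi + 1)" "min a (pi / 4)"])
    fix \<alpha> s assume A: "0 < \<alpha>" "\<alpha> < min a (pi / 4)" "s \<in> {0..pi}"
    have "\<bar>step_angle \<alpha> s - \<alpha>\<bar> \<le> 16 * C * \<alpha> ^ 3 * \<bar>s - 0\<bar>"
      using lip[of \<alpha> s 0] z[of \<alpha>] A by auto
    also have "\<dots> \<le> 16 * C * \<alpha> ^ 3 * (pi + 1)" using C A by (intro mult_left_mono) auto
    finally show "\<bar>step_angle \<alpha> s - \<alpha>\<bar> \<le> 16 * C * (pi + 1) * \<alpha> ^ 3" by (simp add: algebra_simps)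
  next
    fix \<alpha> s s' assume A: "0 < \<alpha>" "\<alpha> < min a (pi / 4)" "s \<in> {0..pi}" "s' \<in> {0..pi}"
    have "\<bar>step_angle \<alpha> s - \<alpha> - (step_angle \<alpha> s' - \<alpha>)\<bar> \<le> 1 * (16 * C * \<alpha> ^ 3 * \<bar>s - s'\<bar>)"
      using lip[OF A] by simp
    also have "\<dots> \<le> (pi + 1) * (16 * C * \<alpha> ^ 3 * \<bar>s - s'\<bar>)"
      using C A by (intro mult_right_mono) auto
    finally show "\<bar>step_angle \<alpha> s - \<alpha> - (step_angle \<alpha> s' - \<alpha>)\<bar> \<le> 16 * C * (pi + 1) * \<alpha> ^ 3 * \<bar>s - s'\<bar>"
      by (simp add: algebra_simps)
  qed (use C in auto)
qed

lemma lip_order_remainder: "lip_order 0 (\<lambda>\<alpha> s. remainder \<alpha>)"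
  by (rule lip_order_param[of 1 1]) (use remainder_bounds in \<open>auto intro: less_imp_le\<close>)

lemma lip_order_main: "lip_order 1 (\<lambda>\<alpha> s. \<alpha> * (1 + remainder \<alpha>))"
  by (rule lip_order_mult_le[OF lip_order_ident lip_order_add[OF lip_order_const lip_order_remainder]]) simp

text \<open>The error of order 3 per step, multiplied by about 1/\<alpha> steps, remains of order 2
  and thus smaller than \<alpha> r(\<alpha>).\<close>

lemma approx_arcs_angle:
  "approx_order 2 (\<lambda>\<alpha> s. pi / 2 - real (arcs \<alpha>) * step_angle \<alpha> s) (\<lambda>\<alpha> s. \<alpha> * (1 + remainder \<alpha>))"
proof -
  have "lip_order (Suc 2) (\<lambda>\<alpha> s. step_angle \<alpha> s - \<alpha>)"
    using approx_step_angle unfolding approx_order_def by (simp add: numeral_3_eq_3 numeral_2_eq_2)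
  then have 1: "lip_order 2 (\<lambda>\<alpha> s. real (arcs \<alpha>) * (step_angle \<alpha> s - \<alpha>))"
    by (rule lip_order_divide[of _ _ "pi / 2" "pi / 4"]) (use arcs_eq in auto)
  show ?thesis
    unfolding approx_order_def
  proof (rule lip_order_cong[OF lip_order_minus[OF 1], of "pi / 4"])
    fix \<alpha> s :: real assume "0 < \<alpha>" "\<alpha> < pi / 4"
    then show "pi / 2 - real (arcs \<alpha>) * step_angle \<alpha> s - \<alpha> * (1 + remainder \<alpha>) = - (real (arcs \<alpha>) * (step_angle \<alpha> s - \<alpha>))"
      unfolding right_diff_distrib using arcs_eq(3)[of \<alpha>] by linarith
  qed simp
qed

lemma lip_order_arcs_angle: "lip_order 1 (\<lambda>\<alpha> s. pi / 2 - real (arcs \<alpha>) * step_angle \<alpha> s)"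
  by (rule approx_lip_order[OF approx_mono[OF approx_arcs_angle] lip_order_main]) simp

lemma approx_pow_re: "approx_order 2 (\<lambda>\<alpha> s. pow_re \<alpha> (arcs \<alpha>) s) (\<lambda>\<alpha> s. \<alpha> * (1 + remainder \<alpha>))"
proof -
  have "approx_order 2 (\<lambda>\<alpha> s. sin (pi / 2 - real (arcs \<alpha>) * step_angle \<alpha> s)) (\<lambda>\<alpha> s. pi / 2 - real (arcs \<alpha>) * step_angle \<alpha> s)"
    by (rule approx_sin[OF lip_order_arcs_angle]) simp
  from approx_trans[OF this approx_arcs_angle] show ?thesis
    by (simp add: pow_re_def sin_diff)
qed

text \<open>The function itself grows like 1/\<alpha>; it is scaled by \<alpha> so that it fits
  orders that are natural numbers. The scaling is undone by a factor of positive order that always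
  accompanies it.\<close>

lemma approx_pow_im: "approx_order 2 (\<lambda>\<alpha> s. \<alpha> * pow_im \<alpha> (arcs \<alpha>) s) (\<lambda>\<alpha> s. 1)"
proof -
  have 1: "approx_order 2 (\<lambda>\<alpha> s. cos (pi / 2 - real (arcs \<alpha>) * step_angle \<alpha> s)) (\<lambda>\<alpha> s. 1)"
    by (rule approx_cos[OF lip_order_arcs_angle]) simp
  have k1: "lip_order 1 step_angle"
    by (rule approx_lip_order[OF approx_mono[OF approx_step_angle] lip_order_ident]) simp
  have "approx_order 3 (\<lambda>\<alpha> s. sin (step_angle \<alpha> s)) (\<lambda>\<alpha> s. \<alpha>)"
    by (rule approx_trans[OF approx_sin[OF k1] approx_step_angle]) simp
  then have "lip_order (Suc 2) (\<lambda>\<alpha> s. sin (step_angle \<alpha> s) - \<alpha>)"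
    unfolding approx_order_def by (simp add: numeral_3_eq_3 numeral_2_eq_2)
  then have "lip_order 2 (\<lambda>\<alpha> s. (- 1 / \<alpha>) * (sin (step_angle \<alpha> s) - \<alpha>))"
    by (rule lip_order_divide[of _ _ 1 1]) auto
  from lip_order_inverse[OF this]
  have "lip_order 2 (\<lambda>\<alpha> s. 1 / (1 - (- 1 / \<alpha>) * (sin (step_angle \<alpha> s) - \<alpha>)) - 1)" by simp
  then have 2: "approx_order 2 (\<lambda>\<alpha> s. \<alpha> / sin (step_angle \<alpha> s)) (\<lambda>\<alpha> s. 1)"
    unfolding approx_order_def by (rule lip_order_cong[where b = "pi / 4"]) (auto simp: field_simps)
  from approx_mult[OF 1 2 lip_order_const lip_order_const]
  have "approx_order 2 (\<lambda>\<alpha> s. cos (pi / 2 - real (arcs \<alpha>) * step_angle \<alpha> s) * (\<alpha> / sin (step_angle \<alpha> s))) (\<lambda>\<alpha> s. 1)"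
    by simp
  then show ?thesis by (simp add: pow_im_def cos_diff mult.commute)
qed

lemma approx_E: "approx_order 2 (\<lambda>\<alpha> s. pow_im \<alpha> (arcs \<alpha>) s * (cos (half_excess \<alpha> s) * sin \<alpha>)) (\<lambda>\<alpha> s. 1)"
proof -
  have "lip_order (Suc 2) (\<lambda>\<alpha> s. sin \<alpha> - \<alpha>)"
    using approx_sin_alpha unfolding approx_order_def by (simp add: numeral_3_eq_3 numeral_2_eq_2)
  then have "lip_order 2 (\<lambda>\<alpha> s. (1 / \<alpha>) * (sin \<alpha> - \<alpha>))"
    by (rule lip_order_divide[of _ _ 1 1]) auto
  then have 1: "approx_order 2 (\<lambda>\<alpha> s. sin \<alpha> / \<alpha>) (\<lambda>\<alpha> s. 1)"
    unfolding approx_order_def by (rule lip_order_cong[of _ _ 1]) (auto simp: field_simps)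
  from approx_mult[OF approx_cos_half_excess 1 lip_order_const lip_order_const]
  have 2: "approx_order 2 (\<lambda>\<alpha> s. cos (half_excess \<alpha> s) * (sin \<alpha> / \<alpha>)) (\<lambda>\<alpha> s. 1)" by simp
  from approx_mult[OF approx_pow_im 2 lip_order_const lip_order_const]
  have "approx_order 2 (\<lambda>\<alpha> s. (\<alpha> * pow_im \<alpha> (arcs \<alpha>) s) * (cos (half_excess \<alpha> s) * (sin \<alpha> / \<alpha>))) (\<lambda>\<alpha> s. 1)"
    by simp
  then show ?thesis by (rule approx_cong[where b = 1]) auto
qed

lemma approx_E2: "approx_order 3 (\<lambda>\<alpha> s. pow_im \<alpha> (arcs \<alpha>) s * (cos (half_excess \<alpha> s) * (sin \<alpha>)\<^sup>2)) (\<lambda>\<alpha> s. \<alpha>)"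
  using approx_mult[OF approx_E approx_sin_alpha lip_order_const lip_order_ident, of 3]
  by (simp add: power2_eq_square mult.assoc)

text \<open>The sine of the half excess is \<alpha>^2 sin s to leading order, and the growth
  1/\<alpha> of the power coefficient reduces it to \<alpha> sin s.\<close>

lemma approx_F: "approx_order 2 (\<lambda>\<alpha> s. pow_im \<alpha> (arcs \<alpha>) s * sin (half_excess \<alpha> s)) (\<lambda>\<alpha> s. \<alpha> * sin s)"
proof -
  have "lip_order (Suc 3) (\<lambda>\<alpha> s. sin (half_excess \<alpha> s) - \<alpha> * \<alpha> * sin s)"
    using approx_sin_half_excess unfolding approx_order_def by simp
  then have "lip_order 3 (\<lambda>\<alpha> s. (1 / \<alpha>) * (sin (half_excess \<alpha> s) - \<alpha> * \<alpha> * sin s))"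
    by (rule lip_order_divide[of _ _ 1 1]) auto
  then have 1: "approx_order 3 (\<lambda>\<alpha> s. sin (half_excess \<alpha> s) / \<alpha>) (\<lambda>\<alpha> s. \<alpha> * sin s)"
    unfolding approx_order_def by (rule lip_order_cong[of _ _ 1]) (auto simp: field_simps)
  have "approx_order 2 (\<lambda>\<alpha> s. (\<alpha> * pow_im \<alpha> (arcs \<alpha>) s) * (sin (half_excess \<alpha> s) / \<alpha>)) (\<lambda>\<alpha> s. 1 * (\<alpha> * sin s))"
    by (rule approx_mult[OF approx_pow_im 1 lip_order_const lip_order_mult[OF lip_order_ident lip_order_sin_s]]) simp_all
  then show ?thesis by (rule approx_cong[where b = 1]) auto
qed

lemma lip_order_F: "lip_order 1 (\<lambda>\<alpha> s. pow_im \<alpha> (arcs \<alpha>) s * sin (half_excess \<alpha> s))"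
  by (rule approx_lip_order[OF approx_mono[OF approx_F] lip_order_mult_le[OF lip_order_ident lip_order_sin_s]]) simp_all

lemma lip_order_delay: "lip_order 1 (\<lambda>\<alpha> s. real (arcs \<alpha>) * half_excess \<alpha> s)"
proof -
  have "lip_order (Suc 1) half_excess" using lip_order_half_excess by (simp add: numeral_2_eq_2)
  then show ?thesis by (rule lip_order_divide[of _ _ "pi / 2" "pi / 4"]) (use arcs_eq in auto)
qed

text \<open>Duration of the last arc at time \<open>k\<^sub>M \<pi>\<close>.\<close>

definition last_arc :: "real \<Rightarrow> real \<Rightarrow> real" where
  "last_arc \<alpha> s = pi - s - 2 * (real (arcs \<alpha>) * half_excess \<alpha> s)"

lemma half_sum: "(s + last_arc \<alpha> s) / 2 = pi / 2 - real (arcs \<alpha>) * half_excess \<alpha> s"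
  by (simp add: last_arc_def field_simps)

lemma approx_half_last:
  "approx_order 1 (\<lambda>\<alpha> s. sin (last_arc \<alpha> s / 2)) (\<lambda>\<alpha> s. cos (s / 2))"
  "approx_order 1 (\<lambda>\<alpha> s. cos (last_arc \<alpha> s / 2)) (\<lambda>\<alpha> s. sin (s / 2))"
proof -
  have e: "last_arc \<alpha> s / 2 = pi / 2 - (s / 2 + real (arcs \<alpha>) * half_excess \<alpha> s)" for \<alpha> s
    by (simp add: last_arc_def field_simps)
  show "approx_order 1 (\<lambda>\<alpha> s. sin (last_arc \<alpha> s / 2)) (\<lambda>\<alpha> s. cos (s / 2))"
    unfolding e sin_diff using approx_sin_shift(2)[OF lip_order_half_s lip_order_delay] by simp
  show "approx_order 1 (\<lambda>\<alpha> s. cos (last_arc \<alpha> s / 2)) (\<lambda>\<alpha> s. sin (s / 2))"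
    unfolding e cos_diff using approx_sin_shift(1)[OF lip_order_half_s lip_order_delay] by simp
qed

lemma approx_half_sum:
  "approx_order 2 (\<lambda>\<alpha> s. sin ((s + last_arc \<alpha> s) / 2)) (\<lambda>\<alpha> s. 1)"
  "lip_order 1 (\<lambda>\<alpha> s. cos ((s + last_arc \<alpha> s) / 2))"
  unfolding half_sum sin_diff cos_diff
  using approx_cos[OF lip_order_delay, of 2] lip_order_sin[OF lip_order_delay] by simp_all

lemma approx1_mult:
  "approx_order 1 f f' \<Longrightarrow> approx_order 1 g g' \<Longrightarrow> lip_order 0 f' \<Longrightarrow> lip_order 0 g' \<Longrightarrow>
    approx_order 1 (\<lambda>\<alpha> s. f \<alpha> s * g \<alpha> s) (\<lambda>\<alpha> s. f' \<alpha> s * g' \<alpha> s)"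
  by (rule approx_mult) auto

abbreviation final_coords :: "real \<Rightarrow> real \<Rightarrow> real \<times> real \<times> real \<times> real" where
  "final_coords \<alpha> s \<equiv> front_coords \<alpha> (arcs \<alpha>) s (last_arc \<alpha> s)"

lemma lip_order_main': "lip_order 1 (\<lambda>\<alpha> s. - (\<alpha> * remainder \<alpha>))"
  by (rule lip_order_minus[OF lip_order_mult_le[OF lip_order_ident lip_order_remainder]]) simp

text \<open>The radius appears here: the contribution \<alpha> of the first and last arcs cancels
  the 1 in \<alpha> (1 + r(\<alpha>)), so that only -\<alpha> r(\<alpha>) is left at first
  order.\<close>

lemma approx_coord_0: "approx_order 2 (\<lambda>\<alpha> s. fst (final_coords \<alpha> s)) (\<lambda>\<alpha> s. - (\<alpha> * remainder \<alpha>))"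
proof -
  have 1: "approx_order 2 (\<lambda>\<alpha> s. cos \<alpha> * pow_re \<alpha> (arcs \<alpha>) s) (\<lambda>\<alpha> s. 1 * (\<alpha> * (1 + remainder \<alpha>)))"
    by (rule approx_mult[OF approx_cos_alpha approx_pow_re lip_order_const lip_order_main]) simp_all
  have 2: "approx_order 2 (\<lambda>\<alpha> s. pow_im \<alpha> (arcs \<alpha>) s * (cos (half_excess \<alpha> s) * (sin \<alpha>)\<^sup>2) - cos \<alpha> * pow_re \<alpha> (arcs \<alpha>) s)
      (\<lambda>\<alpha> s. \<alpha> - 1 * (\<alpha> * (1 + remainder \<alpha>)))"
    by (rule approx_diff[OF approx_mono[OF approx_E2] 1]) simp
  have 3: "lip_order 1 (\<lambda>\<alpha> s. \<alpha> - 1 * (\<alpha> * (1 + remainder \<alpha>)))"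
    by (rule lip_order_diff[OF lip_order_ident lip_order_mult_le[OF lip_order_const lip_order_main]]) simp
  note 4 = approx_mult[OF approx_half_sum(1) 2 lip_order_const 3, of 2]
  have 5: "lip_order 2 (\<lambda>\<alpha> s. pow_im \<alpha> (arcs \<alpha>) s * sin (half_excess \<alpha> s) * cos ((s + last_arc \<alpha> s) / 2))"
    by (rule lip_order_mult_le[OF lip_order_F approx_half_sum(2)]) simp
  have "approx_order 2 (\<lambda>\<alpha> s. sin ((s + last_arc \<alpha> s) / 2) * (pow_im \<alpha> (arcs \<alpha>) s * (cos (half_excess \<alpha> s) * (sin \<alpha>)\<^sup>2) - cos \<alpha> * pow_re \<alpha> (arcs \<alpha>) s)
      - pow_im \<alpha> (arcs \<alpha>) s * sin (half_excess \<alpha> s) * cos ((s + last_arc \<alpha> s) / 2))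
      (\<lambda>\<alpha> s. 1 * (\<alpha> - 1 * (\<alpha> * (1 + remainder \<alpha>))) - 0)"
    by (rule approx_diff[OF 4 approx_zero[THEN iffD2, OF 5]]) simp_all
  then show ?thesis
    by (rule approx_cong[where b = "pi / 4"]) (auto simp: front_coords_0 algebra_simps)
qed

lemma lip_order_sin_last: "lip_order 0 (\<lambda>\<alpha> s. sin (last_arc \<alpha> s / 2))"
  by (rule approx_lip_order[OF approx_mono[OF approx_half_last(1)] lip_order_cos_half]) simp

text \<open>Two terms of first order occur, -\<alpha> sin s from the accumulated excess and 2
  \<alpha> sin(s/2) cos(s/2) from the first and last arcs. They cancel by the double angle
  formula.\<close>

lemma lip_order_coord_3: "lip_order 2 (\<lambda>\<alpha> s. snd (snd (snd (final_coords \<alpha> s))))"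
proof -
  let ?S = "\<lambda>\<alpha> s. sin (s / 2) * sin (last_arc \<alpha> s / 2)"
  let ?a = "\<lambda>\<alpha> s. pow_im \<alpha> (arcs \<alpha>) s * (cos (half_excess \<alpha> s) * (sin \<alpha>)\<^sup>2)"
  let ?d = "\<lambda>\<alpha> s. pow_im \<alpha> (arcs \<alpha>) s * sin (half_excess \<alpha> s)"
  let ?u = "\<lambda>\<alpha> s. (s + last_arc \<alpha> s) / 2"
  have C1: "lip_order 1 (\<lambda>\<alpha> s. pow_re \<alpha> (arcs \<alpha>) s)"
    by (rule approx_lip_order[OF approx_mono[OF approx_pow_re] lip_order_main]) simp
  have S0: "lip_order 0 ?S" by (rule lip_order_mult_le[OF lip_order_sin_half lip_order_sin_last]) simp
  have 1: "lip_order 1 (\<lambda>\<alpha> s. cos (?u \<alpha> s) + 2 * (sin \<alpha>)\<^sup>2 * ?S \<alpha> s)"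
    by (rule lip_order_add[OF approx_half_sum(2)
          lip_order_mult_le[OF lip_order_mult[OF lip_order_const lip_order_sin_alpha_sq] S0]]) simp
  have 2: "lip_order 2 (\<lambda>\<alpha> s. pow_re \<alpha> (arcs \<alpha>) s * (cos (?u \<alpha> s) + 2 * (sin \<alpha>)\<^sup>2 * ?S \<alpha> s))"
    by (rule lip_order_mult_le[OF C1 1]) simp
  have F1: "lip_order 1 (\<lambda>\<alpha> s. \<alpha> * sin s)" by (rule lip_order_mult_le[OF lip_order_ident lip_order_sin_s]) simp
  have 3: "approx_order 2 (\<lambda>\<alpha> s. ?d \<alpha> s * sin (?u \<alpha> s)) (\<lambda>\<alpha> s. \<alpha> * sin s * 1)"
    by (rule approx_mult[OF approx_F approx_half_sum(1) F1 lip_order_const]) simp_all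
  have 4: "approx_order 2 (\<lambda>\<alpha> s. cos \<alpha> * (?d \<alpha> s * sin (?u \<alpha> s))) (\<lambda>\<alpha> s. 1 * (\<alpha> * sin s * 1))"
    by (rule approx_mult[OF approx_cos_alpha 3 lip_order_const lip_order_mult[OF F1 lip_order_const]]) simp_all
  have 5: "approx_order 1 ?S (\<lambda>\<alpha> s. sin (s / 2) * cos (s / 2))"
    by (rule approx1_mult[OF approx_refl approx_half_last(1) lip_order_sin_half lip_order_cos_half])
  have sc: "lip_order 0 (\<lambda>\<alpha> s. sin (s / 2) * cos (s / 2))"
    by (rule lip_order_mult_le[OF lip_order_sin_half lip_order_cos_half]) simp
  have 6: "approx_order 1 (\<lambda>\<alpha> s. 2 * ?S \<alpha> s) (\<lambda>\<alpha> s. 2 * (sin (s / 2) * cos (s / 2)))"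
    by (rule approx1_mult[OF approx_refl 5 lip_order_const sc])
  have 7: "approx_order 2 (\<lambda>\<alpha> s. ?a \<alpha> s * cos \<alpha>) (\<lambda>\<alpha> s. \<alpha> * 1)"
    by (rule approx_mult[OF approx_E2 approx_cos_alpha lip_order_ident lip_order_const]) simp_all
  have 8: "approx_order 2 (\<lambda>\<alpha> s. 2 * ?S \<alpha> s * (?a \<alpha> s * cos \<alpha>)) (\<lambda>\<alpha> s. 2 * (sin (s / 2) * cos (s / 2)) * (\<alpha> * 1))"
    by (rule approx_mult[OF 6 7 lip_order_mult[OF lip_order_const sc] lip_order_mult[OF lip_order_ident lip_order_const]]) simp_all
  have "approx_order 2 (\<lambda>\<alpha> s. pow_re \<alpha> (arcs \<alpha>) s * (cos (?u \<alpha> s) + 2 * (sin \<alpha>)\<^sup>2 * ?S \<alpha> s)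
        - cos \<alpha> * (?d \<alpha> s * sin (?u \<alpha> s)) + 2 * ?S \<alpha> s * (?a \<alpha> s * cos \<alpha>))
      (\<lambda>\<alpha> s. 0 - 1 * (\<alpha> * sin s * 1) + 2 * (sin (s / 2) * cos (s / 2)) * (\<alpha> * 1))"
    by (rule approx_add[OF approx_diff[OF approx_zero[THEN iffD2, OF 2] 4] 8])
  then have "approx_order 2 (\<lambda>\<alpha> s. snd (snd (snd (final_coords \<alpha> s)))) (\<lambda>\<alpha> s. 0)"
  proof (rule approx_cong[where b = "pi / 4"])
    show "0 = 0 - 1 * (\<alpha> * sin s * 1) + 2 * (sin (s / 2) * cos (s / 2)) * (\<alpha> * 1)" for \<alpha> s :: real
      using sin_double[of "s / 2"] by simp
  qed (simp_all add: front_coords_3)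
  then show ?thesis by (simp add: approx_zero)
qed

text \<open>Order 1 is accurate enough, since in the point on the sphere these coordinates are
  multiplied by the two others, which are of order 1 and 2.\<close>

lemma approx_coord_12:
  "approx_order 1 (\<lambda>\<alpha> s. fst (snd (final_coords \<alpha> s))) (\<lambda>\<alpha> s. - sin s)"
  "approx_order 1 (\<lambda>\<alpha> s. fst (snd (snd (final_coords \<alpha> s)))) (\<lambda>\<alpha> s. - cos s)"
proof -
  let ?C = "\<lambda>\<alpha> s. pow_re \<alpha> (arcs \<alpha>) s"
  let ?E = "\<lambda>\<alpha> s. pow_im \<alpha> (arcs \<alpha>) s * (cos (half_excess \<alpha> s) * sin \<alpha>)"
  let ?F = "\<lambda>\<alpha> s. pow_im \<alpha> (arcs \<alpha>) s * sin (half_excess \<alpha> s)"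
  let ?c = "\<lambda>\<alpha> s. cos (s / 2)" and ?x = "\<lambda>\<alpha> s. sin \<alpha> * sin (s / 2)" and ?y = "\<lambda>\<alpha> s. cos \<alpha> * sin (s / 2)"
  let ?c' = "\<lambda>\<alpha> s. cos (last_arc \<alpha> s / 2)" and ?x' = "\<lambda>\<alpha> s. sin \<alpha> * sin (last_arc \<alpha> s / 2)"
  let ?y' = "\<lambda>\<alpha> s. cos \<alpha> * sin (last_arc \<alpha> s / 2)"
  have one: "lip_order 0 (\<lambda>\<alpha> s. 1)" by (rule lip_order_const)
  have C: "lip_order 1 ?C" by (rule approx_lip_order[OF approx_mono[OF approx_pow_re] lip_order_main]) simp
  have E: "approx_order 1 ?E (\<lambda>\<alpha> s. 1)" by (rule approx_mono[OF approx_E]) simp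
  have E0: "lip_order 0 ?E" by (rule approx_lip_order[OF approx_mono[OF E] one]) simp
  have ca: "approx_order 1 (\<lambda>\<alpha> s. cos \<alpha>) (\<lambda>\<alpha> s. 1)" by (rule approx_mono[OF approx_cos_alpha]) simp
  have x: "lip_order 1 ?x" by (rule lip_order_mult_le[OF lip_order_sin_alpha lip_order_sin_half]) simp
  have x': "lip_order 1 ?x'" by (rule lip_order_mult_le[OF lip_order_sin_alpha lip_order_sin_last]) simp
  have y: "approx_order 1 ?y (\<lambda>\<alpha> s. 1 * sin (s / 2))"
    by (rule approx1_mult[OF ca approx_refl one lip_order_sin_half])
  have y1: "lip_order 0 (\<lambda>\<alpha> s. 1 * sin (s / 2))" using lip_order_sin_half by simp
  have y0: "lip_order 0 ?y" by (rule approx_lip_order[OF approx_mono[OF y] y1]) simp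
  have y': "approx_order 1 ?y' (\<lambda>\<alpha> s. 1 * cos (s / 2))"
    by (rule approx1_mult[OF ca approx_half_last(1) one lip_order_cos_half])
  have y'1: "lip_order 0 (\<lambda>\<alpha> s. 1 * cos (s / 2))" using lip_order_cos_half by simp
  have p0: "lip_order 1 (\<lambda>\<alpha> s. ?C \<alpha> s * ?c \<alpha> s - ?F \<alpha> s * ?y \<alpha> s)"
    by (intro lip_order_diff lip_order_mult_le[OF C lip_order_cos_half] lip_order_mult_le[OF lip_order_F y0]) simp_all
  have p3: "lip_order 1 (\<lambda>\<alpha> s. ?C \<alpha> s * ?y \<alpha> s + ?F \<alpha> s * ?c \<alpha> s - ?E \<alpha> s * ?x \<alpha> s)"
    by (intro lip_order_diff lip_order_add lip_order_mult_le[OF C y0] lip_order_mult_le[OF lip_order_F lip_order_cos_half]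
        lip_order_mult_le[OF E0 x]) simp_all
  have Cx: "approx_order 1 (\<lambda>\<alpha> s. ?C \<alpha> s * ?x \<alpha> s) (\<lambda>\<alpha> s. 0)"
    unfolding approx_zero by (rule lip_order_mult_le[OF C x]) simp
  have Fx: "approx_order 1 (\<lambda>\<alpha> s. ?F \<alpha> s * ?x \<alpha> s) (\<lambda>\<alpha> s. 0)"
    unfolding approx_zero by (rule lip_order_mult_le[OF lip_order_F x]) simp
  have p1: "approx_order 1 (\<lambda>\<alpha> s. ?C \<alpha> s * ?x \<alpha> s + ?E \<alpha> s * ?y \<alpha> s) (\<lambda>\<alpha> s. 0 + 1 * (1 * sin (s / 2)))"
    by (rule approx_add[OF Cx approx1_mult[OF E y one y1]])
  have p1': "approx_order 1 (\<lambda>\<alpha> s. ?C \<alpha> s * ?x \<alpha> s + ?E \<alpha> s * ?y \<alpha> s) (\<lambda>\<alpha> s. sin (s / 2))"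
    using p1 by simp
  have p2: "approx_order 1 (\<lambda>\<alpha> s. ?E \<alpha> s * ?c \<alpha> s + ?F \<alpha> s * ?x \<alpha> s) (\<lambda>\<alpha> s. 1 * cos (s / 2) + 0)"
    by (rule approx_add[OF approx1_mult[OF E approx_refl one lip_order_cos_half] Fx])
  have p2': "approx_order 1 (\<lambda>\<alpha> s. ?E \<alpha> s * ?c \<alpha> s + ?F \<alpha> s * ?x \<alpha> s) (\<lambda>\<alpha> s. cos (s / 2))"
    using p2 by simp
  have c': "approx_order 1 ?c' (\<lambda>\<alpha> s. sin (s / 2))" by (rule approx_half_last(2))
  have y'': "approx_order 1 ?y' (\<lambda>\<alpha> s. cos (s / 2))" using y' by simp
  have x0: "lip_order 0 ?x'" by (rule lip_order_mono[OF x']) simp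
  have xp3: "approx_order 1 (\<lambda>\<alpha> s. ?x' \<alpha> s * (?C \<alpha> s * ?y \<alpha> s + ?F \<alpha> s * ?c \<alpha> s - ?E \<alpha> s * ?x \<alpha> s)) (\<lambda>\<alpha> s. 0)"
    unfolding approx_zero by (rule lip_order_mult_le[OF x' p3]) simp
  have xp0: "approx_order 1 (\<lambda>\<alpha> s. ?x' \<alpha> s * (?C \<alpha> s * ?c \<alpha> s - ?F \<alpha> s * ?y \<alpha> s)) (\<lambda>\<alpha> s. 0)"
    unfolding approx_zero by (rule lip_order_mult_le[OF x' p0]) simp
  note sh = lip_order_sin_half and ch = lip_order_cos_half
  have q1: "approx_order 1 (\<lambda>\<alpha> s. - (?c' \<alpha> s * (?E \<alpha> s * ?c \<alpha> s + ?F \<alpha> s * ?x \<alpha> s))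
        - ?x' \<alpha> s * (?C \<alpha> s * ?y \<alpha> s + ?F \<alpha> s * ?c \<alpha> s - ?E \<alpha> s * ?x \<alpha> s)
        - ?y' \<alpha> s * (?C \<alpha> s * ?x \<alpha> s + ?E \<alpha> s * ?y \<alpha> s))
      (\<lambda>\<alpha> s. - (sin (s / 2) * cos (s / 2)) - 0 - cos (s / 2) * sin (s / 2))"
    by (rule approx_diff[OF approx_diff[OF approx_minus[OF approx1_mult[OF c' p2' sh ch]] xp3] approx1_mult[OF y'' p1' ch sh]])
  show "approx_order 1 (\<lambda>\<alpha> s. fst (snd (final_coords \<alpha> s))) (\<lambda>\<alpha> s. - sin s)"
    using q1
  proof (rule approx_cong[where b = 1])
    show "- sin s = - (sin (s / 2) * cos (s / 2)) - 0 - cos (s / 2) * sin (s / 2)" for s :: real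
      using sin_double[of "s / 2"] by simp
  qed (simp_all add: front_coords_def Let_def)
  have q2: "approx_order 1 (\<lambda>\<alpha> s. ?c' \<alpha> s * (?C \<alpha> s * ?x \<alpha> s + ?E \<alpha> s * ?y \<alpha> s)
        - ?y' \<alpha> s * (?E \<alpha> s * ?c \<alpha> s + ?F \<alpha> s * ?x \<alpha> s)
        - ?x' \<alpha> s * (?C \<alpha> s * ?c \<alpha> s - ?F \<alpha> s * ?y \<alpha> s))
      (\<lambda>\<alpha> s. sin (s / 2) * sin (s / 2) - cos (s / 2) * cos (s / 2) - 0)"
    by (rule approx_diff[OF approx_diff[OF approx1_mult[OF c' p1' sh sh] approx1_mult[OF y'' p2' ch ch]] xp0])
  show "approx_order 1 (\<lambda>\<alpha> s. fst (snd (snd (final_coords \<alpha> s)))) (\<lambda>\<alpha> s. - cos s)"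
    using q2
  proof (rule approx_cong[where b = 1])
    show "- cos s = sin (s / 2) * sin (s / 2) - cos (s / 2) * cos (s / 2) - 0" for s :: real
      using cos_double[of "s / 2"] by (simp add: power2_eq_square)
  qed (simp_all add: front_coords_def Let_def)
qed

lemma qpoint4_components:
  "qpoint4 q $ 1 = 2 * (fst (snd q) * snd (snd (snd q)) + fst q * fst (snd (snd q)))"
  "qpoint4 q $ 2 = 2 * (fst (snd (snd q)) * snd (snd (snd q)) - fst q * fst (snd q))"
  "qpoint4 q $ 3 = (fst q)\<^sup>2 + (snd (snd (snd q)))\<^sup>2 - (fst (snd q))\<^sup>2 - (fst (snd (snd q)))\<^sup>2"
  by (simp_all add: qpoint4_def qpoint_def split: prod.split)

text \<open>To leading order the front is the circle of radius \<open>2 \<alpha> r(\<alpha>)\<close> around the south pole.\<close>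

lemma approx_front:
  "approx_order 2 (\<lambda>\<alpha> s. qpoint4 (final_coords \<alpha> s) $ 1) (\<lambda>\<alpha> s. 2 * (\<alpha> * remainder \<alpha> * cos s))"
  "approx_order 2 (\<lambda>\<alpha> s. qpoint4 (final_coords \<alpha> s) $ 2) (\<lambda>\<alpha> s. - (2 * (\<alpha> * remainder \<alpha> * sin s)))"
proof -
  let ?a = "\<lambda>\<alpha> s. fst (final_coords \<alpha> s)" and ?b = "\<lambda>\<alpha> s. fst (snd (final_coords \<alpha> s))"
  let ?c = "\<lambda>\<alpha> s. fst (snd (snd (final_coords \<alpha> s)))" and ?d = "\<lambda>\<alpha> s. snd (snd (snd (final_coords \<alpha> s)))"
  have ms: "lip_order 0 (\<lambda>\<alpha> s. - sin s)" and mc: "lip_order 0 (\<lambda>\<alpha> s. - cos s)"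
    by (rule lip_order_minus[OF lip_order_sin_s] lip_order_minus[OF lip_order_cos_s])+
  have b0: "lip_order 0 ?b" by (rule approx_lip_order[OF approx_mono[OF approx_coord_12(1)] ms]) simp
  have c0: "lip_order 0 ?c" by (rule approx_lip_order[OF approx_mono[OF approx_coord_12(2)] mc]) simp
  have bd: "approx_order 2 (\<lambda>\<alpha> s. ?b \<alpha> s * ?d \<alpha> s) (\<lambda>\<alpha> s. 0)"
    unfolding approx_zero by (rule lip_order_mult_le[OF b0 lip_order_coord_3]) simp
  have cd: "approx_order 2 (\<lambda>\<alpha> s. ?c \<alpha> s * ?d \<alpha> s) (\<lambda>\<alpha> s. 0)"
    unfolding approx_zero by (rule lip_order_mult_le[OF c0 lip_order_coord_3]) simp
  have ac: "approx_order 2 (\<lambda>\<alpha> s. ?a \<alpha> s * ?c \<alpha> s) (\<lambda>\<alpha> s. - (\<alpha> * remainder \<alpha>) * - cos s)"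
    by (rule approx_mult[OF approx_coord_0 approx_coord_12(2) lip_order_main' mc]) simp_all
  have ab: "approx_order 2 (\<lambda>\<alpha> s. ?a \<alpha> s * ?b \<alpha> s) (\<lambda>\<alpha> s. - (\<alpha> * remainder \<alpha>) * - sin s)"
    by (rule approx_mult[OF approx_coord_0 approx_coord_12(1) lip_order_main' ms]) simp_all
  have l1: "lip_order 1 (\<lambda>\<alpha> s. 0 + - (\<alpha> * remainder \<alpha>) * - cos s)"
    using lip_order_mult_le[OF lip_order_main' mc, of 1] by simp
  have l2: "lip_order 1 (\<lambda>\<alpha> s. 0 - - (\<alpha> * remainder \<alpha>) * - sin s)"
    using lip_order_minus[OF lip_order_mult_le[OF lip_order_main' ms, of 1]] by simp
  have "approx_order 2 (\<lambda>\<alpha> s. 2 * (?b \<alpha> s * ?d \<alpha> s + ?a \<alpha> s * ?c \<alpha> s)) (\<lambda>\<alpha> s. 2 * (0 + - (\<alpha> * remainder \<alpha>) * - cos s))"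
    by (rule approx_mult[OF approx_refl[of 2] approx_add[OF bd ac] lip_order_const l1]) simp_all
  then show "approx_order 2 (\<lambda>\<alpha> s. qpoint4 (final_coords \<alpha> s) $ 1) (\<lambda>\<alpha> s. 2 * (\<alpha> * remainder \<alpha> * cos s))"
    by (simp add: qpoint4_components)
  have "approx_order 2 (\<lambda>\<alpha> s. 2 * (?c \<alpha> s * ?d \<alpha> s - ?a \<alpha> s * ?b \<alpha> s)) (\<lambda>\<alpha> s. 2 * (0 - - (\<alpha> * remainder \<alpha>) * - sin s))"
    by (rule approx_mult[OF approx_refl[of 2] approx_diff[OF cd ab] lip_order_const l2]) simp_all
  then show "approx_order 2 (\<lambda>\<alpha> s. qpoint4 (final_coords \<alpha> s) $ 2) (\<lambda>\<alpha> s. - (2 * (\<alpha> * remainder \<alpha> * sin s)))"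
    by (simp add: qpoint4_components)
qed

lemma lip_order_continuous:
  assumes "lip_order k f"
  shows "\<exists>a>0. \<forall>\<alpha>. 0 < \<alpha> \<and> \<alpha> < a \<longrightarrow> continuous_on {0..pi} (f \<alpha>)"
proof -
  obtain C a where C: "0 \<le> C" "0 < a"
    "\<And>\<alpha> s s'. 0 < \<alpha> \<Longrightarrow> \<alpha> < a \<Longrightarrow> s \<in> {0..pi} \<Longrightarrow> s' \<in> {0..pi} \<Longrightarrow>
       \<bar>f \<alpha> s - f \<alpha> s'\<bar> \<le> C * \<alpha> ^ k * \<bar>s - s'\<bar>"
    by (rule lip_orderE[OF assms]) blast
  have "continuous_on {0..pi} (f \<alpha>)" if "0 < \<alpha>" "\<alpha> < a" for \<alpha>
    by (rule lipschitz_on_continuous_on[OF lipschitz_onI[where L = "C * \<alpha> ^ k"]])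
      (use C(1) C(3)[OF that] that in \<open>auto simp: dist_real_def\<close>)
  with C(2) show ?thesis by blast
qed

lemma final_coords_continuous:
  "\<exists>a>0. \<forall>\<alpha>. 0 < \<alpha> \<and> \<alpha> < a \<longrightarrow> continuous_on {0..pi} (\<lambda>s. qpoint4 (final_coords \<alpha> s))"
proof -
  have 0: "lip_order 0 (\<lambda>\<alpha> s. fst (final_coords \<alpha> s))"
    by (rule approx_lip_order[OF approx_mono[OF approx_coord_0] lip_order_mono[OF lip_order_main']]) simp_all
  have 1: "lip_order 0 (\<lambda>\<alpha> s. fst (snd (final_coords \<alpha> s)))"
    by (rule approx_lip_order[OF approx_mono[OF approx_coord_12(1)] lip_order_minus[OF lip_order_sin_s]]) simp
  have 2: "lip_order 0 (\<lambda>\<alpha> s. fst (snd (snd (final_coords \<alpha> s))))"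
    by (rule approx_lip_order[OF approx_mono[OF approx_coord_12(2)] lip_order_minus[OF lip_order_cos_s]]) simp
  note 3 = lip_order_coord_3
  obtain a0 where a0: "a0 > 0" "\<And>\<alpha>. 0 < \<alpha> \<Longrightarrow> \<alpha> < a0 \<Longrightarrow> continuous_on {0..pi} (\<lambda>s. fst (final_coords \<alpha> s))"
    using lip_order_continuous[OF 0] by blast
  obtain a1 where a1: "a1 > 0" "\<And>\<alpha>. 0 < \<alpha> \<Longrightarrow> \<alpha> < a1 \<Longrightarrow> continuous_on {0..pi} (\<lambda>s. fst (snd (final_coords \<alpha> s)))"
    using lip_order_continuous[OF 1] by blast
  obtain a2 where a2: "a2 > 0" "\<And>\<alpha>. 0 < \<alpha> \<Longrightarrow> \<alpha> < a2 \<Longrightarrow> continuous_on {0..pi} (\<lambda>s. fst (snd (snd (final_coords \<alpha> s))))"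
    using lip_order_continuous[OF 2] by blast
  obtain a3 where a3: "a3 > 0" "\<And>\<alpha>. 0 < \<alpha> \<Longrightarrow> \<alpha> < a3 \<Longrightarrow> continuous_on {0..pi} (\<lambda>s. snd (snd (snd (final_coords \<alpha> s))))"
    using lip_order_continuous[OF 3] by blast
  have "continuous_on {0..pi} (\<lambda>s. qpoint4 (final_coords \<alpha> s))"
    if "0 < \<alpha>" "\<alpha> < min (min a0 a1) (min a2 a3)" for \<alpha>
  proof -
    have c: "continuous_on {0..pi} (\<lambda>s. fst (final_coords \<alpha> s))"
      "continuous_on {0..pi} (\<lambda>s. fst (snd (final_coords \<alpha> s)))"
      "continuous_on {0..pi} (\<lambda>s. fst (snd (snd (final_coords \<alpha> s))))"
      "continuous_on {0..pi} (\<lambda>s. snd (snd (snd (final_coords \<alpha> s))))"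
      using that a0(2) a1(2) a2(2) a3(2) by simp_all
    have "continuous_on {0..pi} (\<lambda>s. qpoint4 (final_coords \<alpha> s) $ i)" for i :: 3
    proof -
      have "i = 1 \<or> i = 2 \<or> i = 3" using exhaust_3 by blast
      then show ?thesis unfolding qpoint4_components
        by (elim disjE) (simp_all only: qpoint4_components, (intro continuous_intros c)+)
    qed
    then have "continuous_on {0..pi} (\<lambda>s. \<chi> i. qpoint4 (final_coords \<alpha> s) $ i)"
      by (rule continuous_on_vec_lambda)
    then show ?thesis by simp
  qed
  moreover have "0 < min (min a0 a1) (min a2 a3)" using a0(1) a1(1) a2(1) a3(1) by simp
  ultimately show ?thesis by blast
qed

section \<open>The front as a Jordan curve\<close>

text \<open>The accumulated delay vanishes at s = \<pi> and is Lipschitz in s with constant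
  O(\<alpha>), so it is at most (\<pi> - s)/2 for small \<alpha>. A bound of order \<alpha> alone
  would fail near s = \<pi>.\<close>

lemma last_arc_nonneg:
  "\<exists>a>0. \<forall>\<alpha> s. 0 < \<alpha> \<and> \<alpha> < a \<and> s \<in> {0..pi} \<longrightarrow> 0 \<le> last_arc \<alpha> s"
proof -
  obtain C a where C: "0 \<le> C" "0 < a"
    "\<And>\<alpha> s s'. 0 < \<alpha> \<Longrightarrow> \<alpha> < a \<Longrightarrow> s \<in> {0..pi} \<Longrightarrow> s' \<in> {0..pi} \<Longrightarrow>
       \<bar>real (arcs \<alpha>) * half_excess \<alpha> s - real (arcs \<alpha>) * half_excess \<alpha> s'\<bar> \<le> C * \<alpha> ^ 1 * \<bar>s - s'\<bar>"
    by (rule lip_orderE[OF lip_order_delay]) blast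
  have "0 \<le> last_arc \<alpha> s" if A: "0 < \<alpha>" "\<alpha> < min a (1 / (2 * (C + 1)))" "s \<in> {0..pi}" for \<alpha> s
  proof -
    have z: "half_excess \<alpha> pi = 0" by (simp add: half_excess_def)
    have "real (arcs \<alpha>) * half_excess \<alpha> s \<le> C * \<alpha> * (pi - s)"
      using C(3)[of \<alpha> s pi] A z by simp
    also have "\<dots> \<le> 1 / 2 * (pi - s)"
    proof (rule mult_right_mono)
      have "\<alpha> * (2 * (C + 1)) \<le> 1" using A C(1) by (simp add: pos_less_divide_eq less_imp_le)
      then show "C * \<alpha> \<le> 1 / 2" using A by (simp add: algebra_simps)
    qed (use A in simp)
    finally show ?thesis by (simp add: last_arc_def)
  qed
  moreover have "0 < min a (1 / (2 * (C + 1)))" using C by simp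
  ultimately show ?thesis by blast
qed

text \<open>Given by a formula that makes sense on the closed interval [0, \<pi>], whereas first
  arcs have durations in (0, \<pi>]. The added end point s = 0 makes each half of the front a
  compact arc.\<close>

definition front_curve :: "real \<Rightarrow> real \<Rightarrow> real \<Rightarrow> real^3" where
  "front_curve \<alpha> \<epsilon> s = half_turn (- ((-1) ^ arcs \<alpha> * \<epsilon>)) (qpoint4 (final_coords \<alpha> s))"

lemma bang_bang_front_curve:
  assumes \<alpha>: "0 < \<alpha>" "\<alpha> < pi / 4" and \<epsilon>: "\<epsilon>\<^sup>2 = 1" and s: "s \<in> {0..pi}" and l: "0 \<le> last_arc \<alpha> s"
  shows "bang_bang \<alpha> \<epsilon> s (real (kM \<alpha>) * pi) = front_curve \<alpha> \<epsilon> s"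
proof -
  have D: "0 \<le> half_excess \<alpha> s" using half_excess_nonneg[OF \<alpha>, of s] s by simp
  have "0 \<le> real (arcs \<alpha>) * half_excess \<alpha> s" using D by simp
  then have u: "last_arc \<alpha> s \<le> v_dur \<alpha> s"
    unfolding last_arc_def v_dur_half_excess using s D unfolding atLeastAtMost_iff by linarith
  have k: "real (kM \<alpha>) = real (arcs \<alpha>) + 1" using arcs_eq(1)[OF \<alpha>] by (simp add: of_nat_diff)
  have "s + real (arcs \<alpha>) * v_dur \<alpha> s + last_arc \<alpha> s = real (kM \<alpha>) * pi"
    unfolding k by (simp add: last_arc_def v_dur_half_excess algebra_simps)
  then show ?thesis
    using bang_bang_front_coords[OF \<alpha> l u \<epsilon>, of "arcs \<alpha>"] by (simp add: front_curve_def)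
qed

text \<open>A first arc of duration zero followed by arcs of duration v(0) = \<pi> is the trajectory
  that starts with the opposite sign and a first arc of duration \<pi> = v(\<pi>). So the two halves
  of the front close up.\<close>

lemma front_curve_ends:
  assumes \<alpha>: "0 < \<alpha>" "\<alpha> < pi / 4"
  shows "front_curve \<alpha> \<epsilon> 0 = front_curve \<alpha> (- \<epsilon>) pi"
proof -
  have D: "half_excess \<alpha> 0 = 0" "half_excess \<alpha> pi = 0" by (simp_all add: half_excess_def)
  have k: "step_angle \<alpha> 0 = step_angle \<alpha> pi" by (simp add: step_angle_def D)
  have "half_turn (-1) (qpoint4 (final_coords \<alpha> 0)) = qpoint4 (final_coords \<alpha> pi)"
    by (simp add: vec3_eq_iff half_turn_def qpoint4_components)
      (simp add: front_coords_def Let_def last_arc_def D pow_re_def pow_im_def k power2_eq_square algebra_simps)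
  then have "front_curve \<alpha> (- \<epsilon>) pi = half_turn ((-1) ^ arcs \<alpha> * \<epsilon>) (half_turn (-1) (qpoint4 (final_coords \<alpha> 0)))"
    by (simp add: front_curve_def)
  also have "\<dots> = front_curve \<alpha> \<epsilon> 0" by (simp add: half_turn_mult front_curve_def)
  finally show ?thesis by simp
qed

text \<open>The chord has length 2 |sin((x - y)/2)|, which for |x - y| \<le> \<pi> is bounded below
  by the linear estimate for the sine and above by the sum of the coordinate differences.\<close>

lemma circle_separation:
  fixes x y :: real
  assumes "\<bar>x - y\<bar> \<le> pi"
  shows "\<bar>x - y\<bar> / 4 \<le> \<bar>cos x - cos y\<bar> + \<bar>sin x - sin y\<bar>"
proof -
  let ?a = "\<bar>cos x - cos y\<bar>" and ?b = "\<bar>sin x - sin y\<bar>" and ?h = "sin ((x - y) / 2)"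
  have h: "(cos x - cos y)\<^sup>2 + (sin x - sin y)\<^sup>2 = (2 * ?h)\<^sup>2"
  proof -
    have "(cos x - cos y)\<^sup>2 + (sin x - sin y)\<^sup>2 = 2 - 2 * cos (x - y)"
      using sin_cos_squared_add[of x] sin_cos_squared_add[of y]
      by (simp add: cos_diff power2_eq_square algebra_simps)
    also have "cos (x - y) = 1 - 2 * ?h\<^sup>2"
      using cos_double_sin[of "(x - y) / 2"] unfolding times_divide_eq_right nonzero_mult_div_cancel_left[OF zero_neq_numeral[symmetric]] .
    finally show ?thesis by (simp add: power_mult_distrib)
  qed
  have "(2 * \<bar>?h\<bar>)\<^sup>2 = ?a\<^sup>2 + ?b\<^sup>2" using h by (simp add: power_mult_distrib)
  also have "\<dots> \<le> (?a + ?b)\<^sup>2" by (simp add: power2_sum)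
  finally have le: "2 * \<bar>?h\<bar> \<le> ?a + ?b" by (rule power2_le_imp_le) simp
  have "\<bar>x - y\<bar> / 2 / 4 \<le> sin (\<bar>x - y\<bar> / 2)" using assms by (intro sin_ge_quarter) auto
  also have "sin (\<bar>x - y\<bar> / 2) \<le> \<bar>?h\<bar>"
  proof (cases "x \<le> y")
    case True
    have "sin ((y - x) / 2) = - ?h" unfolding sin_minus[symmetric] by (simp add: minus_divide_left)
    with True show ?thesis by simp
  qed simp
  finally show ?thesis using le by simp
qed

lemma half_turn_components:
  "half_turn \<sigma> x $ 1 = \<sigma> * x $ 1" "half_turn \<sigma> x $ 2 = \<sigma> * x $ 2" "half_turn \<sigma> x $ 3 = x $ 3"
  by (simp_all add: half_turn_def)

lemma front_curve_components:
  "front_curve \<alpha> \<epsilon> s $ 1 = - ((-1) ^ arcs \<alpha> * \<epsilon>) * qpoint4 (final_coords \<alpha> s) $ 1"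
  "front_curve \<alpha> \<epsilon> s $ 2 = - ((-1) ^ arcs \<alpha> * \<epsilon>) * qpoint4 (final_coords \<alpha> s) $ 2"
  by (simp_all add: front_curve_def half_turn_components)

text \<open>The error terms are Lipschitz in \<open>s\<close> with a constant smaller than the radius of the limit
  circle, so that the curve is as injective as the circle.\<close>

lemma perturbed_circle:
  fixes z w :: "real \<Rightarrow> real"
  assumes l: "\<forall>s\<in>{0..pi}. \<forall>s'\<in>{0..pi}.
      \<bar>(z s - 2 * (\<rho> * cos s)) - (z s' - 2 * (\<rho> * cos s'))\<bar> \<le> L * \<bar>s - s'\<bar>"
    "\<forall>s\<in>{0..pi}. \<forall>s'\<in>{0..pi}.
      \<bar>(w s - - (2 * (\<rho> * sin s))) - (w s' - - (2 * (\<rho> * sin s')))\<bar> \<le> L * \<bar>s - s'\<bar>"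
    and L: "4 * L < \<rho>" "0 \<le> L" and s: "s \<in> {0..pi}" "s' \<in> {0..pi}"
  shows "z s = z s' \<Longrightarrow> w s = w s' \<Longrightarrow> s = s'"
    and "z s = - z s' \<Longrightarrow> w s = - w s' \<Longrightarrow> z 0 = - z pi \<Longrightarrow> w 0 = - w pi \<Longrightarrow> s \<le> s' \<Longrightarrow> s = 0 \<and> s' = pi"
proof -
  \<comment> \<open>The circle of radius 2 \<rho> separates parameters at a rate of at least
    \<rho>/2, while the errors move at a rate of at most 2 L in total; 4 L < \<rho> leaves only x =
    y.\<close>
  have key: "x = y" if A: "\<bar>x - y\<bar> \<le> pi" "\<bar>2 * (\<rho> * (cos x - cos y))\<bar> \<le> L * \<bar>x - y\<bar>"
    "\<bar>2 * (\<rho> * (sin x - sin y))\<bar> \<le> L * \<bar>x - y\<bar>" for x y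
  proof -
    have \<rho>: "0 < \<rho>" using L by simp
    have "2 * \<rho> * (\<bar>x - y\<bar> / 4) \<le> 2 * \<rho> * (\<bar>cos x - cos y\<bar> + \<bar>sin x - sin y\<bar>)"
      using circle_separation[OF A(1)] \<rho> by (intro mult_left_mono) auto
    also have "\<dots> = \<bar>2 * (\<rho> * (cos x - cos y))\<bar> + \<bar>2 * (\<rho> * (sin x - sin y))\<bar>"
      using \<rho> by (simp add: abs_mult distrib_left)
    also have "\<dots> \<le> 2 * L * \<bar>x - y\<bar>" using A by simp
    finally have "(\<rho> - 4 * L) * \<bar>x - y\<bar> \<le> 0" by (simp add: algebra_simps)
    then show "x = y" using L(1) by (simp add: mult_le_0_iff)
  qed
  show "s = s'" if "z s = z s'" "w s = w s'"
  proof (rule key)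
    have "2 * (\<rho> * (cos s - cos s')) = - ((z s - 2 * (\<rho> * cos s)) - (z s' - 2 * (\<rho> * cos s')))"
      using that by (simp add: algebra_simps)
    then show "\<bar>2 * (\<rho> * (cos s - cos s'))\<bar> \<le> L * \<bar>s - s'\<bar>" using l(1)[rule_format, OF s] by simp
    have "2 * (\<rho> * (sin s - sin s')) = ((w s - - (2 * (\<rho> * sin s))) - (w s' - - (2 * (\<rho> * sin s'))))"
      using that by (simp add: algebra_simps)
    then show "\<bar>2 * (\<rho> * (sin s - sin s'))\<bar> \<le> L * \<bar>s - s'\<bar>" using l(2)[rule_format, OF s] by simp
  qed (use s in auto)
  show "s = 0 \<and> s' = pi" if A: "z s = - z s'" "w s = - w s'" "z 0 = - z pi" "w 0 = - w pi" "s \<le> s'"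
  proof -
    have 0: "0 \<in> {0..pi}" "pi \<in> {0..pi}" by simp_all
    have d: "\<bar>s - (s' - pi)\<bar> = \<bar>s - 0\<bar> + \<bar>s' - pi\<bar>" using s by simp
    \<comment> \<open>Antipodal values mean equal points of the circle at s and s' - \<pi>. The
      errors are compared through the ends 0 and \<pi>, whose values are known to be antipodal; as
      |s - (s' - \<pi>)| = |s| + |s' - \<pi>|, the two Lipschitz bounds add up without loss.\<close>
    have "s = s' - pi"
    proof (rule key)
      show "\<bar>s - (s' - pi)\<bar> \<le> pi" using s A by simp
      have "2 * (\<rho> * (cos s - cos (s' - pi))) = - (((z s - 2 * (\<rho> * cos s)) - (z 0 - 2 * (\<rho> * cos 0)))
          + ((z s' - 2 * (\<rho> * cos s')) - (z pi - 2 * (\<rho> * cos pi))))"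
        using A by (simp add: algebra_simps cos_diff)
      then show "\<bar>2 * (\<rho> * (cos s - cos (s' - pi)))\<bar> \<le> L * \<bar>s - (s' - pi)\<bar>"
        using l(1)[rule_format, OF s(1) 0(1)] l(1)[rule_format, OF s(2) 0(2)] unfolding d distrib_left by linarith
      have "2 * (\<rho> * (sin s - sin (s' - pi))) = ((w s - - (2 * (\<rho> * sin s))) - (w 0 - - (2 * (\<rho> * sin 0))))
          + ((w s' - - (2 * (\<rho> * sin s'))) - (w pi - - (2 * (\<rho> * sin pi))))"
        using A by (simp add: algebra_simps sin_diff)
      then show "\<bar>2 * (\<rho> * (sin s - sin (s' - pi)))\<bar> \<le> L * \<bar>s - (s' - pi)\<bar>"
        using l(2)[rule_format, OF s(1) 0(1)] l(2)[rule_format, OF s(2) 0(2)] unfolding d distrib_left by linarith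
    qed
    then show ?thesis using s by simp
  qed
qed

text \<open>The hypothesis r(\<alpha>) > \<delta> is used here: the Lipschitz constant of the errors
  is O(\<alpha>^2), the radius is more than 2 \<alpha> \<delta>, so the former is dominated for
  small \<alpha>. The two signs \<epsilon> give antipodal halves in the first two
  coordinates.\<close>

lemma front_curve_injective:
  assumes "0 < \<delta>"
  shows "\<exists>a>0. \<forall>\<alpha>. 0 < \<alpha> \<and> \<alpha> < a \<and> \<delta> < remainder \<alpha> \<longrightarrow>
    (\<forall>\<epsilon> \<epsilon>' s s'. \<epsilon> \<in> {-1, 1} \<and> \<epsilon>' \<in> {-1, 1} \<and> s \<in> {0..pi} \<and> s' \<in> {0..pi} \<and>
       front_curve \<alpha> \<epsilon> s = front_curve \<alpha> \<epsilon>' s' \<longrightarrow>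
       \<epsilon> = \<epsilon>' \<and> s = s' \<or> \<epsilon> = - \<epsilon>' \<and> {s, s'} = {0, pi})"
proof -
  let ?z = "\<lambda>\<alpha> s. qpoint4 (final_coords \<alpha> s) $ 1" and ?w = "\<lambda>\<alpha> s. qpoint4 (final_coords \<alpha> s) $ 2"
  obtain C a where C: "0 \<le> C" "0 < a" "\<And>\<alpha> s s'. 0 < \<alpha> \<Longrightarrow> \<alpha> < a \<Longrightarrow> s \<in> {0..pi} \<Longrightarrow> s' \<in> {0..pi} \<Longrightarrow>
      \<bar>(?z \<alpha> s - 2 * (\<alpha> * remainder \<alpha> * cos s)) - (?z \<alpha> s' - 2 * (\<alpha> * remainder \<alpha> * cos s'))\<bar> \<le> C * \<alpha> ^ 2 * \<bar>s - s'\<bar>"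
    by (rule lip_orderE[OF approx_front(1)[unfolded approx_order_def]]) blast
  obtain B b where B: "0 \<le> B" "0 < b" "\<And>\<alpha> s s'. 0 < \<alpha> \<Longrightarrow> \<alpha> < b \<Longrightarrow> s \<in> {0..pi} \<Longrightarrow> s' \<in> {0..pi} \<Longrightarrow>
      \<bar>(?w \<alpha> s - - (2 * (\<alpha> * remainder \<alpha> * sin s))) - (?w \<alpha> s' - - (2 * (\<alpha> * remainder \<alpha> * sin s')))\<bar> \<le> B * \<alpha> ^ 2 * \<bar>s - s'\<bar>"
    by (rule lip_orderE[OF approx_front(2)[unfolded approx_order_def]]) blast
  \<comment> \<open>The last entry is the condition 4 (C + B) \<alpha>^2 < \<alpha> r(\<alpha>)
    after division by \<alpha>; adding 1 keeps the denominator positive.\<close>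
  define c where "c = Min {a, b, pi / 4, \<delta> / (4 * (C + B) + 1)}"
  have "0 < c" unfolding c_def using C(1,2) B(1,2) assms by simp
  moreover have "\<epsilon> = \<epsilon>' \<and> s = s' \<or> \<epsilon> = - \<epsilon>' \<and> {s, s'} = {0, pi}"
    if A: "0 < \<alpha>" "\<alpha> < c" "\<delta> < remainder \<alpha>" and \<epsilon>: "\<epsilon> \<in> {-1, 1}" "\<epsilon>' \<in> {-1, 1}"
      and s: "s \<in> {0..pi}" "s' \<in> {0..pi}" and e: "front_curve \<alpha> \<epsilon> s = front_curve \<alpha> \<epsilon>' s'" for \<alpha> \<epsilon> \<epsilon>' s s'
  proof -
    have c: "\<alpha> < a" "\<alpha> < b" "\<alpha> < pi / 4" "\<alpha> < \<delta> / (4 * (C + B) + 1)" using A(2) by (simp_all add: c_def)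
    define L where "L = (C + B) * \<alpha> ^ 2"
    have "\<alpha> * (4 * (C + B) + 1) < \<delta>" using c(4) C(1) B(1) by (simp add: pos_less_divide_eq)
    then have "\<alpha> * (4 * (C + B)) < remainder \<alpha>" using A by (simp add: algebra_simps)
    then have "\<alpha> * (\<alpha> * (4 * (C + B))) < \<alpha> * remainder \<alpha>" using A(1) by (rule mult_strict_left_mono)
    then have L: "4 * L < \<alpha> * remainder \<alpha>" by (simp add: L_def power2_eq_square algebra_simps)
    have L0: "0 \<le> L" using C(1) B(1) by (simp add: L_def)
    have CB: "C * \<alpha> ^ 2 * \<bar>x\<bar> \<le> L * \<bar>x\<bar>" "B * \<alpha> ^ 2 * \<bar>x\<bar> \<le> L * \<bar>x\<bar>" for x
      unfolding L_def using C(1) B(1) by (intro mult_right_mono; simp)+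
    have CL: "\<forall>s\<in>{0..pi}. \<forall>s'\<in>{0..pi}. \<bar>(?z \<alpha> s - 2 * (\<alpha> * remainder \<alpha> * cos s)) - (?z \<alpha> s' - 2 * (\<alpha> * remainder \<alpha> * cos s'))\<bar> \<le> L * \<bar>s - s'\<bar>"
      by (intro ballI order_trans[OF C(3)[OF A(1) c(1)] CB(1)])
    have BL: "\<forall>s\<in>{0..pi}. \<forall>s'\<in>{0..pi}. \<bar>(?w \<alpha> s - - (2 * (\<alpha> * remainder \<alpha> * sin s))) - (?w \<alpha> s' - - (2 * (\<alpha> * remainder \<alpha> * sin s')))\<bar> \<le> L * \<bar>s - s'\<bar>"
      by (intro ballI order_trans[OF B(3)[OF A(1) c(2)] CB(2)])
    note pc = perturbed_circle[of "?z \<alpha>" "\<alpha> * remainder \<alpha>" L "?w \<alpha>", OF CL BL L L0]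
    have zw: "\<epsilon> * ?z \<alpha> s = \<epsilon>' * ?z \<alpha> s'" "\<epsilon> * ?w \<alpha> s = \<epsilon>' * ?w \<alpha> s'"
      if e: "front_curve \<alpha> \<epsilon> s = front_curve \<alpha> \<epsilon>' s'" for \<epsilon> \<epsilon>' s s'
    proof -
      have m: "(-1) ^ arcs \<alpha> \<noteq> (0 :: real)" by simp
      have "- ((-1) ^ arcs \<alpha> * \<epsilon>) * ?z \<alpha> s = - ((-1) ^ arcs \<alpha> * \<epsilon>') * ?z \<alpha> s'"
        unfolding front_curve_components[symmetric] e ..
      then have "(-1) ^ arcs \<alpha> * (\<epsilon> * ?z \<alpha> s) = (-1) ^ arcs \<alpha> * (\<epsilon>' * ?z \<alpha> s')"
        unfolding mult.assoc minus_mult_left[symmetric] neg_equal_iff_equal .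
      then show "\<epsilon> * ?z \<alpha> s = \<epsilon>' * ?z \<alpha> s'" unfolding mult_cancel_left using m by blast
      have "- ((-1) ^ arcs \<alpha> * \<epsilon>) * ?w \<alpha> s = - ((-1) ^ arcs \<alpha> * \<epsilon>') * ?w \<alpha> s'"
        unfolding front_curve_components[symmetric] e ..
      then have "(-1) ^ arcs \<alpha> * (\<epsilon> * ?w \<alpha> s) = (-1) ^ arcs \<alpha> * (\<epsilon>' * ?w \<alpha> s')"
        unfolding mult.assoc minus_mult_left[symmetric] neg_equal_iff_equal .
      then show "\<epsilon> * ?w \<alpha> s = \<epsilon>' * ?w \<alpha> s'" unfolding mult_cancel_left using m by blast
    qed
    have ends: "?z \<alpha> 0 = - ?z \<alpha> pi" "?w \<alpha> 0 = - ?w \<alpha> pi"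
      using zw[OF front_curve_ends[OF A(1) c(3), of 1]] by simp_all
    note zw[OF e]
    then consider "\<epsilon> = \<epsilon>'" "?z \<alpha> s = ?z \<alpha> s'" "?w \<alpha> s = ?w \<alpha> s'"
      | "\<epsilon> = - \<epsilon>'" "?z \<alpha> s = - ?z \<alpha> s'" "?w \<alpha> s = - ?w \<alpha> s'"
      using \<epsilon> by fastforce
    then show ?thesis
    proof cases
      case 1
      then show ?thesis using pc(1)[OF s] by blast
    next
      case 2
      show ?thesis
      proof (cases "s \<le> s'")
        case True
        then show ?thesis using pc(2)[OF s 2(2,3) ends] 2(1) by auto
      next
        case False
        have "?z \<alpha> s' = - ?z \<alpha> s" "?w \<alpha> s' = - ?w \<alpha> s" using 2 by simp_all
        then show ?thesis using pc(2)[OF s(2,1) _ _ ends] False 2(1) by auto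
      qed
    qed
  qed
  ultimately show ?thesis by blast
qed

lemma continuous_on_half_turn: "continuous_on S f \<Longrightarrow> continuous_on S (\<lambda>x. half_turn \<sigma> (f x))"
proof -
  assume f: "continuous_on S f"
  have "continuous_on S (\<lambda>x. half_turn \<sigma> (f x) $ i)" for i
    using exhaust_3[of i] by (elim disjE) (simp_all add: half_turn_components continuous_intros f)
  then have "continuous_on S (\<lambda>x. \<chi> i. half_turn \<sigma> (f x) $ i)" by (rule continuous_on_vec_lambda)
  then show ?thesis by simp
qed

text \<open>Two arcs, one for each sign, that meet only in their ends; the parameter s = 0 is
  redundant in the union because it coincides with s = \<pi> for the other sign.\<close>

lemma bang_front_simple_closed:
  assumes "0 < \<delta>"
  shows "\<exists>a>0. \<forall>\<alpha>. 0 < \<alpha> \<and> \<alpha> < a \<and> \<delta> < remainder \<alpha> \<longrightarrow>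
    (\<exists>\<gamma>. simple_path \<gamma> \<and> pathfinish \<gamma> = pathstart \<gamma> \<and> path_image \<gamma> = bang_front \<alpha> (real (kM \<alpha>) * pi))"
proof -
  obtain a where a: "0 < a" and a_inj: "\<forall>\<alpha>. 0 < \<alpha> \<and> \<alpha> < a \<and> \<delta> < remainder \<alpha> \<longrightarrow>
    (\<forall>\<epsilon> \<epsilon>' s s'. \<epsilon> \<in> {-1, 1} \<and> \<epsilon>' \<in> {-1, 1} \<and> s \<in> {0..pi} \<and> s' \<in> {0..pi} \<and>
       front_curve \<alpha> \<epsilon> s = front_curve \<alpha> \<epsilon>' s' \<longrightarrow>
       \<epsilon> = \<epsilon>' \<and> s = s' \<or> \<epsilon> = - \<epsilon>' \<and> {s, s'} = {0, pi})"
    using front_curve_injective[OF assms] by (elim exE conjE)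
  obtain b where b: "0 < b" "\<And>\<alpha>. 0 < \<alpha> \<Longrightarrow> \<alpha> < b \<Longrightarrow> continuous_on {0..pi} (\<lambda>s. qpoint4 (final_coords \<alpha> s))"
    using final_coords_continuous by blast
  obtain c where c: "0 < c" "\<And>\<alpha> s. 0 < \<alpha> \<Longrightarrow> \<alpha> < c \<Longrightarrow> s \<in> {0..pi} \<Longrightarrow> 0 \<le> last_arc \<alpha> s"
    using last_arc_nonneg by blast
  have "\<exists>\<gamma>. simple_path \<gamma> \<and> pathfinish \<gamma> = pathstart \<gamma> \<and> path_image \<gamma> = bang_front \<alpha> (real (kM \<alpha>) * pi)"
    if A: "0 < \<alpha>" "\<alpha> < Min {a, b, c, pi / 4}" "\<delta> < remainder \<alpha>" for \<alpha>
  proof -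
    have \<alpha>: "0 < \<alpha>" "\<alpha> < pi / 4" and ab: "\<alpha> < a" "\<alpha> < b" "\<alpha> < c" using A by auto
    have inj: "\<epsilon> = \<epsilon>' \<and> s = s' \<or> \<epsilon> = - \<epsilon>' \<and> {s, s'} = {0, pi}"
      if "\<epsilon> \<in> {-1, 1}" "\<epsilon>' \<in> {-1, 1}" "s \<in> {0..pi}" "s' \<in> {0..pi}"
        "front_curve \<alpha> \<epsilon> s = front_curve \<alpha> \<epsilon>' s'" for \<epsilon> \<epsilon>' s s'
      by (rule a_inj[rule_format]; intro conjI; fact)
    define g where "g \<epsilon> = (\<lambda>\<tau>. front_curve \<alpha> \<epsilon> (pi * \<tau>))" for \<epsilon>
    have sub: "(\<lambda>\<tau>. pi * \<tau>) ` {0..1} = {0..pi}"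
    proof -
      have "(*) pi ` {0..1} = {0..pi}" using image_mult_atLeastAtMost[of pi 0 1] by simp
      then show ?thesis .
    qed
    have im: "path_image (g \<epsilon>) = front_curve \<alpha> \<epsilon> ` {0..pi}" for \<epsilon>
      unfolding path_image_def g_def sub[symmetric] image_image by (rule refl)
    have arc: "arc (g \<epsilon>)" if "\<epsilon> \<in> {-1, 1}" for \<epsilon>
    proof -
      have "continuous_on {0..pi} (front_curve \<alpha> \<epsilon>)"
        unfolding front_curve_def by (rule continuous_on_half_turn[OF b(2)[OF \<alpha>(1) ab(2)]])
      then have "continuous_on {0..1} (g \<epsilon>)"
        unfolding g_def by (rule continuous_on_compose2[OF _ _ equalityD1[OF sub]]) (intro continuous_intros)
      moreover have "inj_on (g \<epsilon>) {0..1}"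
      proof (rule inj_onI)
        fix x y :: real assume xy: "x \<in> {0..1}" "y \<in> {0..1}" "g \<epsilon> x = g \<epsilon> y"
        have "pi * x \<in> {0..pi}" "pi * y \<in> {0..pi}" using xy sub by blast+
        from inj[OF that that this] xy(3) that have "pi * x = pi * y" by (auto simp: g_def)
        then show "x = y" by simp
      qed
      ultimately show ?thesis by (simp add: arc_def path_def)
    qed
    have ends: "pathstart (g \<epsilon>) = front_curve \<alpha> \<epsilon> 0" "pathfinish (g \<epsilon>) = front_curve \<alpha> \<epsilon> pi" for \<epsilon>
      by (simp_all add: pathstart_def pathfinish_def g_def)
    have fs: "pathfinish (g 1) = pathstart (g (-1))" "pathfinish (g (-1)) = pathstart (g 1)"
      unfolding ends using front_curve_ends[OF \<alpha>, of "-1"] front_curve_ends[OF \<alpha>, of 1] by simp_all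
    have int: "path_image (g 1) \<inter> path_image (g (-1)) \<subseteq> {pathstart (g 1), pathstart (g (-1))}"
    proof
      fix p assume "p \<in> path_image (g 1) \<inter> path_image (g (-1))"
      then obtain s s' where s: "s \<in> {0..pi}" "s' \<in> {0..pi}" "p = front_curve \<alpha> 1 s" "p = front_curve \<alpha> (-1) s'"
        unfolding im by blast
      from inj[of 1 "-1" s s'] s have "{s, s'} = {0, pi}" by auto
      then have "s = 0 \<or> s' = 0" by (auto simp: doubleton_eq_iff)
      then show "p \<in> {pathstart (g 1), pathstart (g (-1))}" unfolding ends using s(3,4) by auto
    qed
    have "simple_path (g 1 +++ g (-1))"
      by (rule simple_path_join_loop[OF arc arc fs int]) simp_all
    moreover have "pathfinish (g 1 +++ g (-1)) = pathstart (g 1 +++ g (-1))" using fs by simp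
    moreover have "path_image (g 1 +++ g (-1)) = bang_front \<alpha> (real (kM \<alpha>) * pi)"
    proof -
      have bb: "bang_bang \<alpha> \<epsilon> s (real (kM \<alpha>) * pi) = front_curve \<alpha> \<epsilon> s" if "\<epsilon> \<in> {-1, 1}" "s \<in> {0..pi}" for \<epsilon> s
        by (rule bang_bang_front_curve[OF \<alpha> _ that(2) c(2)[OF \<alpha>(1) ab(3) that(2)]]) (use that in auto)
      have "bang_front \<alpha> (real (kM \<alpha>) * pi) = front_curve \<alpha> 1 ` {0..pi} \<union> front_curve \<alpha> (-1) ` {0..pi}"
      proof
        show "bang_front \<alpha> (real (kM \<alpha>) * pi) \<subseteq> front_curve \<alpha> 1 ` {0..pi} \<union> front_curve \<alpha> (-1) ` {0..pi}"
        proof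
          fix q assume "q \<in> bang_front \<alpha> (real (kM \<alpha>) * pi)"
          then obtain \<epsilon> s where q: "q = bang_bang \<alpha> \<epsilon> s (real (kM \<alpha>) * pi)" "\<epsilon> \<in> {-1, 1}" "0 < s" "s \<le> pi"
            unfolding bang_front_def[OF \<alpha>] by blast
          have s: "s \<in> {0..pi}" using q by simp
          have "q = front_curve \<alpha> \<epsilon> s" using q(1) bb[OF q(2) s] by simp
          then show "q \<in> front_curve \<alpha> 1 ` {0..pi} \<union> front_curve \<alpha> (-1) ` {0..pi}" using q(2) s by blast
        qed
        have *: "front_curve \<alpha> \<epsilon> s \<in> bang_front \<alpha> (real (kM \<alpha>) * pi)" if \<epsilon>: "\<epsilon> \<in> {-1, 1}" and s: "s \<in> {0<..pi}" for \<epsilon> s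
          unfolding bang_front_def[OF \<alpha>] using bb[OF \<epsilon>, of s] \<epsilon> s
          by (intro CollectI exI[of _ \<epsilon>] exI[of _ s]) auto
        have "front_curve \<alpha> \<epsilon> s \<in> bang_front \<alpha> (real (kM \<alpha>) * pi)" if \<epsilon>: "\<epsilon> \<in> {-1, 1}" and s: "s \<in> {0..pi}" for \<epsilon> s
        proof (cases "s = 0")
          case True
          show ?thesis unfolding True front_curve_ends[OF \<alpha>] by (rule *) (use \<epsilon> in auto)
        next
          case False
          show ?thesis by (rule *) (use \<epsilon> s False in auto)
        qed
        then show "front_curve \<alpha> 1 ` {0..pi} \<union> front_curve \<alpha> (-1) ` {0..pi} \<subseteq> bang_front \<alpha> (real (kM \<alpha>) * pi)"
          by blast
      qed
      then show ?thesis using fs by (simp add: path_image_join im)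
    qed
    ultimately show ?thesis by blast
  qed
  moreover have "0 < Min {a, b, c, pi / 4}" using a b(1) c(1) by simp
  ultimately show ?thesis by blast
qed

lemma qpoint4_eq_north: "qpoint4 q = north \<Longrightarrow> fst (snd q) = 0 \<and> fst (snd (snd q)) = 0"
  by (cases q) (auto simp: qpoint4_def dest: qpoint_eq_north)

lemma qpoint4_eq_south: "qpoint4 q = - north \<Longrightarrow> fst q = 0 \<and> snd (snd (snd q)) = 0"
  by (cases q) (auto simp: qpoint4_def dest: qpoint_eq_south)

lemma half_turn_eq_pole:
  assumes "\<sigma>\<^sup>2 = 1" "half_turn \<sigma> x = north \<or> half_turn \<sigma> x = - north"
  shows "half_turn \<sigma> x = x"
  using assms by (auto simp: vec3_eq_iff half_turn_components north_components)

text \<open>At N the two middle coordinates vanish, but to leading order they are -sin s and -cos s,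
  and |sin s| + |cos s| \<ge> 1.\<close>

lemma north_notin_bang_front:
  "\<exists>a>0. \<forall>\<alpha>. 0 < \<alpha> \<and> \<alpha> < a \<longrightarrow> north \<notin> bang_front \<alpha> (real (kM \<alpha>) * pi)"
proof -
  obtain C a where C: "0 \<le> C" "0 < a" "\<And>\<alpha> s. 0 < \<alpha> \<Longrightarrow> \<alpha> < a \<Longrightarrow> s \<in> {0..pi} \<Longrightarrow>
      \<bar>fst (snd (final_coords \<alpha> s)) - - sin s\<bar> \<le> C * \<alpha> ^ 1"
    by (rule lip_orderE[OF approx_coord_12(1)[unfolded approx_order_def]]) blast
  obtain B b where B: "0 \<le> B" "0 < b" "\<And>\<alpha> s. 0 < \<alpha> \<Longrightarrow> \<alpha> < b \<Longrightarrow> s \<in> {0..pi} \<Longrightarrow>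
      \<bar>fst (snd (snd (final_coords \<alpha> s))) - - cos s\<bar> \<le> B * \<alpha> ^ 1"
    by (rule lip_orderE[OF approx_coord_12(2)[unfolded approx_order_def]]) blast
  obtain c where c: "0 < c" "\<And>\<alpha> s. 0 < \<alpha> \<Longrightarrow> \<alpha> < c \<Longrightarrow> s \<in> {0..pi} \<Longrightarrow> 0 \<le> last_arc \<alpha> s"
    using last_arc_nonneg by blast
  have "north \<notin> bang_front \<alpha> (real (kM \<alpha>) * pi)"
    if A: "0 < \<alpha>" "\<alpha> < Min {a, b, c, pi / 4, 1 / (C + B + 1)}" for \<alpha>
  proof
    have \<alpha>: "0 < \<alpha>" "\<alpha> < pi / 4" and ab: "\<alpha> < a" "\<alpha> < b" "\<alpha> < c" "\<alpha> < 1 / (C + B + 1)" using A by auto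
    assume "north \<in> bang_front \<alpha> (real (kM \<alpha>) * pi)"
    then obtain \<epsilon> s where q: "bang_bang \<alpha> \<epsilon> s (real (kM \<alpha>) * pi) = north" "\<epsilon> \<in> {-1, 1}" "0 < s" "s \<le> pi"
      unfolding bang_front_def[OF \<alpha>] by force
    have s: "s \<in> {0..pi}" using q by simp
    have \<epsilon>: "\<epsilon>\<^sup>2 = 1" using q(2) by auto
    have \<sigma>: "(- ((-1) ^ arcs \<alpha> * \<epsilon>))\<^sup>2 = 1" using \<epsilon> by (simp add: power_minus_one_square)
    have "front_curve \<alpha> \<epsilon> s = north" using q(1) bang_bang_front_curve[OF \<alpha> \<epsilon> s c(2)[OF \<alpha>(1) ab(3) s]] by simp
    then have "qpoint4 (final_coords \<alpha> s) = north"
      using half_turn_eq_pole[OF \<sigma>] unfolding front_curve_def by metis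
    then have "fst (snd (final_coords \<alpha> s)) = 0 \<and> fst (snd (snd (final_coords \<alpha> s))) = 0"
      by (rule qpoint4_eq_north)
    then have le: "\<bar>sin s\<bar> \<le> C * \<alpha>" "\<bar>cos s\<bar> \<le> B * \<alpha>"
      using C(3)[OF \<alpha>(1) ab(1) s] B(3)[OF \<alpha>(1) ab(2) s] by simp_all
    have "\<alpha> * (C + B + 1) < 1" using ab(4) C(1) B(1) by (simp add: pos_less_divide_eq)
    then have "\<bar>sin s\<bar> + \<bar>cos s\<bar> < 1" using le \<alpha> by (simp add: algebra_simps)
    then have "(\<bar>sin s\<bar> + \<bar>cos s\<bar>)\<^sup>2 < 1" by (simp add: abs_square_less_1)
    moreover have "(sin s)\<^sup>2 + (cos s)\<^sup>2 \<le> (\<bar>sin s\<bar> + \<bar>cos s\<bar>)\<^sup>2" by (simp add: power2_sum)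
    ultimately show False by simp
  qed
  moreover have "0 < Min {a, b, c, pi / 4, 1 / (C + B + 1)}" using C(1,2) B(1,2) c(1) by simp
  ultimately show ?thesis by blast
qed

section \<open>No extremal passes through the south pole\<close>

text \<open>The common factor of the two coefficients in the first coordinate, which are in the
  ratio of cos^2 \<alpha> + sin^2 \<alpha> cos s to sin s. With the modulus R of
  \<open>half_excess_polar\<close> it equals \<open>pow_im\<close> times sin^2 \<alpha> / R, so the
  half excess disappears from the equations.\<close>

definition arc_ratio :: "real \<Rightarrow> nat \<Rightarrow> real \<Rightarrow> real" where
  "arc_ratio \<alpha> n s =
    pow_im \<alpha> n s * (cos (half_excess \<alpha> s) * (sin \<alpha>)\<^sup>2) / ((cos \<alpha>)\<^sup>2 + (sin \<alpha>)\<^sup>2 * cos s)"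

context
  fixes \<alpha> :: real
  assumes \<alpha>: "0 < \<alpha>" "\<alpha> < pi / 4"
begin

lemma arc_ratio_mult:
  "pow_im \<alpha> n s * (cos (half_excess \<alpha> s) * (sin \<alpha>)\<^sup>2) = arc_ratio \<alpha> n s * ((cos \<alpha>)\<^sup>2 + (sin \<alpha>)\<^sup>2 * cos s)"
  "pow_im \<alpha> n s * sin (half_excess \<alpha> s) = arc_ratio \<alpha> n s * sin s"
proof -
  let ?D = "half_excess \<alpha> s" and ?g = "(cos \<alpha>)\<^sup>2 + (sin \<alpha>)\<^sup>2 * cos s"
  have g: "0 < ?g" using switch_denominator_pos[OF \<alpha>] .
  then show "pow_im \<alpha> n s * (cos ?D * (sin \<alpha>)\<^sup>2) = arc_ratio \<alpha> n s * ?g" by (simp add: arc_ratio_def)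
  obtain R where R: "0 < R" "?g = R * cos ?D" "(sin \<alpha>)\<^sup>2 * sin s = R * sin ?D"
    by (rule half_excess_polar[OF \<alpha>])
  have "arc_ratio \<alpha> n s * sin s = pow_im \<alpha> n s * cos ?D * ((sin \<alpha>)\<^sup>2 * sin s) / ?g"
    by (simp add: arc_ratio_def)
  also have "\<dots> = pow_im \<alpha> n s * sin ?D * ?g / ?g" unfolding R(2,3) by simp
  also have "\<dots> = pow_im \<alpha> n s * sin ?D" using g by simp
  finally show "pow_im \<alpha> n s * sin ?D = arc_ratio \<alpha> n s * sin s" by simp
qed

text \<open>Eliminating the last arc from the equations \<open>q\<^sub>0 = q\<^sub>3 = 0\<close> of the south pole.\<close>

lemma south_elimination:
  assumes q0: "fst (front_coords \<alpha> n s t) = 0" and q3: "snd (snd (snd (front_coords \<alpha> n s t))) = 0"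
  defines "K \<equiv> arc_ratio \<alpha> n s" and "g \<equiv> (cos \<alpha>)\<^sup>2 + (sin \<alpha>)\<^sup>2 * cos s"
  defines "b \<equiv> cos \<alpha> * pow_re \<alpha> n s - K * g"
  shows "b * sin ((s + t) / 2) + K * sin s * cos ((s + t) / 2) = 0"
    and "(b + K * cos s) * (b * g - (sin \<alpha>)\<^sup>2 * K * (sin s)\<^sup>2) = 0"
proof -
  define u where "u = (s + t) / 2"
  define C where "C = pow_re \<alpha> n s"
  define d where "d = K * sin s"
  define h where "h = (sin \<alpha>)\<^sup>2 * C + cos \<alpha> * (K * g)"
  have P: "2 * (sin (s / 2) * sin (t / 2)) = cos (s - u) - cos u"
  proof -
    have "s - u = s / 2 - t / 2" "u = s / 2 + t / 2" by (simp_all add: u_def field_simps)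
    then show ?thesis by (simp add: cos_add cos_diff)
  qed
  have e0: "b * sin u + d * cos u = 0"
    using q0 unfolding front_coords_0[OF \<alpha>] arc_ratio_mult b_def d_def K_def g_def u_def by (simp add: algebra_simps)
  then show "b * sin ((s + t) / 2) + K * sin s * cos ((s + t) / 2) = 0" by (simp add: d_def u_def)
  have "C * (cos u + (sin \<alpha>)\<^sup>2 * (cos (s - u) - cos u)) - cos \<alpha> * (d * sin u) + (cos (s - u) - cos u) * (K * g * cos \<alpha>) = 0"
    using q3 P unfolding front_coords_3[OF \<alpha>] arc_ratio_mult u_def[symmetric] C_def[symmetric] K_def[symmetric] g_def[symmetric] d_def
    by algebra
  then have e3: "(cos \<alpha> * b + h * cos s) * cos u + (h * sin s - cos \<alpha> * d) * sin u = 0"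
    unfolding h_def b_def C_def[symmetric] cos_diff using sin_cos_squared_add[of \<alpha>] by algebra
  \<comment> \<open>Both equations are linear and homogeneous in (cos u, sin u), which is never
    zero; so their determinant vanishes. It factors into the product claimed.\<close>
  have "((cos \<alpha> * b + h * cos s) * b - (h * sin s - cos \<alpha> * d) * d) * cos u = 0"
    "((cos \<alpha> * b + h * cos s) * b - (h * sin s - cos \<alpha> * d) * d) * sin u = 0"
    using e0 e3 by algebra+
  moreover have "cos u \<noteq> 0 \<or> sin u \<noteq> 0" using sin_zero_norm_cos_one by force
  ultimately have "(cos \<alpha> * b + h * cos s) * b - (h * sin s - cos \<alpha> * d) * d = 0"
    unfolding mult_eq_0_iff by blast
  then show "(b + K * cos s) * (b * g - (sin \<alpha>)\<^sup>2 * K * (sin s)\<^sup>2) = 0"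
    using sin_cos_squared_add[of s] sin_cos_squared_add[of \<alpha>]
    unfolding d_def h_def g_def b_def C_def[symmetric] by algebra
qed

text \<open>The first factor equals cos \<alpha> (C - K cos \<alpha> (1 - cos s)), and 1 - cos s
  \<le> 2 is the reason for asking 2 K < C. The second is then positive with room to spare, since
  its negative part carries a factor sin^2 \<alpha>.\<close>

lemma south_factors_pos:
  fixes s :: real
  assumes K: "0 \<le> K" "2 * K < C" and a: "\<alpha> \<le> 1 / 4"
  defines "g \<equiv> (cos \<alpha>)\<^sup>2 + (sin \<alpha>)\<^sup>2 * cos s"
  defines "b \<equiv> cos \<alpha> * C - K * g"
  shows "0 < b + K * cos s" "0 < b * g - (sin \<alpha>)\<^sup>2 * K * (sin s)\<^sup>2"
proof -
  have c: "0 < cos \<alpha>" using small_angle(2)[OF \<alpha>] .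
  have g: "0 < g" using switch_denominator_pos[OF \<alpha>] by (simp add: g_def)
  have "(sin \<alpha>)\<^sup>2 \<le> \<alpha>\<^sup>2" using \<alpha> small_angle(1)[OF \<alpha>] sin_x_le_x[of \<alpha>] by (intro power_mono) auto
  also have "\<dots> \<le> (1 / 4)\<^sup>2" using \<alpha> a by (intro power_mono) auto
  finally have s: "(sin \<alpha>)\<^sup>2 \<le> 1 / 16" by (simp add: power_divide)
  have c1: "(cos \<alpha>)\<^sup>2 \<le> cos \<alpha>" using c by (simp add: power2_eq_square mult_left_le)
  have c2: "15 / 16 \<le> (cos \<alpha>)\<^sup>2" using s by (simp add: cos_squared_eq)
  have gg: "g = 1 - (sin \<alpha>)\<^sup>2 * (1 - cos s)" by (simp add: g_def cos_squared_eq algebra_simps)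
  have "(sin \<alpha>)\<^sup>2 * (1 - cos s) \<le> 1 / 16 * 2"
    using s cos_ge_minus_one[of s] by (intro mult_mono) auto
  then have g1: "7 / 8 \<le> g" "g \<le> 1" unfolding gg by (simp_all add: mult_nonneg_nonneg)
  have "cos \<alpha> * (1 - cos s) \<le> 1 * 2" using c cos_ge_minus_one[of s] by (intro mult_mono) auto
  then have "K * (cos \<alpha> * (1 - cos s)) \<le> K * 2" using K by (intro mult_left_mono) auto
  then have "0 < cos \<alpha> * (C - K * (cos \<alpha> * (1 - cos s)))" using K(2) c by simp
  also have "\<dots> = b + K * cos s"
    using sin_cos_squared_add[of \<alpha>] unfolding b_def g_def by algebra
  finally show "0 < b + K * cos s" .
  have "2 * K * cos \<alpha> < C * cos \<alpha>" using K c by (intro mult_strict_right_mono)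
  moreover have "K * g \<le> K * 1" using K g1 by (intro mult_left_mono)
  ultimately have b: "K * (2 * cos \<alpha> - 1) < b" by (simp add: b_def algebra_simps)
  have "(sin \<alpha>)\<^sup>2 * (sin s)\<^sup>2 \<le> 1 / 16 * 1" using s by (intro mult_mono) (auto simp: abs_square_le_1)
  also have "\<dots> \<le> (7 / 8) * (7 / 8)" by simp
  also have "\<dots> \<le> (2 * cos \<alpha> - 1) * g" using c1 c2 g1 by (intro mult_mono) auto
  finally have "K * ((sin \<alpha>)\<^sup>2 * (sin s)\<^sup>2) \<le> K * ((2 * cos \<alpha> - 1) * g)" using K by (intro mult_left_mono)
  also have "\<dots> = K * (2 * cos \<alpha> - 1) * g" by simp
  also have "\<dots> < b * g" using b g by (rule mult_strict_right_mono)
  finally show "0 < b * g - (sin \<alpha>)\<^sup>2 * K * (sin s)\<^sup>2" by (simp add: mult_ac)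
qed

text \<open>The power coefficient is at most 1 / sin \<alpha>, because the step angle is at least
  \<alpha>, and the denominator is at least 1 - 2 \<alpha>^2, whose inverse is at most 1 + 4
  \<alpha>^2 in this range.\<close>

lemma arc_ratio_bounds:
  assumes n: "0 \<le> sin (real n * step_angle \<alpha> s)" and a: "\<alpha> \<le> 1 / 4" and s: "0 \<le> s" "s \<le> pi"
  shows "0 \<le> arc_ratio \<alpha> n s" "arc_ratio \<alpha> n s \<le> \<alpha> * (1 + 4 * \<alpha>\<^sup>2)"
proof -
  let ?D = "half_excess \<alpha> s" and ?g = "(cos \<alpha>)\<^sup>2 + (sin \<alpha>)\<^sup>2 * cos s"
  have g: "0 < ?g" using switch_denominator_pos[OF \<alpha>] .
  have sa: "0 < sin \<alpha>" "sin \<alpha> \<le> \<alpha>" using small_angle(1)[OF \<alpha>] sin_x_le_x[of \<alpha>] \<alpha> by auto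
  have k: "\<alpha> \<le> step_angle \<alpha> s" "step_angle \<alpha> s < pi / 2" using step_angle_bounds[OF \<alpha>] by auto
  have "sin \<alpha> \<le> sin (step_angle \<alpha> s)" using k \<alpha> by (intro sin_monotone_2pi_le) auto
  then have im: "0 \<le> pow_im \<alpha> n s" "pow_im \<alpha> n s \<le> 1 / sin \<alpha>"
    unfolding pow_im_def using n sa by (auto intro!: frac_le divide_nonneg_pos)
  have D: "0 \<le> cos ?D" using half_excess_nonneg[OF \<alpha> s] by (intro cos_ge_zero) auto
  show "0 \<le> arc_ratio \<alpha> n s" unfolding arc_ratio_def using im(1) D g by (intro divide_nonneg_pos mult_nonneg_nonneg) auto
  have sq: "(sin \<alpha>)\<^sup>2 \<le> \<alpha>\<^sup>2" using sa by (intro power_mono) auto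
  have "(sin \<alpha>)\<^sup>2 * (1 - cos s) \<le> \<alpha>\<^sup>2 * 2"
    using sq cos_ge_minus_one[of s] by (intro mult_mono) auto
  moreover have "?g = 1 - (sin \<alpha>)\<^sup>2 * (1 - cos s)" by (simp add: cos_squared_eq algebra_simps)
  ultimately have g1: "1 - 2 * \<alpha>\<^sup>2 \<le> ?g" by simp
  have "\<alpha>\<^sup>2 \<le> (1 / 4)\<^sup>2" using a \<alpha> by (intro power_mono) auto
  then have a2: "\<alpha>\<^sup>2 \<le> 1 / 16" by (simp add: power_divide)
  have "pow_im \<alpha> n s * (cos ?D * (sin \<alpha>)\<^sup>2) \<le> 1 / sin \<alpha> * (1 * (sin \<alpha>)\<^sup>2)"
    using im D sa by (intro mult_mono) auto
  also have "\<dots> = sin \<alpha>" using sa by (simp add: power2_eq_square)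
  also have "\<dots> \<le> \<alpha>" by (rule sa)
  also have "\<alpha> * 1 \<le> \<alpha> * ((1 + 4 * \<alpha>\<^sup>2) * (1 - 2 * \<alpha>\<^sup>2))"
  proof (rule mult_left_mono)
    have "0 \<le> \<alpha>\<^sup>2 * (1 - 4 * \<alpha>\<^sup>2)" using a2 by (intro mult_nonneg_nonneg) auto
    then show "1 \<le> (1 + 4 * \<alpha>\<^sup>2) * (1 - 2 * \<alpha>\<^sup>2)" by (simp add: algebra_simps)
  qed (use \<alpha> in simp)
  also have "\<alpha> * ((1 + 4 * \<alpha>\<^sup>2) * (1 - 2 * \<alpha>\<^sup>2)) \<le> \<alpha> * ((1 + 4 * \<alpha>\<^sup>2) * ?g)"
    using \<alpha> g1 by (intro mult_left_mono) auto
  finally have "pow_im \<alpha> n s * (cos ?D * (sin \<alpha>)\<^sup>2) \<le> \<alpha> * (1 + 4 * \<alpha>\<^sup>2) * ?g" by (simp add: mult.assoc)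
  then show "arc_ratio \<alpha> n s \<le> \<alpha> * (1 + 4 * \<alpha>\<^sup>2)"
    unfolding arc_ratio_def using g by (simp add: pos_divide_le_eq)
qed

end

lemma cos_ge_one_minus: "1 - x\<^sup>2 / 2 \<le> cos x" for x :: real
proof -
  have "\<bar>sin (x / 2)\<bar>\<^sup>2 \<le> \<bar>x / 2\<bar>\<^sup>2" by (intro power_mono abs_sin_x_le_abs_x) auto
  then have "(sin (x / 2))\<^sup>2 \<le> x\<^sup>2 / 4" by (simp add: power_divide)
  then show ?thesis using cos_double_sin[of "x / 2"] by simp
qed

lemma sin_ge_small:
  fixes y :: real
  assumes "0 \<le> y" "y \<le> pi"
  shows "y * (1 - y\<^sup>2 / 2) \<le> sin y"
proof (cases "y = 0")
  case False
  then have "0 < y" using assms by simp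
  then obtain z where z: "0 < z" "z < y" "sin y - sin 0 = (y - 0) * cos z"
    using MVT2[of 0 y sin cos] by (metis DERIV_sin)
  have "1 - y\<^sup>2 / 2 \<le> cos y" using cos_ge_one_minus[of y] by simp
  also have "\<dots> \<le> cos z" using z assms by (intro cos_monotone_0_pi_le) auto
  finally have "y * (1 - y\<^sup>2 / 2) \<le> y * cos z" using \<open>0 < y\<close> by (intro mult_left_mono) auto
  then show ?thesis using z by simp
qed simp

text \<open>The real part of the power is the sine of the angle missing to \<pi>/2. This angle is at
  least about \<alpha> (1 + r) after all full arcs and about \<alpha> (2 + r) before the last of
  them, while \<open>arc_ratio\<close> is at most about \<alpha>. In both inequalities the margin is
  r(\<alpha>) > \<delta>.\<close>

lemma coefficient_bounds:
  assumes "0 < \<delta>"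
  shows "\<exists>a>0. \<forall>\<alpha> n s. 0 < \<alpha> \<and> \<alpha> < a \<and> \<delta> < remainder \<alpha> \<and> s \<in> {0..pi} \<and> n \<le> arcs \<alpha> \<longrightarrow>
    0 \<le> arc_ratio \<alpha> n s \<and> arc_ratio \<alpha> n s < cos \<alpha> * pow_re \<alpha> n s \<and>
    (n < arcs \<alpha> \<longrightarrow> 2 * arc_ratio \<alpha> n s < pow_re \<alpha> n s)"
proof -
  obtain C a where C: "0 \<le> C" "0 < a" "\<And>\<alpha> s. 0 < \<alpha> \<Longrightarrow> \<alpha> < a \<Longrightarrow> s \<in> {0..pi} \<Longrightarrow>
      \<bar>pi / 2 - real (arcs \<alpha>) * step_angle \<alpha> s - \<alpha> * (1 + remainder \<alpha>)\<bar> \<le> C * \<alpha> ^ 2"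
    by (rule lip_orderE[OF approx_arcs_angle[unfolded approx_order_def]]) blast
  \<comment> \<open>23 = 15 + 8: 15 \<alpha>^2 bounds the loss in passing from the angle to its
    sine, and 8 \<alpha>^2 is twice the excess 4 \<alpha>^2 allowed in the bound for
    \<open>arc_ratio\<close>.\<close>
  define c where "c = Min {a, 1 / 4, 1 / (C + 1), \<delta> / (C + 23)}"
  have c0: "0 < c" unfolding c_def using C assms by simp
  have main: "0 \<le> arc_ratio \<alpha> n s \<and> arc_ratio \<alpha> n s < cos \<alpha> * pow_re \<alpha> n s \<and>
    (n < arcs \<alpha> \<longrightarrow> 2 * arc_ratio \<alpha> n s < pow_re \<alpha> n s)"
    if A: "0 < \<alpha>" "\<alpha> < c" "\<delta> < remainder \<alpha>" and s: "s \<in> {0..pi}" and n: "n \<le> arcs \<alpha>" for \<alpha> n s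
  proof -
    have c: "\<alpha> < a" "\<alpha> \<le> 1 / 4" "\<alpha> < 1 / (C + 1)" "\<alpha> < \<delta> / (C + 23)" using A(2) by (simp_all add: c_def)
    have \<alpha>: "0 < \<alpha>" "\<alpha> < pi / 4" using A(1) c(2) pi_gt3 by auto
    let ?k = "step_angle \<alpha> s" and ?r = "remainder \<alpha>"
    have k: "\<alpha> \<le> ?k" using step_angle_bounds[OF \<alpha>] by auto
    have r: "\<delta> < ?r" "?r < 1" using A(3) remainder_bounds[OF A(1)] by auto
    have "\<alpha> * (C + 23) < \<delta>" using c(4) C(1) by (simp add: pos_less_divide_eq)
    then have small: "C * \<alpha> + 23 * \<alpha> < ?r" using r by (simp add: algebra_simps)
    have "\<alpha> * (C + 1) < 1" using c(3) C(1) by (simp add: pos_less_divide_eq)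
    then have Ca: "C * \<alpha> < 1" using \<alpha> by (simp add: algebra_simps)
    have a2: "\<alpha>\<^sup>2 \<le> \<alpha> / 4" using \<alpha> c(2) by (simp add: power2_eq_square)
    have lower: "\<alpha> * (real m + ?r - C * \<alpha> - 15 * \<alpha>\<^sup>2) \<le> pow_re \<alpha> n s" and upper: "0 \<le> sin (real n * ?k)"
      if m: "m \<le> 2" "1 \<le> m" "n + m \<le> arcs \<alpha> + 1" for m
    proof -
      \<comment> \<open>A lower bound for the missing angle when at least m - 1 of the full arcs are
        still to come: each of these adds a step angle of at least \<alpha>. Only m = 1 and m = 2
        are used.\<close>
      define y where "y = \<alpha> * (real m + ?r) - C * \<alpha>\<^sup>2"
      have y_eq: "y = \<alpha> * (real m + ?r - C * \<alpha>)" by (simp add: y_def power2_eq_square algebra_simps)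
      have pos: "0 \<le> real m + ?r - C * \<alpha>" "real m + ?r - C * \<alpha> \<le> 3"
        using m Ca C(1) \<alpha> r assms by (auto simp: of_nat_le_iff[where 'a = real, of 1 m, simplified])
          (use \<alpha> C(1) mult_nonneg_nonneg[of C \<alpha>] in linarith)
      have y: "0 \<le> y" "y \<le> 3 * \<alpha>" unfolding y_eq using pos \<alpha> by auto
      have "real n + real m \<le> real (arcs \<alpha>) + 1" using m(3) by linarith
      then have "(real n + real m) * ?k \<le> (real (arcs \<alpha>) + 1) * ?k" using k \<alpha> by (intro mult_right_mono) auto
      then have nk: "real n * ?k \<le> real (arcs \<alpha>) * ?k - (real m - 1) * ?k" by (simp add: algebra_simps)
      have "(real m - 1) * \<alpha> \<le> (real m - 1) * ?k" using k m by (intro mult_left_mono) auto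
      with nk C(3)[OF \<alpha>(1) c(1) s] have le: "y \<le> pi / 2 - real n * ?k"
        unfolding y_def by (simp add: algebra_simps abs_le_iff)
      have n0: "0 \<le> real n * ?k" using k \<alpha> by simp
      show "0 \<le> sin (real n * ?k)" using n0 le y(1) by (intro sin_ge_zero) linarith+
      have "y\<^sup>2 \<le> (3 * \<alpha>)\<^sup>2" using y by (intro power_mono) auto
      then have "y\<^sup>2 \<le> 9 * \<alpha>\<^sup>2" by (simp add: power_mult_distrib)
      then have y2: "1 - 5 * \<alpha>\<^sup>2 \<le> 1 - y\<^sup>2 / 2"
        using zero_le_power2[of \<alpha>] by linarith
      have "\<alpha> * (real m + ?r - C * \<alpha> - 15 * \<alpha>\<^sup>2) \<le> \<alpha> * ((real m + ?r - C * \<alpha>) * (1 - 5 * \<alpha>\<^sup>2))"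
      proof (rule mult_left_mono)
        have "(real m + ?r - C * \<alpha>) * (5 * \<alpha>\<^sup>2) \<le> 3 * (5 * \<alpha>\<^sup>2)" using pos by (intro mult_right_mono) auto
        then show "real m + ?r - C * \<alpha> - 15 * \<alpha>\<^sup>2 \<le> (real m + ?r - C * \<alpha>) * (1 - 5 * \<alpha>\<^sup>2)"
          by (simp add: right_diff_distrib)
      qed (use \<alpha> in simp)
      also have "\<dots> = y * (1 - 5 * \<alpha>\<^sup>2)" by (simp add: y_eq)
      also have "\<dots> \<le> y * (1 - y\<^sup>2 / 2)" using y2 y by (intro mult_left_mono)
      also have "\<dots> \<le> sin y" using y c(2) pi_gt3 by (intro sin_ge_small) auto
      also have "\<dots> \<le> sin (pi / 2 - real n * ?k)" using y le n0 by (intro sin_monotone_2pi_le) auto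
      also have "\<dots> = pow_re \<alpha> n s" by (simp add: pow_re_def sin_diff)
      finally show "\<alpha> * (real m + ?r - C * \<alpha> - 15 * \<alpha>\<^sup>2) \<le> pow_re \<alpha> n s" .
    qed
    have s': "0 \<le> s" "s \<le> pi" using s by auto
    have n1: "n + 1 \<le> arcs \<alpha> + 1" using n by simp
    note K = arc_ratio_bounds[OF \<alpha> upper[OF _ _ n1] c(2) s']
    have K0: "0 \<le> arc_ratio \<alpha> n s" and K1: "arc_ratio \<alpha> n s \<le> \<alpha> * (1 + 4 * \<alpha>\<^sup>2)" using K by simp_all
    have low1: "\<alpha> * (1 + ?r - C * \<alpha> - 15 * \<alpha>\<^sup>2) \<le> pow_re \<alpha> n s" using lower[OF _ _ n1] by simp
    have "arc_ratio \<alpha> n s < cos \<alpha> * pow_re \<alpha> n s"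
    proof -
      let ?w = "1 + ?r - C * \<alpha> - 15 * \<alpha>\<^sup>2"
      have w: "1 + 8 * \<alpha>\<^sup>2 \<le> ?w" "?w \<le> 2" using small a2 r Ca C(1) \<alpha> mult_nonneg_nonneg[of C \<alpha>] zero_le_power2[of \<alpha>] by linarith+
      have w0: "0 \<le> ?w" using w(1) by (rule order_trans[rotated]) simp
      have ca: "1 - \<alpha>\<^sup>2 \<le> cos \<alpha>" using cos_ge_one_minus[of \<alpha>] zero_le_power2[of \<alpha>] by linarith
      have "1 + 4 * \<alpha>\<^sup>2 < (1 - \<alpha>\<^sup>2) * ?w"
      proof -
        have "\<alpha>\<^sup>2 * ?w \<le> \<alpha>\<^sup>2 * 2" using w(2) by (intro mult_left_mono) auto
        then have "?w - 2 * \<alpha>\<^sup>2 \<le> (1 - \<alpha>\<^sup>2) * ?w" unfolding left_diff_distrib by simp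
        moreover have "0 < \<alpha>\<^sup>2" using \<alpha> by simp
        ultimately show ?thesis using w(1) by linarith
      qed
      also have "\<dots> \<le> cos \<alpha> * ?w" using ca w0 by (rule mult_right_mono)
      finally have "\<alpha> * (1 + 4 * \<alpha>\<^sup>2) < \<alpha> * (cos \<alpha> * ?w)" using \<alpha>(1) by (rule mult_strict_left_mono)
      also have "\<dots> = cos \<alpha> * (\<alpha> * ?w)" by simp
      also have "\<dots> \<le> cos \<alpha> * pow_re \<alpha> n s" using low1 small_angle(2)[OF \<alpha>] by (intro mult_left_mono) auto
      finally show ?thesis using K1 by linarith
    qed
    moreover have "2 * arc_ratio \<alpha> n s < pow_re \<alpha> n s" if "n < arcs \<alpha>"
    proof -
      have "\<alpha> * (2 + 8 * \<alpha>\<^sup>2) < \<alpha> * (2 + ?r - C * \<alpha> - 15 * \<alpha>\<^sup>2)"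
        using small a2 \<alpha> by (intro mult_strict_left_mono) auto
      also have "\<dots> \<le> pow_re \<alpha> n s" using lower[of 2] that by simp
      finally show ?thesis using K1 by (simp add: algebra_simps)
    qed
    ultimately show ?thesis using K0 by blast
  qed
  show ?thesis
    by (rule exI[of _ c], intro conjI[OF c0] allI impI, elim conjE) (rule main)
qed

text \<open>Before the last full arc is completed both factors of the eliminated equation are
  positive. After it only the weaker coefficient bound is available, but there the time limit
  restricts the first and last arcs so much that the first equation alone has a positive left-hand
  side.\<close>

lemma south_notin_bang_front:
  assumes "0 < \<delta>"
  shows "\<exists>a>0. \<forall>\<alpha> t. 0 < \<alpha> \<and> \<alpha> < a \<and> \<delta> < remainder \<alpha> \<and> 0 < t \<and> t \<le> real (kM \<alpha>) * pi \<longrightarrow>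
    - north \<notin> bang_front \<alpha> t"
proof -
  obtain a where a: "0 < a" and co: "\<forall>\<alpha> n s. 0 < \<alpha> \<and> \<alpha> < a \<and> \<delta> < remainder \<alpha> \<and> s \<in> {0..pi} \<and> n \<le> arcs \<alpha> \<longrightarrow>
    0 \<le> arc_ratio \<alpha> n s \<and> arc_ratio \<alpha> n s < cos \<alpha> * pow_re \<alpha> n s \<and>
    (n < arcs \<alpha> \<longrightarrow> 2 * arc_ratio \<alpha> n s < pow_re \<alpha> n s)"
    using coefficient_bounds[OF assms] by (elim exE conjE)
  have main: "- north \<notin> bang_front \<alpha> t"
    if A: "0 < \<alpha>" "\<alpha> < min a (1 / 4)" "\<delta> < remainder \<alpha>" "0 < t" "t \<le> real (kM \<alpha>) * pi" for \<alpha> t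
  proof
    have \<alpha>: "0 < \<alpha>" "\<alpha> < pi / 4" and a4: "\<alpha> \<le> 1 / 4" and aa: "\<alpha> < a" using A pi_gt3 by auto
    assume "- north \<in> bang_front \<alpha> t"
    then obtain \<epsilon> s where q: "bang_bang \<alpha> \<epsilon> s t = - north" "\<epsilon> \<in> {-1, 1}" "0 < s" "s \<le> pi"
      unfolding bang_front_def[OF \<alpha>] by force
    have \<epsilon>: "\<epsilon>\<^sup>2 = 1" using q(2) by auto
    show False
    proof (cases "t \<le> s")
      case True
      then have "flow \<alpha> \<epsilon> t north = - north" using q(1) by (simp add: bang_bang_def)
      then show False using flow_north_ne(2)[OF \<alpha> \<epsilon> A(4)] True q(4) by simp
    next
      case False
      then have "s < t" by simp
      then obtain n where n: "s + real n * v_dur \<alpha> s < t" "t \<le> s + real n * v_dur \<alpha> s + v_dur \<alpha> s"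
        using arc_index_exists[OF v_dur_pos[of \<alpha> s]] by blast
      define \<tau> where "\<tau> = t - (s + real n * v_dur \<alpha> s)"
      have \<tau>: "0 < \<tau>" "\<tau> \<le> v_dur \<alpha> s" and t: "t = s + real n * v_dur \<alpha> s + \<tau>" using n by (simp_all add: \<tau>_def)
      have v: "pi \<le> v_dur \<alpha> s" unfolding v_dur_half_excess using half_excess_nonneg[OF \<alpha>, of s] q by simp
      then have nv: "real n * pi \<le> real n * v_dur \<alpha> s" by (intro mult_left_mono) auto
      have "real n * pi < real (kM \<alpha>) * pi" using nv A(5) n(1) q(3) by linarith
      then have nk: "n \<le> arcs \<alpha>" by simp
      have \<sigma>: "(- ((-1) ^ n * \<epsilon>))\<^sup>2 = 1" using \<epsilon> by (simp add: power_minus_one_square)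
      have h: "half_turn (- ((-1) ^ n * \<epsilon>)) (qpoint4 (front_coords \<alpha> n s \<tau>)) = - north"
        using q(1) bang_bang_front_coords[OF \<alpha> less_imp_le[OF \<tau>(1)] \<tau>(2) \<epsilon>, of n] unfolding t by simp
      have "qpoint4 (front_coords \<alpha> n s \<tau>) = - north"
        using half_turn_eq_pole[OF \<sigma> disjI2[OF h]] h by simp
      then have z: "fst (front_coords \<alpha> n s \<tau>) = 0" "snd (snd (snd (front_coords \<alpha> n s \<tau>))) = 0"
        using qpoint4_eq_south by blast+
      have s: "s \<in> {0..pi}" using q by simp
      have K: "0 \<le> arc_ratio \<alpha> n s" "arc_ratio \<alpha> n s < cos \<alpha> * pow_re \<alpha> n s"
        "n < arcs \<alpha> \<Longrightarrow> 2 * arc_ratio \<alpha> n s < pow_re \<alpha> n s"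
        using co[rule_format, of \<alpha> s n] A(1,3) aa s nk by blast+
      show False
      proof (cases "n < arcs \<alpha>")
        case True
        then show False
          using south_elimination(2)[OF \<alpha> z] south_factors_pos[OF \<alpha> K(1) K(3)[OF True] a4, of s]
          by (metis less_irrefl mult_eq_0_iff)
      next
        case False
        \<comment> \<open>Interior arcs last at least \<pi>, so k_M - 1 of them leave at most \<pi>
          for the first and the last arc together. Half of their sum is then an angle in (0,
          \<pi>/2], where sine and cosine are nonnegative.\<close>
        then have "real n * pi = real (kM \<alpha>) * pi - pi"
          using nk arcs_eq(1)[OF \<alpha>] by (simp add: of_nat_diff left_diff_distrib)
        then have "s + \<tau> \<le> pi" using nv A(5) unfolding t by linarith
        then have u: "0 < (s + \<tau>) / 2" "(s + \<tau>) / 2 \<le> pi / 2" using q(3) \<tau>(1) by simp_all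
        have "(cos \<alpha>)\<^sup>2 + (sin \<alpha>)\<^sup>2 * cos s \<le> (cos \<alpha>)\<^sup>2 + (sin \<alpha>)\<^sup>2 * 1"
          by (intro add_left_mono mult_left_mono) auto
        then have "arc_ratio \<alpha> n s * ((cos \<alpha>)\<^sup>2 + (sin \<alpha>)\<^sup>2 * cos s) \<le> arc_ratio \<alpha> n s * 1"
          using K(1) by (intro mult_left_mono) auto
        then have b: "0 < cos \<alpha> * pow_re \<alpha> n s - arc_ratio \<alpha> n s * ((cos \<alpha>)\<^sup>2 + (sin \<alpha>)\<^sup>2 * cos s)"
          using K(2) by linarith
        have "0 < sin ((s + \<tau>) / 2)" "0 \<le> cos ((s + \<tau>) / 2)" "0 \<le> sin s"
          using u q by (auto intro!: sin_gt_zero cos_ge_zero sin_ge_zero)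
        then have "0 < (cos \<alpha> * pow_re \<alpha> n s - arc_ratio \<alpha> n s * ((cos \<alpha>)\<^sup>2 + (sin \<alpha>)\<^sup>2 * cos s)) * sin ((s + \<tau>) / 2)
            + arc_ratio \<alpha> n s * sin s * cos ((s + \<tau>) / 2)"
          using b K(1) by (intro add_pos_nonneg mult_pos_pos mult_nonneg_nonneg)
        then show False using south_elimination(1)[OF \<alpha> z] by simp
      qed
    qed
  qed
  have a0: "0 < min a (1 / 4)" using a by simp
  show ?thesis
    by (rule exI[of _ "min a (1 / 4)"], intro conjI[OF a0] allI impI, elim conjE) (rule main)
qed

section \<open>Choice of the threshold for \<alpha>\<close>

theorem proposition4:
  fixes \<delta> :: real
  assumes "\<delta> > 0"
  shows "\<exists>\<alpha>\<^sub>0>0. \<forall>\<alpha>. 0 < \<alpha> \<and> \<alpha> < pi / 4 \<and> \<alpha> < \<alpha>\<^sub>0 \<and> remainder \<alpha> > \<delta> \<longrightarrow>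
      extremal_front \<alpha> (real (kM \<alpha>) * pi) homeomorphic sphere (0 :: real^2) 1 \<and>
      (\<forall>k\<in>{1..kM \<alpha>}. \<forall>\<epsilon>\<in>{-1, 1}. switching_curve_optimal \<alpha> (real (kM \<alpha>) * pi) k \<epsilon>) \<and>
      optimal_front \<alpha> (real (kM \<alpha>) * pi) = extremal_front \<alpha> (real (kM \<alpha>) * pi)"
proof -
  obtain a where a: "0 < a" and curve: "\<forall>\<alpha>. 0 < \<alpha> \<and> \<alpha> < a \<and> \<delta> < remainder \<alpha> \<longrightarrow>
    (\<exists>\<gamma>. simple_path \<gamma> \<and> pathfinish \<gamma> = pathstart \<gamma> \<and> path_image \<gamma> = bang_front \<alpha> (real (kM \<alpha>) * pi))"
    using bang_front_simple_closed[OF assms] by (elim exE conjE)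
  obtain b where b: "0 < b" and north: "\<forall>\<alpha>. 0 < \<alpha> \<and> \<alpha> < b \<longrightarrow> north \<notin> bang_front \<alpha> (real (kM \<alpha>) * pi)"
    using north_notin_bang_front by (elim exE conjE)
  obtain c where c: "0 < c" and south: "\<forall>\<alpha> t. 0 < \<alpha> \<and> \<alpha> < c \<and> \<delta> < remainder \<alpha> \<and> 0 < t \<and> t \<le> real (kM \<alpha>) * pi \<longrightarrow>
    - north \<notin> bang_front \<alpha> t"
    using south_notin_bang_front[OF assms] by (elim exE conjE)
  have main: "extremal_front \<alpha> (real (kM \<alpha>) * pi) homeomorphic sphere (0 :: real^2) 1 \<and>
      (\<forall>k\<in>{1..kM \<alpha>}. \<forall>\<epsilon>\<in>{-1, 1}. switching_curve_optimal \<alpha> (real (kM \<alpha>) * pi) k \<epsilon>) \<and>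
      optimal_front \<alpha> (real (kM \<alpha>) * pi) = extremal_front \<alpha> (real (kM \<alpha>) * pi)"
    if \<alpha>: "0 < \<alpha>" "\<alpha> < pi / 4" and A: "\<alpha> < min a (min b c)" "\<delta> < remainder \<alpha>" for \<alpha>
  proof -
    let ?T = "real (kM \<alpha>) * pi"
    have abc: "\<alpha> < a" "\<alpha> < b" "\<alpha> < c" using A by auto
    have T: "0 < ?T" using arcs_eq(1)[OF \<alpha>] by simp
    obtain \<gamma> where \<gamma>: "simple_path \<gamma>" "pathfinish \<gamma> = pathstart \<gamma>" "path_image \<gamma> = bang_front \<alpha> ?T"
      using curve \<alpha>(1) abc(1) A(2) by blast
    have n: "north \<notin> bang_front \<alpha> ?T" using north \<alpha>(1) abc(2) by blast
    have s: "- north \<notin> bang_front \<alpha> t" if "0 < t" "t \<le> ?T" for t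
      using south \<alpha>(1) abc(3) A(2) that by blast
    note opt = front_optimal[OF \<alpha> T \<gamma> n s]
    have "switching_curve_optimal \<alpha> ?T k \<epsilon>" if \<epsilon>: "\<epsilon> \<in> {-1, 1}" for k \<epsilon>
      unfolding switching_curve_optimal_def
    proof (intro ballI)
      fix s t assume st: "s \<in> {0<..pi}" "t \<in> {0..?T}"
      have "(-1) ^ k * \<epsilon> \<in> {-1, 1}" using \<epsilon> by (cases "even k") auto
      then show "time_optimal \<alpha> t (bang_bang \<alpha> ((-1) ^ k * \<epsilon>) s)"
        using st by (intro opt(2)) auto
    qed
    then show ?thesis using opt(1,3) by blast
  qed
  have m: "0 < min a (min b c)" using a b c by simp
  show ?thesis
    by (rule exI[of _ "min a (min b c)"], intro conjI[OF m] allI impI, elim conjE) (rule main)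
qed

end
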